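(* Let $\Omega\subset\mathbb{R}^3$ be an open bounded domain of class $Lip_{loc}$, $T>0$, $\nu>0$, and let $L$ be a hyperplane with $\Omega_L=\Omega\cap L\ne\varnothing$, written as $L=\{x\in\mathbb{R}^3: x_3=b-a_1x_1-a_2x_2\}$ with $a_1,a_2\neq0$. Then for any $(f_L,u_{0L})\in L^2(0,T;V^*(\Omega_L))\times H(\Omega_L)$ the problem $$\frac{\partial u_L}{\partial t}-\nu A_1u_L+B_1(u_L,u_L)=f_L\quad\text{on }(0,T)\times\Omega_L,$$ $$\operatorname{div}u_L=D_1u_{L1}+D_2u_{L2}-\tfrac12\big(a_1^{-1}D_1+a_2^{-1}D_2\big)u_{L3}=0,\quad x\in\Omega_L,\ t>0,$$ $$u_L(0,x)=u_{0L}(x),\ x\in\Omega_L;\qquad u_L|_{(0,T)\times\partial\Omega_L}=0$$ has a unique weak solution $u_L(t,x)$ that is contained in $\mathcal{V}(Q_L^T)$.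
   Context: $Lip_{loc}$ is the class of locally Lipschitz domains. Write $Q_L^T=(0,T)\times\Omega_L$ and $D_i=\partial/\partial x_i$. $\Omega_L$ is identified with its projection $P_{x_3}\Omega_L\subset\mathbb{R}^2$ onto the $(x_1,x_2)$-plane (a finite union of bounded domains of class $Lip_{loc}$, of positive measure), functions on $\Omega_L$ are regarded as functions of $(x_1,x_2)$, and integrals over $\Omega_L$ mean integrals over $P_{x_3}\Omega_L$ with respect to $dx_1dx_2$. For three-component functions $u,w$ of $(x_1,x_2)$ put $$A_1=D_1^2+D_2^2+\tfrac14\big(a_1^{-1}D_1+a_2^{-1}D_2\big)^2,\qquad B_1(u,w)=\Big[u_1D_1+u_2D_2-\tfrac12u_3\big(a_1^{-1}D_1+a_2^{-1}D_2\big)\Big]w .$$ $V(\Omega_L)$ and $H(\Omega_L)$ are the closures in $(W_0^{1,2}(\Omega_L))^3$ and $(L^2(\Omega_L))^3$ of the set of $\varphi\in(C_0^\infty(\Omega_L))^3$ with $D_1\varphi_1+D_2\varphi_2-\frac12(a_1^{-1}D_1+a_2^{-1}D_2)\varphi_3=0$; $V^*(\Omega_L)$ is the dual of $V(\Omega_L)$, and $\langle\cdot,\cdot\rangle_{\Omega_L}$ is the duality extending $\langle g,h\rangle_{\Omega_L}=\sum_{i=1}^3\int_{P_{x_3}\Omega_L}g_ih_i\,dx_1dx_2$. Put $$\mathcal{V}(Q_L^T)=\{w\in L^2(0,T;V(\Omega_L))\cap L^\infty(0,T;H(\Omega_L)):\ w'\in L^2(0,T;V^*(\Omega_L))\}.$$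 A weak solution is a function $u_L\in\mathcal{V}(Q_L^T)$ such that, for all $v\in V(\Omega_L)$ and almost every $t\in(0,T)$, $$\frac{d}{dt}\langle u_L,v\rangle_{\Omega_L}-\nu\langle A_1u_L,v\rangle_{\Omega_L}+\langle B_1(u_L,u_L),v\rangle_{\Omega_L}=\langle f_L,v\rangle_{\Omega_L},$$ and $\langle u_L(t),v\rangle_{\Omega_L}|_{t=0}=\langle u_{0L},v\rangle_{\Omega_L}$ for all $v\in H(\Omega_L)$. *)

theory Defs
  imports "HOL-Analysis.Analysis"
begin

text \<open>Elements of spaces of the type L2, W12 and their duals are handled through representatives:
  a function on an open set \<open>S\<close> is a total function of which only the values on \<open>S\<close> (up to null
  sets) are relevant.  Vector-valued function spaces stand for the powers of the scalar ones.\<close>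

section \<open>Locally Lipschitz domains\<close>

text \<open>Near every boundary point, in Cartesian coordinates whose last axis is \<open>e\<close>, the set is the part
  of a ball lying on one side of the graph of a Lipschitz function of the remaining coordinates.\<close>

definition lip_loc_domain :: "'a::euclidean_space set \<Rightarrow> bool" where
  "lip_loc_domain S \<longleftrightarrow> open S \<and> connected S \<and> S \<noteq> {} \<and>
     (\<forall>x\<in>frontier S. \<exists>e r C g. norm e = 1 \<and> r > 0 \<and> C-lipschitz_on {z. z \<bullet> e = 0} (g :: 'a \<Rightarrow> real) \<and>
        S \<inter> ball x r = {y \<in> ball x r. g (y - (y \<bullet> e) *\<^sub>R e) < y \<bullet> e})"

section \<open>Test functions and weak derivatives\<close>

definition dir_deriv :: "'a::euclidean_space \<Rightarrow> ('a \<Rightarrow> 'b::real_normed_vector) \<Rightarrow> 'a \<Rightarrow> 'b" where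
  "dir_deriv e f x = frechet_derivative f (at x) e"

primrec Ck :: "nat \<Rightarrow> ('a::euclidean_space \<Rightarrow> 'b::real_normed_vector) \<Rightarrow> bool" where
  "Ck 0 f \<longleftrightarrow> continuous_on UNIV f"
| "Ck (Suc k) f \<longleftrightarrow> f differentiable_on UNIV \<and> (\<forall>e\<in>Basis. Ck k (dir_deriv e f))"

text \<open>Functions with compact support in \<open>S\<close> are extended by zero to the whole space.\<close>

definition test_fun :: "'a::euclidean_space set \<Rightarrow> ('a \<Rightarrow> 'b::real_normed_vector) set" where
  "test_fun S = {\<phi>. (\<forall>k. Ck k \<phi>) \<and> compact (closure {x. \<phi> x \<noteq> 0}) \<and> closure {x. \<phi> x \<noteq> 0} \<subseteq> S}"

definition loc_integrable :: "'a::euclidean_space set \<Rightarrow> ('a \<Rightarrow> 'b::euclidean_space) \<Rightarrow> bool" where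
  "loc_integrable S f \<longleftrightarrow> (\<forall>K. compact K \<and> K \<subseteq> S \<longrightarrow> integrable (lebesgue_on K) f)"

definition has_weak_deriv ::
  "'a::euclidean_space set \<Rightarrow> 'a \<Rightarrow> ('a \<Rightarrow> 'b::euclidean_space) \<Rightarrow> ('a \<Rightarrow> 'b) \<Rightarrow> bool" where
  "has_weak_deriv S e f g \<longleftrightarrow> loc_integrable S f \<and> loc_integrable S g \<and>
     (\<forall>\<phi>\<in>test_fun S. (LINT x|lebesgue_on S. (dir_deriv e \<phi> x :: real) *\<^sub>R f x)
                    = - (LINT x|lebesgue_on S. \<phi> x *\<^sub>R g x))"

text \<open>An arbitrary representative; weak derivatives are unique up to null sets.\<close>

definition weak_deriv ::
  "'a::euclidean_space set \<Rightarrow> 'a \<Rightarrow> ('a \<Rightarrow> 'b::euclidean_space) \<Rightarrow> 'a \<Rightarrow> 'b" where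
  "weak_deriv S e f = (SOME g. has_weak_deriv S e f g)"

section \<open>L2 and Sobolev spaces\<close>

definition L2_space :: "'a::euclidean_space set \<Rightarrow> ('a \<Rightarrow> 'b::euclidean_space) set" where
  "L2_space S = {f \<in> borel_measurable (lebesgue_on S). integrable (lebesgue_on S) (\<lambda>x. (norm (f x))\<^sup>2)}"

definition L2_norm :: "'a::euclidean_space set \<Rightarrow> ('a \<Rightarrow> 'b::euclidean_space) \<Rightarrow> real" where
  "L2_norm S f = sqrt (LINT x|lebesgue_on S. (norm (f x))\<^sup>2)"

definition L2_pair ::
  "'a::euclidean_space set \<Rightarrow> ('a \<Rightarrow> 'b::euclidean_space) \<Rightarrow> ('a \<Rightarrow> 'b) \<Rightarrow> real" where
  "L2_pair S g h = (LINT x|lebesgue_on S. g x \<bullet> h x)"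

definition W12_space :: "'a::euclidean_space set \<Rightarrow> ('a \<Rightarrow> 'b::euclidean_space) set" where
  "W12_space S = {f \<in> L2_space S. \<forall>e\<in>Basis. \<exists>g\<in>L2_space S. has_weak_deriv S e f g}"

definition W12_norm :: "'a::euclidean_space set \<Rightarrow> ('a \<Rightarrow> 'b::euclidean_space) \<Rightarrow> real" where
  "W12_norm S f = sqrt ((L2_norm S f)\<^sup>2 + (\<Sum>e\<in>Basis. (L2_norm S (weak_deriv S e f))\<^sup>2))"

definition norm_closure :: "'x::minus set \<Rightarrow> ('x \<Rightarrow> real) \<Rightarrow> 'x set \<Rightarrow> 'x set" where
  "norm_closure X N A = {x \<in> X. \<forall>\<epsilon>>0. \<exists>y\<in>A. N (x - y) < \<epsilon>}"

definition W12_0 :: "'a::euclidean_space set \<Rightarrow> ('a \<Rightarrow> 'b::euclidean_space) set" where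
  "W12_0 S = norm_closure (W12_space S) (W12_norm S) (test_fun S)"

section \<open>Bochner spaces\<close>

text \<open>\<open>X\<close> is a linear space of representatives with seminorm \<open>N\<close>.\<close>

definition strongly_measurable ::
  "'t measure \<Rightarrow> 'x::minus set \<Rightarrow> ('x \<Rightarrow> real) \<Rightarrow> ('t \<Rightarrow> 'x) \<Rightarrow> bool" where
  "strongly_measurable M X N w \<longleftrightarrow> (AE t in M. w t \<in> X) \<and>
     (\<exists>s :: nat \<Rightarrow> 't \<Rightarrow> 'x. (\<forall>n. simple_function M (s n) \<and> s n ` space M \<subseteq> X) \<and>
        (AE t in M. (\<lambda>n. N (w t - s n t)) \<longlonglongrightarrow> 0))"

definition Bochner_L2 :: "real \<Rightarrow> 'x::minus set \<Rightarrow> ('x \<Rightarrow> real) \<Rightarrow> (real \<Rightarrow> 'x) set" where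
  "Bochner_L2 T X N = {w. strongly_measurable (lebesgue_on {0<..<T}) X N w \<and>
     integrable (lebesgue_on {0<..<T}) (\<lambda>t. (N (w t))\<^sup>2)}"

definition Bochner_Linf :: "real \<Rightarrow> 'x::minus set \<Rightarrow> ('x \<Rightarrow> real) \<Rightarrow> (real \<Rightarrow> 'x) set" where
  "Bochner_Linf T X N = {w. strongly_measurable (lebesgue_on {0<..<T}) X N w \<and>
     (\<exists>C. AE t in lebesgue_on {0<..<T}. N (w t) \<le> C)}"

section \<open>The spaces of divergence-free fields on a plane section\<close>

definition proj12 :: "real^3 \<Rightarrow> real^2" where
  "proj12 x = vector [x$1, x$2]"

abbreviation e1 :: "real^2" where "e1 \<equiv> axis 1 1"
abbreviation e2 :: "real^2" where "e2 \<equiv> axis 2 1"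

type_synonym field3 = "real^2 \<Rightarrow> real^3"

definition div_free_tests :: "(real^2) set \<Rightarrow> real \<Rightarrow> real \<Rightarrow> field3 set" where
  "div_free_tests S a1 a2 = {\<phi> \<in> test_fun S. \<forall>x\<in>S.
     dir_deriv e1 \<phi> x $ 1 + dir_deriv e2 \<phi> x $ 2
     - 1/2 * (inverse a1 * dir_deriv e1 \<phi> x $ 3 + inverse a2 * dir_deriv e2 \<phi> x $ 3) = 0}"

definition V_space :: "(real^2) set \<Rightarrow> real \<Rightarrow> real \<Rightarrow> field3 set" where
  "V_space S a1 a2 = norm_closure (W12_0 S) (W12_norm S) (div_free_tests S a1 a2)"

definition H_space :: "(real^2) set \<Rightarrow> real \<Rightarrow> real \<Rightarrow> field3 set" where
  "H_space S a1 a2 = norm_closure (L2_space S) (L2_norm S) (div_free_tests S a1 a2)"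

text \<open>Functionals are total functions of which only the values on \<open>V_space\<close> are relevant; boundedness
  makes them independent of representatives.\<close>

definition V_dual :: "(real^2) set \<Rightarrow> real \<Rightarrow> real \<Rightarrow> (field3 \<Rightarrow> real) set" where
  "V_dual S a1 a2 = {F.
     (\<forall>v\<in>V_space S a1 a2. \<forall>w\<in>V_space S a1 a2. F (\<lambda>x. v x + w x) = F v + F w) \<and>
     (\<forall>c. \<forall>v\<in>V_space S a1 a2. F (\<lambda>x. c *\<^sub>R v x) = c * F v) \<and>
     (\<exists>C. \<forall>v\<in>V_space S a1 a2. \<bar>F v\<bar> \<le> C * W12_norm S v)}"

definition V_dual_norm :: "(real^2) set \<Rightarrow> real \<Rightarrow> real \<Rightarrow> (field3 \<Rightarrow> real) \<Rightarrow> real" where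
  "V_dual_norm S a1 a2 F = (SUP v\<in>{v \<in> V_space S a1 a2. W12_norm S v \<le> 1}. \<bar>F v\<bar>)"

text \<open>The time derivative is the distributional derivative with values in the dual of \<open>V_space\<close>,
  into which \<open>w t\<close> is embedded by \<open>L2_pair\<close>; an identity between elements of the dual is tested on
  all \<open>v\<close> (evaluation at \<open>v\<close> commutes with the Bochner integral).\<close>

definition VQ_space :: "real \<Rightarrow> (real^2) set \<Rightarrow> real \<Rightarrow> real \<Rightarrow> (real \<Rightarrow> field3) set" where
  "VQ_space T S a1 a2 =
     {w \<in> Bochner_L2 T (V_space S a1 a2) (W12_norm S) \<inter> Bochner_Linf T (H_space S a1 a2) (L2_norm S).
        \<exists>w' \<in> Bochner_L2 T (V_dual S a1 a2) (V_dual_norm S a1 a2).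
          \<forall>v\<in>V_space S a1 a2. has_weak_deriv {0<..<T} 1 (\<lambda>t. L2_pair S (w t) v) (\<lambda>t. w' t v)}"

section \<open>The operators and weak solutions\<close>

text \<open>\<open>dual_deriv S e g\<close> is the distributional derivative of \<open>g\<close> in direction \<open>e\<close>, as a map from
  L2 to the dual of \<open>W12_0 S\<close>.  The second-order operator takes \<open>u\<close> in \<open>V_space\<close> to the dual: one
  derivative is the weak derivative of \<open>u\<close>, the other one acts on the resulting L2 function.\<close>

definition dual_deriv :: "(real^2) set \<Rightarrow> real^2 \<Rightarrow> field3 \<Rightarrow> field3 \<Rightarrow> real" where
  "dual_deriv S e g v = - L2_pair S g (weak_deriv S e v)"

definition A1_op :: "(real^2) set \<Rightarrow> real \<Rightarrow> real \<Rightarrow> field3 \<Rightarrow> field3 \<Rightarrow> real" where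
  "A1_op S a1 a2 u v =
     dual_deriv S e1 (weak_deriv S e1 u) v + dual_deriv S e2 (weak_deriv S e2 u) v +
     (let g = (\<lambda>x. inverse a1 *\<^sub>R weak_deriv S e1 u x + inverse a2 *\<^sub>R weak_deriv S e2 u x)
      in 1/4 * (inverse a1 * dual_deriv S e1 g v + inverse a2 * dual_deriv S e2 g v))"

definition B1_op :: "(real^2) set \<Rightarrow> real \<Rightarrow> real \<Rightarrow> field3 \<Rightarrow> field3 \<Rightarrow> field3" where
  "B1_op S a1 a2 u w = (\<lambda>x.
     u x $ 1 *\<^sub>R weak_deriv S e1 w x + u x $ 2 *\<^sub>R weak_deriv S e2 w x
     - (1/2 * u x $ 3) *\<^sub>R (inverse a1 *\<^sub>R weak_deriv S e1 w x + inverse a2 *\<^sub>R weak_deriv S e2 w x))"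

text \<open>The derivative in time of the pairing is a distributional derivative on \<open>(0,T)\<close>.  The value of
  the pairing at \<open>t = 0\<close> is that of its continuous representative on \<open>[0,T]\<close>, since \<open>u\<close> is only
  determined for almost every \<open>t\<close>.\<close>

definition weak_solution ::
  "real \<Rightarrow> (real^2) set \<Rightarrow> real \<Rightarrow> real \<Rightarrow> real \<Rightarrow> (real \<Rightarrow> field3 \<Rightarrow> real) \<Rightarrow> field3 \<Rightarrow> (real \<Rightarrow> field3) \<Rightarrow> bool"
  where
  "weak_solution T S a1 a2 \<nu> f u0 u \<longleftrightarrow>
     u \<in> VQ_space T S a1 a2 \<and>
     (\<forall>v\<in>V_space S a1 a2. \<exists>g. has_weak_deriv {0<..<T} 1 (\<lambda>t. L2_pair S (u t) v) g \<and>
        (AE t in lebesgue_on {0<..<T}.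
           g t - \<nu> * A1_op S a1 a2 (u t) v + L2_pair S (B1_op S a1 a2 (u t) (u t)) v = f t v)) \<and>
     (\<forall>v\<in>H_space S a1 a2. \<exists>c. continuous_on {0..T} c \<and>
        (AE t in lebesgue_on {0<..<T}. c t = L2_pair S (u t) v) \<and> c 0 = L2_pair S u0 v)"

end

theory Submission
  imports Defs "HOL-Library.Function_Algebras"
begin

text \<open>The equation is reduced to an abstract one, \<open>u' + A u + B(u, u) = f\<close>, for a form \<open>a\<close> that is coercive
  on \<open>V\<close> and a trilinear form \<open>b\<close> that vanishes when its last two arguments agree and satisfies
  \<open>|b(u, v, w)| \<le> C (|u| \<parallel>u\<parallel>)\<^sup>1\<^sup>/\<^sup>2 \<parallel>v\<parallel> (|w| \<parallel>w\<parallel>)\<^sup>1\<^sup>/\<^sup>2\<close>.  The energy identity and Gronwall's lemma bound the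
  difference of two solutions by the difference of their data.  This gives uniqueness.  It also gives
  existence without any compactness argument: the data are approximated by an initial value in \<open>V\<close> and a
  force that is Lipschitz in time and compatible with it at time 0; the interpolant of the semi-implicit
  Euler scheme then solves the equation exactly with a slightly perturbed force, so that these
  interpolants form a Cauchy sequence.

  On the plane section the bound on \<open>b\<close> is Ladyzhenskaya's inequality and coercivity is Poincare's
  inequality; \<open>b(u, v, v) = 0\<close> because the plane field \<open>(u\<^sub>1 - u\<^sub>3/(2a\<^sub>1), u\<^sub>2 - u\<^sub>3/(2a\<^sub>2))\<close> that transports \<open>v\<close>
  is divergence free.  The equation with the distributional time derivative is equivalent to the equation
  integrated in time, by the lemma of du Bois-Reymond.\<close>

text \<open>Approximate solutions can be compared by stability only if the error of their force is
  small in L2 in time with values in the dual of \<open>V\<close>. For the Euler interpolant this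
  needs difference quotients bounded in L2 in time with values in \<open>V\<close>, uniformly in the
  step. The bound comes from differencing the scheme in time, which explains the Lipschitz force and
  its compatibility: at time 0 the force must equal \<open>A x + B(x, x)\<close>, so that the
  initial quotient is 0. Compatibility costs nothing, because an L2 force may be altered on a short
  initial interval. The exponent 1/2 in the bound on \<open>b\<close> is decisive: for a difference
  \<open>z\<close> of solutions \<open>u\<close> and \<open>w\<close> only \<open>b(z, u, z)\<close>
  survives, and Young's inequality turns it into a part of the dissipation plus a multiple of
  \<open>||u||^2 |z|^2\<close>, where \<open>||u||^2\<close> is integrable in time. Since
  \<open>u\<close> alone enters, one Gronwall factor serves a whole bounded family of solutions. All
  spaces consist of representatives with seminorms, so limits are unique only up to seminorm
  0.\<close>

instantiation "fun" :: (type, real_vector) real_vector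
begin

definition "scaleR c f = (\<lambda>x. c *\<^sub>R f x)"

instance
  by standard (auto simp: scaleR_fun_def fun_eq_iff algebra_simps)

end

lemma scaleR_fun_apply [simp]: "(c *\<^sub>R f) x = c *\<^sub>R f x"
  by (simp add: scaleR_fun_def)

lemma sum_fun_apply [simp]: "(\<Sum>i\<in>I. f i) x = (\<Sum>i\<in>I. f i x)"
  by (induction I rule: infinite_finite_induct) auto

lemma tendsto_zero_inverse:
  fixes x :: "nat => real"
  assumes "\<And>n. 0 \<le> x n" "\<And>n. x n < inverse (real (Suc n))" shows "x \<longlonglongrightarrow> 0"
  by (rule Lim_null_comparison[OF _ LIMSEQ_inverse_real_of_nat])
    (use assms in \<open>auto intro!: always_eventually less_imp_le\<close>)

section \<open>Seminormed spaces of representatives\<close>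

text \<open>Elements are representatives: functions that agree almost everywhere have distance 0, so
  definiteness cannot be assumed. \<open>N\<close> is constrained on the subspace \<open>X\<close>
  only, which explains the membership conditions throughout.\<close>

locale seminormed =
  fixes X :: "'x::real_vector set" and N :: "'x => real"
  assumes subspace: "subspace X"
    and triangle: "\<And>x y. x \<in> X ==> y \<in> X ==> N (x + y) \<le> N x + N y"
    and homogeneous: "\<And>c x. x \<in> X ==> N (c *\<^sub>R x) = \<bar>c\<bar> * N x"
begin

lemma zero_mem [simp, intro]: "0 \<in> X"
  and add_mem [intro]: "x \<in> X ==> y \<in> X ==> x + y \<in> X"
  and diff_mem [intro]: "x \<in> X ==> y \<in> X ==> x - y \<in> X"
  and scaleR_mem [intro]: "x \<in> X ==> c *\<^sub>R x \<in> X"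
  using subspace by (auto simp: subspace_0 subspace_add subspace_diff subspace_scale)

lemma sum_mem: "(\<And>i. i \<in> I ==> f i \<in> X) ==> (\<Sum>i\<in>I. f i) \<in> X"
  using subspace by (rule subspace_sum)

lemma uminus_mem [intro]: "x \<in> X ==> - x \<in> X"
  using subspace by (rule subspace_neg)

lemma N_zero [simp]: "N 0 = 0"
  using homogeneous[of 0 0] by simp

lemma N_uminus [simp]: "x \<in> X ==> N (- x) = N x"
  using homogeneous[of x "-1"] by simp

lemma N_nonneg [simp]: "x \<in> X ==> 0 \<le> N x"
  using triangle[of x "- x"] by (auto simp: uminus_mem)

lemma N_commute: "x \<in> X ==> y \<in> X ==> N (x - y) = N (y - x)"
  using N_uminus[of "x - y"] diff_mem by simp

lemma triangle_diff: "x \<in> X ==> y \<in> X ==> N (x - y) \<le> N x + N y"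
  using triangle[of x "- y"] by (auto simp: uminus_mem)

lemma triangle_3: "x \<in> X ==> y \<in> X ==> z \<in> X ==> N (x - z) \<le> N (x - y) + N (y - z)"
  using triangle[of "x - y" "y - z"] diff_mem by simp

lemma N_le: "x \<in> X ==> y \<in> X ==> N x \<le> N y + N (x - y)"
  using triangle[of y "x - y"] diff_mem by simp

lemma N_diff_abs: "x \<in> X ==> y \<in> X ==> \<bar>N x - N y\<bar> \<le> N (x - y)"
  using N_le[of x y] N_le[of y x] N_commute[of x y] by auto

lemma N_square_add: "x \<in> X ==> y \<in> X ==> (N (x + y))^2 \<le> 2 * (N x)^2 + 2 * (N y)^2"
proof -
  assume a: "x \<in> X" "y \<in> X"
  have "(N (x + y))^2 \<le> (N x + N y)^2" using a triangle add_mem by (intro power_mono) auto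
  also have "\<dots> \<le> 2 * (N x)^2 + 2 * (N y)^2"
    using zero_le_power2[of "N x - N y"] by (simp add: power2_eq_square algebra_simps)
  finally show ?thesis .
qed

lemma N_tendsto:
  assumes "\<And>n. x n \<in> X" "y \<in> X" "(\<lambda>n. N (y - x n)) \<longlonglongrightarrow> 0"
  shows "(\<lambda>n. N (x n)) \<longlonglongrightarrow> N y"
proof (rule Lim_null[THEN iffD2], rule Lim_null_comparison)
  show "\<forall>\<^sub>F n in sequentially. norm (N (x n) - N y) \<le> N (y - x n)"
    using N_diff_abs[OF assms(2,1)] by (intro always_eventually) (simp add: abs_minus_commute)
qed (use assms in auto)

lemma tendsto_functional:
  assumes bd: "\<And>x. x \<in> X ==> \<bar>F x\<bar> \<le> C * N x"
    and diff: "\<And>x y. x \<in> X ==> y \<in> X ==> F (x - y) = F x - F y"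
    and u: "u \<in> X" "\<And>n. x n \<in> X" "(\<lambda>n. N (u - x n)) \<longlonglongrightarrow> 0"
  shows "(\<lambda>n. F (x n)) \<longlonglongrightarrow> F u"
proof (rule Lim_null[THEN iffD2], rule Lim_null_comparison)
  show "(\<lambda>n. C * N (u - x n)) \<longlonglongrightarrow> 0"
    using tendsto_mult_right_zero[OF u(3)] by simp
  show "\<forall>\<^sub>F n in sequentially. norm (F (x n) - F u) \<le> C * N (u - x n)"
  proof (intro always_eventually allI)
    fix n
    show "norm (F (x n) - F u) \<le> C * N (u - x n)"
      using bd[OF diff_mem[OF u(1,2)], of n] diff[OF u(1,2), of n] by (simp add: abs_minus_commute)
  qed
qed

lemma norm_closure_E:
  assumes x: "x \<in> norm_closure X N A" and A: "A \<subseteq> X"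
  obtains y where "\<And>n. y n \<in> A" "(\<lambda>n. N (x - y n)) \<longlonglongrightarrow> 0"
proof -
  have "\<exists>y\<in>A. N (x - y) < inverse (real (Suc n))" for n using x by (auto simp: norm_closure_def)
  then obtain y where y: "\<And>n. y n \<in> A" "\<And>n. N (x - y n) < inverse (real (Suc n))" by metis
  have "(\<lambda>n. N (x - y n)) \<longlonglongrightarrow> 0"
    by (rule tendsto_zero_inverse) (use x y A in \<open>auto simp: norm_closure_def intro!: N_nonneg diff_mem\<close>)
  then show ?thesis using that y by blast
qed

lemma subset_norm_closure: "A \<subseteq> X ==> A \<subseteq> norm_closure X N A"
  by (auto simp: norm_closure_def intro!: bexI)

end

section \<open>Measurability of almost everywhere limits\<close>

lemma complete_measure_lebesgue_on:
  assumes "S \<in> sets lebesgue"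
  shows "complete_measure (lebesgue_on S)"
proof
  fix A B assume "B \<subseteq> A" "A \<in> null_sets (lebesgue_on S)"
  then have A: "A \<in> null_sets lebesgue" "A \<subseteq> S"
    using assms null_sets_restrict_space[of S lebesgue] by auto
  then have "B \<in> null_sets lebesgue"
    using \<open>B \<subseteq> A\<close> completion.complete2 by blast
  then show "B \<in> sets (lebesgue_on S)"
    using A(2) \<open>B \<subseteq> A\<close> assms by (auto simp: sets_restrict_space_iff)
qed

lemma (in complete_measure) borel_measurable_AE_eq:
  fixes f g :: "'a => 'b::topological_space"
  assumes "f \<in> borel_measurable M" "AE x in M. f x = g x"
  shows "g \<in> borel_measurable M"
proof (rule measurableI)
  fix A :: "'b set" assume A: "A \<in> sets borel"
  have 1: "f -` A \<inter> space M \<in> sets M" using assms(1) A by (rule measurable_sets)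
  have 2: "AE x in M. x \<in> f -` A \<inter> space M \<longleftrightarrow> x \<in> g -` A \<inter> space M"
    using assms(2) by (auto elim: eventually_mono)
  show "g -` A \<inter> space M \<in> sets M"
    by (rule in_sets_AE[OF 2 1]) auto
qed auto

lemma (in complete_measure) borel_measurable_AE_limit:
  fixes f :: "nat => 'a => 'b::metric_space"
  assumes f: "\<And>n. f n \<in> borel_measurable M" and lim: "AE x in M. (\<lambda>n. f n x) \<longlonglongrightarrow> g x"
  shows "g \<in> borel_measurable M"
proof -
  obtain Z where Z: "Z \<in> null_sets M" "\<And>x. x \<in> space M - Z ==> (\<lambda>n. f n x) \<longlonglongrightarrow> g x"
    using lim by (auto elim!: AE_E3)
  \<comment> \<open>On the exceptional null set all terms are replaced by one and the same constant,
    so that convergence holds everywhere; completeness of the measure then removes the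
    change.\<close>
  define c where "c = g undefined"
  define g' where "g' x = (if x \<in> Z then c else g x)" for x
  have [measurable]: "Z \<in> sets M" using Z(1) by auto
  note [measurable] = f
  have "g' \<in> borel_measurable M"
  proof (rule borel_measurable_LIMSEQ_metric)
    show "(\<lambda>x. if x \<in> Z then c else f n x) \<in> borel_measurable M" for n by measurable
    show "(\<lambda>n. if x \<in> Z then c else f n x) \<longlonglongrightarrow> g' x" if "x \<in> space M" for x
      using Z(2)[of x] that by (auto simp: g'_def)
  qed
  moreover have "AE x in M. g' x = g x"
    using AE_not_in[OF Z(1)] by (auto simp: g'_def elim!: eventually_mono)
  ultimately show ?thesis by (rule borel_measurable_AE_eq)
qed

section \<open>Bochner spaces with values in a seminormed space\<close>

definition L2b :: "'t measure => 'x::minus set => ('x => real) => ('t => 'x) set" where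
  "L2b M X N = {w. strongly_measurable M X N w \<and> integrable M (\<lambda>t. (N (w t))^2)}"

text \<open>Instantiated for curves in \<open>V\<close>, for curves in its dual and, with Euclidean
  values, for functions on a bounded open set. Finiteness of the measure puts bounded functions into
  \<open>L2\<close>; completeness makes almost everywhere limits measurable.\<close>

locale bochner = seminormed X N + finite_measure M + complete_measure M
  for X :: "'x::real_vector set" and N :: "'x => real" and M :: "'t measure"
begin

abbreviation "SM \<equiv> strongly_measurable M X N"
abbreviation "L2 \<equiv> L2b M X N"

lemma SM_mem: "SM w ==> AE t in M. w t \<in> X"
  by (auto simp: strongly_measurable_def)

lemma SM_E:
  assumes "SM w"
  obtains s where "\<And>n. simple_function M (s n)" "\<And>n t. t \<in> space M ==> s n t \<in> X"
    "AE t in M. w t \<in> X" "AE t in M. (\<lambda>n. N (w t - s n t)) \<longlonglongrightarrow> 0"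
  using assms unfolding strongly_measurable_def image_subset_iff by blast

lemma SM_I:
  assumes "\<And>n. simple_function M (s n)" "\<And>n t. t \<in> space M ==> s n t \<in> X"
    "AE t in M. w t \<in> X" "AE t in M. (\<lambda>n. N (w t - s n t)) \<longlonglongrightarrow> 0"
  shows "SM w"
  using assms unfolding strongly_measurable_def image_subset_iff by blast

lemma SM_measurable:
  assumes "SM w" shows "(\<lambda>t. N (w t)) \<in> borel_measurable M"
proof -
  obtain s where s: "\<And>n. simple_function M (s n)" "\<And>n t. t \<in> space M ==> s n t \<in> X"
    "AE t in M. w t \<in> X" "AE t in M. (\<lambda>n. N (w t - s n t)) \<longlonglongrightarrow> 0"
    using assms by (rule SM_E) blast
  show ?thesis
  proof (rule borel_measurable_AE_limit)
    show "(\<lambda>t. N (s n t)) \<in> borel_measurable M" for n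
      using simple_function_compose[OF s(1), of N n] by (auto simp: comp_def intro: borel_measurable_simple_function)
    show "AE t in M. (\<lambda>n. N (s n t)) \<longlonglongrightarrow> N (w t)"
      using s(3,4) AE_space by eventually_elim (rule N_tendsto[OF s(2)])
  qed
qed

lemma SM_simple:
  assumes "simple_function M s" "\<And>t. t \<in> space M ==> s t \<in> X"
  shows "SM s"
  by (rule SM_I[where s = "\<lambda>_. s"]) (use assms in auto)

text \<open>The simple approximations of both arguments are inserted into \<open>\<Phi>\<close>.
  Sequential continuity of \<open>\<Phi>\<close> at each pair is enough, so that sums and quadratic
  operators are covered by the same argument.\<close>

lemma SM_compose2:
  fixes XA :: "'y::minus set" and XB :: "'z::minus set"
  assumes w: "strongly_measurable M XA NA w" and z: "strongly_measurable M XB NB z"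
    and mem: "\<And>x y. x \<in> XA ==> y \<in> XB ==> \<Phi> x y \<in> X"
    and cont: "\<And>x y x' y'. x \<in> XA ==> y \<in> XB ==> (\<And>n. x' n \<in> XA) ==> (\<And>n. y' n \<in> XB) ==>
       (\<lambda>n. NA (x - x' n)) \<longlonglongrightarrow> 0 ==> (\<lambda>n. NB (y - y' n)) \<longlonglongrightarrow> 0 ==>
       (\<lambda>n. N (\<Phi> x y - \<Phi> (x' n) (y' n))) \<longlonglongrightarrow> 0"
  shows "SM (\<lambda>t. \<Phi> (w t) (z t))"
proof -
  obtain s where s: "\<And>n. simple_function M (s n)" "\<And>n t. t \<in> space M ==> s n t \<in> XA"
    "AE t in M. w t \<in> XA" "AE t in M. (\<lambda>n. NA (w t - s n t)) \<longlonglongrightarrow> 0"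
    using w unfolding strongly_measurable_def image_subset_iff by blast
  obtain r where r: "\<And>n. simple_function M (r n)" "\<And>n t. t \<in> space M ==> r n t \<in> XB"
    "AE t in M. z t \<in> XB" "AE t in M. (\<lambda>n. NB (z t - r n t)) \<longlonglongrightarrow> 0"
    using z unfolding strongly_measurable_def image_subset_iff by blast
  show ?thesis
  proof (rule SM_I[where s = "\<lambda>n t. \<Phi> (s n t) (r n t)"])
    show "simple_function M (\<lambda>t. \<Phi> (s n t) (r n t))" for n
      using s(1) r(1) by (rule simple_function_compose2)
    show "t \<in> space M ==> \<Phi> (s n t) (r n t) \<in> X" for n t using s(2) r(2) mem by auto
    show "AE t in M. \<Phi> (w t) (z t) \<in> X" using s(3) r(3) by eventually_elim (rule mem)
    show "AE t in M. (\<lambda>n. N (\<Phi> (w t) (z t) - \<Phi> (s n t) (r n t))) \<longlonglongrightarrow> 0"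
      using s(3,4) r(3,4) AE_space by eventually_elim (rule cont, use s(2) r(2) in auto)
  qed
qed

lemma SM_compose1:
  fixes XA :: "'y::minus set"
  assumes w: "strongly_measurable M XA NA w"
    and mem: "\<And>x. x \<in> XA ==> \<Phi> x \<in> X"
    and cont: "\<And>x x'. x \<in> XA ==> (\<And>n. x' n \<in> XA) ==> (\<lambda>n. NA (x - x' n)) \<longlonglongrightarrow> 0 ==>
       (\<lambda>n. N (\<Phi> x - \<Phi> (x' n))) \<longlonglongrightarrow> 0"
  shows "SM (\<lambda>t. \<Phi> (w t))"
  using SM_compose2[OF w w, of "\<lambda>x _. \<Phi> x"] mem cont by blast

lemma SM_add:
  assumes "SM w" "SM z" shows "SM (\<lambda>t. w t + z t)"
proof (rule SM_compose2[OF assms, where \<Phi> = "\<lambda>x y. x + y"])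
  fix x y x' y' assume *: "x \<in> X" "y \<in> X" "\<And>n. x' n \<in> X" "\<And>n. y' n \<in> X"
    "(\<lambda>n. N (x - x' n)) \<longlonglongrightarrow> 0" "(\<lambda>n. N (y - y' n)) \<longlonglongrightarrow> 0"
  show "(\<lambda>n. N (x + y - (x' n + y' n))) \<longlonglongrightarrow> 0"
  proof (rule Lim_null_comparison[OF _ tendsto_add_zero[OF *(5,6)]], intro always_eventually allI)
    fix n
    show "norm (N (x + y - (x' n + y' n))) \<le> N (x - x' n) + N (y - y' n)"
      using triangle[of "x - x' n" "y - y' n"] *(1-4) diff_mem add_mem by (simp add: add_diff_add)
  qed
qed auto

lemma SM_scaleR:
  assumes "SM w" shows "SM (\<lambda>t. c *\<^sub>R w t)"
proof (rule SM_compose1[OF assms, where \<Phi> = "\<lambda>x. c *\<^sub>R x"])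
  fix x x' assume *: "x \<in> X" "\<And>n. x' n \<in> X" "(\<lambda>n. N (x - x' n)) \<longlonglongrightarrow> 0"
  have "(\<lambda>n. N (c *\<^sub>R x - c *\<^sub>R x' n)) = (\<lambda>n. \<bar>c\<bar> * N (x - x' n))"
    using * homogeneous by (auto simp: diff_mem simp flip: scaleR_diff_right)
  then show "(\<lambda>n. N (c *\<^sub>R x - c *\<^sub>R x' n)) \<longlonglongrightarrow> 0"
    using tendsto_mult_right_zero[OF *(3), of "\<bar>c\<bar>"] by simp
qed auto

lemma SM_real:
  fixes \<phi> :: "'t => real"
  assumes "\<phi> \<in> borel_measurable M" "x \<in> X"
  shows "SM (\<lambda>t. \<phi> t *\<^sub>R x)"
proof -
  obtain F where F: "\<And>i. simple_function M (F i)"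
     "\<And>t. t \<in> space M ==> (\<lambda>i. F i t) \<longlonglongrightarrow> \<phi> t"
    using borel_measurable_implies_sequence_metric[OF assms(1), of 0] by metis
  show ?thesis
  proof (rule SM_I[where s = "\<lambda>n t. F n t *\<^sub>R x"])
    show "simple_function M (\<lambda>t. F n t *\<^sub>R x)" for n
      using simple_function_compose[OF F(1), of "\<lambda>c. c *\<^sub>R x"] by (simp add: comp_def)
    show "AE t in M. (\<lambda>n. N (\<phi> t *\<^sub>R x - F n t *\<^sub>R x)) \<longlonglongrightarrow> 0"
    proof (intro AE_I2)
      fix t assume "t \<in> space M"
      then have "(\<lambda>n. \<bar>\<phi> t - F n t\<bar> * N x) \<longlonglongrightarrow> \<bar>\<phi> t - \<phi> t\<bar> * N x"
        using F(2) by (intro tendsto_intros) auto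
      then show "(\<lambda>n. N (\<phi> t *\<^sub>R x - F n t *\<^sub>R x)) \<longlonglongrightarrow> 0"
        using homogeneous[OF assms(2)] by (simp flip: scaleR_diff_left)
    qed
  qed (use assms in auto)
qed

lemma SM_sum: "(\<And>i. i \<in> I ==> SM (w i)) ==> SM (\<lambda>t. \<Sum>i\<in>I. w i t)"
proof (induction I rule: infinite_finite_induct)
  case (insert i I)
  then show ?case using SM_add[of "w i" "\<lambda>t. \<Sum>i\<in>I. w i t"] by auto
qed (auto intro: SM_simple)

lemma L2_D:
  assumes "w \<in> L2"
  shows "SM w" "integrable M (\<lambda>t. (N (w t))^2)" "AE t in M. w t \<in> X" "(\<lambda>t. N (w t)) \<in> borel_measurable M"
  using assms SM_mem SM_measurable by (auto simp: L2b_def)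

lemma L2_I:
  assumes "SM w" "integrable M g" "AE t in M. (N (w t))^2 \<le> g t"
  shows "w \<in> L2"
proof -
  have "integrable M (\<lambda>t. (N (w t))^2)"
    using SM_measurable[OF assms(1)] assms(3)
    by (intro Bochner_Integration.integrable_bound[OF assms(2)]) auto
  then show ?thesis using assms(1) by (simp add: L2b_def)
qed

lemma L2_bounded:
  assumes "SM w" "AE t in M. N (w t) \<le> C" shows "w \<in> L2"
proof (rule L2_I[OF assms(1)])
  show "AE t in M. (N (w t))^2 \<le> C^2"
    using assms(2) SM_mem[OF assms(1)] by eventually_elim (auto intro!: power_mono)
qed simp

lemma L2_add:
  assumes *: "w \<in> L2" "z \<in> L2" shows "(\<lambda>t. w t + z t) \<in> L2"
proof -
  show ?thesis
  proof (rule L2_I[OF SM_add])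
    show "integrable M (\<lambda>t. 2 * (N (w t))^2 + 2 * (N (z t))^2)" using * L2_D by auto
    show "AE t in M. (N (w t + z t))^2 \<le> 2 * (N (w t))^2 + 2 * (N (z t))^2"
      using L2_D(3)[OF *(1)] L2_D(3)[OF *(2)] by eventually_elim (rule N_square_add)
  qed (use * L2_D in auto)
qed

lemma L2_scaleR:
  assumes *: "w \<in> L2" shows "(\<lambda>t. c *\<^sub>R w t) \<in> L2"
proof -
  show ?thesis
  proof (rule L2_I[OF SM_scaleR])
    show "integrable M (\<lambda>t. c^2 * (N (w t))^2)" using * L2_D by auto
    show "AE t in M. (N (c *\<^sub>R w t))^2 \<le> c^2 * (N (w t))^2"
      using L2_D(3)[OF *] by eventually_elim (auto simp: homogeneous power_mult_distrib)
  qed (use * L2_D in auto)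
qed

lemma L2_diff: "w \<in> L2 ==> z \<in> L2 ==> (\<lambda>t. w t - z t) \<in> L2"
  using L2_add[OF _ L2_scaleR, of w z "-1"] by simp

lemma L2_integral_add:
  assumes "w \<in> L2" "z \<in> L2"
  shows "(\<integral>t. (N (w t + z t))^2 \<partial>M) \<le> 2 * (\<integral>t. (N (w t))^2 \<partial>M) + 2 * (\<integral>t. (N (z t))^2 \<partial>M)"
proof -
  have "(\<integral>t. (N (w t + z t))^2 \<partial>M) \<le> (\<integral>t. 2 * (N (w t))^2 + 2 * (N (z t))^2 \<partial>M)"
  proof (rule integral_mono_AE)
    show "AE t in M. (N (w t + z t))^2 \<le> 2 * (N (w t))^2 + 2 * (N (z t))^2"
      using L2_D(3)[OF assms(1)] L2_D(3)[OF assms(2)] by eventually_elim (rule N_square_add)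
  qed (use assms L2_add L2_D in auto)
  then show ?thesis using assms L2_D by simp
qed

lemma L2_triangle_3:
  assumes "w \<in> L2" "y \<in> L2" "z \<in> L2"
  shows "(\<integral>t. (N (w t - z t))^2 \<partial>M) \<le> 2 * (\<integral>t. (N (w t - y t))^2 \<partial>M) + 2 * (\<integral>t. (N (y t - z t))^2 \<partial>M)"
  using L2_integral_add[OF L2_diff[OF assms(1,2)] L2_diff[OF assms(2,3)]] by simp

lemma L2_integral_commute:
  assumes "w \<in> L2" "y \<in> L2"
  shows "(\<integral>t. (N (w t - y t))^2 \<partial>M) = (\<integral>t. (N (y t - w t))^2 \<partial>M)"
proof (rule integral_cong_AE)
  show "AE t in M. (N (w t - y t))^2 = (N (y t - w t))^2"
    using L2_D(3)[OF assms(1)] L2_D(3)[OF assms(2)] by eventually_elim (simp add: N_commute)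
qed (use assms L2_diff L2_D(4) in \<open>auto intro!: borel_measurable_power\<close>)

lemma L2_simple:
  assumes "simple_function M s" "\<And>t. t \<in> space M ==> s t \<in> X"
  shows "s \<in> L2"
proof (rule L2_bounded[OF SM_simple[OF assms]])
  have "finite ((\<lambda>t. N (s t)) ` space M)"
    using finite_imageI[OF simple_functionD(1)[OF assms(1)], of N] by (simp add: image_image)
  then show "AE t in M. N (s t) \<le> Max ((\<lambda>t. N (s t)) ` space M)"
    by (intro AE_I2 Max_ge) auto
qed

lemma L2_dense_simple:
  assumes "w \<in> L2" "e > 0"
  obtains s where "simple_function M s" "\<And>t. t \<in> space M ==> s t \<in> X" "(\<integral>t. (N (w t - s t))^2 \<partial>M) < e"
proof -
  obtain s where s: "\<And>n. simple_function M (s n)" "\<And>n t. t \<in> space M ==> s n t \<in> X"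
    "AE t in M. w t \<in> X" "AE t in M. (\<lambda>n. N (w t - s n t)) \<longlonglongrightarrow> 0"
    using L2_D(1)[OF assms(1)] by (rule SM_E) blast
  note w = L2_D[OF assms(1)]
  \<comment> \<open>Cutting off where the simple function exceeds twice \<open>N (w t)\<close> gives
    \<open>N (w t - r n t) \<le> 3 * N (w t)\<close>, hence an integrable bound for dominated
    convergence. Where \<open>N (w t) > 0\<close> the cut-off is inactive for large
    \<open>n\<close>; where \<open>N (w t) = 0\<close> the difference has seminorm 0 from the
    start.\<close>
  define r where "r n t = (if N (s n t) \<le> 2 * N (w t) then s n t else 0)" for n t
  have r: "simple_function M (r n)" for n
  proof -
    have [measurable]: "(\<lambda>t. N (w t)) \<in> borel_measurable M" by (rule w)
    have [measurable]: "(\<lambda>t. N (s n t)) \<in> borel_measurable M"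
      using SM_simple[OF s(1,2)] by (rule SM_measurable)
    have "{t \<in> space M. N (s n t) \<le> 2 * N (w t)} \<in> sets M" by measurable
    then show ?thesis unfolding r_def using s(1) by (intro simple_function_If) auto
  qed
  have rX: "t \<in> space M ==> r n t \<in> X" for n t using s(2) by (auto simp: r_def)
  have dL2: "(\<lambda>t. w t - r n t) \<in> L2" for n by (intro L2_diff assms L2_simple r rX)
  have "(\<lambda>n. \<integral>t. (N (w t - r n t))^2 \<partial>M) \<longlonglongrightarrow> (\<integral>t. 0 \<partial>M)"
  proof (rule integral_dominated_convergence)
    show "integrable M (\<lambda>t. 9 * (N (w t))^2)" using w(2) by auto
    show "(\<lambda>t. (N (w t - r n t))^2) \<in> borel_measurable M" for n using L2_D(4)[OF dL2] by auto
    show "AE t in M. (\<lambda>n. (N (w t - r n t))^2) \<longlonglongrightarrow> 0"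
      using s(3,4) AE_space
    proof eventually_elim
      case (elim t)
      have lim: "(\<lambda>n. N (w t - r n t)) \<longlonglongrightarrow> 0"
      proof (cases "N (w t) = 0")
        case True
        have "N (w t - r n t) = 0" for n
        proof -
          have "N (r n t) \<le> 0" using True by (simp add: r_def)
          then show ?thesis
            using triangle_diff[OF elim(1) rX[OF elim(3)], of n] N_nonneg[OF diff_mem[OF elim(1) rX[OF elim(3)]], of n] True
            by linarith
        qed
        then show ?thesis by simp
      next
        case False
        then have p: "N (w t) > 0" using N_nonneg[OF elim(1)] by linarith
        have "(\<lambda>n. N (s n t)) \<longlonglongrightarrow> N (w t)" using N_tendsto[OF s(2)[OF elim(3)] elim(1,2)] .
        then have "\<forall>\<^sub>F n in sequentially. N (s n t) < 2 * N (w t)"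
          using p by (intro order_tendstoD(2)) auto
        then have "\<forall>\<^sub>F n in sequentially. N (w t - s n t) = N (w t - r n t)"
          by eventually_elim (auto simp: r_def)
        then show ?thesis by (rule Lim_transform_eventually[OF elim(2)])
      qed
      show ?case using tendsto_power[OF lim, of 2] by simp
    qed
    show "AE t in M. norm ((N (w t - r n t))^2) \<le> 9 * (N (w t))^2" for n
      using s(3) AE_space
    proof eventually_elim
      case (elim t)
      have "N (r n t) \<le> 2 * N (w t)" using elim by (auto simp: r_def)
      then have "N (w t - r n t) \<le> 3 * N (w t)" using triangle_diff[OF elim(1) rX[OF elim(2), of n]] by linarith
      then have "(N (w t - r n t))^2 \<le> (3 * N (w t))^2"
        using N_nonneg[OF diff_mem[OF elim(1) rX[OF elim(2)]], of n] by (rule power_mono)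
      then show ?case by (simp add: power_mult_distrib)
    qed
  qed auto
  then have "\<forall>\<^sub>F n in sequentially. (\<integral>t. (N (w t - r n t))^2 \<partial>M) < e"
    using \<open>e > 0\<close> by (intro order_tendstoD(2)) auto
  then obtain n where "(\<integral>t. (N (w t - r n t))^2 \<partial>M) < e"
    using eventually_happens'[OF sequentially_bot] by blast
  then show ?thesis using that[of "r n"] r rX by blast
qed

end

section \<open>Completeness of the Bochner space\<close>

lemma AE_summable:
  fixes g :: "nat => 'a => real"
  assumes g: "\<And>n. integrable M (g n)" "\<And>n. AE x in M. 0 \<le> g n x"
    and S: "summable (\<lambda>n. \<integral>x. g n x \<partial>M)"
  shows "AE x in M. summable (\<lambda>n. g n x)"
proof -
  note [measurable] = borel_measurable_integrable[OF g(1)]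
  have "(\<integral>\<^sup>+x. (\<Sum>n. ennreal (g n x)) \<partial>M) = (\<Sum>n. \<integral>\<^sup>+x. ennreal (g n x) \<partial>M)"
    by (intro nn_integral_suminf) measurable
  also have "\<dots> = (\<Sum>n. ennreal (\<integral>x. g n x \<partial>M))"
    using g by (simp add: nn_integral_eq_integral)
  also have "\<dots> \<noteq> \<infinity>"
    using S g(2) by (simp add: suminf_ennreal2 integral_nonneg_AE)
  finally have "AE x in M. (\<Sum>n. ennreal (g n x)) \<noteq> \<infinity>"
    by (intro nn_integral_noteq_infinite) auto
  moreover have "AE x in M. \<forall>n. 0 \<le> g n x" using g(2) by (simp add: AE_all_countable)
  ultimately show ?thesis
    by eventually_elim (auto intro: summable_suminf_not_top)
qed

text \<open>Completeness along sequences, without uniqueness of the limit, which is determined only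
  up to seminorm 0.\<close>

definition semi_complete :: "'x::minus set => ('x => real) => bool" where
  "semi_complete X N \<longleftrightarrow> (\<forall>x. (\<forall>n::nat. x n \<in> X) \<and> (\<forall>e>0. \<exists>K. \<forall>m\<ge>K. \<forall>n\<ge>K. N (x m - x n) < e) \<longrightarrow>
     (\<exists>y\<in>X. (\<lambda>n. N (y - x n)) \<longlonglongrightarrow> 0))"

lemma semi_completeE:
  assumes "semi_complete X N" "\<And>n::nat. x n \<in> X" "\<And>e. e > 0 ==> \<exists>K. \<forall>m\<ge>K. \<forall>n\<ge>K. N (x m - x n) < e"
  obtains y where "y \<in> X" "(\<lambda>n. N (y - x n)) \<longlonglongrightarrow> 0"
  using assms unfolding semi_complete_def by blast

context seminormed begin

lemma N_summable_Cauchy: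
  assumes "\<And>n. x n \<in> X" "summable (\<lambda>n. N (x (Suc n) - x n))" "e > 0"
  shows "\<exists>K. \<forall>m\<ge>K. \<forall>n\<ge>K. N (x m - x n) < e"
proof -
  define S where "S n = (\<Sum>k<n. N (x (Suc k) - x k))" for n
  have le: "N (x n - x m) \<le> S n - S m" if "m \<le> n" for m n
    using that
  proof (induction n rule: dec_induct)
    case (step n)
    then show ?case
      using triangle_3[OF assms(1) assms(1) assms(1), of "Suc n" m n]
      by (simp add: S_def)
  qed simp
  have "Cauchy S" using assms(2) unfolding S_def summable_iff_convergent by (rule convergent_Cauchy)
  then obtain K where K: "\<And>m n. m \<ge> K ==> n \<ge> K ==> norm (S m - S n) < e"
    using \<open>e > 0\<close> by (meson CauchyD)
  have "N (x m - x n) < e" if "m \<ge> K" "n \<ge> K" for m n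
    using le[of m n] le[of n m] K[OF that] N_commute[OF assms(1) assms(1), of m n] by (cases "m \<le> n") auto
  then show ?thesis by blast
qed

end

context bochner begin

text \<open>Riesz-Fischer: a subsequence with increments of square integral below
  \<open>(1/4)^n\<close> converges almost everywhere, and Fatou's lemma upgrades this to convergence
  of the whole sequence in mean square. The subsequence is part of the conclusion because
  approximate solutions are later also followed pointwise in time.\<close>

theorem L2_complete:
  assumes complete: "semi_complete X N" and w: "\<And>n. w n \<in> L2"
    and Cauchy: "\<And>e. e > 0 ==> \<exists>K. \<forall>m\<ge>K. \<forall>n\<ge>K. (\<integral>t. (N (w m t - w n t))^2 \<partial>M) < e"
  obtains z r where "z \<in> L2" "(\<lambda>n. \<integral>t. (N (z t - w n t))^2 \<partial>M) \<longlonglongrightarrow> 0"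
    "strict_mono r" "AE t in M. (\<lambda>n. N (z t - w (r n) t)) \<longlonglongrightarrow> 0"
proof -
  have "\<exists>K. \<forall>k::nat. \<forall>m\<ge>K k. \<forall>n\<ge>K k. (\<integral>t. (N (w m t - w n t))^2 \<partial>M) < (1/4)^k"
    by (intro choice allI Cauchy) simp
  then obtain K where K: "\<And>k m n. m \<ge> K k ==> n \<ge> K k ==> (\<integral>t. (N (w m t - w n t))^2 \<partial>M) < (1/4)^k"
    by blast
  \<comment> \<open>The sum makes \<open>r n\<close> at least \<open>K n\<close>; the summand
    \<open>n\<close> makes \<open>r\<close> strictly increasing.\<close>
  define r where "r n = (\<Sum>i\<le>n. K i) + n" for n
  have r: "strict_mono r" by (rule strict_monoI_Suc) (simp add: r_def)
  have rK: "K n \<le> r n" for n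
    using member_le_sum[of n "{..n}" K] by (simp add: r_def)
  have rle: "n \<le> r n" for n by (simp add: r_def)
  note w' = L2_D[OF w] and wd = L2_D[OF L2_diff[OF w w]]
  have X: "AE t in M. \<forall>n. w n t \<in> X" using w'(3) by (simp add: AE_all_countable)
  have "AE t in M. summable (\<lambda>n. 2^n * (N (w (r (Suc n)) t - w (r n) t))^2)"
  proof (rule AE_summable)
    show "integrable M (\<lambda>t. 2^n * (N (w (r (Suc n)) t - w (r n) t))^2)" for n using wd(2) by simp
    show "summable (\<lambda>n. \<integral>t. 2^n * (N (w (r (Suc n)) t - w (r n) t))^2 \<partial>M)"
    proof (rule summable_comparison_test'[of "\<lambda>n. (1/2)^n" 0])
      fix n
      have "(\<integral>t. (N (w (r (Suc n)) t - w (r n) t))^2 \<partial>M) \<le> (1/4)^n"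
        using K[of n "r (Suc n)" "r n"] rK[of n] strict_mono_less_eq[OF r, of n "Suc n"] by simp
      then have "2^n * (\<integral>t. (N (w (r (Suc n)) t - w (r n) t))^2 \<partial>M) \<le> 2^n * (1/4)^n"
        by (intro mult_left_mono) auto
      then show "norm (\<integral>t. 2^n * (N (w (r (Suc n)) t - w (r n) t))^2 \<partial>M) \<le> (1/2)^n"
        by (simp add: power_mult_distrib[symmetric])
    qed (simp add: summable_geometric)
  qed simp
  then have lim: "AE t in M. \<exists>y. y \<in> X \<and> (\<lambda>n. N (y - w (r n) t)) \<longlonglongrightarrow> 0"
    using X
  proof eventually_elim
    case (elim t)
    have "summable (\<lambda>n. N (w (r (Suc n)) t - w (r n) t))"
    proof (rule summable_comparison_test')
      show "summable (\<lambda>n. (1/2)^n + 2^n * (N (w (r (Suc n)) t - w (r n) t))^2)"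
        using elim(1) by (intro summable_add) (auto simp: summable_geometric)
      fix n
      define x where "x = N (w (r (Suc n)) t - w (r n) t)"
      have x: "x \<ge> 0" using elim(2) diff_mem by (simp add: x_def)
      \<comment> \<open>Summability of the squares with weights \<open>2^n\<close> implies plain
        summability of the increments, because a geometric series makes up for the missing
        square.\<close>
      have "0 \<le> (1/2)^n + 2^n * x^2 - x"
      proof -
        have "0 \<le> ((1/2)^n - 2^n * x / 2^n)^2 * 2^n + x" using x by simp
        also have "\<dots> = (1/2)^n + 2^n * x^2 - x"
          by (simp add: power2_eq_square field_simps)
        finally show ?thesis .
      qed
      then show "norm (N (w (r (Suc n)) t - w (r n) t)) \<le> (1/2)^n + 2^n * (N (w (r (Suc n)) t - w (r n) t))^2"
        using x by (simp add: x_def)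
    qed
    then have "\<exists>K. \<forall>m\<ge>K. \<forall>n\<ge>K. N (w (r m) t - w (r n) t) < e" if "e > 0" for e
      using that elim(2) by (intro N_summable_Cauchy) auto
    then obtain y where "y \<in> X" "(\<lambda>n. N (y - w (r n) t)) \<longlonglongrightarrow> 0"
      using elim(2) by (rule_tac semi_completeE[OF complete, of "\<lambda>n. w (r n) t"]) auto
    then show ?case by blast
  qed
  define z where "z t = (SOME y. y \<in> X \<and> (\<lambda>n. N (y - w (r n) t)) \<longlonglongrightarrow> 0)" for t
  have z: "AE t in M. z t \<in> X \<and> (\<lambda>n. N (z t - w (r n) t)) \<longlonglongrightarrow> 0"
    using lim by eventually_elim (unfold z_def, rule someI_ex)
  have fatou: "integrable M (\<lambda>t. (N (z t - w n t))^2) \<and> (\<integral>t. (N (z t - w n t))^2 \<partial>M) \<le> (1/4)^k" if n: "n \<ge> K k" for n k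
  proof -
    have meas: "(\<lambda>t. N (z t - w n t)) \<in> borel_measurable M"
    proof (rule borel_measurable_AE_limit)
      show "(\<lambda>t. N (w (r m) t - w n t)) \<in> borel_measurable M" for m by (rule wd)
      show "AE t in M. (\<lambda>m. N (w (r m) t - w n t)) \<longlonglongrightarrow> N (z t - w n t)"
        using z X by eventually_elim (intro N_tendsto, auto)
    qed
    have "(\<integral>\<^sup>+t. ennreal ((N (z t - w n t))^2) \<partial>M) \<le> (\<integral>\<^sup>+t. liminf (\<lambda>m. ennreal ((N (w (r m) t - w n t))^2)) \<partial>M)"
    proof (rule nn_integral_mono_AE)
      show "AE t in M. ennreal ((N (z t - w n t))^2) \<le> liminf (\<lambda>m. ennreal ((N (w (r m) t - w n t))^2))"
        using z X
      proof eventually_elim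
        case (elim t)
        have "(\<lambda>m. N (w (r m) t - w n t)) \<longlonglongrightarrow> N (z t - w n t)"
          using elim by (intro N_tendsto) auto
        then have "(\<lambda>m. ennreal ((N (w (r m) t - w n t))^2)) \<longlonglongrightarrow> ennreal ((N (z t - w n t))^2)"
          by (intro tendsto_intros)
        then show ?case using lim_imp_Liminf[OF sequentially_bot] by (metis order_refl)
      qed
    qed
    also have "\<dots> \<le> liminf (\<lambda>m. \<integral>\<^sup>+t. ennreal ((N (w (r m) t - w n t))^2) \<partial>M)"
      using wd(4) by (intro nn_integral_liminf) auto
    also have "\<dots> \<le> liminf (\<lambda>m. ennreal ((1/4)^k))"
    proof (rule Liminf_mono, rule eventually_sequentiallyI[of "K k"])
      fix m assume "K k \<le> m"
      then have "(\<integral>t. (N (w (r m) t - w n t))^2 \<partial>M) \<le> (1/4)^k"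
        using K[of k "r m" n] rle[of m] n by simp
      then show "(\<integral>\<^sup>+t. ennreal ((N (w (r m) t - w n t))^2) \<partial>M) \<le> ennreal ((1/4)^k)"
        using wd(2) by (simp add: nn_integral_eq_integral)
    qed
    also have "\<dots> = ennreal ((1/4)^k)" by (simp add: Liminf_const)
    finally have *: "(\<integral>\<^sup>+t. ennreal ((N (z t - w n t))^2) \<partial>M) \<le> ennreal ((1/4)^k)" .
    have int: "integrable M (\<lambda>t. (N (z t - w n t))^2)"
      using meas * by (intro integrableI_bounded) (auto simp: less_top[symmetric] top_unique)
    show ?thesis using int * by (simp add: nn_integral_eq_integral)
  qed
  \<comment> \<open>Strong measurability of \<open>z\<close> needs simple functions that converge to
    \<open>z\<close> itself. Those for \<open>w (r n)\<close> are taken so close that their squared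
    errors have a summable integral, hence tend to 0 almost everywhere.\<close>
  have "\<exists>s. simple_function M s \<and> (\<forall>t\<in>space M. s t \<in> X) \<and> (\<integral>t. (N (w (r n) t - s t))^2 \<partial>M) < (1/4)^n" for n
    by (rule L2_dense_simple[OF w[of "r n"], of "(1/4)^n"]) (simp, blast)
  then have "\<exists>s. \<forall>n. simple_function M (s n) \<and> (\<forall>t\<in>space M. s n t \<in> X) \<and> (\<integral>t. (N (w (r n) t - s n t))^2 \<partial>M) < (1/4)^n"
    by (intro choice allI)
  then obtain s where s: "\<And>n. simple_function M (s n)" "\<And>n t. t \<in> space M ==> s n t \<in> X"
    "\<And>n. (\<integral>t. (N (w (r n) t - s n t))^2 \<partial>M) < (1/4)^n" by blast
  have sm: "AE t in M. summable (\<lambda>n. (N (w (r n) t - s n t))^2)"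
  proof (rule AE_summable)
    show "integrable M (\<lambda>t. (N (w (r n) t - s n t))^2)" for n by (rule L2_D(2)[OF L2_diff[OF w L2_simple[OF s(1,2)]]])
    show "summable (\<lambda>n. \<integral>t. (N (w (r n) t - s n t))^2 \<partial>M)"
      by (rule summable_comparison_test'[of "\<lambda>n. (1/4)^n" 0]) (use s(3) in \<open>simp_all add: summable_geometric less_imp_le\<close>)
  qed simp
  have SMz: "SM z"
  proof (rule SM_I[OF s(1,2)])
    show "AE t in M. (\<lambda>n. N (z t - s n t)) \<longlonglongrightarrow> 0"
      using z X sm AE_space
    proof eventually_elim
      case (elim t)
      have m: "z t \<in> X" "w (r n) t \<in> X" "s n t \<in> X" for n using elim s(2) by auto
      have "(\<lambda>n. sqrt ((N (w (r n) t - s n t))^2)) \<longlonglongrightarrow> sqrt 0"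
        by (intro tendsto_real_sqrt summable_LIMSEQ_zero elim(3))
      then have l: "(\<lambda>n. N (w (r n) t - s n t)) \<longlonglongrightarrow> 0" using N_nonneg[OF diff_mem[OF m(2,3)]] by simp
      have lim: "(\<lambda>n. N (z t - w (r n) t) + N (w (r n) t - s n t)) \<longlonglongrightarrow> 0"
        using tendsto_add[OF conjunct2[OF elim(1)] l] by simp
      show ?case
      proof (rule Lim_null_comparison[OF _ lim], intro always_eventually allI)
        fix n show "norm (N (z t - s n t)) \<le> N (z t - w (r n) t) + N (w (r n) t - s n t)"
          using triangle_3[OF m, of n] N_nonneg[OF diff_mem[OF m(1,3)], of n] by simp
      qed
    qed
    show "AE t in M. z t \<in> X" using z by eventually_elim simp
  qed
  have L2z: "z \<in> L2"
  proof (rule L2_I[OF SMz])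
    show "integrable M (\<lambda>t. 2 * (N (z t - w (K 0) t))^2 + 2 * (N (w (K 0) t))^2)" using fatou[of 0 "K 0"] w'(2) by auto
    show "AE t in M. (N (z t))^2 \<le> 2 * (N (z t - w (K 0) t))^2 + 2 * (N (w (K 0) t))^2"
      using z X
    proof eventually_elim
      case (elim t)
      then have "z t - w (K 0) t \<in> X" "w (K 0) t \<in> X" by auto
      from N_square_add[OF this] show ?case by simp
    qed
  qed
  have conv: "(\<lambda>n. \<integral>t. (N (z t - w n t))^2 \<partial>M) \<longlonglongrightarrow> 0"
  proof (rule LIMSEQ_I)
    fix e :: real assume "e > 0"
    obtain k where k: "(1/4)^k < e" using real_arch_pow_inv[of "e" "1/4"] \<open>e > 0\<close> by auto
    show "\<exists>no. \<forall>n\<ge>no. norm ((\<integral>t. (N (z t - w n t))^2 \<partial>M) - 0) < e"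
      using fatou[of k] k by (intro exI[of _ "K k"]) force
  qed
  have "AE t in M. (\<lambda>n. N (z t - w (r n) t)) \<longlonglongrightarrow> 0" using z by eventually_elim auto
  then show ?thesis using that L2z conv r by blast
qed

end

section \<open>Approximation by Lipschitz curves with prescribed initial value\<close>

lemma abs_max_diff_le: "\<bar>max 0 (1 - a) - max 0 (1 - b)\<bar> \<le> \<bar>a - b\<bar>" for a b :: real
  by (auto simp: max_def)

text \<open>Between a closed set inside \<open>E\<close> and an open set around \<open>E\<close> of
  nearly the same measure, \<open>\<phi>\<close> falls linearly with the distance from 1 to 0. The
  closed set is compact because \<open>E\<close> is bounded, so it has positive distance from the
  complement of the open set; this distance is the inverse of the Lipschitz constant.\<close>

lemma indicator_Lipschitz_approx:
  fixes E :: "real set"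
  assumes E: "E \<in> sets lebesgue" "E \<subseteq> {0<..<T}" and "e > 0"
  obtains \<phi> :: "real => real" and L where "\<And>s t. \<bar>\<phi> s - \<phi> t\<bar> \<le> L * \<bar>s - t\<bar>" "L \<ge> 0"
    "\<And>t. t \<le> 0 ==> \<phi> t = 0" "\<And>t. \<bar>\<phi> t\<bar> \<le> 1"
    "(\<integral>t. (indicator E t - \<phi> t)^2 \<partial>lebesgue_on {0<..<T}) < e"
proof -
  let ?M = "lebesgue_on {0<..<T}"
  obtain C where C: "closed C" "C \<subseteq> E" "E - C \<in> lmeasurable" "emeasure lebesgue (E - C) < ennreal (e/2)"
    using sets_lebesgue_inner_closed[OF E(1), of "e/2"] \<open>e > 0\<close> by auto
  obtain U where U: "open U" "E \<subseteq> U" "U - E \<in> lmeasurable" "emeasure lebesgue (U - E) < ennreal (e/2)"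
    using sets_lebesgue_outer_open[OF E(1), of "e/2"] \<open>e > 0\<close> by auto
  \<comment> \<open>The intersection with the time interval forces \<open>\<phi>\<close> to vanish
    up to time 0.\<close>
  define V where "V = U \<inter> {0<..<T}"
  have V: "open V" "E \<subseteq> V" using U E by (auto simp: V_def)
  have mE: "measure lebesgue (E - C) < e/2" "measure lebesgue (U - E) < e/2"
    using C(3,4) U(3,4) \<open>e > 0\<close> by (auto simp: emeasure_eq_measure2 ennreal_less_iff measure_nonneg)
  have D: "(U - E) \<union> (E - C) \<in> lmeasurable" using C U by (intro fmeasurable.Un)
  have "measure lebesgue ((U - E) \<union> (E - C)) \<le> measure lebesgue (U - E) + measure lebesgue (E - C)"
    using C U by (intro measure_Un_le) (auto simp: fmeasurableD)
  then have mD: "measure lebesgue ((U - E) \<union> (E - C)) < e" using mE by linarith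
  have "bounded C" using C(2) E(2) bounded_subset[OF bounded_box[of 0 T], of C] by auto
  then have "compact C" using C(1) by (simp add: compact_eq_bounded_closed)
  moreover have "closed (- V)" "C \<inter> - V = {}" using V C by auto
  ultimately obtain d where d: "d > 0" "\<And>x y. x \<in> C ==> y \<in> - V ==> d \<le> dist x y"
    using separate_compact_closed[of C "- V"] by auto
  define \<phi> where "\<phi> t = (if C = {} then 0 else max 0 (1 - infdist t C / d))" for t
  have lip: "\<bar>\<phi> s - \<phi> t\<bar> \<le> (1/d) * \<bar>s - t\<bar>" for s t
  proof (cases "C = {}")
    case False
    have "\<bar>\<phi> s - \<phi> t\<bar> \<le> \<bar>infdist s C / d - infdist t C / d\<bar>" using False abs_max_diff_le by (simp add: \<phi>_def)
    also have "\<dots> = \<bar>infdist s C - infdist t C\<bar> / d" using d by (simp add: diff_divide_distrib[symmetric] abs_divide)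
    also have "\<dots> \<le> dist s t / d" using d infdist_triangle_abs by (intro divide_right_mono) auto
    finally show ?thesis by (simp add: dist_real_def)
  qed (use d in \<open>simp add: \<phi>_def\<close>)
  have off: "\<phi> t = 0" if "t \<notin> V" for t
  proof (cases "C = {}")
    case False
    have "d \<le> infdist t C" unfolding infdist_notempty[OF False]
      by (rule cINF_greatest[OF False]) (use d(2)[of _ t] that in \<open>auto simp: dist_commute\<close>)
    then show ?thesis using d by (auto simp: \<phi>_def)
  qed (simp add: \<phi>_def)
  have on: "\<phi> t = 1" if "t \<in> C" for t using that by (auto simp: \<phi>_def)
  have bd: "0 \<le> \<phi> t" "\<phi> t \<le> 1" for t using d infdist_nonneg[of t C] by (auto simp: \<phi>_def)
  have le: "(indicator E t - \<phi> t)^2 \<le> indicator ((U - E) \<union> (E - C)) t" for t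
  proof (cases "t \<in> (U - E) \<union> (E - C)")
    case True
    have "\<bar>indicator E t - \<phi> t\<bar> \<le> 1" using bd[of t] by (auto simp: indicator_def)
    then show ?thesis using True by (simp add: abs_square_le_1)
  next
    case False
    then have "t \<in> C \<and> t \<in> E \<or> t \<notin> V \<and> t \<notin> E" using C V by (auto simp: V_def)
    then show ?thesis using on off by auto
  qed
  have "(\<integral>t. (indicator E t - \<phi> t)^2 \<partial>?M) \<le> (\<integral>t. indicator ((U - E) \<union> (E - C)) t \<partial>lebesgue)"
  proof -
    have "(\<integral>t. (indicator E t - \<phi> t)^2 \<partial>?M) = (\<integral>t. indicator {0<..<T} t *\<^sub>R (indicator E t - \<phi> t)^2 \<partial>lebesgue)"
      by (subst integral_restrict_space) auto
    also have "\<dots> \<le> (\<integral>t. indicator ((U - E) \<union> (E - C)) t \<partial>lebesgue)"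
    proof (rule integral_mono')
      show "integrable lebesgue (indicat_real ((U - E) \<union> (E - C)))"
        using D by (intro integrable_real_indicator) (auto simp: fmeasurable_def)
      show "indicat_real {0<..<T} t *\<^sub>R (indicat_real E t - \<phi> t)^2 \<le> indicator ((U - E) \<union> (E - C)) t" for t
        using le[of t] by (cases "t \<in> {0<..<T}") auto
    qed simp
    finally show ?thesis .
  qed
  also have "\<dots> < e" using mD D by (simp add: fmeasurableD)
  finally have "(\<integral>t. (indicator E t - \<phi> t)^2 \<partial>?M) < e" .
  then show ?thesis
    using that[of \<phi> "1/d"] lip d(1) off bd by (auto simp: V_def abs_le_iff intro: order_trans[of _ 0])
qed

locale bochner_time = seminormed X N for X :: "'x::real_vector set" and N :: "'x => real" +
  fixes T :: real
  assumes T: "T > 0"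
begin

abbreviation "M \<equiv> lebesgue_on {0<..<T}"

sublocale bochner X N M
proof -
  interpret finite_measure M by (rule finite_measure_lebesgue_on) simp
  interpret complete_measure M by (rule complete_measure_lebesgue_on) simp
  show "bochner X N M" ..
qed

definition lip_curve :: "real => (real => 'x) => bool" where
  "lip_curve L z \<longleftrightarrow> L \<ge> 0 \<and> (\<forall>t. z t \<in> X) \<and> (\<forall>s t. N (z s - z t) \<le> L * \<bar>s - t\<bar>)"

lemma lip_curve_real:
  assumes "\<And>s t. \<bar>\<phi> s - \<phi> t\<bar> \<le> L * \<bar>s - t\<bar>" "L \<ge> 0" "x \<in> X"
  shows "lip_curve (L * N x) (\<lambda>t. \<phi> t *\<^sub>R x)"
  unfolding lip_curve_def
proof (intro conjI allI)
  fix s t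
  have "N (\<phi> s *\<^sub>R x - \<phi> t *\<^sub>R x) = \<bar>\<phi> s - \<phi> t\<bar> * N x"
    using homogeneous[OF assms(3)] by (simp flip: scaleR_diff_left)
  also have "\<dots> \<le> L * \<bar>s - t\<bar> * N x" using assms N_nonneg by (intro mult_right_mono) auto
  finally show "N (\<phi> s *\<^sub>R x - \<phi> t *\<^sub>R x) \<le> L * N x * \<bar>s - t\<bar>" by (simp add: mult_ac)
qed (use assms in auto)

lemma lip_curve_add:
  assumes "lip_curve K w" "lip_curve L z"
  shows "lip_curve (K + L) (\<lambda>t. w t + z t)"
  unfolding lip_curve_def
proof (intro conjI allI)
  fix s t
  have "N (w s + z s - (w t + z t)) \<le> N (w s - w t) + N (z s - z t)"
    using assms triangle[of "w s - w t" "z s - z t"] by (auto simp: lip_curve_def add_diff_add diff_mem)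
  also have "\<dots> \<le> K * \<bar>s - t\<bar> + L * \<bar>s - t\<bar>" using assms by (auto simp: lip_curve_def intro!: add_mono)
  finally show "N (w s + z s - (w t + z t)) \<le> (K + L) * \<bar>s - t\<bar>" by (simp add: algebra_simps)
qed (use assms in \<open>auto simp: lip_curve_def\<close>)

text \<open>The value is prescribed for all \<open>t \<le> 0\<close>, so that delaying the curve
  past time 0 still yields the initial value. It is independent of \<open>w\<close>, since a square
  integrable function has no initial value of its own.\<close>

definition approx :: "(real => 'x) => 'x => bool" where
  "approx w x0 \<longleftrightarrow> (\<forall>e>0. \<exists>z L. lip_curve L z \<and> (\<forall>t\<le>0. z t = x0) \<and> z \<in> L2 \<and> (\<integral>t. (N (w t - z t))^2 \<partial>M) < e)"

lemma approx_E:
  assumes "approx w x0" "e > 0"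
  obtains L z where "lip_curve L z" "\<forall>t\<le>0. z t = x0" "z \<in> L2" "(\<integral>t. (N (w t - z t))^2 \<partial>M) < e"
  using assms by (auto simp: approx_def)

lemma approx_add:
  assumes "approx w x" "approx z y" "w \<in> L2" "z \<in> L2"
  shows "approx (\<lambda>t. w t + z t) (x + y)"
  unfolding approx_def
proof (intro allI impI)
  fix e :: real assume "e > 0"
  then have e: "e/4 > 0" by simp
  obtain K w' where w': "lip_curve K w'" "\<forall>t\<le>0. w' t = x" "w' \<in> L2" "(\<integral>t. (N (w t - w' t))^2 \<partial>M) < e/4"
    by (rule approx_E[OF assms(1) e]) blast
  obtain L z' where z': "lip_curve L z'" "\<forall>t\<le>0. z' t = y" "z' \<in> L2" "(\<integral>t. (N (z t - z' t))^2 \<partial>M) < e/4"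
    by (rule approx_E[OF assms(2) e]) blast
  have "(\<integral>t. (N (w t + z t - (w' t + z' t)))^2 \<partial>M) < e"
    using L2_integral_add[OF L2_diff[OF assms(3) w'(3)] L2_diff[OF assms(4) z'(3)]] w'(4) z'(4)
    by (simp add: add_diff_add)
  then show "\<exists>z'' L. lip_curve L z'' \<and> (\<forall>t\<le>0. z'' t = x + y) \<and> z'' \<in> L2 \<and> (\<integral>t. (N (w t + z t - z'' t))^2 \<partial>M) < e"
    using w'(2) z'(2)
    by (intro exI[of _ "\<lambda>t. w' t + z' t"] exI[of _ "K + L"] conjI lip_curve_add[OF w'(1) z'(1)] L2_add[OF w'(3) z'(3)]) simp_all
qed

lemma approx_indicator:
  assumes E: "E \<in> sets lebesgue" "E \<subseteq> {0<..<T}" and x: "x \<in> X"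
  shows "approx (\<lambda>t. indicator E t *\<^sub>R x) 0"
  unfolding approx_def
proof (intro allI impI)
  fix e :: real assume "e > 0"
  define e' where "e' = e / ((N x)^2 + 1)"
  have "(N x)^2 + 1 > 0" by (simp add: add_nonneg_pos)
  then have e': "e' > 0" "e' * (N x)^2 < e" using \<open>e > 0\<close> unfolding e'_def by (auto simp: field_simps)
  obtain \<phi> L where \<phi>: "\<And>s t. \<bar>\<phi> s - \<phi> t\<bar> \<le> L * \<bar>s - t\<bar>" "L \<ge> 0" "\<And>t. t \<le> 0 ==> \<phi> t = 0" "\<And>t. \<bar>\<phi> t\<bar> \<le> 1"
    "(\<integral>t. (indicator E t - \<phi> t)^2 \<partial>lebesgue_on {0<..<T}) < e'"
    using indicator_Lipschitz_approx[OF E e'(1)] by blast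
  have "L-lipschitz_on UNIV \<phi>" using \<phi>(1,2) by (auto simp: lipschitz_on_def dist_real_def)
  then have "continuous_on {0<..<T} \<phi>" using lipschitz_on_continuous_on continuous_on_subset by blast
  then have m: "\<phi> \<in> borel_measurable M" by (intro continuous_imp_measurable_on_sets_lebesgue) auto
  have "(\<lambda>t. \<phi> t *\<^sub>R x) \<in> L2"
    using \<phi>(4) x N_nonneg[OF x]
    by (intro L2_bounded[of _ "N x"] SM_real m) (auto simp: homogeneous mult_left_le_one_le)
  moreover have "(\<integral>t. (N (indicator E t *\<^sub>R x - \<phi> t *\<^sub>R x))^2 \<partial>M) < e"
  proof -
    have "(\<integral>t. (N (indicator E t *\<^sub>R x - \<phi> t *\<^sub>R x))^2 \<partial>M) = (\<integral>t. (N x)^2 * (indicator E t - \<phi> t)^2 \<partial>M)"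
      using x by (intro Bochner_Integration.integral_cong) (auto simp flip: scaleR_diff_left simp: homogeneous power_mult_distrib)
    also have "\<dots> = (N x)^2 * (\<integral>t. (indicator E t - \<phi> t)^2 \<partial>M)" by simp
    also have "\<dots> \<le> (N x)^2 * e'" using \<phi>(5) by (intro mult_left_mono) auto
    finally show ?thesis using e'(2) by (simp add: mult_ac)
  qed
  ultimately show "\<exists>z L. lip_curve L z \<and> (\<forall>t\<le>0. z t = 0) \<and> z \<in> L2 \<and> (\<integral>t. (N (indicator E t *\<^sub>R x - z t))^2 \<partial>M) < e"
    using \<phi>(3)
    by (intro exI[of _ "\<lambda>t. \<phi> t *\<^sub>R x"] exI[of _ "L * N x"] conjI lip_curve_real[OF \<phi>(1,2) x]) simp_all
qed

lemma approx_sum: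
  assumes "finite I" "\<And>i. i \<in> I ==> approx (w i) 0" "\<And>i. i \<in> I ==> w i \<in> L2"
  shows "approx (\<lambda>t. \<Sum>i\<in>I. w i t) 0 \<and> (\<lambda>t. \<Sum>i\<in>I. w i t) \<in> L2"
  using assms
proof (induction I rule: finite_induct)
  case empty
  have "lip_curve 0 (\<lambda>_. 0)" by (auto simp: lip_curve_def)
  moreover have "(\<lambda>_. 0) \<in> L2" by (intro L2_simple) auto
  ultimately show ?case by (auto simp: approx_def intro!: exI[of _ 0] exI[of _ "\<lambda>_. 0"])
next
  case (insert i I)
  then show ?case using approx_add[of "w i" 0 "\<lambda>t. \<Sum>i\<in>I. w i t" 0] L2_add by auto
qed

lemma approx_simple:
  assumes s: "simple_function M s" "\<And>t. t \<in> space M ==> s t \<in> X"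
  shows "approx s 0"
proof -
  define I where "I = s ` space M"
  define w where "w y t = indicator (s -` {y} \<inter> space M) t *\<^sub>R y" for y t
  have I: "finite I" "\<And>y. y \<in> I ==> s -` {y} \<inter> space M \<in> sets M" "\<And>y. y \<in> I ==> y \<in> X"
    using s by (auto simp: I_def simple_function_def)
  have eq: "(\<Sum>y\<in>I. w y t) = s t" if "t \<in> space M" for t
  proof -
    have "(\<Sum>y\<in>I. w y t) = (\<Sum>y\<in>I. if y = s t then y else 0)"
      using that by (intro sum.cong) (auto simp: w_def)
    then show ?thesis using I(1) that by (auto simp: I_def)
  qed
  have "approx (\<lambda>t. \<Sum>y\<in>I. w y t) 0 \<and> (\<lambda>t. \<Sum>y\<in>I. w y t) \<in> L2"
  proof (rule approx_sum[OF I(1)])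
    fix y assume y: "y \<in> I"
    have E: "s -` {y} \<inter> space M \<in> sets M" "y \<in> X" using I y by auto
    then have "s -` {y} \<inter> space M \<in> sets lebesgue" "s -` {y} \<inter> space M \<subseteq> {0<..<T}"
      by (auto simp: sets_restrict_space_iff)
    then show "approx (w y) 0" unfolding w_def[abs_def] using E(2) by (rule approx_indicator)
    show "w y \<in> L2" unfolding w_def[abs_def]
      using E N_nonneg[OF E(2)]
      by (intro L2_bounded[of _ "N y"] SM_real borel_measurable_indicator) (auto simp: homogeneous indicator_def)
  qed
  then have A: "approx (\<lambda>t. \<Sum>y\<in>I. w y t) 0" by blast
  have "(\<integral>t. (N (s t - z t))^2 \<partial>M) = (\<integral>t. (N ((\<Sum>y\<in>I. w y t) - z t))^2 \<partial>M)" for z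
    by (rule Bochner_Integration.integral_cong) (auto simp: eq)
  then show ?thesis using A unfolding approx_def by simp
qed

text \<open>Simple functions yield curves that start at 0. The prescribed value \<open>x\<close> is
  then added by a piece that falls linearly from \<open>x\<close> to 0 within time \<open>d\<close>;
  its square integral is at most \<open>d * (N x)^2\<close>.\<close>

theorem approx_L2:
  assumes w: "w \<in> L2" and x: "x \<in> X"
  shows "approx w x"
proof -
  have A: "approx w 0"
    unfolding approx_def
  proof (intro allI impI)
    fix e :: real assume "e > 0"
    then have e: "e/4 > 0" by simp
    obtain s where s: "simple_function M s" "\<And>t. t \<in> space M ==> s t \<in> X" "(\<integral>t. (N (w t - s t))^2 \<partial>M) < e/4"
      using L2_dense_simple[OF w e] by blast
    obtain L z where z: "lip_curve L z" "\<forall>t\<le>0. z t = 0" "z \<in> L2" "(\<integral>t. (N (s t - z t))^2 \<partial>M) < e/4"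
      by (rule approx_E[OF approx_simple[OF s(1,2)] e]) blast
    have "(\<integral>t. (N (w t - z t))^2 \<partial>M) < e"
      using L2_triangle_3[OF w L2_simple[OF s(1,2)] z(3)] s(3) z(4) by simp
    then show "\<exists>z L. lip_curve L z \<and> (\<forall>t\<le>0. z t = 0) \<and> z \<in> L2 \<and> (\<integral>t. (N (w t - z t))^2 \<partial>M) < e"
      using z by blast
  qed
  have L2_0: "(\<lambda>_. 0) \<in> L2" by (intro L2_simple) auto
  have B: "approx (\<lambda>_. 0) x"
    unfolding approx_def
  proof (intro allI impI)
    fix e :: real assume "e > 0"
    define d where "d = e / (2 * ((N x)^2 + 1))"
    have "(N x)^2 + 1 > 0" by (simp add: add_nonneg_pos)
    then have d: "d > 0" "d * (N x)^2 < e" using \<open>e > 0\<close> mult_pos_pos[of e "(N x)^2 + 1"] unfolding d_def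
      by (simp_all add: field_simps add_pos_nonneg)
    define \<psi> where "\<psi> t = max 0 (1 - max 0 t / d)" for t :: real
    have lip: "\<bar>\<psi> s - \<psi> t\<bar> \<le> (1/d) * \<bar>s - t\<bar>" for s t
    proof -
      have "\<bar>\<psi> s - \<psi> t\<bar> \<le> \<bar>max 0 s / d - max 0 t / d\<bar>" unfolding \<psi>_def by (rule abs_max_diff_le)
      also have "\<dots> = \<bar>max 0 s - max 0 t\<bar> / d" using d by (simp add: diff_divide_distrib[symmetric])
      also have "\<dots> \<le> \<bar>s - t\<bar> / d" using d by (intro divide_right_mono) auto
      finally show ?thesis by simp
    qed
    have bd: "0 \<le> \<psi> t" "\<psi> t \<le> 1" for t using d by (auto simp: \<psi>_def)
    have off: "\<psi> t = 0" if "t \<ge> d" for t using that d by (auto simp: \<psi>_def)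
    have "(1/d)-lipschitz_on UNIV \<psi>" using lip d by (auto simp: lipschitz_on_def dist_real_def)
    then have "continuous_on {0<..<T} \<psi>" using lipschitz_on_continuous_on continuous_on_subset by blast
    then have m: "\<psi> \<in> borel_measurable M" by (intro continuous_imp_measurable_on_sets_lebesgue) auto
    have in_L2: "(\<lambda>t. \<psi> t *\<^sub>R x) \<in> L2"
      using bd x N_nonneg[OF x]
      by (intro L2_bounded[of _ "N x"] SM_real m) (auto simp: homogeneous mult_left_le_one_le)
    have "(\<integral>t. (N (0 - \<psi> t *\<^sub>R x))^2 \<partial>M) \<le> (\<integral>t. indicator {0<..<d} t * (N x)^2 \<partial>lebesgue)"
    proof -
      have "(\<integral>t. (N (0 - \<psi> t *\<^sub>R x))^2 \<partial>M) = (\<integral>t. indicator {0<..<T} t *\<^sub>R (N (0 - \<psi> t *\<^sub>R x))^2 \<partial>lebesgue)"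
        by (subst integral_restrict_space) auto
      also have "\<dots> \<le> (\<integral>t. indicator {0<..<d} t * (N x)^2 \<partial>lebesgue)"
      proof (rule integral_mono')
        show "integrable lebesgue (\<lambda>t. indicator {0<..<d} t * (N x)^2)"
          using d by (intro integrable_mult_left) (simp add: integrable_indicator_iff emeasure_lborel_Ioo)
        fix t :: real
        have "(\<psi> t)^2 \<le> 1" using bd[of t] by (simp add: abs_square_le_1)
        then have "(N x)^2 * (\<psi> t)^2 \<le> (N x)^2" by (simp add: mult_left_le)
        then show "indicator {0<..<T} t *\<^sub>R (N (0 - \<psi> t *\<^sub>R x))^2 \<le> indicator {0<..<d} t * (N x)^2"
          using x off[of t] by (cases "t < d") (auto simp: indicator_def homogeneous power_mult_distrib mult_ac scaleR_mem)
      qed auto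
      finally show ?thesis .
    qed
    also have "\<dots> = d * (N x)^2" using d by simp
    finally have "(\<integral>t. (N (0 - \<psi> t *\<^sub>R x))^2 \<partial>M) < e" using d(2) by linarith
    moreover have "\<psi> t *\<^sub>R x = x" if "t \<le> 0" for t using that by (simp add: \<psi>_def)
    ultimately show "\<exists>z L. lip_curve L z \<and> (\<forall>t\<le>0. z t = x) \<and> z \<in> L2 \<and> (\<integral>t. (N (0 - z t))^2 \<partial>M) < e"
      using d(1) in_L2
      by (intro exI[of _ "\<lambda>t. \<psi> t *\<^sub>R x"] exI[of _ "(1/d) * N x"] conjI lip_curve_real[OF lip _ x]) simp_all
  qed
  show ?thesis using approx_add[OF A B w L2_0] by simp
qed

end

section \<open>Integrable functions on an interval\<close>

lemma AE_lebesgue_on_subset: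
  assumes "AE x in lebesgue_on S. P x" "R \<subseteq> S" "S \<in> sets lebesgue" "R \<in> sets lebesgue"
  shows "AE x in lebesgue_on R. P x"
proof -
  have "AE x in lebesgue. x \<in> S \<longrightarrow> P x" using assms by (simp add: AE_restrict_space_iff)
  then have "AE x in lebesgue. x \<in> R \<longrightarrow> P x" by eventually_elim (use assms(2) in auto)
  then show ?thesis using assms by (simp add: AE_restrict_space_iff)
qed

lemma AE_lebesgue_on_Ioo:
  fixes a b :: real
  shows "(AE t in lebesgue_on {a<..<b}. P t) \<longleftrightarrow> (AE t in lebesgue. a < t \<and> t < b \<longrightarrow> P t)"
  by (subst AE_restrict_space_iff) auto

text \<open>This lemma and the next ones mediate between two integrals: the Bochner spaces are
  phrased with the Lebesgue integral over the open interval, primitives and the fundamental theorem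
  of calculus with the gauge integral over closed intervals.\<close>

lemma integrable_lebesgue_on_Ioo:
  fixes f :: "real => real"
  shows "integrable (lebesgue_on {a<..<b}) f \<longleftrightarrow> f absolutely_integrable_on {a..b}"
  using absolutely_integrable_on_Icc_iff_Ioo[of a b f]
  by (simp add: integrable_restrict_space set_integrable_def)

lemma integrable_lebesgue_on_Ioo_sub:
  fixes f :: "real => real"
  assumes "integrable (lebesgue_on {a<..<b}) f" "a \<le> c" "d \<le> b"
  shows "integrable (lebesgue_on {c<..<d}) f"
  using assms unfolding integrable_lebesgue_on_Ioo
  by (meson atLeastatMost_subset_iff set_integrable_subset lmeasurable_cbox fmeasurableD lmeasurable_interval(1))

lemma integral_lebesgue_on_Ioo:
  fixes f :: "real => real"
  assumes "integrable (lebesgue_on {a<..<b}) f"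
  shows "integral\<^sup>L (lebesgue_on {a<..<b}) f = integral {a..b} f"
  using lebesgue_integral_eq_integral[OF assms] by (simp add: integral_open_interval_real)

lemma integrable_Ioo_HK:
  fixes f :: "real => real"
  assumes "integrable (lebesgue_on {a<..<b}) f" "a \<le> c" "d \<le> b"
  shows "f integrable_on {c..d}"
  using integrable_lebesgue_on_Ioo_sub[OF assms]
  by (simp add: integrable_lebesgue_on_Ioo set_lebesgue_integral_eq_integral)

lemma HK_mono_AE:
  fixes f g :: "real => real"
  assumes "integrable (lebesgue_on {a<..<b}) f" "integrable (lebesgue_on {a<..<b}) g"
    "AE t in lebesgue_on {a<..<b}. f t \<le> g t" "a \<le> c" "d \<le> b"
  shows "integral {c..d} f \<le> integral {c..d} g"
proof -
  have f: "integrable (lebesgue_on {c<..<d}) f" and g: "integrable (lebesgue_on {c<..<d}) g"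
    using assms integrable_lebesgue_on_Ioo_sub by blast+
  have "AE t in lebesgue_on {c<..<d}. f t \<le> g t"
    using assms(3) by (rule AE_lebesgue_on_subset) (use assms in auto)
  then have "integral\<^sup>L (lebesgue_on {c<..<d}) f \<le> integral\<^sup>L (lebesgue_on {c<..<d}) g"
    using f g by (intro integral_mono_AE)
  then show ?thesis using f g by (simp add: integral_lebesgue_on_Ioo)
qed

lemma HK_cong_AE:
  fixes f g :: "real => real"
  assumes "integrable (lebesgue_on {a<..<b}) f" "integrable (lebesgue_on {a<..<b}) g"
    "AE t in lebesgue_on {a<..<b}. f t = g t" "a \<le> c" "d \<le> b"
  shows "integral {c..d} f = integral {c..d} g"
proof (rule antisym)
  show "integral {c..d} f \<le> integral {c..d} g"
    using assms(3) by (intro HK_mono_AE[OF assms(1,2) _ assms(4,5)]) (auto elim: eventually_mono)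
  show "integral {c..d} g \<le> integral {c..d} f"
    using assms(3) by (intro HK_mono_AE[OF assms(2,1) _ assms(4,5)]) (auto elim: eventually_mono)
qed

lemma HK_abs_le:
  fixes f g :: "real => real"
  assumes "integrable (lebesgue_on {a<..<b}) f" "integrable (lebesgue_on {a<..<b}) g"
    "AE t in lebesgue_on {a<..<b}. \<bar>f t\<bar> \<le> g t" "a \<le> c" "d \<le> b"
  shows "\<bar>integral {c..d} f\<bar> \<le> integral {c..d} g"
proof -
  have "integral {c..d} f \<le> integral {c..d} g"
    using assms(3) by (intro HK_mono_AE[OF assms(1,2) _ assms(4,5)]) (auto elim: eventually_mono)
  moreover have "integral {c..d} (\<lambda>t. - f t) \<le> integral {c..d} g"
    using assms(3) by (intro HK_mono_AE[OF _ assms(2) _ assms(4,5)]) (auto elim: eventually_mono intro: assms(1))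
  ultimately show ?thesis by simp
qed

lemma HK_primitive_diff:
  fixes f :: "real => real"
  assumes "integrable (lebesgue_on {0<..<T}) f" "0 \<le> s" "s \<le> t" "t \<le> T"
  shows "integral {0..t} f - integral {0..s} f = integral {s..t} f"
  using Henstock_Kurzweil_Integration.integral_combine[of 0 s t f] integrable_Ioo_HK[OF assms(1), of 0 t] assms by simp

lemma HK_primitive_mono:
  fixes f :: "real => real"
  assumes "integrable (lebesgue_on {0<..<T}) f" "AE t in lebesgue_on {0<..<T}. 0 \<le> f t" "0 \<le> s" "s \<le> t" "t \<le> T"
  shows "integral {0..s} f \<le> integral {0..t} f"
  using HK_primitive_diff[OF assms(1,3-5)] HK_mono_AE[of 0 T "\<lambda>_. 0" f s t] assms by simp

lemma HK_primitive_continuous: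
  fixes f :: "real => real"
  assumes "integrable (lebesgue_on {0<..<T}) f"
  shows "continuous_on {0..T} (\<lambda>t. integral {0..t} f)"
  by (rule indefinite_integral_continuous_1, rule integrable_Ioo_HK[OF assms]) auto

text \<open>By Henstock's lemma the Riemann sums of \<open>\<bar>f\<bar>\<close> are small.\<close>

lemma AE_zero_if_box_integrals_zero:
  fixes f :: "'a::euclidean_space => real"
  assumes f: "integrable (lebesgue_on (cbox c d)) f" and z: "\<And>a b. cbox a b \<subseteq> cbox c d ==> integral (cbox a b) f = 0"
  shows "AE x in lebesgue_on (cbox c d). f x = 0"
proof -
  have int: "f integrable_on cbox c d" using f by (simp add: integrable_on_lebesgue_on)
  have "((\<lambda>t. \<bar>f t\<bar>) has_integral 0) (cbox c d)"
    unfolding has_integral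
  proof (intro allI impI)
    fix e :: real assume "e > 0"
    obtain \<gamma> where \<gamma>: "gauge \<gamma>" "\<And>p. p tagged_partial_division_of (cbox c d) ==> \<gamma> fine p ==>
             sum (\<lambda>(x,k). norm(measure lborel k *\<^sub>R f x - integral k f)) p < e"
      using Henstock_lemma[OF int \<open>e > 0\<close>] by blast
    have "norm ((\<Sum>(x, k)\<in>p. measure lborel k *\<^sub>R \<bar>f x\<bar>) - 0) < e" if p: "p tagged_division_of cbox c d" "\<gamma> fine p" for p
    proof -
      have "(\<Sum>(x, k)\<in>p. norm(measure lborel k *\<^sub>R f x - integral k f)) = (\<Sum>(x, k)\<in>p. measure lborel k *\<^sub>R \<bar>f x\<bar>)"
      proof (intro sum.cong refl, clarify)
        fix x k assume xk: "(x, k) \<in> p"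
        obtain a b where k: "k = cbox a b" using tagged_division_ofD(4)[OF p(1) xk] by blast
        have "integral k f = 0" using z[of a b] tagged_division_ofD(3)[OF p(1) xk] unfolding k by blast
        then show "norm (measure lborel k *\<^sub>R f x - integral k f) = measure lborel k *\<^sub>R \<bar>f x\<bar>" by (simp add: abs_mult)
      qed
      moreover have "(\<Sum>(x, k)\<in>p. norm(measure lborel k *\<^sub>R f x - integral k f)) < e"
        using \<gamma>(2)[of p] p tagged_division_of_def by blast
      moreover have "0 \<le> (\<Sum>(x, k)\<in>p. measure lborel k *\<^sub>R \<bar>f x\<bar>)" by (intro sum_nonneg) auto
      ultimately show ?thesis by simp
    qed
    then show "\<exists>\<gamma>. gauge \<gamma> \<and> (\<forall>\<D>. \<D> tagged_division_of cbox c d \<and> \<gamma> fine \<D> \<longrightarrow>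
       norm ((\<Sum>(x, k)\<in>\<D>. measure lborel k *\<^sub>R \<bar>f x\<bar>) - 0) < e)"
      using \<gamma>(1) by blast
  qed
  then have "integral\<^sup>L (lebesgue_on (cbox c d)) (\<lambda>t. \<bar>f t\<bar>) = 0"
    using lebesgue_integral_eq_integral[of "cbox c d" "\<lambda>t. \<bar>f t\<bar>"] f by (auto dest: integral_unique)
  then show ?thesis using f by (subst (asm) integral_nonneg_eq_0_iff_AE) auto
qed

lemma AE_zero_if_primitive_zero:
  fixes f :: "real => real"
  assumes f: "integrable (lebesgue_on {0<..<T}) f" and z: "\<And>t. 0 \<le> t ==> t \<le> T ==> integral {0..t} f = 0"
  shows "AE t in lebesgue_on {0<..<T}. f t = 0"
proof -
  have "AE t in lebesgue_on (cbox 0 T). f t = 0"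
  proof (rule AE_zero_if_box_integrals_zero)
    show "integrable (lebesgue_on (cbox 0 T)) f"
      using f unfolding integrable_lebesgue_on_Ioo by (simp add: integrable_restrict_space set_integrable_def)
    fix a b assume "cbox a b \<subseteq> cbox 0 T"
    then show "integral (cbox a b) f = 0"
      using HK_primitive_diff[OF f, of a b] z[of a] z[of b] by (cases "a \<le> b") auto
  qed
  then show ?thesis by (rule AE_lebesgue_on_subset) auto
qed

lemma AE_shift:
  fixes T d :: real
  assumes "AE t in lebesgue_on {0<..<T}. P t" "0 \<le> d"
  shows "AE t in lebesgue_on {0<..<T}. t > d \<longrightarrow> P (t - d)"
proof -
  have "AE t in lebesgue. 0 < t \<and> t < T \<longrightarrow> P t" using assms(1) by (simp add: AE_lebesgue_on_Ioo)
  then obtain Z where Z: "{t \<in> space lebesgue. \<not> (0 < t \<and> t < T \<longrightarrow> P t)} \<subseteq> Z"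
    "emeasure lebesgue Z = 0" "Z \<in> sets lebesgue"
    by (rule AE_E)
  have "AE t in lebesgue. 0 < t \<and> t < T \<longrightarrow> t > d \<longrightarrow> P (t - d)"
  proof (rule AE_I'[where N = "(+) d ` Z"])
    show "(+) d ` Z \<in> null_sets lebesgue"
      using Z(2,3) negligible_translation[of Z d] by (simp add: negligible_iff_null_sets null_sets_def)
    show "{t \<in> space lebesgue. \<not> (0 < t \<and> t < T \<longrightarrow> t > d \<longrightarrow> P (t - d))} \<subseteq> (+) d ` Z"
    proof
      fix t assume t: "t \<in> {t \<in> space lebesgue. \<not> (0 < t \<and> t < T \<longrightarrow> t > d \<longrightarrow> P (t - d))}"
      then have "t - d \<in> {t \<in> space lebesgue. \<not> (0 < t \<and> t < T \<longrightarrow> P t)}" using assms(2) by auto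
      then have "t - d \<in> Z" using Z(1) by blast
      then show "t \<in> (+) d ` Z" by force
    qed
  qed
  then show ?thesis by (simp add: AE_lebesgue_on_Ioo)
qed

text \<open>Delay by \<open>d\<close> of a function that is thought of as having the constant value
  \<open>c\<close> up to time 0.\<close>

definition shift :: "real => 'b => (real => 'b) => real => 'b" where
  "shift d c f t = (if t \<le> d then c else f (t - d))"

lemma integrable_shift:
  fixes f :: "real => real"
  assumes f: "integrable (lebesgue_on {0<..<T}) f" and d: "0 \<le> d" "d \<le> s" "s \<le> T"
  shows "integrable (lebesgue_on {0<..<s}) (shift d c f)"
    and "integral {0..s} (shift d c f) = d * c + integral {0..s-d} f"
proof -
  have *: "(shift d c f has_integral d * c + integral {0..s-d} f) {0..s}"
    if "integrable (lebesgue_on {0<..<T}) f" for f :: "real => real" and c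
  proof -
    have "(f has_integral integral {0..s-d} f) {0..s-d}"
      using integrable_Ioo_HK[OF that, of 0 "s-d"] d by (auto intro: integrable_integral)
    then have "((\<lambda>t. f (t - d)) has_integral integral {0..s-d} f) {d..s}"
      using has_integral_shift_real_ivl[of f _ 0 "s-d" "-d"] by simp
    then have 1: "(shift d c f has_integral integral {0..s-d} f) {d..s}"
      by (rule has_integral_spike[of "{d}", rotated 2]) (auto simp: shift_def)
    have 2: "(shift d c f has_integral d * c) {0..d}"
      by (rule has_integral_eq[of _ "\<lambda>_. c"]) (use has_integral_const_real[of c 0 d] d in \<open>auto simp: shift_def mult.commute\<close>)
    show ?thesis using has_integral_combine[OF _ _ 2 1] d by simp
  qed
  have "shift d \<bar>c\<bar> (\<lambda>t. \<bar>f t\<bar>) = (\<lambda>t. \<bar>shift d c f t\<bar>)" by (auto simp: shift_def)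
  then have "(\<lambda>t. \<bar>shift d c f t\<bar>) integrable_on {0..s}"
    using *[of "\<lambda>t. \<bar>f t\<bar>" "\<bar>c\<bar>"] f by (auto simp: has_integral_iff)
  then show "integrable (lebesgue_on {0<..<s}) (shift d c f)"
    using *[OF f, of c] by (auto simp: integrable_lebesgue_on_Ioo absolutely_integrable_on_def has_integral_iff)
  show "integral {0..s} (shift d c f) = d * c + integral {0..s-d} f" using *[OF f] by (rule integral_unique)
qed

text \<open>The integral of a backward difference telescopes. In this way pointwise bounds on
  increments over time \<open>d\<close> control the integral of \<open>f\<close> over a short
  interval that ends at \<open>s\<close>.\<close>

lemma integral_diff_shift:
  fixes f :: "real => real"
  assumes f: "integrable (lebesgue_on {0<..<T}) f" and d: "0 \<le> d" "d \<le> s" "s \<le> T"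
  shows "integral {0..s} (\<lambda>t. f t - shift d c f t) = integral {s-d..s} f - d * c"
proof -
  have "integral {0..s} (\<lambda>t. f t - shift d c f t) = integral {0..s} f - integral {0..s} (shift d c f)"
    using f d by (intro integral_diff integrable_Ioo_HK[OF integrable_shift(1)[OF f]] integrable_Ioo_HK[OF f]) auto
  then show ?thesis using integrable_shift(2)[OF f d] HK_primitive_diff[OF f, of "s-d" s] d by simp
qed

section \<open>Duality and semi-inner products\<close>

context seminormed begin

definition dual :: "('x => real) set" where
  "dual = {F. (\<forall>v\<in>X. \<forall>w\<in>X. F (v + w) = F v + F w) \<and> (\<forall>c. \<forall>v\<in>X. F (c *\<^sub>R v) = c * F v) \<and>
     (\<exists>C. \<forall>v\<in>X. \<bar>F v\<bar> \<le> C * N v)}"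

definition dnorm :: "('x => real) => real" where
  "dnorm F = (SUP v\<in>{v \<in> X. N v \<le> 1}. \<bar>F v\<bar>)"

lemma dual_add: "F \<in> dual ==> v \<in> X ==> w \<in> X ==> F (v + w) = F v + F w"
  and dual_scaleR: "F \<in> dual ==> v \<in> X ==> F (c *\<^sub>R v) = c * F v"
  by (auto simp: dual_def)

lemma dual_diff: "F \<in> dual ==> v \<in> X ==> w \<in> X ==> F (v - w) = F v - F w"
  using dual_add[of F v "(-1) *\<^sub>R w"] dual_scaleR[of F w "-1"] scaleR_mem[of w "-1"] by simp

lemma dual_I:
  assumes "\<And>v w. v \<in> X ==> w \<in> X ==> F (v + w) = F v + F w" "\<And>c v. v \<in> X ==> F (c *\<^sub>R v) = c * F v"
    "\<And>v. v \<in> X ==> \<bar>F v\<bar> \<le> C * N v"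
  shows "F \<in> dual"
  using assms unfolding dual_def by blast

lemma dnorm_le:
  assumes "\<And>v. v \<in> X ==> \<bar>F v\<bar> \<le> C * N v" "0 \<le> C"
  shows "dnorm F \<le> C"
  unfolding dnorm_def
proof (rule cSUP_least)
  show "{v \<in> X. N v \<le> 1} \<noteq> {}" using zero_mem by (auto intro!: exI[of _ 0])
  fix v assume v: "v \<in> {v \<in> X. N v \<le> 1}"
  then have "\<bar>F v\<bar> \<le> C * N v" using assms by auto
  also have "\<dots> \<le> C * 1" using v assms by (intro mult_left_mono) auto
  finally show "\<bar>F v\<bar> \<le> C" by simp
qed

lemma dnorm_bdd:
  assumes "F \<in> dual" shows "bdd_above ((\<lambda>v. \<bar>F v\<bar>) ` {v \<in> X. N v \<le> 1})"
proof -
  obtain C where C: "\<And>v. v \<in> X ==> \<bar>F v\<bar> \<le> C * N v" using assms unfolding dual_def by blast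
  have "\<bar>F v\<bar> \<le> \<bar>C\<bar>" if "v \<in> X" "N v \<le> 1" for v
  proof -
    have "\<bar>F v\<bar> \<le> \<bar>C\<bar> * N v" using C[OF that(1)] abs_ge_self[of C] N_nonneg[OF that(1)]
      by (meson mult_right_mono order_trans)
    also have "\<dots> \<le> \<bar>C\<bar> * 1" using that by (intro mult_left_mono) auto
    finally show ?thesis by simp
  qed
  then show ?thesis by (intro bdd_aboveI2[of _ _ "\<bar>C\<bar>"]) auto
qed

lemma dnorm_nonneg: "F \<in> dual ==> 0 \<le> dnorm F"
  unfolding dnorm_def by (rule cSUP_upper2[OF dnorm_bdd, of F 0]) auto

lemma dual_bound:
  assumes F: "F \<in> dual" and v: "v \<in> X"
  shows "\<bar>F v\<bar> \<le> dnorm F * N v"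
proof (cases "N v = 0")
  case True
  obtain C where "\<bar>F v\<bar> \<le> C * N v" using F v by (auto simp: dual_def)
  then show ?thesis using True by simp
next
  case False
  then have p: "N v > 0" using N_nonneg[OF v] by simp
  define w where "w = inverse (N v) *\<^sub>R v"
  have w: "w \<in> X" "N w \<le> 1" using v p by (auto simp: w_def homogeneous)
  have "\<bar>F w\<bar> \<le> dnorm F" unfolding dnorm_def using w by (intro cSUP_upper dnorm_bdd F) auto
  then show ?thesis using p by (simp add: w_def dual_scaleR[OF F v] abs_mult field_simps)
qed

text \<open>Makes the Bochner theory available for forces. Homogeneity follows from the inequality
  \<open>\<le>\<close>, applied to \<open>c\<close> and then to \<open>inverse c\<close>.\<close>

lemma seminormed_dual: "seminormed dual dnorm"
proof
  show "subspace dual"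
    unfolding subspace_def
  proof (intro conjI ballI allI)
    show "0 \<in> dual" by (rule dual_I[where C = 0]) auto
    fix F G :: "'x => real" assume "F \<in> dual" "G \<in> dual"
    then show "F + G \<in> dual"
      using dual_bound[of F] dual_bound[of G]
      by (intro dual_I[where C = "dnorm F + dnorm G"]) (force simp: dual_add dual_scaleR algebra_simps abs_le_iff)+
  next
    fix c and F :: "'x => real" assume F: "F \<in> dual"
    show "c *\<^sub>R F \<in> dual"
    proof (rule dual_I[where C = "\<bar>c\<bar> * dnorm F"])
      fix v assume v: "v \<in> X"
      show "\<bar>(c *\<^sub>R F) v\<bar> \<le> \<bar>c\<bar> * dnorm F * N v"
        using mult_left_mono[OF dual_bound[OF F v], of "\<bar>c\<bar>"] by (simp add: abs_mult mult_ac)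
    qed (use F in \<open>auto simp: dual_add dual_scaleR algebra_simps\<close>)
  qed
  fix F G assume F: "F \<in> dual" and G: "G \<in> dual"
  show "dnorm (F + G) \<le> dnorm F + dnorm G"
  proof (rule dnorm_le)
    fix v assume v: "v \<in> X"
    show "\<bar>(F + G) v\<bar> \<le> (dnorm F + dnorm G) * N v"
      using dual_bound[OF F v] dual_bound[OF G v] by (simp add: algebra_simps)
  qed (use F G dnorm_nonneg in auto)
next
  fix F and c :: real assume F: "F \<in> dual"
  have le: "dnorm (c *\<^sub>R F) \<le> \<bar>c\<bar> * dnorm F" if F: "F \<in> dual" for c F
  proof (rule dnorm_le)
    fix v assume v: "v \<in> X"
    show "\<bar>(c *\<^sub>R F) v\<bar> \<le> \<bar>c\<bar> * dnorm F * N v"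
      using mult_left_mono[OF dual_bound[OF F v], of "\<bar>c\<bar>"] by (simp add: abs_mult mult_ac)
  qed (use F dnorm_nonneg in auto)
  show "dnorm (c *\<^sub>R F) = \<bar>c\<bar> * dnorm F"
  proof (cases "c = 0")
    case True
    have "dnorm 0 \<le> 0" by (rule dnorm_le) auto
    moreover have "0 \<le> dnorm 0" by (rule dnorm_nonneg, rule dual_I[where C = 0]) auto
    ultimately show ?thesis using True by simp
  next
    case False
    have "c *\<^sub>R F \<in> dual"
    proof (rule dual_I[where C = "\<bar>c\<bar> * dnorm F"])
      fix v assume v: "v \<in> X"
      show "\<bar>(c *\<^sub>R F) v\<bar> \<le> \<bar>c\<bar> * dnorm F * N v"
        using mult_left_mono[OF dual_bound[OF F v], of "\<bar>c\<bar>"] by (simp add: abs_mult mult_ac)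
    qed (use F in \<open>auto simp: dual_add dual_scaleR algebra_simps\<close>)
    from le[OF this, of "inverse c"] have "dnorm F \<le> \<bar>inverse c\<bar> * dnorm (c *\<^sub>R F)" using False by simp
    then have "\<bar>c\<bar> * dnorm F \<le> dnorm (c *\<^sub>R F)" using False by (simp add: field_simps abs_inverse)
    then show ?thesis using le[OF F, of c] by simp
  qed
qed

end

locale semi_inner =
  fixes H :: "'x::real_vector set" and h :: "'x => 'x => real"
  assumes subspace_H: "subspace H"
    and sym: "\<And>x y. x \<in> H ==> y \<in> H ==> h x y = h y x"
    and add_left: "\<And>x y z. x \<in> H ==> y \<in> H ==> z \<in> H ==> h (x + y) z = h x z + h y z"
    and scaleR_left: "\<And>c x z. x \<in> H ==> z \<in> H ==> h (c *\<^sub>R x) z = c * h x z"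
    and nonneg: "\<And>x. x \<in> H ==> 0 \<le> h x x"
begin

definition hnorm :: "'x => real" where "hnorm x = sqrt (h x x)"

lemma H_mem: "0 \<in> H" "x \<in> H ==> y \<in> H ==> x + y \<in> H" "x \<in> H ==> y \<in> H ==> x - y \<in> H" "x \<in> H ==> c *\<^sub>R x \<in> H"
  using subspace_H by (auto simp: subspace_0 subspace_add subspace_diff subspace_scale)

lemma add_right: "x \<in> H ==> y \<in> H ==> z \<in> H ==> h z (x + y) = h z x + h z y"
  using sym[of z "x + y"] sym[of z x] sym[of z y] add_left[of x y z] H_mem by simp

lemma scaleR_right: "x \<in> H ==> z \<in> H ==> h z (c *\<^sub>R x) = c * h z x"
  using sym[of z "c *\<^sub>R x"] sym[of z x] scaleR_left[of x z c] H_mem by simp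

lemma diff_left: "x \<in> H ==> y \<in> H ==> z \<in> H ==> h (x - y) z = h x z - h y z"
  using add_left[of x "(-1) *\<^sub>R y" z] scaleR_left[of y z "-1"] H_mem(4)[of y "-1"] by simp

lemma diff_right: "x \<in> H ==> y \<in> H ==> z \<in> H ==> h z (x - y) = h z x - h z y"
  using add_right[of x "(-1) *\<^sub>R y" z] scaleR_right[of y z "-1"] H_mem(4)[of y "-1"] by simp

lemma hnorm_nonneg [simp]: "x \<in> H ==> 0 \<le> hnorm x"
  and hnorm_square: "x \<in> H ==> (hnorm x)^2 = h x x"
  by (simp_all add: hnorm_def nonneg)

lemma h_expand: "x \<in> H ==> y \<in> H ==> h (x + y) (x + y) = h x x + 2 * h x y + h y y"
  using sym[of x y] by (simp add: add_left add_right H_mem)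

lemma h_expand_diff: "x \<in> H ==> y \<in> H ==> h (x - y) (x - y) = h x x - 2 * h x y + h y y"
  using sym[of x y] by (simp add: diff_left diff_right H_mem)

lemma Cauchy_Schwarz:
  assumes "x \<in> H" "y \<in> H" shows "\<bar>h x y\<bar> \<le> hnorm x * hnorm y"
proof -
  have quad: "0 \<le> h x x + 2 * c * h x y + c^2 * h y y" for c
  proof -
    have "0 \<le> h (x + c *\<^sub>R y) (x + c *\<^sub>R y)" using assms H_mem nonneg by simp
    then show ?thesis using assms
      by (simp add: h_expand H_mem scaleR_left scaleR_right power2_eq_square mult_ac)
  qed
  have "(h x y)^2 \<le> h x x * h y y"
  proof (cases "h y y = 0")
    \<comment> \<open>A semi-inner product may be degenerate at \<open>y\<close>. The quadratic in
      \<open>c\<close> is then affine and could not stay nonnegative if \<open>h x y\<close> were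
      not 0; the witness makes its value -1.\<close>
    case True
    have "h x y = 0"
    proof (rule ccontr)
      assume "h x y \<noteq> 0"
      then show False using quad[of "- (h x x + 1) / (2 * h x y)"] True by (simp add: field_simps)
    qed
    then show ?thesis using True by simp
  next
    case False
    then have p: "h y y > 0" using nonneg[OF assms(2)] by simp
    show ?thesis using quad[of "- h x y / h y y"] p by (simp add: field_simps power2_eq_square)
  qed
  then have "sqrt ((h x y)^2) \<le> sqrt (h x x * h y y)" by (rule real_sqrt_le_mono)
  then show ?thesis by (simp add: hnorm_def real_sqrt_mult)
qed

lemma seminormed_hnorm: "seminormed H hnorm"
proof
  fix x y assume a: "x \<in> H" "y \<in> H"
  have "(hnorm (x + y))^2 \<le> (hnorm x + hnorm y)^2"
    using Cauchy_Schwarz[OF a] a by (simp add: hnorm_square H_mem h_expand power2_sum abs_le_iff)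
  then show "hnorm (x + y) \<le> hnorm x + hnorm y" using a by (auto intro: power2_le_imp_le)
next
  fix c x assume "x \<in> H"
  then show "hnorm (c *\<^sub>R x) = \<bar>c\<bar> * hnorm x"
    by (simp add: hnorm_def scaleR_left scaleR_right H_mem real_sqrt_mult flip: mult.assoc)
qed (rule subspace_H)

lemma parallelogram:
  "x \<in> H ==> y \<in> H ==> h (x + y) (x + y) + h (x - y) (x - y) = 2 * h x x + 2 * h y y"
  by (simp add: h_expand h_expand_diff)

end

lemma (in complete_measure) pairing_measurable:
  fixes XA :: "'y::minus set" and XB :: "'z::minus set"
  assumes w: "strongly_measurable M XA NA w" and z: "strongly_measurable M XB NB z"
    and cont: "\<And>x y x' y'. x \<in> XA ==> y \<in> XB ==> (\<And>n. x' n \<in> XA) ==> (\<And>n. y' n \<in> XB) ==>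
       (\<lambda>n. NA (x - x' n)) \<longlonglongrightarrow> 0 ==> (\<lambda>n. NB (y - y' n)) \<longlonglongrightarrow> 0 ==>
       (\<lambda>n. \<beta> (x' n) (y' n)) \<longlonglongrightarrow> (\<beta> x y :: real)"
  shows "(\<lambda>t. \<beta> (w t) (z t)) \<in> borel_measurable M"
proof -
  obtain s where s: "\<And>n. simple_function M (s n)" "\<And>n t. t \<in> space M ==> s n t \<in> XA"
    "AE t in M. w t \<in> XA" "AE t in M. (\<lambda>n. NA (w t - s n t)) \<longlonglongrightarrow> 0"
    using w unfolding strongly_measurable_def image_subset_iff by blast
  obtain r where r: "\<And>n. simple_function M (r n)" "\<And>n t. t \<in> space M ==> r n t \<in> XB"
    "AE t in M. z t \<in> XB" "AE t in M. (\<lambda>n. NB (z t - r n t)) \<longlonglongrightarrow> 0"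
    using z unfolding strongly_measurable_def image_subset_iff by blast
  show ?thesis
  proof (rule borel_measurable_AE_limit)
    show "(\<lambda>t. \<beta> (s n t) (r n t)) \<in> borel_measurable M" for n
      using simple_function_compose2[OF s(1) r(1), of \<beta>] by (rule borel_measurable_simple_function)
    show "AE t in M. (\<lambda>n. \<beta> (s n t) (r n t)) \<longlonglongrightarrow> \<beta> (w t) (z t)"
      using s(3,4) r(3,4) AE_space by eventually_elim (rule cont, use s(2) r(2) in auto)
  qed
qed

section \<open>The energy identity\<close>

text \<open>The Gelfand triple, without identifying anything: an element of \<open>H\<close> acts on
  \<open>V\<close> through \<open>h\<close>, and identities in the dual are tested with elements of
  \<open>V\<close>.\<close>

locale evolution = bochner_time V N T + semi_inner H h
  for V :: "'x::real_vector set" and N :: "'x => real" and T :: real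
    and H :: "'x set" and h :: "'x => 'x => real" +
  assumes V_sub_H: "V \<subseteq> H" and hnorm_le: "v \<in> V ==> hnorm v \<le> N v"
begin

sublocale D: bochner_time dual dnorm T
  by (intro bochner_time.intro seminormed_dual bochner_time_axioms.intro T)

abbreviation "I0 t f \<equiv> integral {0..t} f"

lemma in_H [simp, intro]: "v \<in> V ==> v \<in> H" using V_sub_H by auto

lemma h_bound: "x \<in> V ==> y \<in> V ==> \<bar>h x y\<bar> \<le> N x * N y"
  using Cauchy_Schwarz[of x y] mult_mono[OF hnorm_le[of x] hnorm_le[of y]] hnorm_nonneg[of y] by simp

lemma h_tendsto:
  assumes "x \<in> V" "y \<in> H" "\<And>n. x' n \<in> V" "(\<lambda>n. N (x - x' n)) \<longlonglongrightarrow> 0"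
  shows "(\<lambda>n. h (x' n) y) \<longlonglongrightarrow> h x y"
proof (rule tendsto_functional[OF _ _ assms(1,3,4), where C = "hnorm y"])
  fix x assume x: "x \<in> V"
  show "\<bar>h x y\<bar> \<le> hnorm y * N x"
    using Cauchy_Schwarz[OF in_H[OF x] assms(2)] mult_right_mono[OF hnorm_le[OF x] hnorm_nonneg[OF assms(2)]] by (simp add: mult.commute)
qed (use assms(2) in \<open>auto simp: diff_left\<close>)

lemma dual_tendsto:
  assumes "F \<in> dual" "v \<in> V" "\<And>n. F' n \<in> dual" "\<And>n. v' n \<in> V" "(\<lambda>n. dnorm (F - F' n)) \<longlonglongrightarrow> 0"
    "(\<lambda>n. N (v - v' n)) \<longlonglongrightarrow> 0"
  shows "(\<lambda>n. F' n (v' n)) \<longlonglongrightarrow> F v"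
proof (rule Lim_null[THEN iffD2], rule Lim_null_comparison)
  have "(\<lambda>n. N (v' n)) \<longlonglongrightarrow> N v" using assms by (intro N_tendsto)
  then have "(\<lambda>n. dnorm (F - F' n) * N (v' n) + dnorm F * N (v - v' n)) \<longlonglongrightarrow> 0 * N v + dnorm F * 0"
    using assms by (intro tendsto_intros)
  then show "(\<lambda>n. dnorm (F - F' n) * N (v' n) + dnorm F * N (v - v' n)) \<longlonglongrightarrow> 0" by simp
  show "\<forall>\<^sub>F n in sequentially. norm (F' n (v' n) - F v) \<le> dnorm (F - F' n) * N (v' n) + dnorm F * N (v - v' n)"
  proof (intro always_eventually allI)
    fix n
    have "F' n (v' n) - F v = - ((F - F' n) (v' n) + F (v - v' n))"
      using dual_diff[OF assms(1,2,4)] by simp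
    then have "\<bar>F' n (v' n) - F v\<bar> \<le> \<bar>(F - F' n) (v' n)\<bar> + \<bar>F (v - v' n)\<bar>" by linarith
    also have "\<dots> \<le> dnorm (F - F' n) * N (v' n) + dnorm F * N (v - v' n)"
      using dual_bound[OF D.diff_mem[OF assms(1,3)] assms(4)] dual_bound[OF assms(1) diff_mem[OF assms(2,4)]]
      by (intro add_mono) auto
    finally show "norm (F' n (v' n) - F v) \<le> dnorm (F - F' n) * N (v' n) + dnorm F * N (v - v' n)" by simp
  qed
qed

lemma pairing_measurable_dual: "D.SM F ==> SM w ==> (\<lambda>t. F t (w t)) \<in> borel_measurable M"
  by (rule pairing_measurable[where \<beta> = "\<lambda>F v. F v"]) (auto intro: dual_tendsto)

lemma pairing_integrable:
  assumes "F \<in> D.L2" "w \<in> L2"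
  shows "integrable M (\<lambda>t. F t (w t))"
proof (rule Bochner_Integration.integrable_bound)
  show "integrable M (\<lambda>t. (dnorm (F t))^2 + (N (w t))^2)" using D.L2_D(2)[OF assms(1)] L2_D(2)[OF assms(2)] by simp
  show "(\<lambda>t. F t (w t)) \<in> borel_measurable M" using D.L2_D(1)[OF assms(1)] L2_D(1)[OF assms(2)] by (rule pairing_measurable_dual)
  show "AE t in M. norm (F t (w t)) \<le> norm ((dnorm (F t))^2 + (N (w t))^2)"
    using D.L2_D(3)[OF assms(1)] L2_D(3)[OF assms(2)]
  proof eventually_elim
    case (elim t)
    have "\<bar>F t (w t)\<bar> \<le> dnorm (F t) * N (w t)" using elim by (rule dual_bound)
    also have "\<dots> \<le> (dnorm (F t))^2 + (N (w t))^2"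
      using sum_squares_bound[of "dnorm (F t)" "N (w t)"] zero_le_power2[of "dnorm (F t)"] zero_le_power2[of "N (w t)"]
        mult_nonneg_nonneg[OF dnorm_nonneg[OF elim(1)] N_nonneg[OF elim(2)]] by linarith
    finally show ?case by simp
  qed
qed

lemma const_L2: "v \<in> V ==> (\<lambda>_. v) \<in> L2"
  by (rule L2_simple) auto

lemma hnorm_integrable:
  assumes "w \<in> L2"
  shows "integrable M (\<lambda>t. h (w t) (w t))"
proof (rule Bochner_Integration.integrable_bound)
  show "integrable M (\<lambda>t. (N (w t))^2)" using L2_D(2)[OF assms(1)] by simp
  show "(\<lambda>t. h (w t) (w t)) \<in> borel_measurable M"
  proof (rule pairing_measurable[where \<beta> = h, OF L2_D(1)[OF assms] L2_D(1)[OF assms]])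
    fix x y x' y' assume *: "x \<in> V" "y \<in> V" "\<And>n. x' n \<in> V" "\<And>n. y' n \<in> V"
      "(\<lambda>n. N (x - x' n)) \<longlonglongrightarrow> 0" "(\<lambda>n. N (y - y' n)) \<longlonglongrightarrow> 0"
    have "(\<lambda>n. h (x' n) y) \<longlonglongrightarrow> h x y" using * by (intro h_tendsto) auto
    moreover have "(\<lambda>n. h (x' n) (y' n - y)) \<longlonglongrightarrow> 0"
    proof (rule Lim_null_comparison)
      have "(\<lambda>n. N (x' n)) \<longlonglongrightarrow> N x" using * by (intro N_tendsto)
      then have "(\<lambda>n. N (x' n) * N (y - y' n)) \<longlonglongrightarrow> N x * 0" using * by (intro tendsto_intros)
      then show "(\<lambda>n. N (x' n) * N (y - y' n)) \<longlonglongrightarrow> 0" by simp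
      show "\<forall>\<^sub>F n in sequentially. norm (h (x' n) (y' n - y)) \<le> N (x' n) * N (y - y' n)"
      proof (intro always_eventually allI)
        fix n show "norm (h (x' n) (y' n - y)) \<le> N (x' n) * N (y - y' n)"
          using h_bound[OF *(3) diff_mem[OF *(4,2)], of n n] N_commute[OF *(2,4), of n] by simp
      qed
    qed
    ultimately have "(\<lambda>n. h (x' n) y + h (x' n) (y' n - y)) \<longlonglongrightarrow> h x y + 0" by (intro tendsto_add)
    then show "(\<lambda>n. h (x' n) (y' n)) \<longlonglongrightarrow> h x y" using * by (simp add: diff_right)
  qed
  show "AE t in M. norm (h (w t) (w t)) \<le> norm ((N (w t))^2)"
    using L2_D(3)[OF assms] by eventually_elim (use h_bound in \<open>simp add: power2_eq_square\<close>)
qed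

text \<open>The problem \<open>u' = F\<close>, \<open>u(0) = u0\<close> in integrated form. The
  exceptional null set of times may depend on the test vector.\<close>

definition weakly :: "(real => 'x) => 'x => (real => 'x => real) => bool" where
  "weakly u u0 F \<longleftrightarrow> (\<forall>v\<in>V. AE t in M. h (u t) v = h u0 v + I0 t (\<lambda>r. F r v))"

text \<open>The ranges of the approximating simple functions, together with \<open>x0\<close>, form
  a countable set whose closure contains almost all values of \<open>u\<close>. Separability later
  yields one null set of times for all test vectors that matter.\<close>

lemma SM_separable:
  assumes "SM u" "x0 \<in> V"
  obtains C where "countable C" "C \<subseteq> V" "x0 \<in> norm_closure V N C" "AE t in M. u t \<in> norm_closure V N C"
proof -
  obtain s where s: "\<And>n. simple_function M (s n)" "\<And>n t. t \<in> space M ==> s n t \<in> V"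
    "AE t in M. u t \<in> V" "AE t in M. (\<lambda>n. N (u t - s n t)) \<longlonglongrightarrow> 0"
    using assms(1) by (rule SM_E) blast
  define C where "C = insert x0 (\<Union>n. s n ` space M)"
  have "countable C" unfolding C_def
    by (intro countable_insert countable_UN countable_finite[OF simple_functionD(1)[OF s(1)]]) auto
  moreover have "C \<subseteq> V" using s(2) assms by (auto simp: C_def)
  moreover have "x0 \<in> norm_closure V N C" using assms by (auto simp: norm_closure_def C_def intro!: bexI[of _ x0])
  moreover have "AE t in M. u t \<in> norm_closure V N C"
    using s(3,4) AE_space
  proof eventually_elim
    case (elim t)
    show ?case unfolding norm_closure_def
    proof (intro CollectI conjI allI impI elim)
      fix e :: real assume "e > 0"
      then have "\<forall>\<^sub>F n in sequentially. N (u t - s n t) < e" using elim(2) by (intro order_tendstoD(2)) auto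
      then obtain n where "N (u t - s n t) < e" using eventually_happens'[OF sequentially_bot] by blast
      then show "\<exists>c\<in>C. N (u t - c) < e" using elim(3) by (auto simp: C_def)
    qed
  qed
  ultimately show ?thesis using that by blast
qed

lemma I0_bound:
  assumes "F \<in> D.L2" "v \<in> V" "0 \<le> t" "t \<le> T"
  shows "\<bar>I0 t (\<lambda>r. F r v)\<bar> \<le> (I0 t (\<lambda>r. dnorm (F r))) * N v"
proof -
  have "integrable M (\<lambda>r. dnorm (F r))"
    by (rule square_integrable_imp_integrable[OF D.L2_D(4)[OF assms(1)] D.L2_D(2)[OF assms(1)]])
  then have 1: "integrable M (\<lambda>r. dnorm (F r) * N v)" by simp
  have "\<bar>I0 t (\<lambda>r. F r v)\<bar> \<le> I0 t (\<lambda>r. dnorm (F r) * N v)"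
  proof (rule HK_abs_le[OF pairing_integrable[OF assms(1) const_L2[OF assms(2)]] 1])
    show "AE t in M. \<bar>F t v\<bar> \<le> dnorm (F t) * N v"
      using D.L2_D(3)[OF assms(1)] by eventually_elim (intro dual_bound assms(2))
  qed (use assms in auto)
  then show ?thesis by simp
qed

text \<open>A countable set of test vectors needs only one null set, and both sides of the equation
  are continuous in \<open>v\<close>, so that it extends to the closure. As the closure contains
  almost all values of \<open>u\<close> and the vector \<open>x0\<close>, the equation may be tested
  with these values.\<close>

lemma weakly_all:
  assumes u: "u \<in> L2" and F: "F \<in> D.L2" and w: "weakly u u0 F" and u0: "u0 \<in> H" "x0 \<in> V"
  obtains C where "C \<subseteq> V" "x0 \<in> C" "AE t in M. u t \<in> C"
    "AE t in M. \<forall>v\<in>C. h (u t) v = h u0 v + I0 t (\<lambda>r. F r v)"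
proof -
  obtain C where C: "countable C" "C \<subseteq> V" "x0 \<in> norm_closure V N C" "AE t in M. u t \<in> norm_closure V N C"
    using SM_separable[OF L2_D(1)[OF u] u0(2)] by blast
  have "AE t in M. \<forall>v\<in>C. h (u t) v = h u0 v + I0 t (\<lambda>r. F r v)"
    using C w by (subst AE_ball_countable) (auto simp: weakly_def)
  then have "AE t in M. \<forall>v\<in>norm_closure V N C. h (u t) v = h u0 v + I0 t (\<lambda>r. F r v)"
    using L2_D(3)[OF u] AE_space
  proof eventually_elim
    case (elim t)
    show ?case
    proof
      fix v assume v: "v \<in> norm_closure V N C"
      then have vV: "v \<in> V" by (simp add: norm_closure_def)
      obtain c where c: "\<And>n. c n \<in> C" "(\<lambda>n. N (v - c n)) \<longlonglongrightarrow> 0" using norm_closure_E[OF v C(2)] by blast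
      have cV: "c n \<in> V" for n using c C by auto
      have "(\<lambda>n. h (u t) (c n)) \<longlonglongrightarrow> h (u t) v"
        using h_tendsto[OF vV _ cV c(2), of "u t"] elim(2) sym[of "u t"] vV cV by simp
      moreover have "(\<lambda>n. h u0 (c n) + I0 t (\<lambda>r. F r (c n))) \<longlonglongrightarrow> h u0 v + I0 t (\<lambda>r. F r v)"
      proof (intro tendsto_add)
        show "(\<lambda>n. h u0 (c n)) \<longlonglongrightarrow> h u0 v" using h_tendsto[OF vV _ cV c(2), of "u0"] u0 sym[of u0] vV cV by simp
        show "(\<lambda>n. I0 t (\<lambda>r. F r (c n))) \<longlonglongrightarrow> I0 t (\<lambda>r. F r v)"
        proof (rule Lim_null[THEN iffD2], rule Lim_null_comparison)
          show "(\<lambda>n. (I0 t (\<lambda>r. dnorm (F r))) * N (v - c n)) \<longlonglongrightarrow> 0"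
            using tendsto_mult_right_zero[OF c(2)] by simp
          show "\<forall>\<^sub>F n in sequentially. norm (I0 t (\<lambda>r. F r (c n)) - I0 t (\<lambda>r. F r v)) \<le> (I0 t (\<lambda>r. dnorm (F r))) * N (v - c n)"
          proof (intro always_eventually allI)
            fix n
            have t: "0 \<le> t" "t \<le> T" using elim(3) by auto
            have i: "integrable M (\<lambda>r. F r x)" if "x \<in> V" for x
              by (rule pairing_integrable[OF F const_L2[OF that]])
            have "I0 t (\<lambda>r. F r (c n - v)) = I0 t (\<lambda>r. F r (c n) - F r v)"
              using i vV cV D.L2_D(3)[OF F] t
              by (intro HK_cong_AE[of 0 T]) (auto simp: diff_mem dual_diff elim!: eventually_mono)
            also have "\<dots> = I0 t (\<lambda>r. F r (c n)) - I0 t (\<lambda>r. F r v)"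
              using i vV cV t by (intro integral_diff integrable_Ioo_HK[of 0 T]) auto
            finally show "norm (I0 t (\<lambda>r. F r (c n)) - I0 t (\<lambda>r. F r v)) \<le> (I0 t (\<lambda>r. dnorm (F r))) * N (v - c n)"
              using I0_bound[OF F diff_mem[OF cV vV] t, of n] N_commute[OF vV cV, of n] by simp
          qed
        qed
      qed
      ultimately show "h (u t) v = h u0 v + I0 t (\<lambda>r. F r v)"
        using elim(1) c(1) by (simp add: LIMSEQ_unique)
    qed
  qed
  then show ?thesis using that[of "norm_closure V N C"] C by (auto simp: norm_closure_def)
qed

end

lemma HK_primitive_integrable:
  fixes f :: "real => real"
  assumes "integrable (lebesgue_on {0<..<T}) f"
  shows "integrable (lebesgue_on {0<..<T}) (\<lambda>t. integral {0..t} f)"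
  unfolding integrable_lebesgue_on_Ioo
  by (rule absolutely_integrable_continuous_real, rule HK_primitive_continuous[OF assms])

lemma young:
  fixes a b \<kappa> :: real
  assumes "\<kappa> > 0" shows "a * b \<le> \<kappa>/2 * a^2 + b^2 / (2*\<kappa>)"
proof -
  have "0 \<le> (\<kappa> * a - b)^2 / (2*\<kappa>)" using assms by simp
  also have "\<dots> = \<kappa>/2 * a^2 + b^2 / (2*\<kappa>) - a * b"
    using assms by (simp add: power2_eq_square field_simps)
  finally show ?thesis by simp
qed

context evolution begin

text \<open>The price for replacing a fixed test vector by the moving curve \<open>Z\<close> on a
  short interval. Young's inequality with weight \<open>\<kappa>\<close> separates the size of the
  force, to be made small by \<open>\<kappa>\<close>, from the distance to the curve.\<close>

lemma lip_curve_pairing: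
  assumes F: "F \<in> D.L2" and Z: "lip_curve L Z" "Z \<in> L2" and x: "x \<in> V" and st: "0 \<le> s" "s \<le> t" "t \<le> T" "t - s \<le> d"
    and \<kappa>: "\<kappa> > 0" and B: "\<And>r. s \<le> r ==> r \<le> t ==> N (x - Z r) \<le> B"
  shows "\<bar>integral {s..t} (\<lambda>r. F r x) - integral {s..t} (\<lambda>r. F r (Z r))\<bar> \<le>
    \<kappa>/2 * integral {s..t} (\<lambda>r. (dnorm (F r))^2) + d / (2*\<kappa>) * B^2"
proof -
  have i1: "integrable (lebesgue_on {s<..<t}) (\<lambda>r. F r x)" and i2: "integrable (lebesgue_on {s<..<t}) (\<lambda>r. F r (Z r))"
    and i3: "integrable (lebesgue_on {s<..<t}) (\<lambda>r. (dnorm (F r))^2)"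
    using pairing_integrable[OF F const_L2[OF x]] pairing_integrable[OF F Z(2)] D.L2_D(2)[OF F] st
    by (auto elim!: integrable_lebesgue_on_Ioo_sub)
  have i4: "integrable (lebesgue_on {s<..<t}) (\<lambda>r. \<kappa>/2 * (dnorm (F r))^2 + B^2 / (2*\<kappa>))"
    using i3 finite_measure.integrable_const[OF finite_measure_lebesgue_on, of "{s<..<t}"]
    by (intro Bochner_Integration.integrable_add integrable_mult_right) auto
  have "\<bar>integral {s..t} (\<lambda>r. F r x - F r (Z r))\<bar> \<le> integral {s..t} (\<lambda>r. \<kappa>/2 * (dnorm (F r))^2 + B^2 / (2*\<kappa>))"
  proof (rule HK_abs_le[OF Bochner_Integration.integrable_diff[OF i1 i2] i4])
    have "AE r in lebesgue_on {s<..<t}. F r \<in> dual"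
      using D.L2_D(3)[OF F] by (rule AE_lebesgue_on_subset) (use st in auto)
    then show "AE r in lebesgue_on {s<..<t}. \<bar>F r x - F r (Z r)\<bar> \<le> \<kappa>/2 * (dnorm (F r))^2 + B^2 / (2*\<kappa>)"
      using AE_space
    proof eventually_elim
      case (elim r)
      have Zr: "Z r \<in> V" using Z by (simp add: lip_curve_def)
      have "\<bar>F r x - F r (Z r)\<bar> \<le> dnorm (F r) * N (x - Z r)"
        using dual_bound[OF elim(1) diff_mem[OF x Zr]] dual_diff[OF elim(1) x Zr] by simp
      also have "\<dots> \<le> dnorm (F r) * B" using B[of r] elim by (intro mult_left_mono dnorm_nonneg) auto
      also have "\<dots> \<le> \<kappa>/2 * (dnorm (F r))^2 + B^2 / (2*\<kappa>)" using \<kappa> by (rule young)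
      finally show ?case .
    qed
  qed auto
  moreover have "integral {s..t} (\<lambda>r. F r x - F r (Z r)) = integral {s..t} (\<lambda>r. F r x) - integral {s..t} (\<lambda>r. F r (Z r))"
    using i1 i2 by (intro integral_diff integrable_Ioo_HK[of s t]) auto
  moreover have "integral {s..t} (\<lambda>r. \<kappa>/2 * (dnorm (F r))^2 + B^2 / (2*\<kappa>)) =
      \<kappa>/2 * integral {s..t} (\<lambda>r. (dnorm (F r))^2) + (t - s) * (B^2 / (2*\<kappa>))"
    using integrable_Ioo_HK[OF i3, of s t] st
    by (subst integral_add) (auto intro: integrable_on_mult_right simp del: integral_const_real simp: integral_const_real[unfolded real_scaleR_def] )
  moreover have "(t - s) * (B^2 / (2*\<kappa>)) \<le> d / (2*\<kappa>) * B^2"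
    using mult_right_mono[OF st(4), of "B^2 / (2*\<kappa>)"] \<kappa> by simp
  ultimately show ?thesis by linarith
qed

text \<open>With \<open>x\<close> for the value of \<open>u\<close> delayed by \<open>d\<close>,
  symmetry gives \<open>h (u t) (u t) - h x x = h (u t - x) (u t) + h (u t - x) x\<close>. In both
  terms the test vector is fixed, so the weak equation on the last interval of length
  \<open>d\<close> applies, and \<open>lip_curve_pairing\<close> then inserts \<open>Z\<close>. No
  differentiability of \<open>u\<close> is involved.\<close>

lemma increment:
  assumes u: "u \<in> L2" and F: "F \<in> D.L2" and w: "weakly u u0 F" and u0: "u0 \<in> V"
    and Z: "lip_curve L Z" "Z \<in> L2" "\<forall>t\<le>0. Z t = u0" and d: "d > 0" and \<kappa>: "\<kappa> > 0"
  defines "e \<equiv> \<lambda>t. (N (u t - Z t))^2" and "g \<equiv> \<lambda>t. h (u t) (u t)" and "p \<equiv> \<lambda>t. (dnorm (F t))^2"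
    and "q \<equiv> \<lambda>t. F t (Z t)"
  shows "AE t in M. \<bar>(g t - shift d (h u0 u0) g t) - 2 * (I0 t q - shift d 0 (\<lambda>t. I0 t q) t)\<bar> \<le>
    \<kappa> * (I0 t p - shift d 0 (\<lambda>t. I0 t p) t) + d / \<kappa> * (e t + shift d 0 e t + 2 * L^2 * d^2)"
proof -
  obtain C where C: "C \<subseteq> V" "u0 \<in> C" "AE t in M. u t \<in> C"
    "AE t in M. \<forall>v\<in>C. h (u t) v = h u0 v + I0 t (\<lambda>r. F r v)"
    using weakly_all[OF u F w in_H[OF u0] u0] by blast
  define G where "G t \<longleftrightarrow> u t \<in> C \<and> (\<forall>v\<in>C. h (u t) v = h u0 v + I0 t (\<lambda>r. F r v))" for t
  have G: "AE t in M. G t" using C(3,4) unfolding G_def by eventually_elim auto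
  have L: "L \<ge> 0" and ZV: "\<And>t. Z t \<in> V" and Zl: "\<And>s t. N (Z s - Z t) \<le> L * \<bar>s - t\<bar>"
    using Z(1) by (auto simp: lip_curve_def)
  have ip: "integrable M p" using D.L2_D(2)[OF F] by (simp add: p_def)
  have iq: "integrable M q" unfolding q_def by (rule pairing_integrable[OF F Z(2)])
  show ?thesis
    using G AE_shift[OF G less_imp_le[OF d]] AE_space
  proof eventually_elim
    case (elim t)
    have t: "0 < t" "t < T" using elim(3) by auto
    define s where "s = max 0 (t - d)"
    have s: "0 \<le> s" "s \<le> t" "t - s \<le> d" "s < t" using t d by (auto simp: s_def)
    define x where "x = shift d u0 u t"
    have xC: "x \<in> C" and xeq: "\<And>v. v \<in> C ==> h x v = h u0 v + I0 s (\<lambda>r. F r v)"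
      using elim(2) C(2) by (auto simp: x_def shift_def s_def G_def)
    have xV: "x \<in> V" "u t \<in> V" using C(1) xC elim(1) by (auto simp: G_def)
    have iF: "integrable M (\<lambda>r. F r v)" if "v \<in> V" for v by (rule pairing_integrable[OF F const_L2[OF that]])
    have dh: "h (u t) v - h x v = integral {s..t} (\<lambda>r. F r v)" if "v \<in> C" for v
      using elim(1) xeq[OF that] HK_primitive_diff[OF iF, of v s t] that C(1) s t by (auto simp: G_def)
    have "g t - shift d (h u0 u0) g t = h (u t) (u t) - h x x"
      by (auto simp: g_def shift_def x_def)
    also have "\<dots> = (h (u t) (u t) - h x (u t)) + (h (u t) x - h x x)"
      using sym[of x "u t"] xV by simp
    also have "\<dots> = integral {s..t} (\<lambda>r. F r (u t)) + integral {s..t} (\<lambda>r. F r x)"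
      using dh[of "u t"] dh[OF xC] elim(1) by (simp add: G_def)
    finally have 1: "g t - shift d (h u0 u0) g t = integral {s..t} (\<lambda>r. F r (u t)) + integral {s..t} (\<lambda>r. F r x)" .
    have 2: "I0 t q - shift d 0 (\<lambda>t. I0 t q) t = integral {s..t} q"
      using HK_primitive_diff[OF iq, of s t] s t by (auto simp: shift_def s_def)
    have 3: "I0 t p - shift d 0 (\<lambda>t. I0 t p) t = integral {s..t} p"
      using HK_primitive_diff[OF ip, of s t] s t by (auto simp: shift_def s_def)
    define e1 where "e1 = N (u t - Z t)"
    \<comment> \<open>For \<open>t \<le> d\<close> both \<open>x\<close> and
      \<open>Z (t - d)\<close> are \<open>u0\<close>, so \<open>e2\<close> is 0, in agreement with
      the value 0 that \<open>shift d 0 e\<close> has there.\<close>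
    define e2 where "e2 = N (x - Z (t - d))"
    have es: "e t = e1^2" "shift d 0 e t = e2^2"
      using Z(3) by (auto simp: e_def e1_def e2_def shift_def x_def)
    have 4: "\<bar>integral {s..t} (\<lambda>r. F r (u t)) - integral {s..t} (\<lambda>r. F r (Z r))\<bar> \<le>
      \<kappa>/2 * integral {s..t} (\<lambda>r. (dnorm (F r))^2) + d / (2*\<kappa>) * (e1 + L * d)^2"
    proof (rule lip_curve_pairing[OF F Z(1,2) xV(2) s(1,2) _ s(3) \<kappa>])
      fix r assume r: "s \<le> r" "r \<le> t"
      have "L * \<bar>t - r\<bar> \<le> L * d" using r s by (intro mult_left_mono L) auto
      then show "N (u t - Z r) \<le> e1 + L * d"
        using triangle_3[OF xV(2) ZV ZV, of r t] Zl[of t r] by (simp add: e1_def)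
    qed (use t in auto)
    have 5: "\<bar>integral {s..t} (\<lambda>r. F r x) - integral {s..t} (\<lambda>r. F r (Z r))\<bar> \<le>
      \<kappa>/2 * integral {s..t} (\<lambda>r. (dnorm (F r))^2) + d / (2*\<kappa>) * (e2 + L * d)^2"
    proof (rule lip_curve_pairing[OF F Z(1,2) xV(1) s(1,2) _ s(3) \<kappa>])
      fix r assume r: "s \<le> r" "r \<le> t"
      have "L * \<bar>t - d - r\<bar> \<le> L * d" using r s by (intro mult_left_mono L) (auto simp: s_def)
      then show "N (x - Z r) \<le> e2 + L * d"
        using triangle_3[OF xV(1) ZV ZV, of r "t - d"] Zl[of "t - d" r] by (simp add: e2_def)
    qed (use t in auto)
    have sq: "(a + L * d)^2 \<le> 2 * a^2 + 2 * L^2 * d^2" for a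
      using sum_squares_bound[of a "L * d"] by (simp add: power2_sum power_mult_distrib)
    have "d / (2*\<kappa>) * (e1 + L * d)^2 + d / (2*\<kappa>) * (e2 + L * d)^2 \<le> d / (2*\<kappa>) * (2 * e1^2 + 2 * L^2 * d^2 + (2 * e2^2 + 2 * L^2 * d^2))"
      unfolding distrib_left[symmetric] using sq[of e1] sq[of e2] d \<kappa> by (intro mult_left_mono) auto
    also have "\<dots> = d / \<kappa> * (e1^2 + e2^2 + 2 * L^2 * d^2)" using \<kappa> by (simp add: field_simps)
    finally have 6: "d / (2*\<kappa>) * (e1 + L * d)^2 + d / (2*\<kappa>) * (e2 + L * d)^2 \<le> d / \<kappa> * (e1^2 + e2^2 + 2 * L^2 * d^2)" .
    show ?case unfolding 1 2 3 es using 4 5 6 by (simp add: p_def q_def abs_le_iff)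
  qed
qed

text \<open>The primitive of the defect in the energy identity has derivative 0: on short intervals the defect is
  compared with increments of \<open>u\<close>, in which \<open>u\<close> as a test function is replaced by a Lipschitz curve.\<close>

theorem energy_identity:
  assumes u: "u \<in> L2" and F: "F \<in> D.L2" and w: "weakly u u0 F" and u0: "u0 \<in> V"
  shows "AE t in M. h (u t) (u t) = h u0 u0 + 2 * I0 t (\<lambda>r. F r (u r))"
proof -
  define g where "g t = h (u t) (u t)" for t
  define p where "p t = (dnorm (F t))^2" for t
  define qu where "qu t = F t (u t)" for t
  define G where "G t = g t - h u0 u0 - 2 * I0 t qu" for t
  have ig: "integrable M g" unfolding g_def by (rule hnorm_integrable[OF u])
  have ip: "integrable M p" using D.L2_D(2)[OF F] by (simp add: p_def[abs_def])
  have iqu: "integrable M qu" unfolding qu_def by (rule pairing_integrable[OF F u])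
  note iQu = HK_primitive_integrable[OF iqu] and iP = HK_primitive_integrable[OF ip]
  have iG: "integrable M G" unfolding G_def using ig iQu by simp
  define K where "K = I0 T p"
  have P: "I0 t p \<le> K" "0 \<le> I0 t p" if "0 \<le> t" "t \<le> T" for t
    using HK_primitive_mono[OF ip, of t T] HK_primitive_mono[OF ip, of 0 t] that by (auto simp: K_def p_def)
  have K: "K \<ge> 0" using P[of T] T by simp
  have est: "\<exists>d0>0. \<forall>d \<tau>. 0 < d \<and> d < d0 \<and> d \<le> \<tau> \<and> \<tau> \<le> T \<longrightarrow> \<bar>integral {\<tau>-d..\<tau>} G\<bar> \<le> \<eta> * d" if \<eta>: "\<eta> > 0" for \<eta>
  proof -
    \<comment> \<open>The order of choices matters: first \<open>\<kappa>\<close>, which makes the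
      force terms small; then \<open>\<epsilon>\<close>, the error of the Lipschitz curve, small
      relative to \<open>\<kappa>\<close>; last the length \<open>d0\<close>, because it depends on
      the Lipschitz constant \<open>L\<close> of the curve chosen for
      \<open>\<epsilon>\<close>.\<close>
    define \<kappa> where "\<kappa> = \<eta> / (4 * (K + 1))"
    have \<kappa>: "\<kappa> > 0" "2 * \<kappa> * K \<le> \<eta> / 2" using \<eta> K by (auto simp: \<kappa>_def field_simps)
    define \<epsilon> where "\<epsilon> = \<kappa> * \<eta> / 12"
    have \<epsilon>: "\<epsilon> > 0" using \<kappa> \<eta> by (simp add: \<epsilon>_def)
    obtain L Z where Z: "lip_curve L Z" "\<forall>t\<le>0. Z t = u0" "Z \<in> L2" and Ze: "(\<integral>t. (N (u t - Z t))^2 \<partial>M) < \<epsilon>"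
      by (rule approx_E[OF approx_L2[OF u u0] \<epsilon>]) blast
    define e where "e t = (N (u t - Z t))^2" for t
    define q where "q t = F t (Z t)" for t
    have ie: "integrable M e" unfolding e_def using L2_D(2)[OF L2_diff[OF u Z(3)]] .
    have iq: "integrable M q" unfolding q_def by (rule pairing_integrable[OF F Z(3)])
    note iQ = HK_primitive_integrable[OF iq]
    have E: "I0 t e \<le> \<epsilon>" if "0 \<le> t" "t \<le> T" for t
      using HK_primitive_mono[OF ie, of t T] that Ze integral_lebesgue_on_Ioo[OF ie] by (auto simp: e_def[abs_def])
    have QQ: "\<bar>I0 t q - I0 t qu\<bar> \<le> \<kappa> / 2 * K + \<epsilon> / (2*\<kappa>)" if t: "0 \<le> t" "t \<le> T" for t
    proof -
      have ib: "integrable M (\<lambda>t. \<kappa> / 2 * p t + e t / (2*\<kappa>))" using ip ie by simp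
      have "\<bar>I0 t (\<lambda>t. q t - qu t)\<bar> \<le> I0 t (\<lambda>t. \<kappa> / 2 * p t + e t / (2*\<kappa>))"
      proof (rule HK_abs_le[OF Bochner_Integration.integrable_diff[OF iq iqu] ib])
        show "AE t in M. \<bar>q t - qu t\<bar> \<le> \<kappa> / 2 * p t + e t / (2*\<kappa>)"
          using D.L2_D(3)[OF F] L2_D(3)[OF u]
        proof eventually_elim
          case (elim t)
          have Zt: "Z t \<in> V" using Z(1) by (simp add: lip_curve_def)
          have "\<bar>q t - qu t\<bar> = \<bar>F t (u t - Z t)\<bar>" using dual_diff[OF elim Zt] by (simp add: q_def qu_def abs_minus_commute)
          also have "\<dots> \<le> dnorm (F t) * N (u t - Z t)" using dual_bound[OF elim(1) diff_mem[OF elim(2) Zt]] .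
          also have "\<dots> \<le> \<kappa> / 2 * p t + e t / (2*\<kappa>)" unfolding p_def e_def by (rule young[OF \<kappa>(1)])
          finally show ?case .
        qed
      qed (use t in auto)
      also have "\<dots> = \<kappa> / 2 * I0 t p + I0 t e / (2*\<kappa>)"
        using integrable_Ioo_HK[OF ip, of 0 t] integrable_Ioo_HK[OF ie, of 0 t] t
        by (subst integral_add) (auto intro: integrable_on_mult_right integrable_on_divide)
      also have "\<dots> \<le> \<kappa> / 2 * K + \<epsilon> / (2*\<kappa>)"
        using P[OF t] E[OF t] \<kappa>(1) by (intro add_mono mult_left_mono divide_right_mono) auto
      also have "I0 t (\<lambda>t. q t - qu t) = I0 t q - I0 t qu"
        using t by (intro integral_diff integrable_Ioo_HK[OF iq] integrable_Ioo_HK[OF iqu]) auto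
      finally show ?thesis .
    qed
    define d0 where "d0 = sqrt (\<kappa> * \<eta> / (8 * (L^2 * T + 1)))"
    have LT: "L^2 * T + 1 > 0" using T by (simp add: add_nonneg_pos)
    have d0: "d0 > 0" using \<kappa> \<eta> LT by (simp add: d0_def)
    have bound: "\<bar>integral {\<tau>-d..\<tau>} G\<bar> \<le> \<eta> * d" if d: "0 < d" "d < d0" "d \<le> \<tau>" "\<tau> \<le> T" for d \<tau>
    proof -
      note d' = less_imp_le[OF d(1)] d(3,4)
      define D where "D t = (g t - shift d (h u0 u0) g t) - 2 * (I0 t q - shift d 0 (\<lambda>t. I0 t q) t)" for t
      define R where "R t = \<kappa> * (I0 t p - shift d 0 (\<lambda>t. I0 t p) t) + d / \<kappa> * (e t + shift d 0 e t + 2 * L^2 * d^2)" for t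
      have sub: "integrable (lebesgue_on {0<..<\<tau>}) f" if "integrable M f" for f :: "real => real"
        using integrable_lebesgue_on_Ioo_sub[OF that, of 0 \<tau>] d by simp
      note i = sub[OF ig] sub[OF iQ] sub[OF iP] sub[OF ie] integrable_shift(1)[OF ig d'] integrable_shift(1)[OF iQ d']
        integrable_shift(1)[OF iP d'] integrable_shift(1)[OF ie d']
      have c: "integrable (lebesgue_on {0<..<\<tau>}) (\<lambda>_. c)" for c :: real
        using finite_measure.integrable_const[OF finite_measure_lebesgue_on, of "{0<..<\<tau>}"] by simp
      have iD: "integrable (lebesgue_on {0<..<\<tau>}) D" unfolding D_def using i by simp
      have iR: "integrable (lebesgue_on {0<..<\<tau>}) R" unfolding R_def using i c by simp
      have "AE t in M. \<bar>D t\<bar> \<le> R t"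
        using increment[OF u F w u0 Z(1,3,2) d(1) \<kappa>(1)] unfolding D_def R_def g_def q_def p_def e_def .
      then have "AE t in lebesgue_on {0<..<\<tau>}. \<bar>D t\<bar> \<le> R t" by (rule AE_lebesgue_on_subset) (use d in auto)
      then have DR: "\<bar>I0 \<tau> D\<bar> \<le> I0 \<tau> R" by (rule HK_abs_le[OF iD iR]) auto
      note HK = integrable_Ioo_HK[where a = 0 and b = \<tau> and c = 0 and d = \<tau>, simplified]
      have "I0 \<tau> D = I0 \<tau> (\<lambda>t. g t - shift d (h u0 u0) g t) - 2 * I0 \<tau> (\<lambda>t. I0 t q - shift d 0 (\<lambda>t. I0 t q) t)"
      proof -
        have "I0 \<tau> D = I0 \<tau> (\<lambda>t. g t - shift d (h u0 u0) g t) - I0 \<tau> (\<lambda>t. 2 * (I0 t q - shift d 0 (\<lambda>t. I0 t q) t))"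
          unfolding D_def using i by (intro integral_diff HK) auto
        then show ?thesis by (simp only: integral_mult_right)
      qed
      also have "\<dots> = integral {\<tau>-d..\<tau>} g - d * h u0 u0 - 2 * integral {\<tau>-d..\<tau>} (\<lambda>t. I0 t q)"
        by (simp add: integral_diff_shift[OF ig d'] integral_diff_shift[OF iQ d'])
      finally have Deq: "I0 \<tau> D = integral {\<tau>-d..\<tau>} g - d * h u0 u0 - 2 * integral {\<tau>-d..\<tau>} (\<lambda>t. I0 t q)" .
      have "I0 \<tau> R = \<kappa> * I0 \<tau> (\<lambda>t. I0 t p - shift d 0 (\<lambda>t. I0 t p) t) + d / \<kappa> * (I0 \<tau> e + I0 \<tau> (shift d 0 e) + 2 * L^2 * d^2 * \<tau>)"
      proof -
        have "I0 \<tau> R = I0 \<tau> (\<lambda>t. \<kappa> * (I0 t p - shift d 0 (\<lambda>t. I0 t p) t)) + I0 \<tau> (\<lambda>t. d / \<kappa> * (e t + shift d 0 e t + 2 * L^2 * d^2))"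
          unfolding R_def using i c by (intro integral_add HK) auto
        also have "I0 \<tau> (\<lambda>t. d / \<kappa> * (e t + shift d 0 e t + 2 * L^2 * d^2)) = d / \<kappa> * I0 \<tau> (\<lambda>t. e t + shift d 0 e t + 2 * L^2 * d^2)"
          by simp
        also have "I0 \<tau> (\<lambda>t. e t + shift d 0 e t + 2 * L^2 * d^2) = I0 \<tau> (\<lambda>t. e t + shift d 0 e t) + I0 \<tau> (\<lambda>t. 2 * L^2 * d^2)"
          using i c by (intro integral_add HK) auto
        also have "I0 \<tau> (\<lambda>t. e t + shift d 0 e t) = I0 \<tau> e + I0 \<tau> (shift d 0 e)"
          using i c by (intro integral_add HK) auto
        finally show ?thesis using d by simp
      qed
      also have "\<dots> \<le> \<kappa> * (d * K) + d / \<kappa> * (\<epsilon> + \<epsilon> + 2 * L^2 * d^2 * T)"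
      proof (intro add_mono mult_left_mono)
        have "integral {\<tau>-d..\<tau>} (\<lambda>t. I0 t p) \<le> integral {\<tau>-d..\<tau>} (\<lambda>t. K)"
          using P d integrable_Ioo_HK[OF iP, of "\<tau>-d" \<tau>] by (intro integral_le) auto
        then show "I0 \<tau> (\<lambda>t. I0 t p - shift d 0 (\<lambda>t. I0 t p) t) \<le> d * K"
          using d by (simp add: integral_diff_shift[OF iP d'])
        show "I0 \<tau> (shift d 0 e) \<le> \<epsilon>" using integrable_shift(2)[OF ie d', of 0] E[of "\<tau>-d"] d by simp
        show "I0 \<tau> e \<le> \<epsilon>" using E[of \<tau>] d by simp
      qed (use \<kappa> d in auto)
      finally have Rle: "I0 \<tau> R \<le> \<kappa> * (d * K) + d / \<kappa> * (\<epsilon> + \<epsilon> + 2 * L^2 * d^2 * T)" .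
      have sub2: "f integrable_on {\<tau>-d..\<tau>}" if "integrable M f" for f :: "real => real"
        using integrable_Ioo_HK[OF that, of "\<tau>-d" \<tau>] d by simp
      have "\<bar>integral {\<tau>-d..\<tau>} (\<lambda>t. I0 t q - I0 t qu)\<bar> \<le> integral {\<tau>-d..\<tau>} (\<lambda>t. \<kappa> / 2 * K + \<epsilon> / (2*\<kappa>))"
        using QQ d sub2[OF iQ] sub2[OF iQu] by (intro integral_norm_bound_integral[where 'a = real, unfolded real_norm_def] integrable_diff) auto
      then have QQ2: "\<bar>integral {\<tau>-d..\<tau>} (\<lambda>t. I0 t q) - integral {\<tau>-d..\<tau>} (\<lambda>t. I0 t qu)\<bar> \<le> d * (\<kappa> / 2 * K + \<epsilon> / (2*\<kappa>))"
        using d integral_diff[OF sub2[OF iQ] sub2[OF iQu]] by simp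
      have "integral {\<tau>-d..\<tau>} G = integral {\<tau>-d..\<tau>} (\<lambda>t. g t - h u0 u0) - integral {\<tau>-d..\<tau>} (\<lambda>t. 2 * I0 t qu)"
        unfolding G_def using sub2[OF ig] sub2[OF iQu] by (intro integral_diff integrable_diff) auto
      also have "integral {\<tau>-d..\<tau>} (\<lambda>t. g t - h u0 u0) = integral {\<tau>-d..\<tau>} g - d * h u0 u0"
        using d by (subst integral_diff[OF sub2[OF ig]]) auto
      finally have "integral {\<tau>-d..\<tau>} G = I0 \<tau> D + 2 * (integral {\<tau>-d..\<tau>} (\<lambda>t. I0 t q) - integral {\<tau>-d..\<tau>} (\<lambda>t. I0 t qu))"
        unfolding Deq by simp
      moreover have abs_le: "x = a + 2 * y ==> \<bar>x\<bar> \<le> \<bar>a\<bar> + 2 * \<bar>y\<bar>" for x a y :: real by linarith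
      ultimately have "\<bar>integral {\<tau>-d..\<tau>} G\<bar> \<le> \<bar>I0 \<tau> D\<bar> + 2 * \<bar>integral {\<tau>-d..\<tau>} (\<lambda>t. I0 t q) - integral {\<tau>-d..\<tau>} (\<lambda>t. I0 t qu)\<bar>"
        by blast
      also have "\<dots> \<le> (\<kappa> * (d * K) + d / \<kappa> * (\<epsilon> + \<epsilon> + 2 * L^2 * d^2 * T)) + 2 * (d * (\<kappa> / 2 * K + \<epsilon> / (2*\<kappa>)))"
        using order_trans[OF DR Rle] QQ2 by (intro add_mono mult_left_mono) auto
      also have "\<dots> = d * (2 * \<kappa> * K + (3 * \<epsilon> + 2 * L^2 * d^2 * T) / \<kappa>)"
        using \<kappa> by (simp add: field_simps)
      also have "\<dots> \<le> d * \<eta>"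
      proof (rule mult_left_mono)
        have "d^2 \<le> d0^2" using d by (intro power_mono) auto
        also have "d0^2 = \<kappa> * \<eta> / (8 * (L^2 * T + 1))" using \<kappa> \<eta> LT by (simp add: d0_def)
        finally have "d^2 * (8 * (L^2 * T + 1)) \<le> \<kappa> * \<eta>" using LT by (simp add: field_simps)
        then have "8 * (L^2 * d^2 * T) + 8 * d^2 \<le> \<kappa> * \<eta>" by (simp add: algebra_simps)
        then have "8 * (L^2 * d^2 * T) \<le> \<kappa> * \<eta>" using zero_le_power2[of d] by linarith
        moreover have "3 * \<epsilon> = \<kappa> * \<eta> / 4" by (simp add: \<epsilon>_def)
        ultimately have "(3 * \<epsilon> + 2 * L^2 * d^2 * T) \<le> \<kappa> * \<eta> / 2" by linarith
        then have "(3 * \<epsilon> + 2 * L^2 * d^2 * T) / \<kappa> \<le> \<eta> / 2" using \<kappa> by (simp add: field_simps)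
        then show "2 * \<kappa> * K + (3 * \<epsilon> + 2 * L^2 * d^2 * T) / \<kappa> \<le> \<eta>" using \<kappa>(2) by linarith
      qed (use d in auto)
      finally show ?thesis by (simp add: mult.commute)
    qed
    then show ?thesis using d0 by blast
  qed
  \<comment> \<open>The bound on the last interval holds for every right end \<open>\<tau>\<close>,
    so that it covers intervals on both sides of \<open>x\<close>.\<close>
  have deriv: "((\<lambda>t. I0 t G) has_field_derivative 0) (at x within {0..T})" if x: "x \<in> {0..T}" for x
    unfolding has_field_derivative_def has_derivative_within_alt
  proof (intro conjI allI impI)
    show "bounded_linear ((*) 0 :: real => real)" by (simp add: bounded_linear_mult_right)
    fix \<eta> :: real assume "\<eta> > 0"
    from est[OF this] obtain d0 where d0: "d0 > 0"
      "\<And>d \<tau>. 0 < d ==> d < d0 ==> d \<le> \<tau> ==> \<tau> \<le> T ==> \<bar>integral {\<tau>-d..\<tau>} G\<bar> \<le> \<eta> * d" by blast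
    have D: "\<bar>I0 b G - I0 a G\<bar> \<le> \<eta> * (b - a)" if "0 \<le> a" "a < b" "b \<le> T" "b - a < d0" for a b
      using HK_primitive_diff[OF iG, of a b] d0(2)[of "b - a" b] that by simp
    show "\<exists>d>0. \<forall>y\<in>{0..T}. norm (y - x) < d \<longrightarrow> norm (I0 y G - I0 x G - 0 * (y - x)) \<le> \<eta> * norm (y - x)"
    proof (intro exI[of _ d0] conjI ballI impI d0(1))
      fix y assume y: "y \<in> {0..T}" "norm (y - x) < d0"
      consider "y < x" | "y = x" | "x < y" by linarith
      then show "norm (I0 y G - I0 x G - 0 * (y - x)) \<le> \<eta> * norm (y - x)"
        using D[of x y] D[of y x] x y by cases auto
    qed
  qed
  have "I0 t G = 0" if t: "0 \<le> t" "t \<le> T" for t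
  proof -
    have "\<exists>c. \<forall>x\<in>{0..T}. I0 x G = c" by (rule has_field_derivative_zero_constant[OF _ deriv]) auto
    then show ?thesis using t T by (metis atLeastAtMost_iff cbox_interval content_real_eq_0 integral_refl less_imp_le order_refl)
  qed
  from AE_zero_if_primitive_zero[OF iG this]
  have "AE t in M. G t = 0" by simp
  then show ?thesis by eventually_elim (simp add: G_def g_def qu_def[abs_def])
qed

end

section \<open>The Lax--Milgram theorem\<close>

context seminormed begin

lemma tendsto_form:
  assumes bd: "\<And>x y. x \<in> X ==> y \<in> X ==> \<bar>s x y\<bar> \<le> C * N x * N y"
    and diff: "\<And>x y z. x \<in> X ==> y \<in> X ==> z \<in> X ==> s (x - y) z = s x z - s y z"
    and u: "u \<in> X" "\<And>n. x n \<in> X" "(\<lambda>n. N (u - x n)) \<longlonglongrightarrow> 0" "v \<in> X"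
  shows "(\<lambda>n. s (x n) v) \<longlonglongrightarrow> s u v"
  by (rule tendsto_functional[where F = "\<lambda>x. s x v" and C = "C * N v", OF _ _ u(1-3)])
    (use bd[OF _ u(4)] diff[OF _ _ u(4)] in \<open>auto simp: mult_ac\<close>)

text \<open>Minimizing sequences of \<open>J v = s v v - 2 * F v\<close> are Cauchy by the
  parallelogram identity and coercivity. That \<open>J\<close> does not decrease from the minimizer
  in any direction \<open>v\<close> is the asserted equation.\<close>

theorem Riesz:
  assumes s: "semi_inner X s" and complete: "semi_complete X N" and \<alpha>: "\<alpha> > 0"
    and coercive: "\<And>v. v \<in> X ==> \<alpha> * (N v)^2 \<le> s v v"
    and bd: "\<And>x y. x \<in> X ==> y \<in> X ==> \<bar>s x y\<bar> \<le> C * N x * N y"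
    and F: "F \<in> dual"
  obtains u where "u \<in> X" "\<And>v. v \<in> X ==> s u v = F v"
proof -
  interpret S: semi_inner X s by (rule s)
  define J where "J v = s v v - 2 * F v" for v
  have J_lower: "- ((dnorm F)^2) / \<alpha> \<le> J v" if v: "v \<in> X" for v
  proof -
    have "2 * F v \<le> 2 * (dnorm F * N v)" using dual_bound[OF F v] by simp
    also have "\<dots> \<le> \<alpha> * (N v)^2 + (dnorm F)^2 / \<alpha>"
      using young[of "2*\<alpha>" "N v" "2 * dnorm F"] \<alpha> by (simp add: power_mult_distrib field_simps)
    finally show ?thesis using coercive[OF v] by (simp add: J_def)
  qed
  define d where "d = Inf (J ` X)"
  have bdd: "bdd_below (J ` X)" using J_lower by (intro bdd_belowI2) auto
  have d_le: "d \<le> J v" if "v \<in> X" for v unfolding d_def using bdd that by (intro cINF_lower) auto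
  have "\<exists>x. \<forall>n. x n \<in> X \<and> J (x n) < d + inverse (Suc n)"
  proof (intro choice allI)
    fix n :: nat
    show "\<exists>x. x \<in> X \<and> J x < d + inverse (Suc n)"
      using cINF_less_iff[OF _ bdd, of "d + inverse (Suc n)"] zero_mem unfolding d_def by fastforce
  qed
  then obtain x where x: "\<And>n. x n \<in> X" "\<And>n. J (x n) < d + inverse (Suc n)" by blast
  have est: "\<alpha> * (N (x m - x n))^2 \<le> 2 * (inverse (Suc m) + inverse (Suc n))" for m n
  proof -
    define y where "y = (1/2) *\<^sub>R (x m + x n)"
    have y: "y \<in> X" using x by (auto simp: y_def)
    have "s (x m + x n) (x m + x n) = 4 * s y y"
      using x by (simp add: y_def S.scaleR_left S.scaleR_right add_mem scaleR_mem)
    moreover have "F (x m) + F (x n) = 2 * F y"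
      using x by (simp add: y_def dual_scaleR[OF F] dual_add[OF F] add_mem)
    ultimately have "s (x m - x n) (x m - x n) = 2 * J (x m) + 2 * J (x n) - 4 * J y"
      using S.parallelogram[OF x(1) x(1), of m n] unfolding J_def by (simp add: algebra_simps)
    also have "\<dots> \<le> 2 * (inverse (Suc m) + inverse (Suc n))"
      using x(2)[of m] x(2)[of n] d_le[OF y] by argo
    finally show ?thesis using coercive[OF diff_mem[OF x(1) x(1)]] by (meson order_trans)
  qed
  have "\<exists>K. \<forall>m\<ge>K. \<forall>n\<ge>K. N (x m - x n) < e" if e: "e > 0" for e
  proof -
    obtain K where K: "inverse (Suc K) < \<alpha> * e^2 / 4" using reals_Archimedean[of "\<alpha> * e^2 / 4"] e \<alpha> by auto
    have "N (x m - x n) < e" if "m \<ge> K" "n \<ge> K" for m n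
    proof -
      have "inverse (real (Suc m)) \<le> inverse (Suc K)" "inverse (real (Suc n)) \<le> inverse (Suc K)" using that by (auto intro!: le_imp_inverse_le)
      then have "\<alpha> * (N (x m - x n))^2 < \<alpha> * e^2" using est[of m n] K by argo
      then have "(N (x m - x n))^2 < e^2" using \<alpha> by simp
      then show ?thesis using e by (simp add: power2_less_imp_less)
    qed
    then show ?thesis by blast
  qed
  then obtain u where u: "u \<in> X" "(\<lambda>n. N (u - x n)) \<longlonglongrightarrow> 0"
    using semi_completeE[OF complete, of x] x(1) by metis
  have tN: "(\<lambda>n. N (x n)) \<longlonglongrightarrow> N u" using x u by (intro N_tendsto)
  have t1: "(\<lambda>n. s (x n) u) \<longlonglongrightarrow> s u u"
    by (rule tendsto_form[OF bd _ u(1) x(1) u(2) u(1)]) (auto simp: S.diff_left)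
  have t2: "(\<lambda>n. s (u - x n) (u - x n)) \<longlonglongrightarrow> 0"
  proof (rule Lim_null_comparison)
    show "(\<lambda>n. C * N (u - x n) * N (u - x n)) \<longlonglongrightarrow> 0"
      using tendsto_mult[OF tendsto_mult[OF tendsto_const u(2)] u(2), of C] by simp
    show "\<forall>\<^sub>F n in sequentially. norm (s (u - x n) (u - x n)) \<le> C * N (u - x n) * N (u - x n)"
      using bd[OF diff_mem[OF u(1) x(1)] diff_mem[OF u(1) x(1)]] by (intro always_eventually) auto
  qed
  have eq: "s (x n) (x n) = s (u - x n) (u - x n) + 2 * s (x n) u - s u u" for n
    using S.h_expand_diff[OF u(1) x(1), of n] S.sym[OF u(1) x(1), of n] by simp
  have "(\<lambda>n. s (x n) (x n)) \<longlonglongrightarrow> 0 + 2 * s u u - s u u" unfolding eq by (intro tendsto_intros t1 t2)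
  moreover have "(\<lambda>n. F (x n)) \<longlonglongrightarrow> F u"
    by (rule tendsto_functional[OF dual_bound[OF F] dual_diff[OF F] u(1) x(1) u(2)])
  ultimately have "(\<lambda>n. J (x n)) \<longlonglongrightarrow> (0 + 2 * s u u - s u u) - 2 * F u"
    unfolding J_def by (intro tendsto_intros)
  moreover have "(\<lambda>n. J (x n)) \<longlonglongrightarrow> d"
  proof (rule tendsto_sandwich[OF _ _ tendsto_const])
    show "\<forall>\<^sub>F n in sequentially. d \<le> J (x n)" using d_le x by (intro always_eventually) auto
    show "\<forall>\<^sub>F n in sequentially. J (x n) \<le> d + inverse (real (Suc n))"
      using x(2) by (intro always_eventually) (auto intro: less_imp_le)
    show "(\<lambda>n. d + inverse (real (Suc n))) \<longlonglongrightarrow> d"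
      using tendsto_add[OF tendsto_const LIMSEQ_inverse_real_of_nat, of d] by simp
  qed
  ultimately have Jd: "J u = d" using LIMSEQ_unique[of "\<lambda>n. J (x n)" _ d] by (force simp: J_def)
  have "s u v = F v" if v: "v \<in> X" for v
  proof -
    define c where "c = s u v - F v"
    have quad: "0 \<le> t^2 * s v v + 2 * t * c" for t
    proof -
      have "d \<le> J (u + t *\<^sub>R v)" using u v by (intro d_le) auto
      also have "\<dots> = J u + t^2 * s v v + 2 * t * c"
        using u v by (simp add: J_def c_def S.h_expand scaleR_mem S.scaleR_left S.scaleR_right
            dual_add[OF F] dual_scaleR[OF F] power2_eq_square algebra_simps)
      finally show ?thesis using Jd by simp
    qed
    have "c = 0"
    proof (rule ccontr)
      assume c: "c \<noteq> 0"
      \<comment> \<open>\<open>- c / s v v\<close> would minimize the quadratic, but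
        \<open>s v v\<close> may be 0; the slightly larger \<open>q\<close> still makes the value
        negative.\<close>
      define q where "q = s v v + 1"
      have q: "q > 0" using S.nonneg[OF v] by (simp add: q_def)
      have "(c/q)^2 * s v v + 2 * (- (c/q)) * c = c^2 / q^2 * (s v v - 2 * q)"
        using q by (simp add: power2_eq_square field_simps)
      moreover have "c^2 / q^2 * (s v v - 2 * q) < 0"
        using c q S.nonneg[OF v] by (intro mult_pos_neg) (auto simp: q_def)
      ultimately show False using quad[of "- (c/q)"] by simp
    qed
    then show ?thesis by (simp add: c_def)
  qed
  then show ?thesis using that u by blast
qed

text \<open>The solution is the fixed point of the damped map
  \<open>x \<mapsto> (1 - \<theta>) x + \<theta> R x\<close>, where \<open>R x\<close> represents
  \<open>F - \<beta> x\<close> with respect to \<open>s\<close>. As \<open>\<beta>\<close> vanishes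
  on equal arguments, the increment of \<open>R\<close> is \<open>s\<close>-orthogonal to the
  increment of its argument, and Pythagoras' theorem shows that the map is a contraction.\<close>

theorem Lax_Milgram:
  assumes s: "semi_inner X s" and complete: "semi_complete X N" and \<alpha>: "\<alpha> > 0"
    and coercive: "\<And>v. v \<in> X ==> \<alpha> * (N v)^2 \<le> s v v"
    and bd: "\<And>x y. x \<in> X ==> y \<in> X ==> \<bar>s x y\<bar> \<le> C * N x * N y"
    and \<beta>_bd: "\<And>x y. x \<in> X ==> y \<in> X ==> \<bar>\<beta> x y\<bar> \<le> K * N x * N y" and K: "K \<ge> 0"
    and \<beta>_diff: "\<And>x y z. x \<in> X ==> y \<in> X ==> z \<in> X ==> \<beta> (x - y) z = \<beta> x z - \<beta> y z"
    and \<beta>_add: "\<And>x y z. x \<in> X ==> y \<in> X ==> z \<in> X ==> \<beta> x (y + z) = \<beta> x y + \<beta> x z"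
    and \<beta>_scaleR: "\<And>x y c. x \<in> X ==> y \<in> X ==> \<beta> x (c *\<^sub>R y) = c * \<beta> x y"
    and \<beta>_alt: "\<And>x. x \<in> X ==> \<beta> x x = 0"
    and F: "F \<in> dual"
  obtains u where "u \<in> X" "\<And>v. v \<in> X ==> s u v + \<beta> u v = F v"
proof -
  interpret S: semi_inner X s by (rule s)
  have "\<exists>r. r \<in> X \<and> (\<forall>v\<in>X. s r v = F v - \<beta> x v)" if x: "x \<in> X" for x
  proof -
    have "(\<lambda>v. F v - \<beta> x v) \<in> dual"
    proof (rule dual_I[where C = "dnorm F + K * N x"])
      fix v assume v: "v \<in> X"
      show "\<bar>F v - \<beta> x v\<bar> \<le> (dnorm F + K * N x) * N v"
        using dual_bound[OF F v] \<beta>_bd[OF x v] by (simp add: algebra_simps abs_le_iff)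
    qed (use F x in \<open>auto simp: dual_add dual_scaleR \<beta>_add \<beta>_scaleR algebra_simps\<close>)
    then show ?thesis using Riesz[OF s complete \<alpha> coercive bd, of "\<lambda>v. F v - \<beta> x v"] by metis
  qed
  then obtain R where R: "\<And>x. x \<in> X ==> R x \<in> X" "\<And>x v. x \<in> X ==> v \<in> X ==> s (R x) v = F v - \<beta> x v" by metis
  \<comment> \<open>\<open>\<kappa>\<close> is a Lipschitz constant of \<open>R\<close> in the norm
    of \<open>s\<close>. The factor \<open>\<theta>\<close> minimizes
    \<open>(1 - \<theta>)^2 + \<theta>^2 * \<kappa>^2\<close>, and the minimum is
    \<open>1 - \<theta>\<close>.\<close>
  define \<kappa> where "\<kappa> = K / \<alpha>"
  define \<theta> where "\<theta> = 1 / (1 + \<kappa>^2)"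
  have pos: "1 + \<kappa>^2 > 0" by (simp add: add_pos_nonneg)
  have \<theta>: "\<theta> > 0" "1 - \<theta> \<ge> 0" "\<theta> * \<kappa>^2 = 1 - \<theta>" using pos by (auto simp: \<theta>_def field_simps)
  define u where "u = rec_nat 0 (\<lambda>_ x. (1 - \<theta>) *\<^sub>R x + \<theta> *\<^sub>R R x)"
  have u_Suc: "u (Suc n) = (1 - \<theta>) *\<^sub>R u n + \<theta> *\<^sub>R R (u n)" for n by (simp add: u_def)
  have uX: "u n \<in> X" for n
  proof (induction n)
    case (Suc n)
    then show ?case unfolding u_Suc using R(1) by (intro add_mem scaleR_mem)
  qed (simp add: u_def)
  have contr: "s (u (Suc (Suc n)) - u (Suc n)) (u (Suc (Suc n)) - u (Suc n)) \<le> (1 - \<theta>) * s (u (Suc n) - u n) (u (Suc n) - u n)" for n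
  proof -
    define d where "d = u (Suc n) - u n"
    define r where "r = R (u (Suc n)) - R (u n)"
    have dr: "d \<in> X" "r \<in> X" using uX R by (auto simp: d_def r_def)
    have sr: "s r v = - \<beta> d v" if "v \<in> X" for v
      using that uX R by (simp add: r_def d_def S.diff_left \<beta>_diff)
    have "s r r \<le> \<kappa>^2 * s d d"
    proof -
      have "s r r \<le> K * (N d * N r)" using sr[OF dr(2)] \<beta>_bd[OF dr] by (simp add: abs_le_iff mult.assoc)
      also have "\<dots> \<le> \<alpha>/2 * (N r)^2 + K^2 / (2*\<alpha>) * (N d)^2"
        using young[OF \<alpha>, of "N r" "K * N d"] by (simp add: power_mult_distrib mult_ac)
      also have "\<dots> \<le> 1/2 * s r r + \<kappa>^2 / 2 * s d d"
      proof -
        have "K^2 / (2*\<alpha>) * (N d)^2 = \<kappa>^2 / 2 * (\<alpha> * (N d)^2)" using \<alpha> by (simp add: \<kappa>_def power2_eq_square)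
        also have "\<dots> \<le> \<kappa>^2 / 2 * s d d" using coercive[OF dr(1)] by (intro mult_left_mono) auto
        finally show ?thesis using coercive[OF dr(2)] by simp
      qed
      finally show ?thesis by simp
    qed
    then have "\<theta>^2 * s r r \<le> \<theta>^2 * (\<kappa>^2 * s d d)" by (intro mult_left_mono) auto
    moreover have "u (Suc (Suc n)) - u (Suc n) = (1 - \<theta>) *\<^sub>R d + \<theta> *\<^sub>R r"
      by (simp add: u_Suc[of "Suc n"] d_def r_def) (simp add: u_Suc algebra_simps)
    moreover have "s ((1 - \<theta>) *\<^sub>R d + \<theta> *\<^sub>R r) ((1 - \<theta>) *\<^sub>R d + \<theta> *\<^sub>R r) = (1 - \<theta>)^2 * s d d + \<theta>^2 * s r r"
      using dr sr[OF dr(1)] S.sym[OF dr] \<beta>_alt[OF dr(1)]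
      by (simp add: S.h_expand scaleR_mem S.scaleR_left S.scaleR_right power2_eq_square)
    ultimately have "s (u (Suc (Suc n)) - u (Suc n)) (u (Suc (Suc n)) - u (Suc n)) \<le> (1 - \<theta>)^2 * s d d + \<theta> * (\<theta> * \<kappa>^2) * s d d"
      by (simp add: power2_eq_square)
    also have "\<dots> = (1 - \<theta>) * s d d" unfolding \<theta>(3) by (simp add: power2_eq_square algebra_simps)
    finally show ?thesis by (simp add: d_def)
  qed
  define c0 where "c0 = s (u 1 - u 0) (u 1 - u 0)"
  have c0: "c0 \<ge> 0" unfolding c0_def by (intro S.nonneg diff_mem uX)
  have geo: "s (u (Suc n) - u n) (u (Suc n) - u n) \<le> c0 * (1 - \<theta>) ^ n" for n
  proof (induction n)
    case (Suc n)
    show ?case using contr[of n] mult_left_mono[OF Suc \<theta>(2)] by (simp add: mult_ac)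
  qed (simp add: c0_def)
  have Nd: "N (u (Suc n) - u n) \<le> sqrt (c0 / \<alpha>) * sqrt (1 - \<theta>) ^ n" for n
  proof -
    have "\<alpha> * (N (u (Suc n) - u n))^2 \<le> c0 * (1 - \<theta>) ^ n"
      using geo[of n] coercive[OF diff_mem[OF uX uX], of "Suc n" n] by linarith
    then have "(N (u (Suc n) - u n))^2 \<le> c0 / \<alpha> * (1 - \<theta>) ^ n" using \<alpha> by (simp add: field_simps)
    then have "sqrt ((N (u (Suc n) - u n))^2) \<le> sqrt (c0 / \<alpha> * (1 - \<theta>) ^ n)" by (rule real_sqrt_le_mono)
    then show ?thesis using N_nonneg[OF diff_mem[OF uX uX], of "Suc n" n]
      by (simp add: real_sqrt_mult real_sqrt_divide real_sqrt_power)
  qed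
  have "summable (\<lambda>n. sqrt (c0 / \<alpha>) * sqrt (1 - \<theta>) ^ n)"
    using \<theta>(1,2) by (intro summable_mult summable_geometric) auto
  then have "summable (\<lambda>n. N (u (Suc n) - u n))"
    by (rule summable_comparison_test'[of _ 0]) (use Nd N_nonneg[OF diff_mem[OF uX uX]] in auto)
  then obtain z where z: "z \<in> X" "(\<lambda>n. N (z - u n)) \<longlonglongrightarrow> 0"
    by (rule semi_completeE[OF complete uX N_summable_Cauchy[OF uX]])
  have "s z v + \<beta> z v = F v" if v: "v \<in> X" for v
  proof -
    have t1: "(\<lambda>n. s (u n) v) \<longlonglongrightarrow> s z v"
      by (rule tendsto_form[OF bd _ z(1) uX z(2) v]) (auto simp: S.diff_left)
    have t2: "(\<lambda>n. \<beta> (u n) v) \<longlonglongrightarrow> \<beta> z v"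
      by (rule tendsto_form[OF \<beta>_bd _ z(1) uX z(2) v]) (auto simp: \<beta>_diff)
    have "s (u (Suc n)) v = (1 - \<theta>) * s (u n) v + \<theta> * (F v - \<beta> (u n) v)" for n
      using v uX R by (simp add: u_Suc S.add_left S.scaleR_left scaleR_mem)
    moreover have "(\<lambda>n. (1 - \<theta>) * s (u n) v + \<theta> * (F v - \<beta> (u n) v)) \<longlonglongrightarrow> (1 - \<theta>) * s z v + \<theta> * (F v - \<beta> z v)"
      by (intro tendsto_intros t1 t2)
    ultimately have "(1 - \<theta>) * s z v + \<theta> * (F v - \<beta> z v) = s z v"
      using LIMSEQ_Suc[OF t1] by (simp add: LIMSEQ_unique)
    then have "\<theta> * (F v - \<beta> z v - s z v) = 0" by (simp add: algebra_simps)
    then show ?thesis using \<theta> by simp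
  qed
  then show ?thesis using that z by blast
qed

end

section \<open>Abstract Navier--Stokes equations: stability\<close>

text \<open>A strict failure at one time would persist on a nondegenerate interval, which is not a
  null set.\<close>

lemma AE_le_continuous:
  fixes f g :: "real => real"
  assumes "AE t in lebesgue_on {0<..<T}. f t \<le> g t" "continuous_on {0..T} f" "continuous_on {0..T} g"
    "T > 0" "t \<in> {0..T}"
  shows "f t \<le> g t"
proof (rule ccontr)
  assume "\<not> f t \<le> g t"
  define D where "D s = f s - g s" for s
  have D: "continuous_on {0..T} D" "D t > 0"
    using assms(2,3) \<open>\<not> f t \<le> g t\<close> by (auto simp: D_def intro!: continuous_intros)
  obtain d where d: "d > 0" "\<And>s. s \<in> {0..T} ==> dist s t < d ==> dist (D s) (D t) < D t"
    using D assms(5) unfolding continuous_on_iff by blast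
  define p q where "p = max 0 (t - d)" and "q = min T (t + d)"
  define I where "I = {p<..<q}"
  have "p < q" using assms(4,5) d(1) by (auto simp: p_def q_def)
  then have I: "emeasure lebesgue I \<noteq> 0" by (simp add: I_def)
  have "AE s in lebesgue. 0 < s \<and> s < T \<longrightarrow> f s \<le> g s" using assms(1) by (simp add: AE_lebesgue_on_Ioo)
  then have "AE s in lebesgue. s \<notin> I"
  proof eventually_elim
    case (elim s)
    show ?case
    proof
      assume "s \<in> I"
      then have s: "0 < s" "s < T" "dist s t < d" by (auto simp: I_def p_def q_def dist_real_def)
      then have "D s > 0" using d(2)[of s] by (auto simp: dist_real_def)
      then show False using elim s by (simp add: D_def)
    qed
  qed
  then have "I \<in> null_sets lebesgue" by (simp add: AE_iff_null_sets I_def)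
  then show False using I by (simp add: null_sets_def)
qed

text \<open>The right-hand side \<open>Y\<close> is increasing, so while the primitive of
  \<open>k\<close> grows by 1/2, \<open>Y\<close> at most doubles. The intermediate value theorem
  cuts the interval into pieces of this kind; induction on their number gives the factor
  \<open>2 ^ m\<close>. Integrability of \<open>k\<close> is enough for this.\<close>

lemma Gronwall:
  fixes k y :: "real => real"
  assumes k: "integrable (lebesgue_on {0<..<T}) k" "AE t in lebesgue_on {0<..<T}. 0 \<le> k t"
    and ky: "integrable (lebesgue_on {0<..<T}) (\<lambda>t. k t * y t)" "AE t in lebesgue_on {0<..<T}. 0 \<le> y t"
    and le: "AE t in lebesgue_on {0<..<T}. y t \<le> c + integral {0..t} (\<lambda>t. k t * y t)" and c: "c \<ge> 0"
    and m: "integral {0..t} k \<le> real m / 2" and t: "0 \<le> t" "t \<le> T"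
  shows "c + integral {0..t} (\<lambda>t. k t * y t) \<le> 2 ^ m * c"
proof -
  define Y where "Y t = c + integral {0..t} (\<lambda>t. k t * y t)" for t
  define K where "K t = integral {0..t} k" for t
  have mono_y: "Y s \<le> Y t" if "0 \<le> s" "s \<le> t" "t \<le> T" for s t
    unfolding Y_def using that k(2) ky(2)
    by (intro add_left_mono HK_primitive_mono[OF ky(1)]) (auto elim: eventually_elim2)
  have step: "Y t - Y s \<le> Y t * (K t - K s)" if st: "0 \<le> s" "s \<le> t" "t \<le> T" for s t
  proof -
    have i: "integrable (lebesgue_on {s<..<t}) (\<lambda>t. k t * y t)" "integrable (lebesgue_on {s<..<t}) k"
      using integrable_lebesgue_on_Ioo_sub[OF ky(1)] integrable_lebesgue_on_Ioo_sub[OF k(1)] st by auto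
    have "AE r in lebesgue_on {0<..<T}. 0 \<le> k r \<and> y r \<le> Y r" using k(2) le by eventually_elim (simp add: Y_def)
    then have "AE r in lebesgue_on {s<..<t}. 0 \<le> k r \<and> y r \<le> Y r"
      by (rule AE_lebesgue_on_subset) (use st in auto)
    then have ae: "AE r in lebesgue_on {s<..<t}. k r * y r \<le> k r * Y t"
      using AE_space by eventually_elim (use mono_y st in \<open>auto intro!: mult_left_mono elim: order_trans\<close>)
    have "integral {s..t} (\<lambda>t. k t * y t) \<le> integral {s..t} (\<lambda>r. k r * Y t)"
      by (rule HK_mono_AE[OF i(1) integrable_mult_left[OF i(2)] ae]) auto
    then show ?thesis
      using HK_primitive_diff[OF ky(1) st] HK_primitive_diff[OF k(1) st] by (simp add: Y_def K_def mult.commute)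
  qed
  have Y0: "Y t \<ge> 0" if "0 \<le> t" "t \<le> T" for t using mono_y[of 0 t] that c by (simp add: Y_def)
  have K: "continuous_on {0..T} K" unfolding K_def by (rule HK_primitive_continuous[OF k(1)])
  have "K t \<le> real m / 2 ==> Y t \<le> 2 ^ m * c" using t
  proof (induction m arbitrary: t)
    case 0
    then have "Y t * K t \<le> 0" using Y0[of t] by (simp add: mult_nonneg_nonpos)
    then show ?case using step[of 0 t] 0 by (simp add: Y_def K_def)
  next
    case (Suc m)
    show ?case
    proof (cases "K t \<le> real m / 2")
      case True
      then have "Y t \<le> 2 ^ m * c" using Suc by simp
      then show ?thesis using c by (simp add: order_trans[OF _ mult_right_mono])
    next
      case False
      have "continuous_on {0..t} K" using K by (rule continuous_on_subset) (use Suc.prems in auto)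
      then obtain s where s: "0 \<le> s" "s \<le> t" "K s = real m / 2"
        using IVT'[of K 0 "real m / 2" t] False Suc.prems by (auto simp: K_def)
      have "Y t * (K t - K s) \<le> Y t * (1/2)"
        using Suc.prems s(3) Y0[of t] by (intro mult_left_mono) auto
      then have "Y t \<le> 2 * Y s" using step[of s t] s Suc.prems by simp
      moreover have "Y s \<le> 2 ^ m * c" using Suc.IH[of s] s Suc.prems by simp
      ultimately show ?thesis by simp
    qed
  qed
  then show ?thesis using m by (simp add: Y_def K_def)
qed

text \<open>Coercivity refers to the full norm \<open>N\<close>, so on the plane section it has
  Poincare's inequality built in. Density serves to approximate initial values, and test vectors in
  \<open>H\<close>, by elements of \<open>V\<close>.\<close>

locale navier_stokes = evolution V N T H h
  for V :: "'x::real_vector set" and N :: "'x => real" and T :: real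
    and H :: "'x set" and h :: "'x => 'x => real" +
  fixes a :: "'x => 'x => real" and b :: "'x => 'x => 'x => real" and \<alpha> Ca Cb :: real
  assumes complete: "semi_complete V N"
    and dense: "\<And>x e. x \<in> H ==> e > 0 ==> \<exists>v\<in>V. hnorm (x - v) < e"
    and a: "semi_inner V a" and \<alpha>: "\<alpha> > 0"
    and coercive: "\<And>v. v \<in> V ==> \<alpha> * (N v)^2 \<le> a v v"
    and a_bound: "\<And>u v. u \<in> V ==> v \<in> V ==> \<bar>a u v\<bar> \<le> Ca * N u * N v" and Ca: "Ca \<ge> 0"
    and b_add1: "\<And>u u' v w. u \<in> V ==> u' \<in> V ==> v \<in> V ==> w \<in> V ==> b (u + u') v w = b u v w + b u' v w"
    and b_add2: "\<And>u v v' w. u \<in> V ==> v \<in> V ==> v' \<in> V ==> w \<in> V ==> b u (v + v') w = b u v w + b u v' w"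
    and b_add3: "\<And>u v w w'. u \<in> V ==> v \<in> V ==> w \<in> V ==> w' \<in> V ==> b u v (w + w') = b u v w + b u v w'"
    and b_scaleR1: "\<And>c u v w. u \<in> V ==> v \<in> V ==> w \<in> V ==> b (c *\<^sub>R u) v w = c * b u v w"
    and b_scaleR2: "\<And>c u v w. u \<in> V ==> v \<in> V ==> w \<in> V ==> b u (c *\<^sub>R v) w = c * b u v w"
    and b_scaleR3: "\<And>c u v w. u \<in> V ==> v \<in> V ==> w \<in> V ==> b u v (c *\<^sub>R w) = c * b u v w"
    and b_alt: "\<And>u v. u \<in> V ==> v \<in> V ==> b u v v = 0"
    and b_bound: "\<And>u v w. u \<in> V ==> v \<in> V ==> w \<in> V ==>
      \<bar>b u v w\<bar> \<le> Cb * sqrt (hnorm u * N u) * N v * sqrt (hnorm w * N w)" and Cb: "Cb \<ge> 0"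
begin

sublocale A: semi_inner V a by (rule a)

lemma b_diff1: "u \<in> V ==> u' \<in> V ==> v \<in> V ==> w \<in> V ==> b (u - u') v w = b u v w - b u' v w"
  using b_add1[of u "(-1) *\<^sub>R u'" v w] b_scaleR1[of u' v w "-1"] scaleR_mem[of u' "-1"] by simp

lemma b_diff2: "u \<in> V ==> v \<in> V ==> v' \<in> V ==> w \<in> V ==> b u (v - v') w = b u v w - b u v' w"
  using b_add2[of u v "(-1) *\<^sub>R v'" w] b_scaleR2[of u v' w "-1"] scaleR_mem[of v' "-1"] by simp

lemma b_antisym: "u \<in> V ==> v \<in> V ==> w \<in> V ==> b u v w = - b u w v"
  using b_alt[of u "v + w"] b_alt[of u v] b_alt[of u w] by (simp add: b_add2 b_add3 add_mem)

lemma interp_le: "u \<in> V ==> sqrt (hnorm u * N u) \<le> N u"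
proof -
  assume u: "u \<in> V"
  have "hnorm u * N u \<le> N u * N u" using hnorm_le[OF u] N_nonneg[OF u] by (rule mult_right_mono)
  then have "sqrt (hnorm u * N u) \<le> sqrt (N u * N u)" by (rule real_sqrt_le_mono)
  then show ?thesis using N_nonneg[OF u] by simp
qed

lemma interp_nonneg [simp]: "u \<in> V ==> 0 \<le> sqrt (hnorm u * N u)"
  by simp

lemma b_bound':
  assumes "u \<in> V" "v \<in> V" "w \<in> V" shows "\<bar>b u v w\<bar> \<le> Cb * N u * N v * N w"
proof -
  have "\<bar>b u v w\<bar> \<le> Cb * sqrt (hnorm u * N u) * N v * sqrt (hnorm w * N w)" using assms by (rule b_bound)
  also have "\<dots> \<le> Cb * N u * N v * N w"
    using assms Cb interp_le by (intro mult_mono mult_nonneg_nonneg) auto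
  finally show ?thesis .
qed

lemma b_bound_same:
  assumes "u \<in> V" "v \<in> V" shows "\<bar>b u v u\<bar> \<le> Cb * hnorm u * N u * N v"
proof -
  have "\<bar>b u v u\<bar> \<le> Cb * sqrt (hnorm u * N u) * N v * sqrt (hnorm u * N u)" using assms by (intro b_bound)
  also have "\<dots> = Cb * N v * (sqrt (hnorm u * N u) * sqrt (hnorm u * N u))" by (simp add: mult_ac)
  also have "sqrt (hnorm u * N u) * sqrt (hnorm u * N u) = hnorm u * N u" using assms by simp
  finally show ?thesis by (simp add: mult_ac)
qed

definition A_op :: "'x => 'x => real" where "A_op u = (\<lambda>v. a u v)"
definition B_op :: "'x => 'x => 'x => real" where "B_op u w = (\<lambda>v. b u w v)"

lemma A_op_dual: "u \<in> V ==> A_op u \<in> dual"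
  by (rule dual_I[where C = "Ca * N u"]) (auto simp: A_op_def A.add_right A.scaleR_right a_bound)

lemma B_op_dual: "u \<in> V ==> w \<in> V ==> B_op u w \<in> dual"
  by (rule dual_I[where C = "Cb * N u * N w"]) (auto simp: B_op_def b_add3 b_scaleR3 b_bound')

lemma dnorm_A_op: "u \<in> V ==> dnorm (A_op u) \<le> Ca * N u"
  using a_bound Ca N_nonneg by (intro dnorm_le) (auto simp: A_op_def)

text \<open>By antisymmetry the differentiated argument becomes the test vector; the outer arguments
  are then equal and their square roots combine to \<open>hnorm u * N u\<close>. Being linear in the
  strong norm, this is square integrable in time as soon as \<open>u\<close> is bounded in
  \<open>H\<close>.\<close>

lemma dnorm_B_op_same:
  assumes u: "u \<in> V" shows "dnorm (B_op u u) \<le> Cb * hnorm u * N u"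
proof (rule dnorm_le)
  fix v assume v: "v \<in> V"
  show "\<bar>B_op u u v\<bar> \<le> Cb * hnorm u * N u * N v"
    using b_bound_same[OF u v] b_antisym[OF u u v] by (simp add: B_op_def)
qed (use u Cb N_nonneg in auto)

lemma dnorm_A_op_diff:
  assumes "u \<in> V" "w \<in> V" shows "dnorm (A_op u - A_op w) \<le> Ca * N (u - w)"
proof (rule dnorm_le)
  fix v assume "v \<in> V"
  then show "\<bar>(A_op u - A_op w) v\<bar> \<le> Ca * N (u - w) * N v"
    using assms a_bound[OF diff_mem[OF assms]] by (simp add: A_op_def A.diff_left)
qed (use Ca assms diff_mem in auto)

lemma dnorm_B_op_diff:
  assumes "u \<in> V" "w \<in> V" "x \<in> V" "y \<in> V"
  shows "dnorm (B_op u x - B_op w y) \<le> Cb * N (u - w) * N x + Cb * N w * N (x - y)"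
proof (rule dnorm_le)
  fix v assume v: "v \<in> V"
  have "(B_op u x - B_op w y) v = b (u - w) x v + b w (x - y) v"
    using assms v by (simp add: B_op_def b_diff1 b_diff2)
  also have "\<bar>\<dots>\<bar> \<le> Cb * N (u - w) * N x * N v + Cb * N w * N (x - y) * N v"
    using b_bound'[OF diff_mem[OF assms(1,2)] assms(3) v] b_bound'[OF assms(2) diff_mem[OF assms(3,4)] v] by linarith
  finally show "\<bar>(B_op u x - B_op w y) v\<bar> \<le> (Cb * N (u - w) * N x + Cb * N w * N (x - y)) * N v"
    by (simp add: algebra_simps)
qed (use Cb assms diff_mem in auto)

lemma A_op_SM:
  assumes "SM u" shows "D.SM (\<lambda>t. A_op (u t))"
proof (rule D.SM_compose1[OF assms, where \<Phi> = A_op])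
  fix x x' assume *: "x \<in> V" "\<And>n. x' n \<in> V" "(\<lambda>n. N (x - x' n)) \<longlonglongrightarrow> 0"
  show "(\<lambda>n. dnorm (A_op x - A_op (x' n))) \<longlonglongrightarrow> 0"
  proof (rule Lim_null_comparison[OF _ tendsto_mult_right_zero[OF *(3)]], intro always_eventually allI)
    show "norm (dnorm (A_op x - A_op (x' n))) \<le> Ca * N (x - x' n)" for n
      using dnorm_A_op_diff[OF *(1,2)] dnorm_nonneg[OF D.diff_mem[OF A_op_dual A_op_dual]] * by simp
  qed
qed (rule A_op_dual)

lemma B_op_SM:
  assumes "SM u" "SM w" shows "D.SM (\<lambda>t. B_op (u t) (w t))"
proof (rule D.SM_compose2[OF assms, where \<Phi> = B_op])
  fix x y x' y' assume *: "x \<in> V" "y \<in> V" "\<And>n. x' n \<in> V" "\<And>n. y' n \<in> V"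
    "(\<lambda>n. N (x - x' n)) \<longlonglongrightarrow> 0" "(\<lambda>n. N (y - y' n)) \<longlonglongrightarrow> 0"
  have "(\<lambda>n. N (x' n)) \<longlonglongrightarrow> N x" using * by (intro N_tendsto)
  then have "(\<lambda>n. Cb * N (x - x' n) * N y + Cb * N (x' n) * N (y - y' n)) \<longlonglongrightarrow> Cb * 0 * N y + Cb * N x * 0"
    using * by (intro tendsto_intros)
  then have lim: "(\<lambda>n. Cb * N (x - x' n) * N y + Cb * N (x' n) * N (y - y' n)) \<longlonglongrightarrow> 0" by simp
  show "(\<lambda>n. dnorm (B_op x y - B_op (x' n) (y' n))) \<longlonglongrightarrow> 0"
  proof (rule Lim_null_comparison[OF _ lim], intro always_eventually allI)
    show "norm (dnorm (B_op x y - B_op (x' n) (y' n))) \<le> Cb * N (x - x' n) * N y + Cb * N (x' n) * N (y - y' n)" for n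
      using dnorm_B_op_diff[OF *(1,3,2,4)] dnorm_nonneg[OF D.diff_mem[OF B_op_dual B_op_dual]] * by simp
  qed
qed (rule B_op_dual)

lemma A_op_L2:
  assumes u: "u \<in> L2" shows "(\<lambda>t. A_op (u t)) \<in> D.L2"
proof (rule D.L2_I[OF A_op_SM])
  show "integrable M (\<lambda>t. Ca^2 * (N (u t))^2)" using L2_D[OF u] by simp
  show "AE t in M. (dnorm (A_op (u t)))^2 \<le> Ca^2 * (N (u t))^2"
    using L2_D(3)[OF u] by eventually_elim
      (use dnorm_A_op dnorm_nonneg[OF A_op_dual] in \<open>auto simp flip: power_mult_distrib intro!: power_mono\<close>)
qed (rule L2_D[OF u])

lemma B_op_L2:
  assumes u: "u \<in> L2" and C: "AE t in M. hnorm (u t) \<le> C" shows "(\<lambda>t. B_op (u t) (u t)) \<in> D.L2"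
proof (rule D.L2_I[OF B_op_SM])
  show "integrable M (\<lambda>t. (Cb * C)^2 * (N (u t))^2)" using L2_D[OF u] by simp
  show "AE t in M. (dnorm (B_op (u t) (u t)))^2 \<le> (Cb * C)^2 * (N (u t))^2"
    using L2_D(3)[OF u] C
  proof eventually_elim
    case (elim t)
    have "dnorm (B_op (u t) (u t)) \<le> Cb * hnorm (u t) * N (u t)" using elim by (intro dnorm_B_op_same)
    also have "\<dots> \<le> Cb * C * N (u t)" using elim Cb by (intro mult_right_mono mult_left_mono) auto
    finally show ?case
      using dnorm_nonneg[OF B_op_dual] elim by (auto simp flip: power_mult_distrib intro!: power_mono)
  qed
qed (rule L2_D[OF u])+

definition force :: "(real => 'x) => (real => 'x => real) => real => 'x => real" where
  "force u g t = g t - A_op (u t) - B_op (u t) (u t)"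

text \<open>The bound in \<open>H\<close> places the convective term, and thereby the whole force,
  in \<open>D.L2\<close>, so that the energy identity applies.\<close>

definition solves :: "(real => 'x) => 'x => (real => 'x => real) => bool" where
  "solves u u0 g \<longleftrightarrow> u \<in> L2 \<and> (\<exists>C. AE t in M. hnorm (u t) \<le> C) \<and> weakly u u0 (force u g)"

lemma force_L2: "u \<in> L2 ==> AE t in M. hnorm (u t) \<le> C ==> g \<in> D.L2 ==> force u g \<in> D.L2"
  unfolding force_def[abs_def] by (intro D.L2_diff A_op_L2 B_op_L2)

lemma weakly_diff:
  assumes u: "u \<in> L2" "weakly u x F" and w: "w \<in> L2" "weakly w y G"
    and F: "F \<in> D.L2" and G: "G \<in> D.L2" and xy: "x \<in> H" "y \<in> H"
  shows "weakly (\<lambda>t. u t - w t) (x - y) (\<lambda>t. F t - G t)"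
  unfolding weakly_def
proof
  fix v assume v: "v \<in> V"
  have "AE t in M. h (u t) v = h x v + I0 t (\<lambda>r. F r v)" "AE t in M. h (w t) v = h y v + I0 t (\<lambda>r. G r v)"
    using u(2) w(2) v by (auto simp: weakly_def)
  then show "AE t in M. h (u t - w t) v = h (x - y) v + I0 t (\<lambda>r. (F r - G r) v)"
    using L2_D(3)[OF u(1)] L2_D(3)[OF w(1)] AE_space
  proof eventually_elim
    case (elim t)
    have i: "integrable M (\<lambda>r. F r v)" "integrable M (\<lambda>r. G r v)"
      using pairing_integrable[OF F const_L2[OF v]] pairing_integrable[OF G const_L2[OF v]] by auto
    have "I0 t (\<lambda>r. (F r - G r) v) = I0 t (\<lambda>r. F r v) - I0 t (\<lambda>r. G r v)"
      using elim(5) by (simp add: integral_diff integrable_Ioo_HK[OF i(1)] integrable_Ioo_HK[OF i(2)])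
    then show ?case using elim v xy by (simp add: diff_left)
  qed
qed

text \<open>For \<open>z = u - w\<close> one has
  \<open>b(u, u, z) - b(w, w, z) = b(z, u, z) + b(w, z, z)\<close>, and the last term vanishes. The
  Gronwall coefficient therefore contains \<open>u\<close> only, and the factor \<open>2 ^ m\<close>
  is independent of \<open>w\<close>. The difference of the initial values lies in \<open>V\<close>
  because the energy identity is stated for such initial values.\<close>

theorem stability:
  assumes u: "solves u x g" and w: "solves w y f" and g: "g \<in> D.L2" and f: "f \<in> D.L2"
    and xy: "x \<in> H" "y \<in> H" "x - y \<in> V"
    and m: "2 * Cb^2 / \<alpha> * (\<integral>t. (N (u t))^2 \<partial>M) \<le> real m / 2"
  defines "c \<equiv> h (x - y) (x - y) + 2 / \<alpha> * (\<integral>t. (dnorm (g t - f t))^2 \<partial>M)"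
  shows "AE t in M. (hnorm (u t - w t))^2 \<le> 2 ^ m * c"
    and "\<alpha> * (\<integral>t. (N (u t - w t))^2 \<partial>M) \<le> 2 ^ m * c"
proof -
  obtain Cu Cw where u': "u \<in> L2" "AE t in M. hnorm (u t) \<le> Cu" "weakly u x (force u g)"
    and w': "w \<in> L2" "AE t in M. hnorm (w t) \<le> Cw" "weakly w y (force w f)"
    using u w unfolding solves_def by blast
  define z where "z t = u t - w t" for t
  define F where "F t = force u g t - force w f t" for t
  have FL: "F \<in> D.L2" unfolding F_def by (intro D.L2_diff force_L2[OF u'(1,2) g] force_L2[OF w'(1,2) f])
  have zL: "z \<in> L2" unfolding z_def by (rule L2_diff[OF u'(1) w'(1)])
  have wk: "weakly z (x - y) F"
    unfolding z_def[abs_def] F_def[abs_def] by (rule weakly_diff[OF u'(1,3) w'(1,3) force_L2[OF u'(1,2) g] force_L2[OF w'(1,2) f] xy(1,2)])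
  have en: "AE t in M. h (z t) (z t) = h (x - y) (x - y) + 2 * I0 t (\<lambda>r. F r (z r))"
    by (rule energy_identity[OF zL FL wk xy(3)])
  define k where "k t = 2 * Cb^2 / \<alpha> * (N (u t))^2" for t
  define Y where "Y t = (hnorm (z t))^2" for t
  define n where "n t = (N (z t))^2" for t
  define d where "d t = (dnorm (g t - f t))^2" for t
  have uV: "AE t in M. u t \<in> V" and wV: "AE t in M. w t \<in> V" and gD: "AE t in M. g t \<in> dual" and fD: "AE t in M. f t \<in> dual"
    using L2_D(3)[OF u'(1)] L2_D(3)[OF w'(1)] D.L2_D(3)[OF g] D.L2_D(3)[OF f] by auto
  have ik: "integrable M k" unfolding k_def using L2_D(2)[OF u'(1)] by simp
  have inn: "integrable M n" unfolding n_def using L2_D(2)[OF zL] .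
  have id: "integrable M d" unfolding d_def using D.L2_D(2)[OF D.L2_diff[OF g f]] .
  have iY: "integrable M (\<lambda>t. h (z t) (z t))" by (rule hnorm_integrable[OF zL])
  have zV: "AE t in M. z t \<in> V" by (rule L2_D(3)[OF zL])
  have Yeq: "AE t in M. h (z t) (z t) = Y t" using zV by eventually_elim (simp add: Y_def hnorm_square)
  have Ym: "Y \<in> borel_measurable M" by (rule borel_measurable_AE_eq[OF borel_measurable_integrable[OF iY] Yeq])
  have Ybd: "AE t in M. Y t \<le> (Cu + Cw)^2"
    using uV wV u'(2) w'(2)
  proof eventually_elim
    case (elim t)
    interpret Hn: seminormed H hnorm by (rule seminormed_hnorm)
    have "hnorm (z t) \<le> Cu + Cw" using Hn.triangle_diff[of "u t" "w t"] elim by (simp add: z_def)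
    moreover have "0 \<le> hnorm (z t)" using elim diff_mem by (simp add: z_def)
    ultimately show ?case unfolding Y_def by (intro power_mono)
  qed
  have ikY: "integrable M (\<lambda>t. k t * Y t)"
  proof (rule Bochner_Integration.integrable_bound)
    show "integrable M (\<lambda>t. k t * (Cu + Cw)^2)" using ik by simp
    show "(\<lambda>t. k t * Y t) \<in> borel_measurable M" using ik Ym by simp
    show "AE t in M. norm (k t * Y t) \<le> norm (k t * (Cu + Cw)^2)"
      using Ybd by eventually_elim (auto simp: abs_mult Y_def intro!: mult_left_mono)
  qed
  \<comment> \<open>Coercivity supplies \<open>2 * \<alpha> * n r\<close>. Young's inequality spends
    one quarter of it on the force and one quarter on convection; \<open>\<alpha> * n r\<close>
    remains and yields the bound in \<open>V\<close>.\<close>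
  have pt: "AE r in M. 2 * F r (z r) \<le> 2 / \<alpha> * d r + k r * Y r - \<alpha> * n r"
    using uV wV gD fD
  proof eventually_elim
    case (elim r)
    have z: "z r \<in> V" and gf: "g r - f r \<in> dual" using elim diff_mem D.diff_mem by (auto simp: z_def)
    have "F r (z r) = (g r - f r) (z r) - (a (u r) (z r) - a (w r) (z r)) - (b (u r) (u r) (z r) - b (w r) (w r) (z r))"
      by (simp add: F_def force_def A_op_def B_op_def)
    also have "a (u r) (z r) - a (w r) (z r) = a (z r) (z r)" using A.diff_left[OF elim(1,2) z] by (simp add: z_def)
    also have "b (u r) (u r) (z r) - b (w r) (w r) (z r) = b (z r) (u r) (z r) + b (w r) (z r) (z r)"
      using b_diff1[OF elim(1,2) elim(1) z] b_diff2[OF elim(2) elim(1,2) z] by (simp add: z_def)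
    also have "b (w r) (z r) (z r) = 0" using b_alt[OF elim(2) z] .
    finally have 1: "F r (z r) = (g r - f r) (z r) - a (z r) (z r) - b (z r) (u r) (z r)" by simp
    have "2 * (g r - f r) (z r) \<le> 2 * (N (z r) * dnorm (g r - f r))" using dual_bound[OF gf z] by (simp add: mult.commute)
    also have "\<dots> \<le> 2 * (\<alpha>/4 * (N (z r))^2 + (dnorm (g r - f r))^2 / \<alpha>)"
      using young[of "\<alpha>/2" "N (z r)" "dnorm (g r - f r)"] \<alpha> by simp
    finally have 2: "2 * (g r - f r) (z r) \<le> \<alpha>/2 * n r + 2 / \<alpha> * d r" by (simp add: n_def d_def)
    have "- 2 * b (z r) (u r) (z r) \<le> 2 * (N (z r) * (Cb * hnorm (z r) * N (u r)))"
    proof -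
      have "Cb * hnorm (z r) * N (z r) * N (u r) = N (z r) * (Cb * hnorm (z r) * N (u r))" by (simp only: mult_ac)
      then show ?thesis using b_bound_same[OF z elim(1)] by linarith
    qed
    also have "\<dots> \<le> 2 * (\<alpha>/4 * (N (z r))^2 + (Cb * hnorm (z r) * N (u r))^2 / \<alpha>)"
      using young[of "\<alpha>/2" "N (z r)" "Cb * hnorm (z r) * N (u r)"] \<alpha> by simp
    also have "\<dots> = \<alpha>/2 * n r + k r * Y r" by (simp add: n_def k_def Y_def power_mult_distrib)
    finally have 3: "- 2 * b (z r) (u r) (z r) \<le> \<alpha>/2 * n r + k r * Y r" .
    have 4: "\<alpha> * n r \<le> a (z r) (z r)" using coercive[OF z] by (simp add: n_def)
    show ?case using 1 2 3 4 by linarith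
  qed
  have iF: "integrable M (\<lambda>r. F r (z r))" by (rule pairing_integrable[OF FL zL])
  have iR: "integrable M (\<lambda>r. 2 / \<alpha> * d r + k r * Y r - \<alpha> * n r)" using id ikY inn by simp
  have main: "AE t in M. Y t + \<alpha> * I0 t n \<le> c + I0 t (\<lambda>t. k t * Y t)"
    using en Yeq AE_space
  proof eventually_elim
    case (elim t)
    then have t: "0 \<le> t" "t \<le> T" by auto
    note HK = integrable_Ioo_HK[where a = 0 and b = T and c = 0 and d = t, OF _ _ t(2)]
    have "2 * I0 t (\<lambda>r. F r (z r)) = I0 t (\<lambda>r. 2 * F r (z r))" by simp
    also have "\<dots> \<le> I0 t (\<lambda>r. 2 / \<alpha> * d r + k r * Y r - \<alpha> * n r)"
      using iF by (intro HK_mono_AE[OF _ iR pt]) (use t in auto)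
    also have "\<dots> = I0 t (\<lambda>r. 2 / \<alpha> * d r + k r * Y r) - I0 t (\<lambda>r. \<alpha> * n r)"
      using id ikY inn by (intro integral_diff HK) auto
    also have "I0 t (\<lambda>r. 2 / \<alpha> * d r + k r * Y r) = I0 t (\<lambda>r. 2 / \<alpha> * d r) + I0 t (\<lambda>r. k r * Y r)"
      using id ikY by (intro integral_add HK) auto
    also have "I0 t (\<lambda>r. 2 / \<alpha> * d r) = 2 / \<alpha> * I0 t d" by (rule integral_mult_right)
    also have "I0 t (\<lambda>r. \<alpha> * n r) = \<alpha> * I0 t n" by (rule integral_mult_right)
    finally have "2 * I0 t (\<lambda>r. F r (z r)) \<le> 2 / \<alpha> * I0 t d + I0 t (\<lambda>r. k r * Y r) - \<alpha> * I0 t n" .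
    moreover have "2 / \<alpha> * I0 t d \<le> 2 / \<alpha> * I0 T d"
      using HK_primitive_mono[OF id, of t T] t \<alpha> by (intro mult_left_mono) (auto simp: d_def)
    moreover have "I0 T d = (\<integral>t. (dnorm (g t - f t))^2 \<partial>M)"
      using integral_lebesgue_on_Ioo[OF id] by (simp add: d_def[abs_def])
    ultimately show ?case using elim by (simp add: c_def)
  qed
  have n0: "I0 t n \<ge> 0" if "0 \<le> t" "t \<le> T" for t
    using HK_primitive_mono[OF inn, of 0 t] that by (simp add: n_def)
  have c0: "c \<ge> 0" unfolding c_def using nonneg[OF in_H[OF xy(3)]] \<alpha> by (intro add_nonneg_nonneg mult_nonneg_nonneg) auto
  have Kt: "I0 t k \<le> real m / 2" if "0 \<le> t" "t \<le> T" for t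
  proof -
    have "I0 t k \<le> I0 T k" using HK_primitive_mono[OF ik, of t T] that \<alpha> by (simp add: k_def)
    also have "\<dots> = (\<integral>t. k t \<partial>M)" using integral_lebesgue_on_Ioo[OF ik] by simp
    finally show ?thesis using m by (simp add: k_def)
  qed
  have gr: "c + I0 t (\<lambda>t. k t * Y t) \<le> 2 ^ m * c" if t: "0 \<le> t" "t \<le> T" for t
  proof (rule Gronwall[OF ik _ ikY _ _ c0 Kt[OF t] t])
    show "AE t in M. Y t \<le> c + I0 t (\<lambda>t. k t * Y t)"
      using main AE_space
    proof eventually_elim
      case (elim t)
      have "0 \<le> \<alpha> * I0 t n" using n0[of t] elim \<alpha> by simp
      then show ?case using elim by linarith
    qed
  qed (auto simp: k_def Y_def \<alpha> less_imp_le)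
  show "AE t in M. (hnorm (u t - w t))^2 \<le> 2 ^ m * c"
    using main AE_space
  proof eventually_elim
    case (elim t)
    have "0 \<le> \<alpha> * I0 t n" using n0[of t] elim \<alpha> by simp
    then show ?case using elim gr[of t] by (simp add: Y_def z_def)
  qed
  \<comment> \<open>The bound is known for almost every time; continuity of the primitive carries it
    to the endpoint \<open>T\<close>.\<close>
  have "\<alpha> * I0 T n \<le> 2 ^ m * c"
  proof (rule AE_le_continuous[where f = "\<lambda>t. \<alpha> * I0 t n" and g = "\<lambda>_. 2 ^ m * c" and T = T])
    show "AE t in M. \<alpha> * I0 t n \<le> 2 ^ m * c"
      using main AE_space
    proof eventually_elim
      case (elim t)
      have "0 \<le> Y t" by (simp add: Y_def)
      then show ?case using elim gr[of t] by simp
    qed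
  qed (use T in \<open>auto intro!: continuous_intros HK_primitive_continuous[OF inn]\<close>)
  then show "\<alpha> * (\<integral>t. (N (u t - w t))^2 \<partial>M) \<le> 2 ^ m * c"
    using integral_lebesgue_on_Ioo[OF inn] by (simp add: n_def[abs_def] z_def)
qed

theorem uniqueness:
  assumes u: "solves u x g" and w: "solves w x g" and g: "g \<in> D.L2" and x: "x \<in> H"
  shows "AE t in M. hnorm (u t - w t) = 0"
proof -
  obtain m where m: "2 * Cb^2 / \<alpha> * (\<integral>t. (N (u t))^2 \<partial>M) \<le> real m / 2"
    using real_arch_simple[of "2 * (2 * Cb^2 / \<alpha> * (\<integral>t. (N (u t))^2 \<partial>M))"] by auto
  have "x - x \<in> V" by simp
  from stability(1)[OF u w g g x x this m]
  have "AE t in M. (hnorm (u t - w t))^2 \<le> 0" using scaleR_left[of 0 0 0] D.N_zero by simp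
  then show ?thesis by eventually_elim simp
qed

end

section \<open>The semi-implicit Euler scheme\<close>

text \<open>The induction step for the summed bound on the difference quotients, reduced to plain
  reals.\<close>

lemma sumd_arith:
  fixes z c S C Z A k G z' x y :: real
  assumes "z + c * S \<le> C * Z * A + k * G" "z' + c * x \<le> (1 + C * y) * z + G" "C * y * z \<le> C * y * Z"
  shows "z' + c * (S + x) \<le> C * Z * (A + y) + (k + 1) * G"
  using assms by (simp add: algebra_simps)

lemma discrete_Gronwall:
  fixes z x :: "nat => real"
  assumes z: "z 0 \<le> 0" and step: "\<And>k. k < n ==> z (Suc k) \<le> (1 + x k) * z k + g" and x: "\<And>k. 0 \<le> x k" and g: "0 \<le> g"
  shows "k \<le> n ==> z k \<le> exp (\<Sum>j<k. x j) * (real k * g)"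
proof (induction k)
  case (Suc k)
  define P where "P = exp (\<Sum>j<k. x j)"
  have P: "1 \<le> P" unfolding P_def using x by (simp add: sum_nonneg)
  have "z (Suc k) \<le> (1 + x k) * z k + g" using step Suc by simp
  also have "\<dots> \<le> (1 + x k) * (P * (real k * g)) + g"
    using Suc x[of k] by (intro add_mono mult_left_mono) (auto simp: P_def)
  also have "\<dots> \<le> exp (x k) * (P * (real k * g)) + exp (x k) * (P * g)"
  proof (intro add_mono mult_right_mono)
    have "1 \<le> exp (x k) * P" using P x[of k] by (simp add: mult_ge1_I)
    then show "g \<le> exp (x k) * (P * g)" using mult_right_mono[of 1 "exp (x k) * P" g] g by (simp add: mult.assoc)
  qed (use P g exp_ge_add_one_self in auto)
  also have "\<dots> = exp (\<Sum>j<Suc k. x j) * (real (Suc k) * g)"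
    by (simp add: P_def exp_add algebra_simps)
  finally show ?case .
qed (use z in simp)

context navier_stokes begin

text \<open>The transporting field \<open>w\<close> is the previous iterate, so the problem for
  \<open>u\<close> is linear. Convection contributes a form that vanishes on equal arguments, hence
  a solution exists for every step length.\<close>

lemma Euler_step:
  assumes w: "w \<in> V" and F: "F \<in> dual" and \<tau>: "\<tau> > 0"
  obtains u where "u \<in> V" "\<And>v. v \<in> V ==> h u v + \<tau> * a u v + \<tau> * b w u v = h w v + \<tau> * F v"
proof -
  define s where "s u v = h u v + \<tau> * a u v" for u v
  have s: "semi_inner V s"
    by unfold_locales (use subspace \<tau> nonneg A.nonneg sym A.sym in
        \<open>auto simp: s_def add_left A.add_left scaleR_left A.scaleR_left algebra_simps add_nonneg_nonneg\<close>)
  have G: "(\<lambda>v. h w v + \<tau> * F v) \<in> dual"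
  proof (rule dual_I[where C = "N w + \<tau> * dnorm F"])
    fix v assume v: "v \<in> V"
    have "\<bar>\<tau> * F v\<bar> \<le> \<tau> * (dnorm F * N v)" using dual_bound[OF F v] \<tau> by (simp add: abs_mult)
    then show "\<bar>h w v + \<tau> * F v\<bar> \<le> (N w + \<tau> * dnorm F) * N v"
      using h_bound[OF w v] by (simp add: algebra_simps abs_le_iff)
  qed (use w F in \<open>auto simp: add_right scaleR_right dual_add dual_scaleR algebra_simps\<close>)
  show ?thesis
  proof (rule Lax_Milgram[OF s complete, where \<alpha> = "\<tau> * \<alpha>" and C = "1 + \<tau> * Ca" and \<beta> = "\<lambda>u v. \<tau> * b w u v" and K = "\<tau> * (Cb * N w)"
        and F = "\<lambda>v. h w v + \<tau> * F v"])
    show "\<tau> * \<alpha> * (N v)^2 \<le> s v v" if "v \<in> V" for v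
    proof -
      have "\<tau> * (\<alpha> * (N v)^2) \<le> \<tau> * a v v" using coercive[OF that] \<tau> by (intro mult_left_mono) auto
      then show ?thesis using nonneg[OF in_H[OF that]] by (simp add: s_def mult.assoc)
    qed
    show "\<bar>s x y\<bar> \<le> (1 + \<tau> * Ca) * N x * N y" if "x \<in> V" "y \<in> V" for x y
    proof -
      have "\<bar>\<tau> * a x y\<bar> \<le> \<tau> * (Ca * N x * N y)" using a_bound[OF that] \<tau> by (simp add: abs_mult)
      then show ?thesis using h_bound[OF that] by (simp add: s_def algebra_simps abs_le_iff)
    qed
    show "\<bar>\<tau> * b w x y\<bar> \<le> \<tau> * (Cb * N w) * N x * N y" if "x \<in> V" "y \<in> V" for x y
      using mult_left_mono[OF b_bound'[OF w that], of \<tau>] \<tau> by (simp add: abs_mult mult_ac)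
    fix u assume "u \<in> V" "\<And>v. v \<in> V ==> s u v + \<tau> * b w u v = h w v + \<tau> * F v"
    then show thesis using that by (simp add: s_def)
  qed (use \<tau> \<alpha> Cb w G in \<open>auto simp: b_diff2 b_add3 b_scaleR3 b_alt algebra_simps\<close>)
qed

definition bounds :: "real => real => nat => (nat => 'x) => (nat => 'x) => bool" where
  "bounds R W n U d \<longleftrightarrow> (\<forall>k\<le>n. N (U k) \<le> R) \<and> T / real n * (\<Sum>k=1..n. (N (d k))^2) \<le> W"

text \<open>\<open>d k\<close> is the difference quotient at step \<open>k\<close>. The equation is
  required for \<open>k = 0\<close> as well, where \<open>k - 1\<close> is 0 and
  \<open>d 0 = 0\<close>: this is the compatibility of the force with the initial value, and it
  allows consecutive equations to be subtracted from the first step on.\<close>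

definition scheme :: "(real => 'x => real) => real => (nat => 'x) => (nat => 'x) => bool" where
  "scheme f \<tau> U d \<longleftrightarrow> (\<forall>k. U k \<in> V \<and> d k \<in> V) \<and> d 0 = 0 \<and> (\<forall>k. U (Suc k) = U k + \<tau> *\<^sub>R d (Suc k)) \<and>
     (\<forall>k. \<forall>v\<in>V. h (d k) v + a (U k) v + b (U (k - 1)) (U k) v = f (real k * \<tau>) v)"

lemma scheme_exists:
  assumes x: "x \<in> V" and f: "\<And>t. f t \<in> dual" "\<And>v. v \<in> V ==> f 0 v = a x v + b x x v" and \<tau>: "\<tau> > 0"
  obtains U d where "scheme f \<tau> U d" "U 0 = x"
proof -
  have "\<exists>u. u \<in> V \<and> (\<forall>v\<in>V. h u v + \<tau> * a u v + \<tau> * b w u v = h w v + \<tau> * F v)" if "w \<in> V" "F \<in> dual" for w F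
    using Euler_step[OF that \<tau>] by metis
  then obtain E where E: "\<And>w F. w \<in> V ==> F \<in> dual ==> E w F \<in> V"
    "\<And>w F v. w \<in> V ==> F \<in> dual ==> v \<in> V ==> h (E w F) v + \<tau> * a (E w F) v + \<tau> * b w (E w F) v = h w v + \<tau> * F v"
    by metis
  define U where "U = rec_nat x (\<lambda>k w. E w (f (real (Suc k) * \<tau>)))"
  have U: "U 0 = x" "\<And>k. U (Suc k) = E (U k) (f (real (Suc k) * \<tau>))" by (simp_all add: U_def)
  have UV: "U k \<in> V" for k
  proof (induction k)
    case (Suc k)
    then show ?case unfolding U(2) using f(1) by (rule E(1))
  qed (simp add: U x)
  define d where "d k = (if k = 0 then 0 else (1/\<tau>) *\<^sub>R (U k - U (k - 1)))" for k
  have dV: "d k \<in> V" for k using UV by (auto simp: d_def)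
  have "h (d k) v + a (U k) v + b (U (k - 1)) (U k) v = f (real k * \<tau>) v" if v: "v \<in> V" for k v
  proof (cases k)
    case 0
    then show ?thesis using f(2)[OF v] scaleR_left[of 0 v 0] v by (simp add: d_def U H_mem)
  next
    case (Suc j)
    have "h (U k) v + \<tau> * a (U k) v + \<tau> * b (U j) (U k) v = h (U j) v + \<tau> * f (real k * \<tau>) v"
      unfolding Suc U(2) using UV f(1) v by (rule E(2))
    then have "(1/\<tau>) * (h (U k) v - h (U j) v) + a (U k) v + b (U j) (U k) v = f (real k * \<tau>) v"
      using \<tau> by (simp add: field_simps)
    then show ?thesis using Suc UV v by (simp add: d_def scaleR_left diff_left diff_mem)
  qed
  moreover have "U (Suc k) = U k + \<tau> *\<^sub>R d (Suc k)" for k using \<tau> by (simp add: d_def)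
  ultimately have "scheme f \<tau> U d" using UV dV by (auto simp: scheme_def d_def)
  then show ?thesis using that U(1) by blast
qed

text \<open>Testing with the new iterate bounds the iterates in \<open>H\<close>, and in
  \<open>V\<close> on average over time. Testing the difference of two consecutive equations with
  the new quotient bounds the quotients in \<open>H\<close>, and in \<open>V\<close> on average; the
  growth rate in this second estimate is summable by the first one. Finally the equation itself,
  with its quotient now bounded in \<open>H\<close>, bounds each iterate in
  \<open>V\<close>.\<close>

lemma scheme_bounds:
  assumes x: "x \<in> V" and f: "D.lip_curve \<Lambda> f"
  obtains R W where "R \<ge> 0" "W \<ge> 0" "\<And>n U d. n > 0 ==> scheme f (T / real n) U d ==> U 0 = x ==> bounds R W n U d"
proof -
  have fD: "\<And>t. f t \<in> dual" and fl: "\<And>s t. dnorm (f s - f t) \<le> \<Lambda> * \<bar>s - t\<bar>" and \<Lambda>: "\<Lambda> \<ge> 0"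
    using f by (auto simp: D.lip_curve_def)
  define \<Phi> where "\<Phi> = dnorm (f 0) + \<Lambda> * T"
  have f\<Phi>: "dnorm (f t) \<le> \<Phi>" if "0 \<le> t" "t \<le> T" for t
  proof -
    have "\<Lambda> * \<bar>t - 0\<bar> \<le> \<Lambda> * T" using that \<Lambda> by (intro mult_left_mono) auto
    then show ?thesis using D.N_le[OF fD fD, of t 0] fl[of t 0] by (simp add: \<Phi>_def)
  qed
  have \<Phi>: "\<Phi> \<ge> 0" using f\<Phi>[of 0] T dnorm_nonneg[OF fD, of 0] by simp
  \<comment> \<open>\<open>M1\<close> and \<open>M2\<close> come from the first energy estimate;
    \<open>M2\<close> also contains the initial term, with \<open>\<tau> \<le> T\<close>.
    \<open>C3\<close> comes from the convective term of the differenced equation, \<open>Z\<close>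
    from the discrete Gronwall lemma. None of them depends on the number of steps.\<close>
  define M1 where "M1 = h x x + T * \<Phi>^2 / \<alpha>"
  have M1: "M1 \<ge> 0" unfolding M1_def using nonneg[OF in_H[OF x]] T \<alpha> by simp
  define M2 where "M2 = T * (N x)^2 + M1 / \<alpha>"
  have M2: "M2 \<ge> 0" unfolding M2_def using T \<alpha> M1 by simp
  define C3 where "C3 = 4 * Cb^4 / \<alpha>^3 * M1"
  have C3: "C3 \<ge> 0" unfolding C3_def using M1 \<alpha> Cb by simp
  define Z where "Z = exp (C3 * M2) * (2 * T * \<Lambda>^2 / \<alpha>)"
  have Z: "Z \<ge> 0" unfolding Z_def using T \<alpha> by simp
  define W where "W = 4 / (3 * \<alpha>) * (C3 * M2 * Z + 2 * T * \<Lambda>^2 / \<alpha>)"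
  have W: "W \<ge> 0" unfolding W_def using C3 M2 Z T \<alpha> by simp
  define R where "R = (\<Phi> + sqrt Z) / \<alpha>"
  have R: "R \<ge> 0" unfolding R_def using \<Phi> Z \<alpha> by simp
  have "bounds R W n U d" if n: "n > 0" and sch: "scheme f (T / real n) U d" and U0: "U 0 = x" for n U d
  proof -
    define \<tau> where "\<tau> = T / real n"
    have \<tau>: "\<tau> > 0" "real n * \<tau> = T" using n T by (auto simp: \<tau>_def)
    have UV: "\<And>k. U k \<in> V" and dV: "\<And>k. d k \<in> V" and d0: "d 0 = 0" and US: "\<And>k. U (Suc k) = U k + \<tau> *\<^sub>R d (Suc k)"
      and eq: "\<And>k v. v \<in> V ==> h (d k) v + a (U k) v + b (U (k - 1)) (U k) v = f (real k * \<tau>) v"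
      using sch by (auto simp: scheme_def \<tau>_def)
    have kT: "0 \<le> real k * \<tau>" "real k * \<tau> \<le> T" if "k \<le> n" for k
      using \<tau> that mult_right_mono[of "real k" "real n" \<tau>] by auto
    have e1: "h (U (Suc k)) (U (Suc k)) + \<alpha> * (\<tau> * (N (U (Suc k)))^2) \<le> h (U k) (U k) + \<tau> * \<Phi>^2 / \<alpha>" if k: "k < n" for k
    proof -
      let ?u = "U (Suc k)" and ?w = "U k"
      have "h (d (Suc k)) ?u + a ?u ?u = f (real (Suc k) * \<tau>) ?u"
        using eq[OF UV, of "Suc k" "Suc k"] b_alt[OF UV UV, of k "Suc k"] by simp
      then have "\<tau> * h (d (Suc k)) ?u + \<tau> * a ?u ?u = \<tau> * f (real (Suc k) * \<tau>) ?u"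
        by (simp flip: distrib_left)
      moreover have "\<tau> * h (d (Suc k)) ?u = h (?u - ?w) ?u"
      proof -
        have "?u - ?w = \<tau> *\<^sub>R d (Suc k)" by (simp add: US)
        then show ?thesis using scaleR_left[OF in_H[OF dV] in_H[OF UV], of \<tau> "Suc k" "Suc k"] by (simp only:)
      qed
      moreover have "2 * h (?u - ?w) ?u \<ge> h ?u ?u - h ?w ?w"
        using nonneg[OF in_H[OF diff_mem[OF UV UV]], of "Suc k" k] UV sym[of ?u ?w]
        by (simp add: h_expand_diff diff_left)
      moreover have "\<tau> * (\<alpha> * (N ?u)^2) \<le> \<tau> * a ?u ?u" using coercive[OF UV] \<tau> by (intro mult_left_mono) auto
      moreover have "2 * (\<tau> * f (real (Suc k) * \<tau>) ?u) \<le> \<alpha> * (\<tau> * (N ?u)^2) + \<tau> * \<Phi>^2 / \<alpha>"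
      proof -
        have "f (real (Suc k) * \<tau>) ?u \<le> dnorm (f (real (Suc k) * \<tau>)) * N ?u" using dual_bound[OF fD UV] by (simp add: abs_le_iff)
        also have "\<dots> \<le> \<Phi> * N ?u"
          using f\<Phi>[OF kT, of "Suc k"] k UV by (intro mult_right_mono) (auto simp del: of_nat_Suc)
        also have "\<dots> \<le> \<alpha>/2 * (N ?u)^2 + \<Phi>^2 / (2*\<alpha>)" using young[OF \<alpha>, of "N ?u" \<Phi>] by (simp add: mult.commute)
        finally have "2 * \<tau> * f (real (Suc k) * \<tau>) ?u \<le> 2 * \<tau> * (\<alpha>/2 * (N ?u)^2 + \<Phi>^2 / (2*\<alpha>))"
          using \<tau> by (intro mult_left_mono) auto
        then show ?thesis by (simp add: algebra_simps)
      qed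
      ultimately show ?thesis by (simp add: mult_ac)
    qed
    have E1: "h (U k) (U k) + \<alpha> * (\<Sum>j=1..k. \<tau> * (N (U j))^2) \<le> h x x + real k * \<tau> * \<Phi>^2 / \<alpha>" if "k \<le> n" for k
      using that
    proof (induction k)
      case (Suc k)
      then show ?case using e1[of k] by (simp add: algebra_simps add_divide_distrib)
    qed (simp add: U0)
    have E1': "h (U k) (U k) + \<alpha> * (\<Sum>j=1..k. \<tau> * (N (U j))^2) \<le> M1" if "k \<le> n" for k
    proof -
      have "real k * \<tau> * \<Phi>^2 / \<alpha> \<le> T * \<Phi>^2 / \<alpha>" using kT[OF that] \<alpha> by (intro divide_right_mono mult_right_mono) auto
      then show ?thesis using E1[OF that] by (simp add: M1_def)
    qed
    have hU: "(hnorm (U k))^2 \<le> M1" if "k \<le> n" for k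
    proof -
      have "0 \<le> \<alpha> * (\<Sum>j=1..k. \<tau> * (N (U j))^2)" using \<tau> \<alpha> by (intro mult_nonneg_nonneg sum_nonneg) auto
      then show ?thesis using E1'[OF that] hnorm_square[OF in_H[OF UV]] by simp
    qed
    have sumU: "(\<Sum>j<k. \<tau> * (N (U j))^2) \<le> M2" if "k \<le> n" for k
    proof -
      have "(\<Sum>j<k. \<tau> * (N (U j))^2) \<le> (\<Sum>j\<in>{0..k}. \<tau> * (N (U j))^2)"
        using \<tau> by (intro sum_mono2) auto
      also have "\<dots> = \<tau> * (N x)^2 + (\<Sum>j=1..k. \<tau> * (N (U j))^2)"
        using sum.atLeast_Suc_atMost[of 0 k "\<lambda>j. \<tau> * (N (U j))^2"] by (simp add: U0)
      also have "\<dots> \<le> T * (N x)^2 + M1 / \<alpha>"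
      proof (intro add_mono mult_right_mono)
        show "\<tau> \<le> T" using kT[of 1] n by simp
        have "\<alpha> * (\<Sum>j=1..k. \<tau> * (N (U j))^2) \<le> M1" using E1'[OF that] nonneg[OF in_H[OF UV], of k] by simp
        then show "(\<Sum>j=1..k. \<tau> * (N (U j))^2) \<le> M1 / \<alpha>" using \<alpha> by (simp add: field_simps)
      qed auto
      finally show ?thesis by (simp add: M2_def)
    qed
    \<comment> \<open>Besides the square in \<open>H\<close>, \<open>z\<close> stores a quarter of
      the dissipation of its step. It absorbs the strong norm of the old quotient, which enters the
      next step because the transporting field has changed by \<open>\<tau>\<close> times that
      quotient. Three quarters remain for the sum that leads to \<open>W\<close>.\<close>
    define z where "z k = h (d k) (d k) + \<alpha> * \<tau> / 4 * (N (d k))^2" for k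
    have z0: "0 \<le> z k" for k unfolding z_def using nonneg[OF in_H[OF dV]] \<alpha> \<tau> by simp
    have e2: "z (Suc k) + 3 / 4 * \<alpha> * (\<tau> * (N (d (Suc k)))^2) \<le> (1 + C3 * (\<tau> * (N (U k))^2)) * z k + 2 * \<tau> * \<Lambda>^2 / \<alpha>" if k: "k < n" for k
    proof -
      let ?d = "d (Suc k)" and ?e = "d k" and ?u = "U k"
      have Udiff: "U k - U (k - 1) = \<tau> *\<^sub>R d k" using US[of "k - 1"] d0 by (cases k) auto
      have UVd: "U (Suc k) \<in> V" "U k \<in> V" "U (k - 1) \<in> V" "?d \<in> V" "?e \<in> V" using UV dV by auto
      \<comment> \<open>The transported field changes by \<open>\<tau>\<close> times
        \<open>?d\<close>, which contributes nothing because \<open>b ?u ?d ?d = 0\<close>. Only the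
        change of the transporting field survives, as \<open>\<tau> * b ?e ?u ?d\<close>.\<close>
      have 1: "h (?d - ?e) ?d + \<tau> * a ?d ?d + \<tau> * b ?e ?u ?d = (f (real (Suc k) * \<tau>) - f (real k * \<tau>)) ?d"
      proof -
        have "h ?d ?d + a (U (Suc k)) ?d + b ?u (U (Suc k)) ?d - (h ?e ?d + a ?u ?d + b (U (k - 1)) ?u ?d) =
           (f (real (Suc k) * \<tau>) - f (real k * \<tau>)) ?d"
          using eq[OF dV, of "Suc k" "Suc k"] eq[OF dV, of k "Suc k"] by simp
        moreover have "a (U (Suc k)) ?d = a ?u ?d + \<tau> * a ?d ?d"
          using UVd by (simp add: US A.add_left A.scaleR_left scaleR_mem)
        moreover have "b ?u (U (Suc k)) ?d = b ?u ?u ?d"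
          using UVd by (simp add: US b_add2 b_scaleR2 scaleR_mem b_alt)
        moreover have "b ?u ?u ?d - b (U (k - 1)) ?u ?d = \<tau> * b ?e ?u ?d"
          using b_diff1[OF UVd(2,3) UVd(2,4)] b_scaleR1[OF UVd(5,2,4), of \<tau>] unfolding Udiff by simp
        moreover have "h (?d - ?e) ?d = h ?d ?d - h ?e ?d" using UVd by (simp add: diff_left)
        ultimately show ?thesis by linarith
      qed
      have 2: "2 * h (?d - ?e) ?d \<ge> h ?d ?d - h ?e ?e"
        using nonneg[OF in_H[OF diff_mem[OF UVd(4,5)]]] UVd sym[of ?d ?e]
        by (simp add: h_expand_diff diff_left)
      have 3: "\<tau> * (\<alpha> * (N ?d)^2) \<le> \<tau> * a ?d ?d" using coercive[OF dV] \<tau> by (intro mult_left_mono) auto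
      have 4: "(f (real (Suc k) * \<tau>) - f (real k * \<tau>)) ?d \<le> \<tau> * (\<alpha>/4 * (N ?d)^2 + \<Lambda>^2 / \<alpha>)"
      proof -
        have "(f (real (Suc k) * \<tau>) - f (real k * \<tau>)) ?d \<le> dnorm (f (real (Suc k) * \<tau>) - f (real k * \<tau>)) * N ?d"
          using dual_bound[OF D.diff_mem[OF fD fD] dV] by (simp add: abs_le_iff)
        also have "\<dots> \<le> \<Lambda> * \<tau> * N ?d"
          using fl[of "real (Suc k) * \<tau>" "real k * \<tau>"] \<tau> dV by (intro mult_right_mono) (auto simp: algebra_simps)
        also have "\<dots> = \<tau> * (N ?d * \<Lambda>)" by simp
        also have "\<dots> \<le> \<tau> * (\<alpha>/4 * (N ?d)^2 + \<Lambda>^2 / \<alpha>)"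
          using young[of "\<alpha>/2" "N ?d" \<Lambda>] \<alpha> \<tau> by (intro mult_left_mono) auto
        finally show ?thesis .
      qed
      \<comment> \<open>After \<open>?d\<close> and \<open>?u\<close> have been exchanged, the
        square roots fall on \<open>?e\<close> and \<open>?u\<close>. Young's inequality is applied
        twice, first to split off the strong norm of \<open>?d\<close>, then that of
        \<open>?e\<close>. There remains \<open>h ?e ?e\<close> times the square of the strong norm
        of \<open>?u\<close>, which is summable in time.\<close>
      have 5: "- b ?e ?u ?d \<le> \<alpha>/4 * (N ?d)^2 + \<alpha>/8 * (N ?e)^2 + C3/2 * (N ?u)^2 * h ?e ?e"
      proof -
        define p where "p = sqrt (hnorm ?e * N ?e)"
        define q where "q = sqrt (hnorm ?u * N ?u)"
        have p2: "p^2 = hnorm ?e * N ?e" and q2: "q^2 = hnorm ?u * N ?u" using UVd by (auto simp: p_def q_def)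
        have "- b ?e ?u ?d \<le> \<bar>b ?e ?d ?u\<bar>" using b_antisym[OF UVd(5,2,4)] by simp
        also have "\<dots> \<le> N ?d * (Cb * p * q)" using b_bound[OF UVd(5,4,2)] by (simp add: p_def q_def mult_ac)
        also have "\<dots> \<le> \<alpha>/4 * (N ?d)^2 + (Cb * p * q)^2 / \<alpha>"
          using young[of "\<alpha>/2" "N ?d" "Cb * p * q"] \<alpha> by simp
        also have "(Cb * p * q)^2 / \<alpha> = N ?e * (Cb^2 / \<alpha> * hnorm ?e * hnorm ?u * N ?u)"
          by (simp add: power_mult_distrib p2 q2)
        also have "\<dots> \<le> \<alpha>/8 * (N ?e)^2 + 2 / \<alpha> * (Cb^2 / \<alpha> * hnorm ?e * hnorm ?u * N ?u)^2"
          using young[of "\<alpha>/4" "N ?e" "Cb^2 / \<alpha> * hnorm ?e * hnorm ?u * N ?u"] \<alpha> by simp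
        also have "2 / \<alpha> * (Cb^2 / \<alpha> * hnorm ?e * hnorm ?u * N ?u)^2 = 2 * Cb^4 / \<alpha>^3 * (hnorm ?u)^2 * ((N ?u)^2 * h ?e ?e)"
          unfolding hnorm_square[OF in_H[OF UVd(5)], symmetric]
          by (simp add: power_mult_distrib power_divide power2_eq_square power3_eq_cube power4_eq_xxxx mult_ac)
        also have "\<dots> \<le> 2 * Cb^4 / \<alpha>^3 * M1 * ((N ?u)^2 * h ?e ?e)"
          using hU[of k] k nonneg[OF in_H[OF UVd(5)]] Cb \<alpha> by (intro mult_right_mono mult_left_mono) auto
        also have "\<dots> = C3/2 * (N ?u)^2 * h ?e ?e" by (simp add: C3_def)
        finally show ?thesis by simp
      qed
      have 6: "- \<tau> * b ?e ?u ?d \<le> \<tau> * (\<alpha>/4 * (N ?d)^2 + \<alpha>/8 * (N ?e)^2 + C3/2 * (N ?u)^2 * h ?e ?e)"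
        using mult_left_mono[OF 5, of \<tau>] \<tau> by simp
      have "h ?d ?d + \<tau> * \<alpha> * (N ?d)^2 \<le> h ?e ?e + \<alpha> * \<tau> / 4 * (N ?e)^2 + C3 * (\<tau> * (N ?u)^2) * h ?e ?e + 2 * \<tau> * \<Lambda>^2 / \<alpha>"
        using 1 2 3 4 6 by (simp add: algebra_simps)
      also have "\<dots> \<le> (1 + C3 * (\<tau> * (N ?u)^2)) * z k + 2 * \<tau> * \<Lambda>^2 / \<alpha>"
      proof -
        have "C3 * (\<tau> * (N ?u)^2) * h ?e ?e \<le> C3 * (\<tau> * (N ?u)^2) * z k"
          using C3 \<tau> \<alpha> by (intro mult_left_mono) (auto simp: z_def)
        then show ?thesis by (simp add: z_def algebra_simps)
      qed
      finally show ?thesis by (simp add: z_def algebra_simps)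
    qed
    have zZ: "z k \<le> Z" if k: "k \<le> n" for k
    proof -
      have "z k \<le> exp (\<Sum>j<k. C3 * (\<tau> * (N (U j))^2)) * (real k * (2 * \<tau> * \<Lambda>^2 / \<alpha>))"
      proof (rule discrete_Gronwall[OF _ _ _ _ k])
        show "z 0 \<le> 0" using scaleR_left[of 0 0 0] by (simp add: z_def d0 H_mem)
        fix k assume "k < n"
        then show "z (Suc k) \<le> (1 + C3 * (\<tau> * (N (U k))^2)) * z k + 2 * \<tau> * \<Lambda>^2 / \<alpha>"
        proof -
          have "0 \<le> 3 / 4 * \<alpha> * (\<tau> * (N (d (Suc k)))^2)" using \<alpha> \<tau> by (intro mult_nonneg_nonneg) auto
          then show ?thesis using e2[OF \<open>k < n\<close>] by linarith
        qed
      qed (use C3 \<tau> \<alpha> in auto)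
      also have "\<dots> = exp (C3 * (\<Sum>j<k. \<tau> * (N (U j))^2)) * (2 * (real k * \<tau>) * \<Lambda>^2 / \<alpha>)"
        by (simp add: sum_distrib_left)
      also have "\<dots> \<le> exp (C3 * M2) * (2 * T * \<Lambda>^2 / \<alpha>)"
        using sumU[OF k] kT[OF k] C3 \<alpha> by (intro mult_mono divide_right_mono mult_right_mono) (auto intro!: mult_left_mono)
      finally show ?thesis by (simp add: Z_def)
    qed
    have sumd: "z k + 3 / 4 * \<alpha> * (\<Sum>j=1..k. \<tau> * (N (d j))^2) \<le> C3 * Z * (\<Sum>j<k. \<tau> * (N (U j))^2) + real k * (2 * \<tau> * \<Lambda>^2 / \<alpha>)"
      if "k \<le> n" for k
      using that
    proof (induction k)
      case 0
      show ?case using scaleR_left[of 0 0 0] by (simp add: z_def d0 H_mem)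
    next
      case (Suc k)
      have "C3 * (\<tau> * (N (U k))^2) * z k \<le> C3 * (\<tau> * (N (U k))^2) * Z"
        using zZ[of k] Suc C3 \<tau> by (intro mult_left_mono) auto
      from sumd_arith[OF Suc.IH e2 this]
      show ?case using Suc.prems by (simp add: add.commute)
    qed
    have "\<tau> * (\<Sum>k=1..n. (N (d k))^2) \<le> W"
    proof -
      have "3 / 4 * \<alpha> * (\<Sum>j=1..n. \<tau> * (N (d j))^2) \<le> C3 * Z * (\<Sum>j<n. \<tau> * (N (U j))^2) + real n * (2 * \<tau> * \<Lambda>^2 / \<alpha>)"
        using sumd[of n] z0[of n] by simp
      also have "\<dots> \<le> C3 * Z * M2 + 2 * T * \<Lambda>^2 / \<alpha>"
      proof (intro add_mono mult_left_mono)
        have "real n * (2 * \<tau> * \<Lambda>^2 / \<alpha>) = 2 * (real n * \<tau>) * \<Lambda>^2 / \<alpha>" by simp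
        also have "\<dots> = 2 * T * \<Lambda>^2 / \<alpha>" unfolding \<tau>(2) ..
        finally show "real n * (2 * \<tau> * \<Lambda>^2 / \<alpha>) \<le> 2 * T * \<Lambda>^2 / \<alpha>" by (rule eq_refl)
      qed (use sumU C3 Z in auto)
      finally have le: "3 / 4 * \<alpha> * (\<Sum>j=1..n. \<tau> * (N (d j))^2) \<le> C3 * Z * M2 + 2 * T * \<Lambda>^2 / \<alpha>" .
      have "Q \<le> 4 / (3 * \<alpha>) * Y" if "3 / 4 * \<alpha> * Q \<le> Y" for Q Y using that \<alpha> by (simp add: field_simps)
      from this[OF le] show ?thesis by (simp add: W_def sum_distrib_left mult_ac)
    qed
    \<comment> \<open>Coercivity and the equation tested with \<open>U k\<close> give an inequality
      in which both sides carry a factor \<open>N (U k)\<close>; it is cancelled, unless it is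
      0.\<close>
    moreover have "N (U k) \<le> R" if k: "k \<le> n" for k
    proof (cases "N (U k) = 0")
      case False
      then have p: "N (U k) > 0" using N_nonneg[OF UV] by (simp add: less_le)
      have "0 \<le> \<alpha> * \<tau> / 4 * (N (d k))^2" using \<alpha> \<tau> by simp
      then have "(hnorm (d k))^2 \<le> Z" using zZ[OF k] hnorm_square[OF in_H[OF dV]] by (simp add: z_def)
      then have hd: "hnorm (d k) \<le> sqrt Z" by (rule real_le_rsqrt)
      have "\<alpha> * (N (U k))^2 \<le> a (U k) (U k)" by (rule coercive[OF UV])
      also have "\<dots> = f (real k * \<tau>) (U k) - h (d k) (U k)" using eq[OF UV, of k k] b_alt[OF UV UV, of "k - 1" k] by simp
      also have "\<dots> \<le> \<Phi> * N (U k) + sqrt Z * N (U k)"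
      proof -
        have "f (real k * \<tau>) (U k) \<le> dnorm (f (real k * \<tau>)) * N (U k)" using dual_bound[OF fD UV] by (simp add: abs_le_iff)
        also have "\<dots> \<le> \<Phi> * N (U k)" using f\<Phi>[OF kT[OF k]] p by (intro mult_right_mono) auto
        finally have "f (real k * \<tau>) (U k) \<le> \<Phi> * N (U k)" .
        moreover have "- h (d k) (U k) \<le> hnorm (d k) * hnorm (U k)" using Cauchy_Schwarz[of "d k" "U k"] dV UV by (simp add: abs_le_iff)
        moreover have "hnorm (d k) * hnorm (U k) \<le> sqrt Z * N (U k)"
          using hd hnorm_le[OF UV] Z UV by (intro mult_mono) auto
        ultimately show ?thesis by linarith
      qed
      finally have "(\<alpha> * N (U k)) * N (U k) \<le> (\<Phi> + sqrt Z) * N (U k)" by (simp add: power2_eq_square algebra_simps)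
      then have "\<alpha> * N (U k) \<le> \<Phi> + sqrt Z" using p by simp
      then show ?thesis using \<alpha> by (simp add: R_def field_simps)
    qed (use R in simp)
    ultimately show ?thesis by (simp add: bounds_def \<tau>_def)
  qed
  then show ?thesis using that R W by blast
qed

end

section \<open>The interpolant of the scheme\<close>

definition ramp :: "real => nat => real => real" where
  "ramp \<tau> j t = min \<tau> (max 0 (t - real j * \<tau>))"

text \<open>Open on the left and closed on the right, so that every positive time lies in exactly
  one cell, found by rounding \<open>t / \<tau>\<close> up.\<close>

definition cell :: "real => nat => real set" where
  "cell \<tau> j = {real j * \<tau> <.. real (Suc j) * \<tau>}"

lemma cell_integral:
  assumes "\<tau> > 0" "0 \<le> t"
  shows "integral {0..t} (indicator (cell \<tau> j)) = ramp \<tau> j t"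
    and "integrable (lebesgue_on {0<..<t}) (indicator (cell \<tau> j) :: real => real)"
proof -
  have m: "cell \<tau> j \<in> sets lebesgue" by (simp add: cell_def)
  have i: "integrable (lebesgue_on {0<..<t}) (indicator (cell \<tau> j) :: real => real)" for t
  proof (rule finite_measure.integrable_const_bound[where B = 1])
    show "finite_measure (lebesgue_on {0<..<t})" by (rule finite_measure_lebesgue_on) simp
    show "(indicator (cell \<tau> j) :: real => real) \<in> borel_measurable (lebesgue_on {0<..<t})"
      using m by (intro measurable_restrict_space1 borel_measurable_indicator)
  qed (simp add: indicator_def)
  show "integrable (lebesgue_on {0<..<t}) (indicator (cell \<tau> j) :: real => real)" by (rule i)
  define p where "p = real j * \<tau>"
  have p: "0 \<le> p" "cell \<tau> j = {p<..p + \<tau>}" using assms by (auto simp: p_def cell_def algebra_simps)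
  have "measure lebesgue (cell \<tau> j \<inter> {0<..<t}) = ramp \<tau> j t"
  proof -
    consider "t \<le> p" | "p < t" "t \<le> p + \<tau>" | "p + \<tau> < t" by linarith
    then show ?thesis
    proof cases
      case 1
      then have "cell \<tau> j \<inter> {0<..<t} = {}" by (auto simp: p(2))
      then show ?thesis using 1 assms by (simp add: ramp_def p_def)
    next
      case 2
      then have "cell \<tau> j \<inter> {0<..<t} = {p<..<t}" using p(1) by (auto simp: p(2))
      then show ?thesis using 2 by (simp add: ramp_def p_def[symmetric])
    next
      case 3
      then have "cell \<tau> j \<inter> {0<..<t} = {p<..p + \<tau>}" using p(1) by (auto simp: p(2))
      then show ?thesis using 3 assms by (simp add: ramp_def p_def[symmetric])
    qed
  qed
  moreover have "integral\<^sup>L (lebesgue_on {0<..<t}) (indicator (cell \<tau> j) :: real => real) = measure lebesgue (cell \<tau> j \<inter> {0<..<t})"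
    using m by (simp add: measure_restrict_space)
  ultimately show "integral {0..t} (indicator (cell \<tau> j)) = ramp \<tau> j t"
    using integral_lebesgue_on_Ioo[OF i, of t] by simp
qed

lemma cell_unique:
  assumes "\<tau> > 0" "t \<in> cell \<tau> k" shows "t \<in> cell \<tau> j \<longleftrightarrow> j = k"
proof
  assume j: "t \<in> cell \<tau> j"
  have 1: "real j * \<tau> < real (Suc k) * \<tau>" and 2: "real k * \<tau> < real (Suc j) * \<tau>"
    using j assms(2) unfolding cell_def greaterThanAtMost_iff by (metis le_less_trans less_le_trans)+
  have "real j < real (Suc k)" "real k < real (Suc j)"
    using 1 2 assms(1) by (simp_all only: mult_less_cancel_right_pos)
  then show "j = k" by linarith
qed (use assms in simp)

lemma cell_exists:
  assumes "\<tau> > 0" "0 < t" "t < real n * \<tau>"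
  obtains k where "k < n" "t \<in> cell \<tau> k"
proof -
  define k where "k = nat \<lceil>t / \<tau>\<rceil> - 1"
  have p: "0 < t / \<tau>" "t / \<tau> < real n" using assms by (auto simp: field_simps)
  then have c: "1 \<le> \<lceil>t / \<tau>\<rceil>" "\<lceil>t / \<tau>\<rceil> \<le> int n" by linarith+
  then have kc: "real (Suc k) = of_int \<lceil>t / \<tau>\<rceil>" by (simp add: k_def of_nat_diff nat_le_eq_zle le_nat_iff)
  have "real k < t / \<tau>" "t / \<tau> \<le> real (Suc k)" using kc ceiling_correct[of "t / \<tau>"] by auto
  then have "t \<in> cell \<tau> k" using assms(1) by (auto simp: cell_def field_simps)
  moreover have "k < n" using c unfolding k_def by linarith
  ultimately show ?thesis using that by blast
qed

context navier_stokes begin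

lemma sum_cell:
  assumes "\<tau> > 0" "t \<in> cell \<tau> k" "k < n"
  shows "(\<Sum>j<n. indicator (cell \<tau> j) t *\<^sub>R (y j :: 'b::real_vector)) = y k"
proof -
  have "(\<Sum>j<n. indicator (cell \<tau> j) t *\<^sub>R y j) = (\<Sum>j<n. if j = k then y j else 0)"
    using cell_unique[OF assms(1,2)] by (intro sum.cong) auto
  then show ?thesis using assms(3) by simp
qed

text \<open>The interpolant has the primitive of a step function as its time part, and
  \<open>g\<close> is defined so that it solves the equation exactly. The content is the estimate of
  \<open>g - f\<close>: on each cell the equation of the scheme at the right node is subtracted, and
  all remaining terms are of order \<open>\<tau>\<close>, with the quotient of the cell as a factor.
  Square integrability of the quotients makes the total of order \<open>\<tau>^2\<close>.\<close>

lemma interpolant: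
  assumes n: "n > 0" and sch: "scheme f (T / real n) U d" and U0: "U 0 = x" and bd: "bounds R W n U d"
    and f: "D.lip_curve \<Lambda> f" "f \<in> D.L2"
  obtains u g where "solves u x g" "g \<in> D.L2"
    "(\<integral>t. (dnorm (g t - f t))^2 \<partial>M) \<le> (T / real n)^2 * (2 * \<Lambda>^2 * T + 2 * (Ca + 2 * Cb * R)^2 * W)"
proof -
  define \<tau> where "\<tau> = T / real n"
  have \<tau>: "\<tau> > 0" "real n * \<tau> = T" using n T by (auto simp: \<tau>_def)
  have UV: "\<And>k. U k \<in> V" and dV: "\<And>k. d k \<in> V" and US: "\<And>k. U (Suc k) = U k + \<tau> *\<^sub>R d (Suc k)"
    and eq: "\<And>k v. v \<in> V ==> h (d k) v + a (U k) v + b (U (k - 1)) (U k) v = f (real k * \<tau>) v"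
    using sch by (auto simp: scheme_def \<tau>_def)
  have UR: "\<And>k. k \<le> n ==> N (U k) \<le> R" and W: "\<tau> * (\<Sum>k=1..n. (N (d k))^2) \<le> W" using bd by (auto simp: bounds_def \<tau>_def)
  have R: "R \<ge> 0" using UR[of 0] N_nonneg[OF UV, of 0] by simp
  have xV: "x \<in> V" using UV[of 0] U0 by simp
  have fD: "\<And>t. f t \<in> dual" and fl: "\<And>s t. dnorm (f s - f t) \<le> \<Lambda> * \<bar>s - t\<bar>" and \<Lambda>: "\<Lambda> \<ge> 0"
    using f by (auto simp: D.lip_curve_def)
  define hd where "hd j = (\<lambda>v. h (d (Suc j)) v)" for j
  have hdD: "hd j \<in> dual" for j
    by (rule dual_I[where C = "N (d (Suc j))"]) (use dV h_bound in \<open>auto simp: hd_def add_right scaleR_right\<close>)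
  define u where "u t = x + (\<Sum>j<n. ramp \<tau> j t *\<^sub>R d (Suc j))" for t
  define F where "F t = (\<Sum>j<n. indicator (cell \<tau> j) t *\<^sub>R hd j)" for t
  define g where "g t = F t + A_op (u t) + B_op (u t) (u t)" for t
  have ucell: "u t = U k + (t - real k * \<tau>) *\<^sub>R d (Suc k)" if k: "t \<in> cell \<tau> k" "k < n" for t k
  proof -
    have ramp: "ramp \<tau> j t = (if j < k then \<tau> else if j = k then t - real k * \<tau> else 0)" for j
    proof -
      have t: "real k * \<tau> < t" "t \<le> real k * \<tau> + \<tau>" using k by (auto simp: cell_def algebra_simps)
      show ?thesis
      proof (cases j k rule: linorder_cases)
        case less
        then have "real (Suc j) * \<tau> \<le> real k * \<tau>" using \<tau> by (intro mult_right_mono) auto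
        then show ?thesis using less t \<tau> by (auto simp: ramp_def algebra_simps)
      next
        case greater
        then have "real (Suc k) * \<tau> \<le> real j * \<tau>" using \<tau> by (intro mult_right_mono) auto
        then show ?thesis using greater t \<tau> by (auto simp: ramp_def algebra_simps)
      qed (use t in \<open>auto simp: ramp_def\<close>)
    qed
    have tel: "x + (\<Sum>j<k. \<tau> *\<^sub>R d (Suc j)) = U k" for k
      by (induction k) (auto simp: U0 US add.assoc[symmetric])
    have "(\<Sum>j<n. ramp \<tau> j t *\<^sub>R d (Suc j)) = (\<Sum>j<Suc k. ramp \<tau> j t *\<^sub>R d (Suc j))"
      using k(2) by (intro sum.mono_neutral_right) (auto simp: ramp)
    also have "\<dots> = (\<Sum>j<k. \<tau> *\<^sub>R d (Suc j)) + (t - real k * \<tau>) *\<^sub>R d (Suc k)"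
      by (auto simp: ramp)
    finally show ?thesis using tel[of k] by (simp add: u_def add.assoc[symmetric])
  qed
  have uV: "u t \<in> V" for t unfolding u_def by (intro add_mem xV sum_mem scaleR_mem dV)
  \<comment> \<open>On a cell the interpolant is a convex combination of the two adjacent nodes and
    inherits their bound.\<close>
  have uR: "N (u t) \<le> R" if k: "t \<in> cell \<tau> k" "k < n" for t k
  proof -
    define \<theta> where "\<theta> = (t - real k * \<tau>) / \<tau>"
    have \<theta>: "0 \<le> \<theta>" "\<theta> \<le> 1" using k \<tau> by (auto simp: \<theta>_def cell_def field_simps)
    have 1: "U (Suc k) - U k = \<tau> *\<^sub>R d (Suc k)" by (simp add: US)
    have 2: "t - real k * \<tau> = \<theta> * \<tau>" using \<tau> by (simp add: \<theta>_def)
    have "u t = U k + \<theta> *\<^sub>R (U (Suc k) - U k)" unfolding 1 ucell[OF k] 2 by simp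
    also have "\<dots> = (1 - \<theta>) *\<^sub>R U k + \<theta> *\<^sub>R U (Suc k)" by (simp add: algebra_simps)
    finally have "u t = (1 - \<theta>) *\<^sub>R U k + \<theta> *\<^sub>R U (Suc k)" .
    then have "N (u t) \<le> (1 - \<theta>) * N (U k) + \<theta> * N (U (Suc k))"
      using triangle[of "(1 - \<theta>) *\<^sub>R U k" "\<theta> *\<^sub>R U (Suc k)"] UV \<theta> by (simp add: homogeneous scaleR_mem)
    also have "\<dots> \<le> (1 - \<theta>) * R + \<theta> * R" using UR k \<theta> by (intro add_mono mult_left_mono) auto
    finally show ?thesis by (simp add: algebra_simps)
  qed
  have cellT: "\<exists>k<n. t \<in> cell \<tau> k" if "t \<in> space M" for t
    using cell_exists[OF \<tau>(1), of t n] that \<tau>(2) by auto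
  have u_bd: "AE t in M. N (u t) \<le> R" by (rule AE_I2) (use cellT uR in blast)
  have rampM: "ramp \<tau> j \<in> borel_measurable M" for j
  proof (rule continuous_imp_measurable_on_sets_lebesgue)
    show "continuous_on {0<..<T} (ramp \<tau> j)" unfolding ramp_def[abs_def] by (intro continuous_intros)
  qed simp
  have uSM: "SM u" unfolding u_def[abs_def]
    by (intro SM_add SM_sum SM_real rampM dV SM_simple) (auto simp: xV)
  have uL2: "u \<in> L2" by (rule L2_bounded[OF uSM u_bd])
  have uH: "AE t in M. hnorm (u t) \<le> R" using u_bd by eventually_elim (use hnorm_le[OF uV] in \<open>auto intro: order_trans\<close>)
  have cellM: "(indicator (cell \<tau> j) :: real => real) \<in> borel_measurable M" for j
    using cell_integral(2)[OF \<tau>(1), of T j] T by auto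
  have FSM: "D.SM F" unfolding F_def[abs_def] by (intro D.SM_sum D.SM_real cellM hdD)
  have FL2: "F \<in> D.L2"
  proof (rule D.L2_bounded[OF FSM])
    show "AE t in M. dnorm (F t) \<le> (\<Sum>j<n. dnorm (hd j))"
    proof (rule AE_I2)
      fix t assume "t \<in> space M"
      then obtain k where k: "k < n" "t \<in> cell \<tau> k" using cellT by blast
      have "F t = hd k" unfolding F_def by (rule sum_cell[OF \<tau>(1) k(2,1)])
      then show "dnorm (F t) \<le> (\<Sum>j<n. dnorm (hd j))" using k dnorm_nonneg[OF hdD] by (auto intro!: member_le_sum)
    qed
  qed
  have gL2: "g \<in> D.L2" unfolding g_def[abs_def] by (intro D.L2_add FL2 A_op_L2 B_op_L2[OF _ uH] uL2)
  have force: "force u g = F" by (auto simp: force_def g_def fun_eq_iff)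
  have "weakly u x F"
    unfolding weakly_def
  proof (intro ballI AE_I2)
    fix v t assume v: "v \<in> V" and "t \<in> space M"
    then have t: "0 < t" "t < T" by auto
    have i: "(\<lambda>r. indicator (cell \<tau> j) r * hd j v) integrable_on {0..t}" for j
      using integrable_Ioo_HK[OF cell_integral(2)[OF \<tau>(1)], of t 0 t j] t by (intro integrable_on_mult_left) auto
    have hsum: "h (\<Sum>j\<in>I. ramp \<tau> j t *\<^sub>R d (Suc j)) v = (\<Sum>j\<in>I. ramp \<tau> j t * hd j v)" if "finite I" for I
      using that
    proof (induction I rule: finite_induct)
      case empty then show ?case using scaleR_left[of 0 v 0] v by (simp add: H_mem)
    next
      case (insert j I)
      have "(\<Sum>j\<in>I. ramp \<tau> j t *\<^sub>R d (Suc j)) \<in> V" by (intro sum_mem scaleR_mem dV)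
      then show ?case using insert v dV by (simp add: add_left scaleR_left scaleR_mem hd_def)
    qed
    have "I0 t (\<lambda>r. F r v) = I0 t (\<lambda>r. \<Sum>j<n. indicator (cell \<tau> j) r * hd j v)" by (simp add: F_def)
    also have "\<dots> = (\<Sum>j<n. I0 t (\<lambda>r. indicator (cell \<tau> j) r * hd j v))" using i by (intro integral_sum) auto
    also have "\<dots> = (\<Sum>j<n. ramp \<tau> j t * hd j v)" using cell_integral(1)[OF \<tau>(1), of t] t by simp
    finally have "I0 t (\<lambda>r. F r v) = (\<Sum>j<n. ramp \<tau> j t * hd j v)" .
    moreover have "h (u t) v = h x v + h (\<Sum>j<n. ramp \<tau> j t *\<^sub>R d (Suc j)) v"
      unfolding u_def using xV v dV by (intro add_left) (auto intro!: in_H sum_mem scaleR_mem)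
    ultimately show "h (u t) v = h x v + I0 t (\<lambda>r. F r v)" using hsum[of "{..<n}"] by simp
  qed
  then have sol: "solves u x g" using uL2 uH force by (auto simp: solves_def)
  define C where "C = Ca + 2 * Cb * R"
  have C: "C \<ge> 0" using Ca Cb R by (simp add: C_def)
  define y where "y t = 2 * (\<Lambda> * \<tau>)^2 + (\<Sum>j<n. indicator (cell \<tau> j) t * (2 * (C * \<tau>)^2 * (N (d (Suc j)))^2))" for t
  have iy: "integrable M y" unfolding y_def[abs_def] using cell_integral(2)[OF \<tau>(1), of T] T
    by (intro Bochner_Integration.integrable_add Bochner_Integration.integrable_sum integrable_mult_left integrable_const) auto
  have pt: "(dnorm (g t - f t))^2 \<le> y t" if tM: "t \<in> space M" for t
  proof -
    obtain k where k: "k < n" "t \<in> cell \<tau> k" using cellT[OF tM] by blast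
    define e where "e = N (d (Suc k))"
    have e: "e \<ge> 0" using dV by (simp add: e_def)
    have tk: "0 \<le> t - real k * \<tau>" "t - real k * \<tau> \<le> \<tau>" using k by (auto simp: cell_def algebra_simps)
    have 1: "N (u t - U k) \<le> \<tau> * e"
      using ucell[OF k(2,1)] homogeneous[OF dV, of "t - real k * \<tau>" "Suc k"] tk e by (simp add: e_def mult_right_mono)
    have "u t - U (Suc k) = (t - real k * \<tau> - \<tau>) *\<^sub>R d (Suc k)"
      using ucell[OF k(2,1)] by (simp add: US algebra_simps)
    then have "N (u t - U (Suc k)) = \<bar>t - real k * \<tau> - \<tau>\<bar> * e" using homogeneous[OF dV] by (simp add: e_def)
    also have "\<dots> \<le> \<tau> * e" using tk e by (intro mult_right_mono) auto
    finally have 2: "N (u t - U (Suc k)) \<le> \<tau> * e" .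
    have "dnorm (g t - f t) \<le> \<Lambda> * \<tau> + C * \<tau> * e"
    proof (rule dnorm_le)
      fix v assume v: "v \<in> V"
      have Ft: "F t v = h (d (Suc k)) v"
        using arg_cong[OF sum_cell[OF \<tau>(1) k(2,1), of hd], of "\<lambda>F. F v"] by (simp add: F_def hd_def)
      \<comment> \<open>The force is compared at the right node, the viscous term also, while the
        convective term is compared with transport by the left node, as in the semi-implicit
        step.\<close>
      have split: "(g t - f t) v = (f (real (Suc k) * \<tau>) - f t) v + (A_op (u t) - A_op (U (Suc k))) v + (B_op (u t) (u t) - B_op (U k) (U (Suc k))) v"
        using eq[OF v, of "Suc k"] Ft by (simp add: g_def A_op_def B_op_def)
      have "\<bar>(g t - f t) v\<bar> \<le> dnorm (f (real (Suc k) * \<tau>) - f t) * N v + dnorm (A_op (u t) - A_op (U (Suc k))) * N v +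
          dnorm (B_op (u t) (u t) - B_op (U k) (U (Suc k))) * N v"
        unfolding split using dual_bound[OF D.diff_mem[OF fD fD] v, of "real (Suc k) * \<tau>" t]
          dual_bound[OF D.diff_mem[OF A_op_dual[OF uV] A_op_dual[OF UV]] v, of t "Suc k"]
          dual_bound[OF D.diff_mem[OF B_op_dual[OF uV uV] B_op_dual[OF UV UV]] v, of t t k "Suc k"] by linarith
      also have "\<dots> \<le> \<Lambda> * \<tau> * N v + Ca * (\<tau> * e) * N v + (Cb * (\<tau> * e) * R + Cb * R * (\<tau> * e)) * N v"
      proof (intro add_mono mult_right_mono)
        have "\<bar>real (Suc k) * \<tau> - t\<bar> \<le> \<tau>" using tk by (simp add: algebra_simps)
        then have "\<Lambda> * \<bar>real (Suc k) * \<tau> - t\<bar> \<le> \<Lambda> * \<tau>" using \<Lambda> by (rule mult_left_mono)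
        then show "dnorm (f (real (Suc k) * \<tau>) - f t) \<le> \<Lambda> * \<tau>" using fl[of "real (Suc k) * \<tau>" t] by linarith
        show "dnorm (A_op (u t) - A_op (U (Suc k))) \<le> Ca * (\<tau> * e)"
          using dnorm_A_op_diff[OF uV UV, of t "Suc k"] mult_left_mono[OF 2 Ca] by linarith
        have "dnorm (B_op (u t) (u t) - B_op (U k) (U (Suc k))) \<le> Cb * N (u t - U k) * N (u t) + Cb * N (U k) * N (u t - U (Suc k))"
          by (rule dnorm_B_op_diff[OF uV UV uV UV])
        also have "\<dots> \<le> Cb * (\<tau> * e) * R + Cb * R * (\<tau> * e)"
          using 1 2 uR[OF k(2,1)] UR[of k] k(1) Cb R e \<tau> uV UV diff_mem by (intro add_mono mult_mono) auto
        finally show "dnorm (B_op (u t) (u t) - B_op (U k) (U (Suc k))) \<le> Cb * (\<tau> * e) * R + Cb * R * (\<tau> * e)" .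
      qed (use v in auto)
      also have "\<dots> = (\<Lambda> * \<tau> + C * \<tau> * e) * N v" by (simp add: C_def algebra_simps)
      finally show "\<bar>(g t - f t) v\<bar> \<le> (\<Lambda> * \<tau> + C * \<tau> * e) * N v" .
    qed (use \<Lambda> \<tau> C e in auto)
    moreover have "0 \<le> dnorm (g t - f t)"
      by (intro dnorm_nonneg D.diff_mem fD) (auto simp: g_def F_def intro!: D.add_mem D.sum_mem D.scaleR_mem hdD A_op_dual B_op_dual uV)
    ultimately have "(dnorm (g t - f t))^2 \<le> (\<Lambda> * \<tau> + C * \<tau> * e)^2" by (intro power_mono)
    also have "\<dots> \<le> 2 * (\<Lambda> * \<tau>)^2 + 2 * (C * \<tau>)^2 * e^2"
      using sum_squares_bound[of "\<Lambda> * \<tau>" "C * \<tau> * e"] by (simp add: power2_sum power_mult_distrib)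
    also have "\<dots> = y t"
      using sum_cell[OF \<tau>(1) k(2,1), of "\<lambda>j. 2 * (C * \<tau>)^2 * (N (d (Suc j)))^2"] by (simp add: y_def e_def)
    finally show ?thesis .
  qed
  have "(\<integral>t. (dnorm (g t - f t))^2 \<partial>M) \<le> (\<integral>t. y t \<partial>M)"
    using D.L2_D(2)[OF D.L2_diff[OF gL2 f(2)]] iy by (rule integral_mono) (rule pt)
  moreover have "(\<integral>t. y t \<partial>M) = 2 * (\<Lambda> * \<tau>)^2 * T + (\<Sum>j<n. (\<integral>t. indicator (cell \<tau> j) t \<partial>M) * (2 * (C * \<tau>)^2 * (N (d (Suc j)))^2))"
  proof -
    have i: "integrable M (\<lambda>t. indicator (cell \<tau> j) t * (2 * (C * \<tau>)^2 * (N (d (Suc j)))^2))" for j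
      using cell_integral(2)[OF \<tau>(1), of T j] T by (intro integrable_mult_left) auto
    have "(\<integral>t. y t \<partial>M) = (\<integral>t. 2 * (\<Lambda> * \<tau>)^2 \<partial>M) + (\<integral>t. (\<Sum>j<n. indicator (cell \<tau> j) t * (2 * (C * \<tau>)^2 * (N (d (Suc j)))^2)) \<partial>M)"
      unfolding y_def by (intro Bochner_Integration.integral_add integrable_const Bochner_Integration.integrable_sum i)
    also have "(\<integral>t. 2 * (\<Lambda> * \<tau>)^2 \<partial>M) = 2 * (\<Lambda> * \<tau>)^2 * T" using T by (simp add: measure_restrict_space)
    also have "(\<integral>t. (\<Sum>j<n. indicator (cell \<tau> j) t * (2 * (C * \<tau>)^2 * (N (d (Suc j)))^2)) \<partial>M) =
        (\<Sum>j<n. \<integral>t. indicator (cell \<tau> j) t * (2 * (C * \<tau>)^2 * (N (d (Suc j)))^2) \<partial>M)"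
      by (rule Bochner_Integration.integral_sum) (rule i)
    also have "\<dots> = (\<Sum>j<n. (\<integral>t. indicator (cell \<tau> j) t \<partial>M) * (2 * (C * \<tau>)^2 * (N (d (Suc j)))^2))"
      by (simp only: integral_mult_left_zero)
    finally show ?thesis .
  qed
  moreover have "(\<Sum>j<n. (\<integral>t. indicator (cell \<tau> j) t \<partial>M) * (2 * (C * \<tau>)^2 * (N (d (Suc j)))^2)) \<le> (\<Sum>j<n. \<tau> * (2 * (C * \<tau>)^2 * (N (d (Suc j)))^2))"
  proof (intro sum_mono mult_right_mono)
    fix j
    have "(\<integral>t. indicator (cell \<tau> j) t \<partial>M) = ramp \<tau> j T"
      using cell_integral[OF \<tau>(1), of T j] T integral_lebesgue_on_Ioo[of 0 T "indicator (cell \<tau> j)"] by simp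
    then show "(\<integral>t. indicator (cell \<tau> j) t \<partial>M) \<le> \<tau>" by (simp add: ramp_def)
  qed auto
  moreover have "(\<Sum>j<n. \<tau> * (2 * (C * \<tau>)^2 * (N (d (Suc j)))^2)) = 2 * (C * \<tau>)^2 * (\<tau> * (\<Sum>k=1..n. (N (d k))^2))"
  proof -
    have "(\<Sum>k=1..n. (N (d k))^2) = (\<Sum>j<n. (N (d (Suc j)))^2)"
      by (rule sum.reindex_bij_witness[of _ Suc "\<lambda>k. k - 1"]) auto
    then show ?thesis by (simp add: sum_distrib_left mult_ac)
  qed
  moreover have "2 * (C * \<tau>)^2 * (\<tau> * (\<Sum>k=1..n. (N (d k))^2)) \<le> 2 * (C * \<tau>)^2 * W" using W by (intro mult_left_mono) auto
  ultimately have "(\<integral>t. (dnorm (g t - f t))^2 \<partial>M) \<le> 2 * (\<Lambda> * \<tau>)^2 * T + 2 * (C * \<tau>)^2 * W" by linarith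
  also have "\<dots> = \<tau>^2 * (2 * \<Lambda>^2 * T + 2 * C^2 * W)" by (simp add: power_mult_distrib algebra_simps)
  finally have "(\<integral>t. (dnorm (g t - f t))^2 \<partial>M) \<le> \<tau>^2 * (2 * \<Lambda>^2 * T + 2 * C^2 * W)" .
  then show ?thesis using that sol gL2 by (simp add: C_def \<tau>_def)
qed

text \<open>The bounds \<open>R\<close> and \<open>W\<close>, hence \<open>K\<close>, are fixed by
  \<open>x\<close> and the Lipschitz force alone; only afterwards is the number of steps chosen
  large enough.\<close>

theorem approximate_solution:
  assumes f: "f \<in> D.L2" and u0: "u0 \<in> H" and e: "e > 0"
  obtains u x g where "solves u x g" "x \<in> V" "hnorm (u0 - x) < e" "g \<in> D.L2" "(\<integral>t. (dnorm (g t - f t))^2 \<partial>M) < e"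
proof -
  obtain x where x: "x \<in> V" "hnorm (u0 - x) < e" using dense[OF u0 e] by blast
  \<comment> \<open>With this value of the force at time 0, the equation of the scheme holds at step
    0 with quotient 0.\<close>
  define f0 where "f0 = A_op x + B_op x x"
  have f0: "f0 \<in> dual" using x by (simp add: f0_def D.add_mem A_op_dual B_op_dual)
  have e4: "e / 4 > 0" using e by simp
  obtain \<Lambda> F where F: "D.lip_curve \<Lambda> F" "\<forall>t\<le>0. F t = f0" "F \<in> D.L2" "(\<integral>t. (dnorm (f t - F t))^2 \<partial>M) < e/4"
    by (rule D.approx_E[OF D.approx_L2[OF f f0] e4]) blast
  obtain R W where RW: "R \<ge> 0" "W \<ge> 0" "\<And>n U d. n > 0 ==> scheme F (T / real n) U d ==> U 0 = x ==> bounds R W n U d"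
    using scheme_bounds[OF x(1) F(1)] by blast
  define K where "K = 2 * \<Lambda>^2 * T + 2 * (Ca + 2 * Cb * R)^2 * W"
  have K: "K \<ge> 0" using T RW by (simp add: K_def)
  \<comment> \<open>The error contains \<open>n\<close> squared, so a lower bound on
    \<open>n\<close> itself is sufficient by \<open>n \<le> n^2\<close>.\<close>
  obtain n where n: "4 * T^2 * K / e < real n" "n > 0"
    by (metis gt_ex less_trans neq0_conv of_nat_0_less_iff of_nat_less_iff reals_Archimedean2 zero_less_Suc)
  have FD: "\<And>t. F t \<in> dual" using F(1) by (simp add: D.lip_curve_def)
  have F0: "F 0 v = a x v + b x x v" for v using F(2) by (simp add: f0_def A_op_def B_op_def)
  have \<tau>: "T / real n > 0" using T n by simp
  obtain U d where sch: "scheme F (T / real n) U d" "U 0 = x" using scheme_exists[where f = F, OF x(1) FD F0 \<tau>] by blast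
  obtain u g where ug: "solves u x g" "g \<in> D.L2" "(\<integral>t. (dnorm (g t - F t))^2 \<partial>M) \<le> (T / real n)^2 * K"
    using interpolant[OF n(2) sch RW(3)[OF n(2) sch] F(1,3)] unfolding K_def by blast
  have "(T / real n)^2 * K < e / 4"
  proof -
    have "T^2 * K * 4 < real n * e" using n e by (simp add: field_simps)
    also have "\<dots> \<le> (real n)^2 * e"
      using n e by (intro mult_right_mono) (auto simp: power2_eq_square)
    finally show ?thesis using n by (simp add: power_divide field_simps)
  qed
  then have "(\<integral>t. (dnorm (g t - f t))^2 \<partial>M) < e"
    using D.L2_triangle_3[OF ug(2) F(3) f] ug(3) F(4) D.L2_integral_commute[OF f F(3)] by simp
  then show ?thesis using that ug x by blast
qed

end

section \<open>Abstract Navier--Stokes equations: existence\<close>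

context navier_stokes begin

text \<open>Stability against the zero solution is an a priori bound; its Gronwall coefficient is 0,
  so it may be used with \<open>m = 0\<close>.\<close>

lemma zero_solves: "solves (\<lambda>_. 0) 0 (\<lambda>_. 0)"
proof -
  have h0: "h 0 0 = 0" using scaleR_left[of 0 0 0] by (simp add: H_mem)
  have a0: "a 0 v = 0" if "v \<in> V" for v using A.scaleR_left[of 0 v 0] that by simp
  have b0: "b 0 0 v = 0" if "v \<in> V" for v using b_scaleR1[of 0 0 v 0] that by simp
  have "weakly (\<lambda>_. 0) 0 (force (\<lambda>_. 0) (\<lambda>_. 0))"
    by (auto simp: weakly_def force_def A_op_def B_op_def a0 b0)
  then show ?thesis using const_L2[of 0] by (auto simp: solves_def hnorm_def h0)
qed

text \<open>Products are split by Young's inequality so that, after integration in time, the terms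
  with \<open>\<kappa>\<close> need only stay bounded and the terms with \<open>1 / \<kappa>\<close>
  tend to 0 along a convergent sequence.\<close>

lemma force_diff:
  assumes u: "u \<in> V" and w: "w \<in> V" and F: "F \<in> dual" and G: "G \<in> dual" and v: "v \<in> V" and \<kappa>: "\<kappa> > 0"
  shows "\<bar>(F - A_op u - B_op u u) v - (G - A_op w - B_op w w) v\<bar> \<le>
    (\<kappa>/2 * (1 + Ca + Cb * (2 * (N u)^2 + 2 * (N w)^2)) + 1/(2*\<kappa>) * ((dnorm (F - G))^2 + (Ca + Cb) * (N (u - w))^2)) * N v"
proof -
  have d: "u - w \<in> V" using u w by auto
  have "(F - A_op u - B_op u u) v - (G - A_op w - B_op w w) v = (F - G) v - (A_op u - A_op w) v - (B_op u u - B_op w w) v" by simp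
  then have "\<bar>(F - A_op u - B_op u u) v - (G - A_op w - B_op w w) v\<bar> \<le> \<bar>(F - G) v\<bar> + \<bar>(A_op u - A_op w) v\<bar> + \<bar>(B_op u u - B_op w w) v\<bar>"
    by linarith
  also have "\<dots> \<le> dnorm (F - G) * N v + dnorm (A_op u - A_op w) * N v + dnorm (B_op u u - B_op w w) * N v"
    using dual_bound[OF D.diff_mem[OF F G] v] dual_bound[OF D.diff_mem[OF A_op_dual[OF u] A_op_dual[OF w]] v]
      dual_bound[OF D.diff_mem[OF B_op_dual[OF u u] B_op_dual[OF w w]] v] by linarith
  also have "\<dots> = (dnorm (F - G) + dnorm (A_op u - A_op w) + dnorm (B_op u u - B_op w w)) * N v" by (simp add: algebra_simps)
  also have "\<dots> \<le> (\<kappa>/2 * (1 + Ca + Cb * (2 * (N u)^2 + 2 * (N w)^2)) + 1/(2*\<kappa>) * ((dnorm (F - G))^2 + (Ca + Cb) * (N (u - w))^2)) * N v"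
  proof (rule mult_right_mono)
    have 1: "dnorm (F - G) \<le> \<kappa>/2 + 1/(2*\<kappa>) * (dnorm (F - G))^2" using young[OF \<kappa>, of 1 "dnorm (F - G)"] by simp
    have "N (u - w) \<le> \<kappa>/2 + 1/(2*\<kappa>) * (N (u - w))^2" using young[OF \<kappa>, of 1 "N (u - w)"] by simp
    from mult_left_mono[OF this Ca] dnorm_A_op_diff[OF u w]
    have 2: "dnorm (A_op u - A_op w) \<le> \<kappa>/2 * Ca + 1/(2*\<kappa>) * (Ca * (N (u - w))^2)" by (simp add: algebra_simps)
    have "(N u + N w) * N (u - w) \<le> \<kappa>/2 * (N u + N w)^2 + (N (u - w))^2 / (2*\<kappa>)" by (rule young[OF \<kappa>])
    also have "\<dots> \<le> \<kappa>/2 * (2 * (N u)^2 + 2 * (N w)^2) + 1/(2*\<kappa>) * (N (u - w))^2"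
      using \<kappa> sum_squares_bound[of "N u" "N w"] by (intro add_mono mult_left_mono) (auto simp: power2_sum)
    finally have "(N u + N w) * N (u - w) \<le> \<kappa>/2 * (2 * (N u)^2 + 2 * (N w)^2) + 1/(2*\<kappa>) * (N (u - w))^2" .
    from mult_left_mono[OF this Cb]
    have 3: "Cb * ((N u + N w) * N (u - w)) \<le> \<kappa>/2 * (Cb * (2 * (N u)^2 + 2 * (N w)^2)) + 1/(2*\<kappa>) * (Cb * (N (u - w))^2)"
      by (simp add: algebra_simps)
    have "Cb * N (u - w) * N u + Cb * N w * N (u - w) = Cb * ((N u + N w) * N (u - w))" by (simp add: algebra_simps)
    with 3 dnorm_B_op_diff[OF u w u w]
    have 4: "dnorm (B_op u u - B_op w w) \<le> \<kappa>/2 * (Cb * (2 * (N u)^2 + 2 * (N w)^2)) + 1/(2*\<kappa>) * (Cb * (N (u - w))^2)" by linarith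
    have "\<kappa>/2 * (1 + Ca + Cb * (2 * (N u)^2 + 2 * (N w)^2)) + 1/(2*\<kappa>) * ((dnorm (F - G))^2 + (Ca + Cb) * (N (u - w))^2) =
      (\<kappa>/2 + 1/(2*\<kappa>) * (dnorm (F - G))^2) + (\<kappa>/2 * Ca + 1/(2*\<kappa>) * (Ca * (N (u - w))^2)) +
      (\<kappa>/2 * (Cb * (2 * (N u)^2 + 2 * (N w)^2)) + 1/(2*\<kappa>) * (Cb * (N (u - w))^2))"
      by (simp only: distrib_left distrib_right mult_1_right)
    then show "dnorm (F - G) + dnorm (A_op u - A_op w) + dnorm (B_op u u - B_op w w) \<le>
      \<kappa>/2 * (1 + Ca + Cb * (2 * (N u)^2 + 2 * (N w)^2)) + 1/(2*\<kappa>) * ((dnorm (F - G))^2 + (Ca + Cb) * (N (u - w))^2)"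
      using 1 2 4 by linarith
  qed (use v in auto)
  finally show ?thesis .
qed

text \<open>Convergence is strong in L2 in time with values in \<open>V\<close>, so that the
  quadratic term converges in integrated form. Convergence at almost every time identifies the
  left-hand side of the equation.\<close>

lemma limit_solves:
  assumes sol: "\<And>n. solves (u n) (x n) (g n)" "\<And>n. g n \<in> D.L2" "\<And>n. x n \<in> H"
    and w: "w \<in> L2" "AE t in M. hnorm (w t) \<le> C" and f: "f \<in> D.L2" and u0: "u0 \<in> H"
    and lim: "(\<lambda>n. \<integral>t. (N (w t - u n t))^2 \<partial>M) \<longlonglongrightarrow> 0" "AE t in M. (\<lambda>n. N (w t - u n t)) \<longlonglongrightarrow> 0"
      "(\<lambda>n. \<integral>t. (dnorm (g n t - f t))^2 \<partial>M) \<longlonglongrightarrow> 0" "(\<lambda>n. hnorm (u0 - x n)) \<longlonglongrightarrow> 0"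
  shows "solves w u0 f"
proof -
  interpret Hn: seminormed H hnorm by (rule seminormed_hnorm)
  have u: "u n \<in> L2" "\<exists>C. AE t in M. hnorm (u n t) \<le> C" "weakly (u n) (x n) (force (u n) (g n))" for n
    using sol(1)[of n] by (auto simp: solves_def)
  have fn: "force (u n) (g n) \<in> D.L2" for n using u(2)[of n] force_L2[OF u(1) _ sol(2)] by blast
  have fw: "force w f \<in> D.L2" by (rule force_L2[OF w f])
  obtain B where B: "\<And>n. (\<integral>t. (N (w t - u n t))^2 \<partial>M) \<le> B"
    using convergent_imp_Bseq[OF convergentI[OF lim(1)]] unfolding Bseq_def by (auto simp: abs_le_iff)
  define Kw where "Kw = (\<integral>t. (N (w t))^2 \<partial>M)"
  have unB: "(\<integral>t. (N (u n t))^2 \<partial>M) \<le> 2 * B + 2 * Kw" for n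
    using L2_integral_add[OF L2_diff[OF u(1) w(1)] w(1), of n] L2_integral_commute[OF u(1) w(1), of n] B[of n] by (simp add: Kw_def)
  have wk: "AE t in M. h (w t) v = h u0 v + I0 t (\<lambda>r. force w f r v)" if v: "v \<in> V" for v
  proof -
    have conv: "(\<lambda>n. I0 t (\<lambda>r. force (u n) (g n) r v)) \<longlonglongrightarrow> I0 t (\<lambda>r. force w f r v)" if t: "0 \<le> t" "t \<le> T" for t
    proof (rule LIMSEQ_I)
      fix e :: real assume e: "e > 0"
      define K where "K = (1 + Ca) * T + Cb * (2 * (2 * B + 2 * Kw) + 2 * Kw)"
      have Kw: "Kw \<ge> 0" by (simp add: Kw_def)
      have B0: "B \<ge> 0" using B[of 0] by (rule order_trans[rotated]) simp
      have K: "K \<ge> 0" unfolding K_def using Ca Cb T Kw B0 by (intro add_nonneg_nonneg mult_nonneg_nonneg) auto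
      \<comment> \<open>\<open>K\<close> bounds the integrals that come with
        \<open>\<kappa>\<close>, uniformly in \<open>n\<close>; their share is at most
        \<open>e / 2\<close>. The index \<open>n0\<close> is chosen after
        \<open>\<kappa>\<close>.\<close>
      define \<kappa> where "\<kappa> = e / ((K + 1) * (N v + 1))"
      have Nv: "N v \<ge> 0" using v by simp
      have \<kappa>: "\<kappa> > 0" using e K Nv by (simp add: \<kappa>_def)
      define E where "E n = (\<integral>t. (dnorm (g n t - f t))^2 \<partial>M) + (Ca + Cb) * (\<integral>t. (N (w t - u n t))^2 \<partial>M)" for n
      have "E \<longlonglongrightarrow> 0 + (Ca + Cb) * 0" unfolding E_def by (intro tendsto_intros lim)
      then have "(\<lambda>n. 1/(2*\<kappa>) * E n * N v) \<longlonglongrightarrow> 1/(2*\<kappa>) * 0 * N v" by (intro tendsto_intros) simp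
      then have "\<forall>\<^sub>F n in sequentially. 1/(2*\<kappa>) * E n * N v < e/2" using e by (intro order_tendstoD(2)) auto
      then obtain n0 where n0: "\<And>n. n \<ge> n0 ==> 1/(2*\<kappa>) * E n * N v < e/2" by (auto simp: eventually_sequentially)
      have "norm (I0 t (\<lambda>r. force (u n) (g n) r v) - I0 t (\<lambda>r. force w f r v)) < e" if n: "n \<ge> n0" for n
      proof -
        define y where "y r = (\<kappa>/2 * (1 + Ca + Cb * (2 * (N (u n r))^2 + 2 * (N (w r))^2)) +
           1/(2*\<kappa>) * ((dnorm (g n r - f r))^2 + (Ca + Cb) * (N (u n r - w r))^2)) * N v" for r
        have ii: "integrable M (\<lambda>r. (N (u n r))^2)" "integrable M (\<lambda>r. (N (w r))^2)"
          "integrable M (\<lambda>r. (dnorm (g n r - f r))^2)" "integrable M (\<lambda>r. (N (u n r - w r))^2)"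
          using L2_D(2)[OF u(1)] L2_D(2)[OF w(1)] D.L2_D(2)[OF D.L2_diff[OF sol(2) f]] L2_D(2)[OF L2_diff[OF u(1) w(1)]] by auto
        have iy: "integrable M y" unfolding y_def[abs_def] using ii
          by (intro Bochner_Integration.integrable_add integrable_mult_left integrable_mult_right integrable_const) auto
        have i1: "integrable M (\<lambda>r. force (u n) (g n) r v)" and i2: "integrable M (\<lambda>r. force w f r v)"
          using pairing_integrable[OF fn const_L2[OF v]] pairing_integrable[OF fw const_L2[OF v]] by auto
        have "I0 t (\<lambda>r. force (u n) (g n) r v) - I0 t (\<lambda>r. force w f r v) = I0 t (\<lambda>r. force (u n) (g n) r v - force w f r v)"
          using t by (intro integral_diff[symmetric] integrable_Ioo_HK[OF i1] integrable_Ioo_HK[OF i2]) auto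
        then have "\<bar>I0 t (\<lambda>r. force (u n) (g n) r v) - I0 t (\<lambda>r. force w f r v)\<bar> \<le> I0 t y"
        proof (simp only:, intro HK_abs_le[OF Bochner_Integration.integrable_diff[OF i1 i2] iy])
          show "AE r in M. \<bar>force (u n) (g n) r v - force w f r v\<bar> \<le> y r"
            using L2_D(3)[OF u(1)] L2_D(3)[OF w(1)] D.L2_D(3)[OF sol(2)] D.L2_D(3)[OF f]
            unfolding y_def force_def by eventually_elim (intro force_diff v \<kappa>)
        qed (use t in auto)
        also have "I0 t y \<le> I0 T y"
        proof (rule HK_primitive_mono[OF iy _ t])
          show "AE r in M. 0 \<le> y r" unfolding y_def using Ca Cb \<kappa> Nv by (intro AE_I2 mult_nonneg_nonneg add_nonneg_nonneg) auto
        qed simp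
        also have "I0 T y = (\<integral>r. y r \<partial>M)" using integral_lebesgue_on_Ioo[OF iy] by simp
        also have "\<dots> = (\<kappa>/2 * ((1 + Ca) * T + Cb * (2 * (\<integral>r. (N (u n r))^2 \<partial>M) + 2 * Kw)) +
           1/(2*\<kappa>) * ((\<integral>r. (dnorm (g n r - f r))^2 \<partial>M) + (Ca + Cb) * (\<integral>r. (N (u n r - w r))^2 \<partial>M))) * N v"
        proof -
          have "(\<integral>r. 1 + Ca + Cb * (2 * (N (u n r))^2 + 2 * (N (w r))^2) \<partial>M) = (1 + Ca) * T + Cb * (2 * (\<integral>r. (N (u n r))^2 \<partial>M) + 2 * Kw)"
            using ii T by (simp add: Kw_def measure_restrict_space algebra_simps)
          moreover have "integrable M (\<lambda>r. 1 + Ca + Cb * (2 * (N (u n r))^2 + 2 * (N (w r))^2))"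
            using ii by simp
          ultimately show ?thesis using ii unfolding y_def by simp
        qed
        also have "\<dots> \<le> (\<kappa>/2 * K + 1/(2*\<kappa>) * E n) * N v"
          unfolding K_def E_def L2_integral_commute[OF u(1) w(1)]
          using unB[of n] Cb Ca \<kappa> Nv by (intro mult_right_mono add_mono mult_left_mono order_refl) auto
        also have "\<dots> = \<kappa>/2 * K * N v + 1/(2*\<kappa>) * E n * N v" by (simp add: algebra_simps)
        also have "\<dots> < e"
        proof -
          have "\<kappa> * (K * N v) \<le> \<kappa> * ((K + 1) * (N v + 1))" using \<kappa> K Nv by (intro mult_left_mono mult_mono) auto
          also have "\<dots> = e" using K Nv by (simp add: \<kappa>_def)
          finally have "\<kappa>/2 * K * N v \<le> e/2" by simp
          then show ?thesis using n0[OF n] by linarith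
        qed
        finally show ?thesis by simp
      qed
      then show "\<exists>n0. \<forall>n\<ge>n0. norm (I0 t (\<lambda>r. force (u n) (g n) r v) - I0 t (\<lambda>r. force w f r v)) < e" by blast
    qed
    have "AE t in M. \<forall>n. h (u n t) v = h (x n) v + I0 t (\<lambda>r. force (u n) (g n) r v)"
      unfolding AE_all_countable using u(3) v by (auto simp: weakly_def)
    moreover have "AE t in M. \<forall>n. u n t \<in> V" unfolding AE_all_countable using L2_D(3)[OF u(1)] by blast
    ultimately show ?thesis using L2_D(3)[OF w(1)] lim(2) AE_space
    proof eventually_elim
      case (elim t)
      have "(\<lambda>n. h (x n) v) \<longlonglongrightarrow> h u0 v"
        by (rule Hn.tendsto_functional[OF _ _ u0 sol(3) lim(4), where C = "hnorm v"])
          (use v Cauchy_Schwarz[of _ v] in \<open>auto simp: diff_left mult.commute\<close>)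
      then have "(\<lambda>n. h (x n) v + I0 t (\<lambda>r. force (u n) (g n) r v)) \<longlonglongrightarrow> h u0 v + I0 t (\<lambda>r. force w f r v)"
        using elim(5) by (intro tendsto_add conv) auto
      moreover have "(\<lambda>n. h (u n t) v) \<longlonglongrightarrow> h (w t) v" using elim(2-4) v by (intro h_tendsto) auto
      ultimately show ?case using elim(1) by (simp add: LIMSEQ_unique)
    qed
  qed
  then show ?thesis using w by (auto simp: solves_def weakly_def)
qed

theorem existence:
  assumes f: "f \<in> D.L2" and u0: "u0 \<in> H"
  obtains u where "solves u u0 f"
proof -
  interpret Hn: seminormed H hnorm by (rule seminormed_hnorm)
  define Q where "Q n s \<longleftrightarrow> solves (fst s) (fst (snd s)) (snd (snd s)) \<and> fst (snd s) \<in> V \<and>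
     hnorm (u0 - fst (snd s)) < inverse (Suc n) \<and> snd (snd s) \<in> D.L2 \<and>
     (\<integral>t. (dnorm (snd (snd s) t - f t))^2 \<partial>M) < inverse (Suc n)" for n :: nat and s
  have "\<exists>s. Q n s" for n
  proof -
    have "inverse (real (Suc n)) > 0" by simp
    show ?thesis
    proof (rule approximate_solution[OF f u0 \<open>inverse (real (Suc n)) > 0\<close>])
      fix u x g assume "solves u x g" "x \<in> V" "hnorm (u0 - x) < inverse (real (Suc n))" "g \<in> D.L2"
        "(\<integral>t. (dnorm (g t - f t))^2 \<partial>M) < inverse (real (Suc n))"
      then have "Q n (u, x, g)" by (simp add: Q_def)
      then show ?thesis by blast
    qed
  qed
  then obtain q where q: "\<And>n. Q n (q n)" by metis
  define u where "u n = fst (q n)" for n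
  define x where "x n = fst (snd (q n))" for n
  define g where "g n = snd (snd (q n))" for n
  have s: "solves (u n) (x n) (g n)" "x n \<in> V" "hnorm (u0 - x n) < inverse (Suc n)"
    "g n \<in> D.L2" "(\<integral>t. (dnorm (g n t - f t))^2 \<partial>M) < inverse (Suc n)" for n
    using q[of n] by (auto simp: Q_def u_def x_def g_def)
  have u: "u n \<in> L2" for n using s(1)[of n] by (simp add: solves_def)
  have inv1: "inverse (real (Suc n)) \<le> 1" for n by (simp add: field_simps)
  define Kf where "Kf = (\<integral>t. (dnorm (f t))^2 \<partial>M)"
  \<comment> \<open>The constant of \<open>stability\<close> for the comparison with the zero
    solution: the approximate initial values have norm at most \<open>hnorm u0 + 1\<close>, and the
    approximate forces have square integral at most \<open>2 + 2 * Kf\<close>.\<close>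
  define B where "B = (hnorm u0 + 1)^2 + 2 / \<alpha> * (2 + 2 * Kf)"
  have zL: "(\<lambda>_. 0) \<in> D.L2" by (intro D.L2_simple) auto
  have bound: "AE t in M. (hnorm (0 - u n t))^2 \<le> B" "\<alpha> * (\<integral>t. (N (0 - u n t))^2 \<partial>M) \<le> B" for n
  proof -
    have c: "h (0 - x n) (0 - x n) + 2 / \<alpha> * (\<integral>t. (dnorm (0 - g n t))^2 \<partial>M) \<le> B"
      unfolding B_def
    proof (intro add_mono mult_left_mono)
      have x: "x n \<in> H" using s(2) by blast
      have "hnorm (0 - x n) \<le> hnorm u0 + 1"
        using Hn.triangle_diff[OF H_mem(3)[OF u0 x] u0] s(3)[of n] inv1[of n] by simp
      then have "(hnorm (0 - x n))^2 \<le> (hnorm u0 + 1)^2" using x by (intro power_mono) (auto simp: H_mem)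
      then show "h (0 - x n) (0 - x n) \<le> (hnorm u0 + 1)^2" using hnorm_square[OF H_mem(3)[OF H_mem(1) x]] by simp
      show "(\<integral>t. (dnorm (0 - g n t))^2 \<partial>M) \<le> 2 + 2 * Kf"
        using D.L2_triangle_3[OF zL f s(4), of n] D.L2_integral_commute[OF f s(4), of n] D.L2_integral_commute[OF zL f] s(5)[of n] inv1[of n]
        by (simp add: Kf_def)
    qed (use \<alpha> in auto)
    have m: "2 * Cb^2 / \<alpha> * (\<integral>t. (N ((\<lambda>_. 0) t))^2 \<partial>M) \<le> real 0 / 2" by simp
    have x: "0 - x n \<in> V" using s(2) diff_mem zero_mem by blast
    note st = stability[OF zero_solves s(1) zL s(4) H_mem(1) in_H[OF s(2)] x m]
    show "AE t in M. (hnorm (0 - u n t))^2 \<le> B" using st(1) by eventually_elim (use c in simp)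
    show "\<alpha> * (\<integral>t. (N (0 - u n t))^2 \<partial>M) \<le> B" using st(2) c by simp
  qed
  have uB: "(\<integral>t. (N (u n t))^2 \<partial>M) \<le> B / \<alpha>" for n
    using bound(2)[of n] L2_integral_commute[OF const_L2[OF zero_mem] u, of n] \<alpha> by (simp add: field_simps)
  \<comment> \<open>One \<open>m\<close> for all approximate solutions: their norms in L2 with
    values in \<open>V\<close> are uniformly bounded, so the Gronwall factor does not spoil the
    Cauchy estimate.\<close>
  obtain m where m: "2 * (2 * Cb^2 / \<alpha> * (B / \<alpha>)) \<le> real m" using real_arch_simple by blast
  have m': "2 * Cb^2 / \<alpha> * (\<integral>t. (N (u n t))^2 \<partial>M) \<le> real m / 2" for n
  proof -
    have "2 * Cb^2 / \<alpha> * (\<integral>t. (N (u n t))^2 \<partial>M) \<le> 2 * Cb^2 / \<alpha> * (B / \<alpha>)" using uB \<alpha> by (intro mult_left_mono) auto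
    then show ?thesis using m by linarith
  qed
  have est: "\<alpha> * (\<integral>t. (N (u n t - u k t))^2 \<partial>M) \<le> 2 ^ m * ((2 + 4 / \<alpha>) * (inverse (Suc n) + inverse (Suc k)))" for n k
  proof -
    have "\<alpha> * (\<integral>t. (N (u n t - u k t))^2 \<partial>M) \<le> 2 ^ m * (h (x n - x k) (x n - x k) + 2 / \<alpha> * (\<integral>t. (dnorm (g n t - g k t))^2 \<partial>M))"
      by (rule stability(2)[OF s(1) s(1) s(4) s(4) in_H[OF s(2)] in_H[OF s(2)] diff_mem[OF s(2) s(2)] m'])
    also have "\<dots> \<le> 2 ^ m * (2 * (inverse (Suc n) + inverse (Suc k)) + 2 / \<alpha> * (2 * (inverse (Suc n) + inverse (Suc k))))"
    proof (intro mult_left_mono add_mono)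
      have x: "x n \<in> H" "x k \<in> H" using s(2) by auto
      have "hnorm (x n - x k) \<le> hnorm (x n - u0) + hnorm (u0 - x k)" by (rule Hn.triangle_3) (use x u0 in auto)
      also have "\<dots> \<le> inverse (Suc n) + inverse (Suc k)" using s(3)[of n] s(3)[of k] Hn.N_commute[OF x(1) u0] by simp
      finally have le: "hnorm (x n - x k) \<le> inverse (Suc n) + inverse (Suc k)" .
      have "(hnorm (x n - x k))^2 \<le> (inverse (real (Suc n)) + inverse (Suc k)) * (inverse (real (Suc n)) + inverse (Suc k))"
        unfolding power2_eq_square using le x by (intro mult_mono) (auto simp: H_mem)
      also have "\<dots> \<le> 2 * (inverse (Suc n) + inverse (Suc k))" using inv1[of n] inv1[of k] by (intro mult_right_mono) auto
      finally show "h (x n - x k) (x n - x k) \<le> 2 * (inverse (Suc n) + inverse (Suc k))" using hnorm_square[OF H_mem(3)[OF x]] by simp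
      show "(\<integral>t. (dnorm (g n t - g k t))^2 \<partial>M) \<le> 2 * (inverse (Suc n) + inverse (Suc k))"
        using D.L2_triangle_3[OF s(4) f s(4), of n k] D.L2_integral_commute[OF f s(4), of k] s(5)[of n] s(5)[of k] by simp
    qed (use \<alpha> in auto)
    also have "\<dots> = 2 ^ m * ((2 + 4 / \<alpha>) * (inverse (Suc n) + inverse (Suc k)))" by (simp add: algebra_simps)
    finally show ?thesis .
  qed
  have Cauchy: "\<exists>K. \<forall>n\<ge>K. \<forall>k\<ge>K. (\<integral>t. (N (u n t - u k t))^2 \<partial>M) < e" if e: "e > 0" for e
  proof -
    define c where "c = 2 ^ m * (2 + 4 / \<alpha>)"
    have c: "c > 0" using \<alpha> by (simp add: c_def add_pos_pos)
    obtain K where K: "inverse (Suc K) < \<alpha> * e / (2 * c)" using reals_Archimedean[of "\<alpha> * e / (2 * c)"] e \<alpha> c by auto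
    have "(\<integral>t. (N (u n t - u k t))^2 \<partial>M) < e" if "n \<ge> K" "k \<ge> K" for n k
    proof -
      have "inverse (real (Suc n)) \<le> inverse (Suc K)" "inverse (real (Suc k)) \<le> inverse (Suc K)" using that by (auto intro!: le_imp_inverse_le)
      then have "c * (inverse (Suc n) + inverse (Suc k)) \<le> c * (2 * inverse (Suc K))"
        using c by (intro mult_left_mono) linarith+
      also have "\<dots> < \<alpha> * e" using K c by (simp add: field_simps)
      finally have "\<alpha> * (\<integral>t. (N (u n t - u k t))^2 \<partial>M) < \<alpha> * e" using est[of n k] by (simp add: c_def mult.assoc)
      then show ?thesis using \<alpha> by simp
    qed
    then show ?thesis by blast
  qed
  obtain w r where w: "w \<in> L2" "(\<lambda>n. \<integral>t. (N (w t - u n t))^2 \<partial>M) \<longlonglongrightarrow> 0" "strict_mono r" "AE t in M. (\<lambda>n. N (w t - u (r n) t)) \<longlonglongrightarrow> 0"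
    using L2_complete[OF complete u Cauchy] by blast
  have wB: "AE t in M. hnorm (w t) \<le> sqrt B"
  proof -
    have "AE t in M. \<forall>n. (hnorm (0 - u n t))^2 \<le> B" unfolding AE_all_countable using bound(1) by blast
    moreover have "AE t in M. \<forall>n. u n t \<in> V" unfolding AE_all_countable using L2_D(3)[OF u] by blast
    ultimately show ?thesis using w(4) L2_D(3)[OF w(1)]
    proof eventually_elim
      case (elim t)
      have le: "hnorm (u n t) \<le> sqrt B" for n
        using elim(1,2) Hn.N_uminus[of "u n t"] by (intro real_le_rsqrt) auto
      have "(\<lambda>n. hnorm (w t - u (r n) t)) \<longlonglongrightarrow> 0"
      proof (rule Lim_null_comparison[OF _ elim(3)], intro always_eventually allI)
        fix n show "norm (hnorm (w t - u (r n) t)) \<le> N (w t - u (r n) t)"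
          using hnorm_le[of "w t - u (r n) t"] elim diff_mem[of "w t" "u (r n) t"] by simp
      qed
      then have "(\<lambda>n. hnorm (u (r n) t)) \<longlonglongrightarrow> hnorm (w t)" using elim by (intro Hn.N_tendsto) auto
      then show ?case by (rule LIMSEQ_le_const2) (use le in auto)
    qed
  qed
  have "solves w u0 f"
  proof (rule limit_solves[where u = "\<lambda>n. u (r n)" and x = "\<lambda>n. x (r n)" and g = "\<lambda>n. g (r n)", OF s(1,4) in_H[OF s(2)] w(1) wB f u0 _ w(4)])
    show "(\<lambda>n. \<integral>t. (N (w t - u (r n) t))^2 \<partial>M) \<longlonglongrightarrow> 0" using LIMSEQ_subseq_LIMSEQ[OF w(2,3)] by (simp add: comp_def)
    have "(\<lambda>n. \<integral>t. (dnorm (g n t - f t))^2 \<partial>M) \<longlonglongrightarrow> 0"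
      by (rule tendsto_zero_inverse[OF _ s(5)]) simp
    from LIMSEQ_subseq_LIMSEQ[OF this w(3)]
    show "(\<lambda>n. \<integral>t. (dnorm (g (r n) t - f t))^2 \<partial>M) \<longlonglongrightarrow> 0" by (simp add: comp_def)
    have "(\<lambda>n. hnorm (u0 - x n)) \<longlonglongrightarrow> 0"
      by (rule tendsto_zero_inverse) (use s(2,3) u0 in \<open>auto simp: H_mem\<close>)
    from LIMSEQ_subseq_LIMSEQ[OF this w(3)]
    show "(\<lambda>n. hnorm (u0 - x (r n))) \<longlonglongrightarrow> 0" by (simp add: comp_def)
  qed
  then show ?thesis using that by blast
qed

end

section \<open>Test functions\<close>

lemma dir_deriv_unique: "(f has_derivative f') (at x) ==> dir_deriv e f x = f' e"
  unfolding dir_deriv_def using frechet_derivative_at by metis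

lemma has_derivative_dir_deriv:
  assumes "f differentiable (at x)"
  shows "(f has_derivative (\<lambda>e. dir_deriv e f x)) (at x)"
  using assms unfolding dir_deriv_def by (simp add: frechet_derivative_works)

lemma Ck_differentiable: "Ck (Suc k) f ==> f differentiable (at x)"
  by (auto simp: differentiable_on_def)

lemma Ck_Suc_I:
  assumes "\<And>x. (f has_derivative f' x) (at x)" "\<And>e. e \<in> Basis ==> Ck k (\<lambda>x. f' x e)"
  shows "Ck (Suc k) f"
proof -
  have "dir_deriv e f = (\<lambda>x. f' x e)" for e using dir_deriv_unique[OF assms(1)] by auto
  moreover have "f differentiable_on UNIV" using assms(1) by (auto simp: differentiable_on_def differentiable_def)
  ultimately show ?thesis using assms(2) by simp
qed

lemma Ck_Suc_has_derivative:
  assumes "Ck (Suc k) f" shows "(f has_derivative (\<lambda>e. dir_deriv e f x)) (at x)"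
  by (rule has_derivative_dir_deriv[OF Ck_differentiable[OF assms]])

lemma Ck_mono: "Ck (Suc k) f ==> Ck k f"
proof (induction k arbitrary: f)
  case 0
  then show ?case by (auto intro: differentiable_imp_continuous_on)
next
  case (Suc k)
  then show ?case by (metis Ck.simps(2))
qed

lemma Ck_continuous: "Ck k f ==> continuous_on UNIV f"
  by (induction k) (auto intro: differentiable_imp_continuous_on)

lemma Ck_add: "Ck k f ==> Ck k g ==> Ck k (\<lambda>x. f x + g x)"
proof (induction k arbitrary: f g)
  case (Suc k)
  show ?case
    by (rule Ck_Suc_I[where f' = "\<lambda>x e. dir_deriv e f x + dir_deriv e g x"])
      (use Suc in \<open>auto intro!: derivative_intros Ck_Suc_has_derivative[where k = k] Suc.IH\<close>)
qed (auto intro: continuous_intros)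

lemma Ck_bounded_linear:
  assumes "bounded_linear L" shows "Ck k f ==> Ck k (\<lambda>x. L (f x))"
proof (induction k arbitrary: f)
  case 0
  then show ?case using bounded_linear.continuous_on[OF assms] by simp
next
  case (Suc k)
  show ?case
    by (rule Ck_Suc_I[where f' = "\<lambda>x e. L (dir_deriv e f x)"])
      (use Suc in \<open>auto intro!: bounded_linear.has_derivative[OF assms] Ck_Suc_has_derivative[where k = k] Suc.IH\<close>)
qed

lemma Ck_scaleR:
  fixes f :: "'a::euclidean_space => real"
  shows "Ck k f ==> Ck k g ==> Ck k (\<lambda>x. f x *\<^sub>R g x)"
proof (induction k arbitrary: f g)
  case (Suc k)
  have d: "((\<lambda>x. f x *\<^sub>R g x) has_derivative (\<lambda>e. f x *\<^sub>R dir_deriv e g x + dir_deriv e f x *\<^sub>R g x)) (at x)" for x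
    by (intro has_derivative_scaleR Ck_Suc_has_derivative[where k = k] Suc.prems)
  show ?case
    using Suc.prems by (intro Ck_Suc_I[OF d] Ck_add Suc.IH Ck_mono[OF Suc.prems(1)] Ck_mono[OF Suc.prems(2)]) auto
qed (auto intro: continuous_intros)

lemma Ck_const: "Ck k (\<lambda>_. c)"
proof (induction k arbitrary: c)
  case (Suc k)
  show ?case by (rule Ck_Suc_I[where f' = "\<lambda>_ _. 0"]) (auto intro: Suc)
qed simp

lemma Ck_prod:
  fixes f :: "'i => 'a::euclidean_space => real"
  assumes "\<And>i. i \<in> I ==> Ck k (f i)"
  shows "Ck k (\<lambda>x. \<Prod>i\<in>I. f i x)"
  using assms
proof (induction I rule: infinite_finite_induct)
  case (insert i I)
  then show ?case using Ck_scaleR[of k "f i" "\<lambda>x. \<Prod>i\<in>I. f i x"] by simp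
qed (auto intro: Ck_const)

text \<open>The functions \<open>p (1/t) * exp (-1/t)\<close>, \<open>t > 0\<close>, form a class closed under differentiation.\<close>

definition flat :: "real poly => real => real" where
  "flat p t = (if t > 0 then poly p (1/t) * exp (- (1/t)) else 0)"

text \<open>\<open>[:0, 0, 1:]\<close> is the square of the variable: with \<open>x = 1/t\<close>,
  differentiation in \<open>t\<close> turns \<open>p\<close> into \<open>x^2 * (p - p')\<close>,
  evaluated at \<open>x\<close>.\<close>

definition flat_deriv :: "real poly => real poly" where
  "flat_deriv p = [:0, 0, 1:] * (p - pderiv p)"

lemma poly_exp_tendsto: "((\<lambda>x. poly p x * exp (- x)) \<longlongrightarrow> (0::real)) at_top"
proof (induction p)
  case (pCons a p)
  have "((\<lambda>x. a * exp (- x) + x * poly p x * exp (- x)) \<longlongrightarrow> 0 + 0) at_top"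
  proof (intro tendsto_add)
    show "((\<lambda>x. a * exp (- x)) \<longlongrightarrow> 0) at_top"
      by (intro tendsto_mult_right_zero filterlim_compose[OF exp_at_bot] filterlim_uminus_at_bot_at_top)
    show "((\<lambda>x. x * poly p x * exp (- x)) \<longlongrightarrow> 0) at_top"
    proof -
      have "((\<lambda>x. \<Sum>i\<le>degree p. coeff p i * (x ^ Suc i / exp x)) \<longlongrightarrow> (\<Sum>i\<le>degree p. coeff p i * 0)) at_top"
        by (intro tendsto_sum tendsto_mult tendsto_const tendsto_power_div_exp_0)
      moreover have "(\<Sum>i\<le>degree p. coeff p i * (x ^ Suc i / exp x)) = x * poly p x * exp (- x)" for x
        by (simp add: poly_altdef sum_distrib_left sum_distrib_right exp_minus divide_inverse mult_ac)
      ultimately show ?thesis by simp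
    qed
  qed
  then show ?case by (simp add: algebra_simps)
qed simp

lemma flat_tendsto: "((\<lambda>t. flat p t / t) \<longlongrightarrow> 0) (at 0)"
proof -
  \<comment> \<open>Division by \<open>t\<close> multiplies the polynomial in \<open>1/t\<close> by
    its variable, hence \<open>pCons 0 p\<close>; exponential decay still wins.\<close>
  have "((\<lambda>t. poly (pCons 0 p) (inverse t) * exp (- inverse t)) \<longlongrightarrow> 0) (at_right 0)"
    by (rule filterlim_compose[OF poly_exp_tendsto filterlim_inverse_at_top_right])
  then have "((\<lambda>t. flat p t / t) \<longlongrightarrow> 0) (at_right 0)"
    by (rule Lim_transform_eventually)
      (auto simp: flat_def eventually_at_filter field_simps intro!: always_eventually)
  moreover have "((\<lambda>t. flat p t / t) \<longlongrightarrow> 0) (at_left 0)"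
    by (rule Lim_transform_eventually[OF tendsto_const])
      (auto simp: flat_def eventually_at_filter intro!: always_eventually)
  ultimately show ?thesis by (simp add: filterlim_split_at)
qed

lemma flat_has_derivative: "(flat p has_real_derivative flat (flat_deriv p) t) (at t)"
proof (cases t "0::real" rule: linorder_cases)
  case less
  have "((\<lambda>_. 0) has_real_derivative 0) (at t)" by simp
  then have "(flat p has_real_derivative 0) (at t)"
    by (rule DERIV_cong_ev[THEN iffD1, rotated 3])
      (use less in \<open>auto simp: flat_def eventually_nhds intro!: exI[of _ "{..<0}"]\<close>)
  then show ?thesis using less by (simp add: flat_def)
next
  case equal
  have "(flat p has_real_derivative 0) (at 0)"
    unfolding has_field_derivative_iff using flat_tendsto[of p] by (simp add: flat_def)
  then show ?thesis using equal by (simp add: flat_def)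
next
  case greater
  have "((\<lambda>t. poly p (1/t) * exp (- (1/t))) has_real_derivative
     poly (pderiv p) (1/t) * (- (1/t^2)) * exp (- (1/t)) + exp (- (1/t)) * (1/t^2) * poly p (1/t)) (at t)"
    using greater by (auto intro!: derivative_eq_intros DERIV_chain2[OF poly_DERIV] simp: power2_eq_square field_simps)
  also have "poly (pderiv p) (1/t) * (- (1/t^2)) * exp (- (1/t)) + exp (- (1/t)) * (1/t^2) * poly p (1/t) = flat (flat_deriv p) t"
    using greater by (simp add: flat_def flat_deriv_def power2_eq_square field_simps)
  finally show ?thesis
    by (rule DERIV_cong_ev[THEN iffD1, rotated 3])
      (use greater in \<open>auto simp: flat_def eventually_nhds intro!: exI[of _ "{0<..}"]\<close>)
qed

lemma Ck_flat: "Ck k (\<lambda>x. flat p (x \<bullet> e + c))"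
proof (induction k arbitrary: p)
  case 0
  have "continuous_on UNIV (flat p)"
    by (intro continuous_at_imp_continuous_on ballI DERIV_isCont[OF flat_has_derivative])
  moreover have "continuous_on UNIV (\<lambda>x. x \<bullet> e + c)" by (intro continuous_intros)
  ultimately have "continuous_on UNIV (\<lambda>x. flat p (x \<bullet> e + c))"
    by (rule continuous_on_compose2) auto
  then show ?case by simp
next
  case (Suc k)
  have d: "((\<lambda>x. flat p (x \<bullet> e + c)) has_derivative (\<lambda>i. flat (flat_deriv p) (x \<bullet> e + c) * (i \<bullet> e))) (at x)" for x
  proof -
    have "((\<lambda>x. x \<bullet> e + c) has_derivative (\<lambda>i. i \<bullet> e)) (at x)"
      by (auto intro!: derivative_eq_intros)
    from has_derivative_compose[OF this flat_has_derivative[unfolded has_field_derivative_def]]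
    show ?thesis by (simp add: comp_def)
  qed
  show ?case
  proof (rule Ck_Suc_I[OF d])
    fix i :: 'a
    show "Ck k (\<lambda>x. flat (flat_deriv p) (x \<bullet> e + c) * (i \<bullet> e))"
      using Ck_scaleR[OF Suc Ck_const[of k "i \<bullet> e"], of "flat_deriv p"] by simp
  qed
qed

text \<open>The parameter \<open>m\<close> sharpens the edges: as it grows, the functions tend to
  the indicator of the open box, while their support stays in the closed box. They serve to detect
  integrals over boxes.\<close>

definition bump :: "'a::euclidean_space => 'a => real => 'a => real" where
  "bump a b m x = (\<Prod>i\<in>Basis. flat 1 (m * (x \<bullet> i - a \<bullet> i)) * flat 1 (m * (b \<bullet> i - x \<bullet> i)))"

lemma flat_1: "0 \<le> flat 1 t" "flat 1 t \<le> 1" "flat 1 t = 0 \<longleftrightarrow> t \<le> 0"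
  by (auto simp: flat_def)

lemma bump_bounds: "0 \<le> bump a b m x" "bump a b m x \<le> 1"
  by (auto simp: bump_def flat_1 intro!: prod_nonneg prod_le_1 mult_le_one)

lemma bump_nonzero:
  assumes "m > 0" shows "bump a b m x \<noteq> 0 \<longleftrightarrow> x \<in> box a b"
proof -
  have "bump a b m x \<noteq> 0 \<longleftrightarrow> (\<forall>i\<in>(Basis::'a set). 0 < m * (x \<bullet> i - a \<bullet> i) \<and> 0 < m * (b \<bullet> i - x \<bullet> i))"
    by (simp add: bump_def flat_1 not_le)
  then show ?thesis using assms by (simp add: mem_box zero_less_mult_iff)
qed

lemma bump_tendsto: "(\<lambda>n. bump a b (real (Suc n)) x) \<longlonglongrightarrow> indicator (box a b) x"
proof (cases "x \<in> box a b")
  case True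
  have fl: "(\<lambda>n. flat 1 (real (Suc n) * s)) \<longlonglongrightarrow> 1" if "s > 0" for s
  proof -
    have "(\<lambda>n. exp (- (inverse (real (Suc n)) * (1/s)))) \<longlonglongrightarrow> exp (- (0 * (1/s)))"
      by (intro tendsto_intros LIMSEQ_inverse_real_of_nat)
    moreover have "exp (- (inverse (real (Suc n)) * (1/s))) = flat 1 (real (Suc n) * s)" for n
      using that by (simp add: flat_def field_simps del: of_nat_Suc)
    ultimately show ?thesis by simp
  qed
  have "(\<lambda>n. bump a b (real (Suc n)) x) \<longlonglongrightarrow> (\<Prod>i\<in>(Basis::'a set). 1 * 1)"
    unfolding bump_def using True by (intro tendsto_prod tendsto_mult fl) (auto simp: mem_box)
  then show ?thesis using True by simp
next
  case False
  then show ?thesis using bump_nonzero[of "real (Suc n)" a b x for n] by simp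
qed

lemma bump_test_fun:
  assumes "m > 0" "cbox a b \<subseteq> S" shows "bump a b m \<in> test_fun S"
proof -
  have "Ck k (bump a b m)" for k
  proof -
    have "Ck k (\<lambda>x. \<Prod>i\<in>(Basis::'a set). flat 1 (x \<bullet> (m *\<^sub>R i) + - m * (a \<bullet> i)) *\<^sub>R flat 1 (x \<bullet> (- m *\<^sub>R i) + m * (b \<bullet> i)))"
      by (intro Ck_prod Ck_scaleR Ck_flat)
    moreover have "x \<bullet> (m *\<^sub>R i) + - m * (a \<bullet> i) = m * (x \<bullet> i - a \<bullet> i)"
      "x \<bullet> (- m *\<^sub>R i) + m * (b \<bullet> i) = m * (b \<bullet> i - x \<bullet> i)" for x i
      by (simp_all add: algebra_simps)
    ultimately show ?thesis by (simp add: bump_def[abs_def])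
  qed
  moreover have sub: "closure {x. bump a b m x \<noteq> 0} \<subseteq> cbox a b"
    using subsetD[OF box_subset_cbox] by (intro closure_minimal) (auto simp: bump_nonzero[OF assms(1)])
  moreover have "compact (closure {x. bump a b m x \<noteq> 0})"
    using bounded_subset[OF bounded_cbox sub] by (simp add: compact_eq_bounded_closed)
  ultimately show ?thesis using assms by (auto simp: test_fun_def)
qed

section \<open>The fundamental lemma of the calculus of variations\<close>

lemma lebesgue_on_indicator_cong:
  fixes f g :: "'a::euclidean_space => 'b::euclidean_space"
  assumes "A \<in> sets lebesgue" "B \<in> sets lebesgue" "\<And>x. indicator A x *\<^sub>R f x = indicator B x *\<^sub>R g x"
  shows "integrable (lebesgue_on A) f \<longleftrightarrow> integrable (lebesgue_on B) g"
    and "integral\<^sup>L (lebesgue_on A) f = integral\<^sup>L (lebesgue_on B) g"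
  using assms by (simp_all add: integrable_restrict_space integral_restrict_space)

lemma test_fun_zero: "\<phi> \<in> test_fun S ==> x \<notin> S ==> \<phi> x = 0"
  using closure_subset[of "{x. \<phi> x \<noteq> 0}"] by (auto simp: test_fun_def)

lemma test_fun_continuous: "\<phi> \<in> test_fun S ==> continuous_on UNIV \<phi>"
  using Ck_continuous[of 0 \<phi>] by (auto simp: test_fun_def)

lemma test_fun_bounded:
  assumes "\<phi> \<in> test_fun S"
  obtains B where "B \<ge> 0" "\<And>x. norm (\<phi> x) \<le> B"
proof -
  define K where "K = closure {x. \<phi> x \<noteq> 0}"
  have "compact K" using assms by (simp add: test_fun_def K_def)
  then have "bounded (\<phi> ` K)"
    using test_fun_continuous[OF assms] by (intro compact_imp_bounded compact_continuous_image) (auto intro: continuous_on_subset)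
  then obtain B where B: "B > 0" "\<And>x. x \<in> K ==> norm (\<phi> x) \<le> B" unfolding bounded_pos by blast
  have "norm (\<phi> x) \<le> B" for x
  proof (cases "x \<in> K")
    case False
    then have "\<phi> x = 0" using closure_subset[of "{x. \<phi> x \<noteq> 0}"] by (auto simp: K_def)
    then show ?thesis using B by simp
  qed (use B in simp)
  then show ?thesis using that B by (meson less_imp_le)
qed

lemma test_fun_borel [measurable_dest]: "\<phi> \<in> test_fun S ==> \<phi> \<in> borel_measurable borel"
  using test_fun_continuous by (auto intro: borel_measurable_continuous_onI)

lemma borel_lebesgue_on: "f \<in> borel_measurable borel ==> f \<in> borel_measurable (lebesgue_on S)"
  by (metis borel_measurable_subalgebra lborelD measurable_completion measurable_lborel2 measurable_restrict_space1)

lemma test_fun_dir_deriv: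
  assumes "\<phi> \<in> test_fun S" "e \<in> Basis" shows "dir_deriv e \<phi> \<in> test_fun S"
proof -
  have C: "Ck k (dir_deriv e \<phi>)" for k
    using assms Ck.simps(2)[of k \<phi>] by (auto simp: test_fun_def)
  have sub: "{x. dir_deriv e \<phi> x \<noteq> 0} \<subseteq> closure {x. \<phi> x \<noteq> 0}"
  proof safe
    fix x assume x: "dir_deriv e \<phi> x \<noteq> 0"
    show "x \<in> closure {x. \<phi> x \<noteq> 0}"
    proof (rule ccontr)
      assume nx: "x \<notin> closure {x. \<phi> x \<noteq> 0}"
      have "((\<lambda>_. 0) has_derivative (\<lambda>_. 0)) (at x)" by simp
      then have "(\<phi> has_derivative (\<lambda>_. 0)) (at x)"
        by (rule has_derivative_transform_within_open[of _ _ _ _ "- closure {x. \<phi> x \<noteq> 0}"])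
          (use nx closure_subset[of "{x. \<phi> x \<noteq> 0}"] in auto)
      from dir_deriv_unique[OF this] x show False by simp
    qed
  qed
  then have cl: "closure {x. dir_deriv e \<phi> x \<noteq> 0} \<subseteq> closure {x. \<phi> x \<noteq> 0}"
    by (intro closure_minimal) auto
  moreover have "compact (closure {x. dir_deriv e \<phi> x \<noteq> 0})"
    using cl assms(1) bounded_subset[OF compact_imp_bounded cl] by (simp add: compact_eq_bounded_closed test_fun_def)
  ultimately show ?thesis using C assms by (auto simp: test_fun_def)
qed

lemma test_fun_mult_integrable:
  fixes \<psi> :: "'a::euclidean_space => real" and g :: "'a => 'b::euclidean_space"
  assumes \<psi>: "\<psi> \<in> test_fun S" and g: "loc_integrable S g" and S: "S \<in> sets lebesgue"
  shows "integrable (lebesgue_on S) (\<lambda>x. \<psi> x *\<^sub>R g x)"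
proof -
  define K where "K = closure {x. \<psi> x \<noteq> 0}"
  have K: "compact K" "K \<subseteq> S" using \<psi> by (auto simp: test_fun_def K_def)
  then have KL: "K \<in> sets lebesgue" by (simp add: compact_imp_closed borel_closed)
  obtain B where B: "\<And>x. norm (\<psi> x) \<le> B" using test_fun_bounded[OF \<psi>] by blast
  have gK: "integrable (lebesgue_on K) g" using g K by (simp add: loc_integrable_def)
  have m: "\<psi> \<in> borel_measurable (lebesgue_on K)" by (rule borel_lebesgue_on[OF test_fun_borel[OF \<psi>]])
  have "integrable (lebesgue_on K) (\<lambda>x. \<psi> x *\<^sub>R g x)"
  proof (rule Bochner_Integration.integrable_bound)
    show "integrable (lebesgue_on K) (\<lambda>x. B * norm (g x))" using gK by simp
    show "(\<lambda>x. \<psi> x *\<^sub>R g x) \<in> borel_measurable (lebesgue_on K)"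
      using m borel_measurable_integrable[OF gK] by (rule borel_measurable_scaleR)
    show "AE x in lebesgue_on K. norm (\<psi> x *\<^sub>R g x) \<le> norm (B * norm (g x))"
      using B by (intro AE_I2) (auto simp: abs_mult intro!: mult_right_mono intro: order_trans[OF _ abs_ge_self])
  qed
  moreover have eq: "indicator K x *\<^sub>R (\<psi> x *\<^sub>R g x) = indicator S x *\<^sub>R (\<psi> x *\<^sub>R g x)" for x
    using K closure_subset[of "{x. \<psi> x \<noteq> 0}"] by (auto simp: K_def indicator_def)
  ultimately show ?thesis using lebesgue_on_indicator_cong(1)[OF KL S eq] by blast
qed

text \<open>Testing with bumps and dominated convergence give vanishing integrals over all boxes
  inside \<open>S\<close>, hence \<open>f = 0\<close> almost everywhere on each such box; countably
  many boxes cover an open set.\<close>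

theorem fundamental_lemma_real:
  fixes f :: "'a::euclidean_space => real"
  assumes S: "open S" and f: "loc_integrable S f"
    and z: "\<And>\<psi>. \<psi> \<in> test_fun S ==> (LINT x|lebesgue_on S. \<psi> x * f x) = 0"
  shows "AE x in lebesgue_on S. f x = 0"
proof -
  have SL: "S \<in> sets lebesgue" using S by simp
  have box0: "integral (cbox a b) f = 0" if ab: "cbox a b \<subseteq> S" for a b
  proof -
    have fi: "integrable (lebesgue_on (cbox a b)) f" using f ab by (simp add: loc_integrable_def)
    have dom: "integrable (lebesgue_on S) (\<lambda>x. indicator (cbox a b) x *\<^sub>R norm (f x))"
      by (subst lebesgue_on_indicator_cong(1)[OF SL, of "cbox a b" _ "\<lambda>x. norm (f x)"])
        (use ab fi in \<open>auto simp: indicator_def\<close>)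
    have ti: "integrable (lebesgue_on S) (\<lambda>x. bump a b (real (Suc n)) x * f x)" for n
      using test_fun_mult_integrable[OF bump_test_fun[OF _ ab] f SL, of "real (Suc n)"] by simp
    have fb: "(\<lambda>x. indicator (box a b) x * f x) \<in> borel_measurable (lebesgue_on S)"
    proof -
      have 1: "(\<lambda>x. bump a b (real (Suc n)) x * f x) \<in> borel_measurable (lebesgue_on S)" for n
        using ti by auto
      have 2: "(\<lambda>n. bump a b (real (Suc n)) x * f x) \<longlonglongrightarrow> indicator (box a b) x * f x" for x
        by (intro tendsto_intros bump_tendsto)
      show ?thesis by (rule borel_measurable_LIMSEQ_real[OF 2 1])
    qed
    have "(\<lambda>n. LINT x|lebesgue_on S. bump a b (real (Suc n)) x * f x) \<longlonglongrightarrow> (LINT x|lebesgue_on S. indicator (box a b) x * f x)"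
    proof (rule integral_dominated_convergence[OF fb _ dom])
      show "(\<lambda>x. bump a b (real (Suc n)) x * f x) \<in> borel_measurable (lebesgue_on S)" for n using ti by auto
      show "AE x in lebesgue_on S. (\<lambda>n. bump a b (real (Suc n)) x * f x) \<longlonglongrightarrow> indicator (box a b) x * f x"
        by (intro AE_I2 tendsto_intros bump_tendsto)
      show "AE x in lebesgue_on S. norm (bump a b (real (Suc n)) x * f x) \<le> indicator (cbox a b) x *\<^sub>R norm (f x)" for n
      proof (rule AE_I2)
        fix x
        show "norm (bump a b (real (Suc n)) x * f x) \<le> indicator (cbox a b) x *\<^sub>R norm (f x)"
        proof (cases "x \<in> box a b")
          case True
          then show ?thesis using bump_bounds[of a b "real (Suc n)" x] subsetD[OF box_subset_cbox True]
            by (simp add: abs_mult mult_left_le_one_le)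
        next
          case False
          then have "bump a b (real (Suc n)) x = 0" using bump_nonzero[of "real (Suc n)" a b x] by simp
          then show ?thesis by simp
        qed
      qed
    qed
    moreover have "(LINT x|lebesgue_on S. bump a b (real (Suc n)) x * f x) = 0" for n
      using z[OF bump_test_fun[OF _ ab], of "real (Suc n)"] by simp
    ultimately have "(LINT x|lebesgue_on S. indicator (box a b) x * f x) = 0"
      by (simp add: LIMSEQ_const_iff)
    moreover have "(LINT x|lebesgue_on S. indicator (box a b) x * f x) = (LINT x|lebesgue_on (box a b). f x)"
      by (rule lebesgue_on_indicator_cong(2)[OF SL])
        (use ab subsetD[OF box_subset_cbox, of _ a b] in \<open>auto simp: indicator_def\<close>)
    moreover have "integrable (lebesgue_on (box a b)) f"
    proof -
      have "integrable (lebesgue_on (cbox a b)) (\<lambda>x. indicator (box a b) x *\<^sub>R f x)"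
        using fi by (intro integrable_mult_indicator) (auto simp: sets_restrict_space_iff box_subset_cbox)
      then show ?thesis
        by (subst (asm) lebesgue_on_indicator_cong(1)[of "cbox a b" "box a b" _ f])
          (use subsetD[OF box_subset_cbox, of _ a b] in \<open>auto simp: indicator_def\<close>)
    qed
    ultimately show ?thesis using lebesgue_integral_eq_integral[of "box a b" f] by (simp add: integral_open_interval)
  qed
  obtain \<D> where \<D>: "countable \<D>" "\<Union>\<D> = S" "\<And>X. X \<in> \<D> ==> \<exists>a b. X = cbox a b"
    using open_countable_Union_open_cbox[OF S] by metis
  have "AE x in lebesgue. \<forall>X\<in>\<D>. x \<in> X \<longrightarrow> f x = 0"
  proof (subst AE_ball_countable[OF \<D>(1)], rule ballI)
    fix X assume X: "X \<in> \<D>"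
    then obtain a b where ab: "X = cbox a b" using \<D>(3) by blast
    have sub: "cbox a b \<subseteq> S" using X \<D>(2) ab by auto
    have "AE x in lebesgue_on (cbox a b). f x = 0"
    proof (rule AE_zero_if_box_integrals_zero)
      show "integrable (lebesgue_on (cbox a b)) f" using f sub by (simp add: loc_integrable_def)
    qed (use box0 sub in blast)
    then show "AE x in lebesgue. x \<in> X \<longrightarrow> f x = 0" unfolding ab by (simp add: AE_restrict_space_iff)
  qed
  then show ?thesis using SL \<D>(2) by (auto simp: AE_restrict_space_iff elim!: eventually_mono)
qed

theorem fundamental_lemma:
  fixes g :: "'a::euclidean_space => 'b::euclidean_space"
  assumes S: "open S" and g: "loc_integrable S g"
    and z: "\<And>\<psi>. \<psi> \<in> test_fun S ==> (LINT x|lebesgue_on S. \<psi> x *\<^sub>R g x) = 0"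
  shows "AE x in lebesgue_on S. g x = 0"
proof -
  have "AE x in lebesgue_on S. g x \<bullet> i = 0" for i
  proof (rule fundamental_lemma_real[OF S])
    show "loc_integrable S (\<lambda>x. g x \<bullet> i)" using g by (auto simp: loc_integrable_def)
    fix \<psi> :: "'a => real" assume \<psi>: "\<psi> \<in> test_fun S"
    have "(LINT x|lebesgue_on S. \<psi> x *\<^sub>R g x) \<bullet> i = (LINT x|lebesgue_on S. (\<psi> x *\<^sub>R g x) \<bullet> i)"
      using test_fun_mult_integrable[OF \<psi> g] S by (intro integral_inner_left[symmetric]) simp
    then show "(LINT x|lebesgue_on S. \<psi> x * (g x \<bullet> i)) = 0" using z[OF \<psi>] by simp
  qed
  then have "AE x in lebesgue_on S. \<forall>i\<in>Basis. g x \<bullet> i = 0"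
    by (subst AE_ball_countable) (auto intro: countable_finite)
  then show ?thesis by eventually_elim (auto intro: euclidean_eqI)
qed

section \<open>The space L2\<close>

locale bounded_open =
  fixes S :: "'a::euclidean_space set"
  assumes S_open: "open S" and S_bounded: "bounded S"
begin

lemma S_sets [simp]: "S \<in> sets lebesgue" using S_open by simp

lemma S_lmeasurable: "S \<in> lmeasurable"
  using S_bounded S_sets by (rule bounded_set_imp_lmeasurable)

sublocale finite_measure "lebesgue_on S" by (rule finite_measure_lebesgue_on[OF S_lmeasurable])

sublocale complete_measure "lebesgue_on S" by (rule complete_measure_lebesgue_on[OF S_sets])

lemma bochner_L2: "bochner (UNIV :: 'b::euclidean_space set) norm (lebesgue_on S)"
proof -
  interpret seminormed "UNIV :: 'b set" norm by unfold_locales (auto simp: norm_triangle_ineq)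
  show ?thesis ..
qed

text \<open>For Euclidean values measurability and strong measurability coincide, so the theory of
  Bochner spaces, completeness included, carries over to functions on \<open>S\<close>.\<close>

lemma L2_space_eq: "L2_space S = L2b (lebesgue_on S) (UNIV :: 'b::euclidean_space set) norm"
proof -
  interpret bochner "UNIV :: 'b set" norm "lebesgue_on S" by (rule bochner_L2)
  have "SM f" if "f \<in> borel_measurable (lebesgue_on S)" for f :: "'a => 'b"
  proof -
    obtain F where F: "\<And>i. simple_function (lebesgue_on S) (F i)"
       "\<And>t. t \<in> space (lebesgue_on S) ==> (\<lambda>i. F i t) \<longlonglongrightarrow> f t"
      using borel_measurable_implies_sequence_metric[OF \<open>f \<in> borel_measurable (lebesgue_on S)\<close>, of 0] by metis
    show ?thesis
    proof (rule SM_I[OF F(1)])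
      show "AE t in lebesgue_on S. (\<lambda>n. norm (f t - F n t)) \<longlonglongrightarrow> 0"
      proof (rule AE_I2)
        fix t assume "t \<in> space (lebesgue_on S)"
        from tendsto_diff[OF tendsto_const F(2)[OF this], of "f t"]
        show "(\<lambda>n. norm (f t - F n t)) \<longlonglongrightarrow> 0" by (simp add: tendsto_norm_zero_iff)
      qed
    qed auto
  qed
  moreover have "f \<in> borel_measurable (lebesgue_on S)" if f: "SM f" for f :: "'a => 'b"
  proof -
    obtain s where s: "\<And>n. simple_function (lebesgue_on S) (s n)" "AE t in lebesgue_on S. (\<lambda>n. norm (f t - s n t)) \<longlonglongrightarrow> 0"
      using f by (rule SM_E) blast
    show ?thesis
    proof (rule borel_measurable_AE_limit[of s])
      show "s n \<in> borel_measurable (lebesgue_on S)" for n using s(1) by (rule borel_measurable_simple_function)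
      show "AE t in lebesgue_on S. (\<lambda>n. s n t) \<longlonglongrightarrow> f t"
        using s(2)
      proof eventually_elim
        case (elim t)
        then have "(\<lambda>n. f t - (f t - s n t)) \<longlonglongrightarrow> f t - 0" by (intro tendsto_intros) (simp add: tendsto_norm_zero_iff)
        then show ?case by simp
      qed
    qed
  qed
  ultimately show ?thesis unfolding L2_space_def L2b_def by blast
qed

lemma L2_measurable: "f \<in> L2_space S ==> f \<in> borel_measurable (lebesgue_on S)"
  and L2_integrable: "f \<in> L2_space S ==> integrable (lebesgue_on S) (\<lambda>x. (norm (f x))^2)"
  by (auto simp: L2_space_def)

lemma L2_bound:
  assumes "f \<in> borel_measurable (lebesgue_on S)" "integrable (lebesgue_on S) g" "AE x in lebesgue_on S. (norm (f x))^2 \<le> g x"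
  shows "f \<in> L2_space S"
  using assms unfolding L2_space_def
  by (auto intro!: Bochner_Integration.integrable_bound[OF assms(2)] borel_measurable_power borel_measurable_norm)

lemma L2_pair_integrable:
  assumes f: "f \<in> L2_space S" and g: "g \<in> L2_space S"
  shows "integrable (lebesgue_on S) (\<lambda>x. norm (f x) * norm (g x))" "integrable (lebesgue_on S) (\<lambda>x. f x \<bullet> g x)"
proof -
  have m: "f \<in> borel_measurable (lebesgue_on S)" "g \<in> borel_measurable (lebesgue_on S)" using f g by (auto intro: L2_measurable)
  have i: "integrable (lebesgue_on S) (\<lambda>x. (norm (f x))^2 + (norm (g x))^2)" by (intro Bochner_Integration.integrable_add L2_integrable f g)
  have le: "norm (f x) * norm (g x) \<le> (norm (f x))^2 + (norm (g x))^2" for x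
  proof -
    have "2 * norm (f x) * norm (g x) \<le> (norm (f x))^2 + (norm (g x))^2" by (rule sum_squares_bound)
    moreover have "0 \<le> norm (f x) * norm (g x)" by simp
    ultimately show ?thesis by linarith
  qed
  show "integrable (lebesgue_on S) (\<lambda>x. norm (f x) * norm (g x))"
    by (rule Bochner_Integration.integrable_bound[OF i]) (use m le in \<open>auto intro!: borel_measurable_times borel_measurable_norm\<close>)
  show "integrable (lebesgue_on S) (\<lambda>x. f x \<bullet> g x)"
  proof (rule Bochner_Integration.integrable_bound[OF i])
    show "AE x in lebesgue_on S. norm (f x \<bullet> g x) \<le> norm ((norm (f x))^2 + (norm (g x))^2)"
      using order_trans[OF Cauchy_Schwarz_ineq2 le] by (intro AE_I2) simp
  qed (use m in measurable)
qed

lemma semi_inner_L2: "semi_inner (L2_space S :: ('a => 'b::euclidean_space) set) (L2_pair S)"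
proof -
  interpret B: bochner "UNIV :: 'b set" norm "lebesgue_on S" by (rule bochner_L2)
  have 0: "(\<lambda>_. 0) \<in> B.L2" by (rule B.L2_simple) auto
  have "subspace (L2_space S :: ('a => 'b) set)"
    unfolding subspace_def L2_space_eq plus_fun_def scaleR_fun_def zero_fun_def
    using B.L2_add B.L2_scaleR 0 by blast
  then show ?thesis
  proof (unfold_locales)
    fix f g k :: "'a => 'b" assume "f \<in> L2_space S" "g \<in> L2_space S" "k \<in> L2_space S"
    then show "L2_pair S (f + g) k = L2_pair S f k + L2_pair S g k"
      by (simp add: L2_pair_def inner_add_left L2_pair_integrable)
  next
    fix c and f k :: "'a => 'b" assume "f \<in> L2_space S" "k \<in> L2_space S"
    then show "L2_pair S (c *\<^sub>R f) k = c * L2_pair S f k"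
      by (simp add: L2_pair_def)
  qed (auto simp: L2_pair_def inner_commute)
qed

lemma L2_norm_eq: "L2_norm S f = sqrt (L2_pair S f f)"
  by (simp add: L2_norm_def L2_pair_def power2_norm_eq_inner)

lemma L2_norm_square: "(L2_norm S f)^2 = (LINT x|lebesgue_on S. (norm (f x))^2)"
  by (simp add: L2_norm_def)

lemma hnorm_L2: "semi_inner.hnorm (L2_pair S) f = L2_norm S f"
proof -
  interpret semi_inner "L2_space S :: ('a => 'b) set" "L2_pair S" by (rule semi_inner_L2)
  show ?thesis by (simp add: hnorm_def L2_norm_eq)
qed

lemma L2_Cauchy_Schwarz:
  assumes "f \<in> L2_space S" "g \<in> L2_space S"
  shows "\<bar>L2_pair S f g\<bar> \<le> L2_norm S f * L2_norm S g"
proof -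
  interpret semi_inner "L2_space S :: ('a => 'b) set" "L2_pair S" by (rule semi_inner_L2)
  show "\<bar>L2_pair S f g\<bar> \<le> L2_norm S f * L2_norm S g" using Cauchy_Schwarz[OF assms] by (simp add: hnorm_L2)
qed

lemma L2_norm_Cauchy_Schwarz:
  fixes f :: "'a => 'b::euclidean_space" and g :: "'a => 'c::euclidean_space"
  assumes "f \<in> L2_space S" "g \<in> L2_space S"
  shows "integrable (lebesgue_on S) (\<lambda>x. norm (f x) * norm (g x))"
    and "(LINT x|lebesgue_on S. norm (f x) * norm (g x)) \<le> L2_norm S f * L2_norm S g"
proof -
  have n: "(\<lambda>x. norm (f x)) \<in> L2_space S" "(\<lambda>x. norm (g x)) \<in> L2_space S"
    using assms by (auto simp: L2_space_def)
  show "integrable (lebesgue_on S) (\<lambda>x. norm (f x) * norm (g x))" using L2_pair_integrable(1)[OF n] by simp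
  show "(LINT x|lebesgue_on S. norm (f x) * norm (g x)) \<le> L2_norm S f * L2_norm S g"
    using L2_Cauchy_Schwarz[OF n] by (simp add: L2_pair_def L2_norm_def)
qed

lemma seminormed_L2: "seminormed (L2_space S :: ('a => 'b::euclidean_space) set) (L2_norm S)"
proof -
  interpret semi_inner "L2_space S :: ('a => 'b) set" "L2_pair S" by (rule semi_inner_L2)
  have "hnorm = L2_norm S" by (auto simp: hnorm_L2)
  then show ?thesis using seminormed_hnorm by simp
qed

lemma L2_space_complete:
  fixes f :: "nat => 'a => 'b::euclidean_space"
  assumes f: "\<And>n. f n \<in> L2_space S" and Cauchy: "\<And>e. e > 0 ==> \<exists>K. \<forall>m\<ge>K. \<forall>n\<ge>K. L2_norm S (f m - f n) < e"
  obtains g r where "g \<in> L2_space S" "(\<lambda>n. L2_norm S (g - f n)) \<longlonglongrightarrow> 0"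
    "strict_mono r" "AE x in lebesgue_on S. (\<lambda>n. f (r n) x) \<longlonglongrightarrow> g x"
proof -
  interpret B: bochner "UNIV :: 'b set" norm "lebesgue_on S" by (rule bochner_L2)
  have complete: "semi_complete (UNIV :: 'b set) norm"
    unfolding semi_complete_def
  proof (intro allI impI)
    fix x :: "nat => 'b" assume *: "(\<forall>n. x n \<in> UNIV) \<and> (\<forall>e>0. \<exists>K. \<forall>m\<ge>K. \<forall>n\<ge>K. norm (x m - x n) < e)"
    then have "Cauchy x" by (intro CauchyI) blast
    then obtain y where "x \<longlonglongrightarrow> y" using Cauchy_convergent convergent_def by blast
    from tendsto_diff[OF tendsto_const this, of y] show "\<exists>y\<in>UNIV. (\<lambda>n. norm (y - x n)) \<longlonglongrightarrow> 0"
      by (auto simp: tendsto_norm_zero_iff)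
  qed
  have C2: "\<exists>K. \<forall>m\<ge>K. \<forall>n\<ge>K. (LINT x|lebesgue_on S. (norm (f m x - f n x))^2) < e" if e: "e > 0" for e
  proof -
    obtain K where K: "\<And>m n. m \<ge> K ==> n \<ge> K ==> L2_norm S (f m - f n) < sqrt e" using Cauchy[of "sqrt e"] e by auto
    have "(LINT x|lebesgue_on S. (norm (f m x - f n x))^2) < e" if "m \<ge> K" "n \<ge> K" for m n
      using K[OF that] by (simp add: L2_norm_def)
    then show ?thesis by blast
  qed
  obtain g r where g: "g \<in> B.L2" "(\<lambda>n. LINT x|lebesgue_on S. (norm (g x - f n x))^2) \<longlonglongrightarrow> 0"
    "strict_mono r" "AE x in lebesgue_on S. (\<lambda>n. norm (g x - f (r n) x)) \<longlonglongrightarrow> 0"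
    using B.L2_complete[OF complete f[unfolded L2_space_eq] C2] by blast
  have "(\<lambda>n. L2_norm S (g - f n)) \<longlonglongrightarrow> 0"
    using tendsto_real_sqrt[OF g(2)] by (simp add: L2_norm_def)
  moreover have "AE x in lebesgue_on S. (\<lambda>n. f (r n) x) \<longlonglongrightarrow> g x"
    using g(4)
  proof eventually_elim
    case (elim t)
    then have "(\<lambda>n. g t - (g t - f (r n) t)) \<longlonglongrightarrow> g t - 0" by (intro tendsto_intros) (simp add: tendsto_norm_zero_iff)
    then show ?case by simp
  qed
  ultimately show ?thesis using that g by (simp add: L2_space_eq)
qed

lemma L2_AE_cong:
  assumes "f \<in> L2_space S" "AE x in lebesgue_on S. f x = g x"
  shows "g \<in> L2_space S"
proof -
  have "g \<in> borel_measurable (lebesgue_on S)" using L2_measurable[OF assms(1)] assms(2) by (rule borel_measurable_AE_eq)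
  then show ?thesis by (rule L2_bound[OF _ L2_integrable[OF assms(1)]]) (use assms(2) in \<open>auto elim!: eventually_mono\<close>)
qed

lemma L2_pair_cong_AE:
  assumes "AE x in lebesgue_on S. f x = f' x" "AE x in lebesgue_on S. g x = g' x"
    "f \<in> L2_space S" "g \<in> L2_space S"
  shows "L2_pair S f g = L2_pair S f' g'"
  unfolding L2_pair_def
proof (rule integral_cong_AE)
  have m: "f \<in> borel_measurable (lebesgue_on S)" "g \<in> borel_measurable (lebesgue_on S)"
    "f' \<in> borel_measurable (lebesgue_on S)" "g' \<in> borel_measurable (lebesgue_on S)"
    using assms L2_AE_cong L2_measurable by blast+
  show "(\<lambda>x. f x \<bullet> g x) \<in> borel_measurable (lebesgue_on S)" "(\<lambda>x. f' x \<bullet> g' x) \<in> borel_measurable (lebesgue_on S)"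
    using m by measurable
  show "AE x in lebesgue_on S. f x \<bullet> g x = f' x \<bullet> g' x" using assms(1,2) by eventually_elim simp
qed

lemma L2_norm_zero_AE:
  assumes "f \<in> L2_space S" "L2_norm S f = 0" shows "AE x in lebesgue_on S. f x = 0"
  using assms integral_nonneg_eq_0_iff_AE[OF L2_integrable[OF assms(1)]] by (simp add: L2_norm_def)

lemma L2_loc_integrable:
  assumes f: "f \<in> L2_space S" shows "loc_integrable S f"
  unfolding loc_integrable_def
proof (intro allI impI)
  fix K assume K: "compact K \<and> K \<subseteq> S"
  then have KL: "K \<in> sets lebesgue" by (simp add: compact_imp_closed borel_closed)
  have "integrable (lebesgue_on S) f"
    using square_integrable_imp_integrable[of "\<lambda>x. norm (f x)"] L2_measurable[OF f] L2_integrable[OF f] by (simp add: integrable_norm_iff)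
  then have "integrable (lebesgue_on S) (\<lambda>x. indicator K x *\<^sub>R f x)"
    using KL K by (intro integrable_mult_indicator) (auto simp: sets_restrict_space_iff)
  then show "integrable (lebesgue_on K) f"
    by (subst (asm) lebesgue_on_indicator_cong(1)[of S K _ f]) (use KL K in \<open>auto simp: indicator_def\<close>)
qed

end

section \<open>Sobolev spaces\<close>

context seminormed begin

lemma norm_closure_subspace:
  assumes A: "subspace A" "A \<subseteq> X"
  shows "subspace (norm_closure X N A)"
proof (rule subspaceI)
  have "\<exists>y\<in>A. N (0 - y) < e" if "e > 0" for e :: real using that A by (intro bexI[of _ 0]) (auto simp: subspace_0)
  then show "0 \<in> norm_closure X N A" by (auto simp: norm_closure_def)
next
  fix x y assume x: "x \<in> norm_closure X N A" and y: "y \<in> norm_closure X N A"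
  then have xy: "x \<in> X" "y \<in> X" by (auto simp: norm_closure_def)
  have "\<exists>z\<in>A. N (x + y - z) < e" if "e > 0" for e :: real
  proof -
    have e: "e/2 > 0" using that by simp
    obtain x' where x': "x' \<in> A" "N (x - x') < e/2" using x e unfolding norm_closure_def by blast
    obtain y' where y': "y' \<in> A" "N (y - y') < e/2" using y e unfolding norm_closure_def by blast
    have "N ((x - x') + (y - y')) \<le> N (x - x') + N (y - y')"
      using xy x' y' A by (intro triangle diff_mem) auto
    then have "N (x + y - (x' + y')) < e" using x' y' by (simp add: add_diff_add)
    then show ?thesis using x' y' A by (intro bexI[of _ "x' + y'"]) (auto simp: subspace_add)
  qed
  then show "x + y \<in> norm_closure X N A" using xy by (auto simp: norm_closure_def)
next
  fix c x assume x: "x \<in> norm_closure X N A"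
  then have xX: "x \<in> X" by (auto simp: norm_closure_def)
  have "\<exists>z\<in>A. N (c *\<^sub>R x - z) < e" if e: "e > 0" for e :: real
  proof -
    have "e / (\<bar>c\<bar> + 1) > 0" using e by simp
    then obtain x' where x': "x' \<in> A" "N (x - x') < e / (\<bar>c\<bar> + 1)" using x unfolding norm_closure_def by blast
    have xx: "x - x' \<in> X" using xX x' A by auto
    have "N (c *\<^sub>R x - c *\<^sub>R x') = \<bar>c\<bar> * N (x - x')" using homogeneous[OF xx, of c] by (simp add: scaleR_diff_right)
    also have "\<dots> \<le> (\<bar>c\<bar> + 1) * N (x - x')" using xx by (intro mult_right_mono) auto
    also have "\<dots> < e" using x'(2) by (simp add: field_simps)
    finally show ?thesis using x' A by (intro bexI[of _ "c *\<^sub>R x'"]) (auto simp: subspace_scale)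
  qed
  then show "c *\<^sub>R x \<in> norm_closure X N A" using xX by (auto simp: norm_closure_def)
qed

lemma norm_closure_seminormed:
  assumes A: "subspace A" "A \<subseteq> X" shows "seminormed (norm_closure X N A) N"
proof
  show "subspace (norm_closure X N A)" using A by (rule norm_closure_subspace)
qed (auto simp: norm_closure_def intro: triangle homogeneous)

lemma norm_closure_complete:
  assumes A: "A \<subseteq> X" and complete: "semi_complete X N"
  shows "semi_complete (norm_closure X N A) N"
  unfolding semi_complete_def
proof (intro allI impI, elim conjE)
  fix x :: "nat => 'x" assume x: "\<forall>n. x n \<in> norm_closure X N A" and C: "\<forall>e>0. \<exists>K. \<forall>m\<ge>K. \<forall>n\<ge>K. N (x m - x n) < e"
  have xX: "x n \<in> X" for n using x by (auto simp: norm_closure_def)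
  obtain y where y: "y \<in> X" "(\<lambda>n. N (y - x n)) \<longlonglongrightarrow> 0"
    by (rule semi_completeE[OF complete, of x]) (use C xX in blast)+
  have "y \<in> norm_closure X N A"
    unfolding norm_closure_def
  proof (intro CollectI conjI y(1) allI impI)
    fix e :: real assume "e > 0"
    then have e: "e/2 > 0" by simp
    obtain n where n: "N (y - x n) < e/2"
      using order_tendstoD(2)[OF y(2) e] eventually_happens'[OF sequentially_bot] by blast
    have "\<exists>z\<in>A. N (x n - z) < e/2" using x e unfolding norm_closure_def by blast
    then obtain z where z: "z \<in> A" "N (x n - z) < e/2" by blast
    then have "N (y - z) \<le> N (y - x n) + N (x n - z)" using y xX A by (intro triangle_3) auto
    then show "\<exists>z\<in>A. N (y - z) < e" using n z by (intro bexI[of _ z]) auto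
  qed
  then show "\<exists>y\<in>norm_closure X N A. (\<lambda>n. N (y - x n)) \<longlonglongrightarrow> 0" using y by blast
qed

end

context bounded_open begin

lemma loc_integrable_add: "loc_integrable S f ==> loc_integrable S g ==> loc_integrable S (\<lambda>x. f x + g x)"
  and loc_integrable_scaleR: "loc_integrable S f ==> loc_integrable S (\<lambda>x. c *\<^sub>R f x)"
  by (auto simp: loc_integrable_def)

lemma has_weak_derivD:
  assumes "has_weak_deriv S e f g"
  shows "loc_integrable S f" "loc_integrable S g"
    "\<And>\<psi>. \<psi> \<in> test_fun S ==> (LINT x|lebesgue_on S. dir_deriv e \<psi> x *\<^sub>R f x) = - (LINT x|lebesgue_on S. \<psi> x *\<^sub>R g x)"
  using assms by (auto simp: has_weak_deriv_def)

lemma has_weak_deriv_add: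
  assumes f: "has_weak_deriv S e f g" and f': "has_weak_deriv S e f' g'" and e: "e \<in> Basis"
  shows "has_weak_deriv S e (\<lambda>x. f x + f' x) (\<lambda>x. g x + g' x)"
proof -
  note F = has_weak_derivD[OF f] and F' = has_weak_derivD[OF f']
  have "(LINT x|lebesgue_on S. dir_deriv e \<psi> x *\<^sub>R (f x + f' x)) = - (LINT x|lebesgue_on S. \<psi> x *\<^sub>R (g x + g' x))"
    if \<psi>: "\<psi> \<in> test_fun S" for \<psi>
    using test_fun_mult_integrable[OF test_fun_dir_deriv[OF \<psi> e] F(1)] test_fun_mult_integrable[OF test_fun_dir_deriv[OF \<psi> e] F'(1)]
      test_fun_mult_integrable[OF \<psi> F(2)] test_fun_mult_integrable[OF \<psi> F'(2)] F(3)[OF \<psi>] F'(3)[OF \<psi>]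
    by (simp add: scaleR_add_right)
  then show ?thesis using F F' by (simp add: has_weak_deriv_def loc_integrable_add)
qed

lemma has_weak_deriv_scaleR:
  assumes f: "has_weak_deriv S e f g"
  shows "has_weak_deriv S e (\<lambda>x. c *\<^sub>R f x) (\<lambda>x. c *\<^sub>R g x)"
proof -
  note F = has_weak_derivD[OF f]
  have "(LINT x|lebesgue_on S. dir_deriv e \<psi> x *\<^sub>R (c *\<^sub>R f x)) = - (LINT x|lebesgue_on S. \<psi> x *\<^sub>R (c *\<^sub>R g x))"
    if \<psi>: "\<psi> \<in> test_fun S" for \<psi>
    using F(3)[OF \<psi>] by (simp only: scaleR_left_commute[of _ c] integral_scaleR_right scaleR_minus_right)
  then show ?thesis using F by (simp add: has_weak_deriv_def loc_integrable_scaleR)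
qed

lemma has_weak_deriv_unique:
  fixes f :: "'a => 'b::euclidean_space"
  assumes f: "has_weak_deriv S e f g" and f': "has_weak_deriv S e f g'"
  shows "AE x in lebesgue_on S. g x = g' x"
proof -
  note F = has_weak_derivD[OF f] and F' = has_weak_derivD[OF f']
  have "AE x in lebesgue_on S. g x - g' x = 0"
  proof (rule fundamental_lemma[OF S_open])
    show "loc_integrable S (\<lambda>x. g x - g' x)" using F(2) F'(2) by (auto simp: loc_integrable_def)
    fix \<psi> :: "'a => real" assume \<psi>: "\<psi> \<in> test_fun S"
    show "(LINT x|lebesgue_on S. \<psi> x *\<^sub>R (g x - g' x)) = 0"
      using test_fun_mult_integrable[OF \<psi> F(2)] test_fun_mult_integrable[OF \<psi> F'(2)] F(3)[OF \<psi>] F'(3)[OF \<psi>]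
      by (simp add: scaleR_diff_right)
  qed
  then show ?thesis by eventually_elim simp
qed

lemma L2_tendsto_integral:
  fixes f :: "nat => 'a => 'b::euclidean_space"
  assumes \<psi>: "\<psi> \<in> test_fun S" and f: "\<And>n. f n \<in> L2_space S" "g \<in> L2_space S" and lim: "(\<lambda>n. L2_norm S (g - f n)) \<longlonglongrightarrow> 0"
  shows "(\<lambda>n. LINT x|lebesgue_on S. \<psi> x *\<^sub>R f n x) \<longlonglongrightarrow> (LINT x|lebesgue_on S. \<psi> x *\<^sub>R g x)"
proof -
  interpret L: seminormed "L2_space S :: ('a => 'b) set" "L2_norm S" by (rule seminormed_L2)
  obtain B where B: "B \<ge> 0" "\<And>x. norm (\<psi> x) \<le> B" using test_fun_bounded[OF \<psi>] by blast
  have \<psi>L: "\<psi> \<in> L2_space S"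
    by (rule L2_bound[OF borel_lebesgue_on[OF test_fun_borel[OF \<psi>]], of "\<lambda>_. B^2"]) (use power_mono[OF B(2), where n = 2] in auto)
  note ti = test_fun_mult_integrable[OF \<psi> L2_loc_integrable]
  show ?thesis
  proof (rule Lim_null[THEN iffD2], rule Lim_null_comparison)
    show "(\<lambda>n. L2_norm S \<psi> * L2_norm S (g - f n)) \<longlonglongrightarrow> 0" using tendsto_mult_right_zero[OF lim] .
    show "\<forall>\<^sub>F n in sequentially. norm ((LINT x|lebesgue_on S. \<psi> x *\<^sub>R f n x) - (LINT x|lebesgue_on S. \<psi> x *\<^sub>R g x)) \<le> L2_norm S \<psi> * L2_norm S (g - f n)"
    proof (intro always_eventually allI)
      fix n
      have d: "g - f n \<in> L2_space S" using f by auto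
      have "(LINT x|lebesgue_on S. \<psi> x *\<^sub>R f n x) - (LINT x|lebesgue_on S. \<psi> x *\<^sub>R g x) = - (LINT x|lebesgue_on S. \<psi> x *\<^sub>R (g - f n) x)"
        using ti[OF f(1)[of n]] ti[OF f(2)] by (simp add: scaleR_diff_right)
      then have "norm ((LINT x|lebesgue_on S. \<psi> x *\<^sub>R f n x) - (LINT x|lebesgue_on S. \<psi> x *\<^sub>R g x)) \<le> (LINT x|lebesgue_on S. norm (\<psi> x *\<^sub>R (g - f n) x))"
        using integral_norm_bound[of "lebesgue_on S" "\<lambda>x. \<psi> x *\<^sub>R (g - f n) x"] by simp
      also have "\<dots> \<le> L2_norm S \<psi> * L2_norm S (g - f n)"
        using L2_norm_Cauchy_Schwarz(2)[OF \<psi>L d] by simp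
      finally show "norm ((LINT x|lebesgue_on S. \<psi> x *\<^sub>R f n x) - (LINT x|lebesgue_on S. \<psi> x *\<^sub>R g x)) \<le> L2_norm S \<psi> * L2_norm S (g - f n)" .
    qed
  qed
qed

text \<open>The weak derivative is a closed operator: both sides of its defining identity are
  continuous in the L2 norm.\<close>

lemma has_weak_deriv_limit:
  fixes f :: "nat => 'a => 'b::euclidean_space"
  assumes fg: "\<And>n. has_weak_deriv S e (f n) (g n)" and e: "e \<in> Basis" and L2: "\<And>n. f n \<in> L2_space S" "\<And>n. g n \<in> L2_space S" "f' \<in> L2_space S" "g' \<in> L2_space S"
    and lim: "(\<lambda>n. L2_norm S (f' - f n)) \<longlonglongrightarrow> 0" "(\<lambda>n. L2_norm S (g' - g n)) \<longlonglongrightarrow> 0"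
  shows "has_weak_deriv S e f' g'"
  unfolding has_weak_deriv_def
proof (intro conjI ballI L2_loc_integrable L2)
  fix \<psi> :: "'a => real" assume \<psi>: "\<psi> \<in> test_fun S"
  have "(\<lambda>n. LINT x|lebesgue_on S. dir_deriv e \<psi> x *\<^sub>R f n x) \<longlonglongrightarrow> (LINT x|lebesgue_on S. dir_deriv e \<psi> x *\<^sub>R f' x)"
    by (rule L2_tendsto_integral[OF test_fun_dir_deriv[OF \<psi> e] L2(1,3) lim(1)])
  moreover have "(\<lambda>n. - (LINT x|lebesgue_on S. \<psi> x *\<^sub>R g n x)) \<longlonglongrightarrow> - (LINT x|lebesgue_on S. \<psi> x *\<^sub>R g' x)"
    by (intro tendsto_minus L2_tendsto_integral[OF \<psi> L2(2,4) lim(2)])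
  moreover have "(LINT x|lebesgue_on S. dir_deriv e \<psi> x *\<^sub>R f n x) = - (LINT x|lebesgue_on S. \<psi> x *\<^sub>R g n x)" for n
    by (rule has_weak_derivD(3)[OF fg \<psi>])
  ultimately show "(LINT x|lebesgue_on S. dir_deriv e \<psi> x *\<^sub>R f' x) = - (LINT x|lebesgue_on S. \<psi> x *\<^sub>R g' x)"
    by (simp add: LIMSEQ_unique)
qed

lemma weak_deriv_AE_eq: "has_weak_deriv S e f g ==> AE x in lebesgue_on S. weak_deriv S e f x = g x"
  unfolding weak_deriv_def by (rule has_weak_deriv_unique[OF someI[of "has_weak_deriv S e f"]])

lemma W12_L2: "f \<in> W12_space S ==> f \<in> L2_space S"
  by (simp add: W12_space_def)

lemma W12_weak_deriv:
  assumes "f \<in> W12_space S" "e \<in> Basis"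
  shows "has_weak_deriv S e f (weak_deriv S e f)" "weak_deriv S e f \<in> L2_space S"
proof -
  obtain g where g: "g \<in> L2_space S" "has_weak_deriv S e f g" using assms by (auto simp: W12_space_def)
  show "has_weak_deriv S e f (weak_deriv S e f)" unfolding weak_deriv_def by (rule someI[of "has_weak_deriv S e f", OF g(2)])
  have "AE x in lebesgue_on S. g x = weak_deriv S e f x" using weak_deriv_AE_eq[OF g(2)] by eventually_elim simp
  then show "weak_deriv S e f \<in> L2_space S" by (rule L2_AE_cong[OF g(1)])
qed

text \<open>\<open>weak_deriv\<close> is an arbitrary choice of representative, so its linearity can
  be claimed almost everywhere only; integrals do not see the difference.\<close>

lemma weak_deriv_add_AE:
  assumes "f \<in> W12_space S" "g \<in> W12_space S" "e \<in> Basis"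
  shows "AE x in lebesgue_on S. weak_deriv S e (f + g) x = (weak_deriv S e f + weak_deriv S e g) x"
  unfolding plus_fun_def
  by (rule weak_deriv_AE_eq[OF has_weak_deriv_add]) (use assms W12_weak_deriv in auto)

lemma weak_deriv_scaleR_AE:
  assumes "f \<in> W12_space S" "e \<in> Basis"
  shows "AE x in lebesgue_on S. weak_deriv S e (c *\<^sub>R f) x = (c *\<^sub>R weak_deriv S e f) x"
  unfolding scaleR_fun_def
  by (rule weak_deriv_AE_eq[OF has_weak_deriv_scaleR]) (use assms W12_weak_deriv in auto)

lemma W12_subspace: "subspace (W12_space S :: ('a => 'b::euclidean_space) set)"
proof -
  interpret L: semi_inner "L2_space S :: ('a => 'b) set" "L2_pair S" by (rule semi_inner_L2)
  have z: "has_weak_deriv S e (0 :: 'a => 'b) 0" for e by (simp add: has_weak_deriv_def loc_integrable_def zero_fun_def)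
  show ?thesis
    unfolding subspace_def
  proof (intro conjI ballI allI)
    show "0 \<in> (W12_space S :: ('a => 'b) set)" using z L.H_mem(1) by (auto simp: W12_space_def)
    fix f g :: "'a => 'b" assume f: "f \<in> W12_space S" and g: "g \<in> W12_space S"
    have "\<exists>k\<in>L2_space S. has_weak_deriv S e (f + g) k" if e: "e \<in> Basis" for e
      using has_weak_deriv_add[OF W12_weak_deriv(1)[OF f e] W12_weak_deriv(1)[OF g e] e]
        L.H_mem(2)[OF W12_weak_deriv(2)[OF f e] W12_weak_deriv(2)[OF g e]] unfolding plus_fun_def by blast
    then show "f + g \<in> W12_space S" using L.H_mem(2)[OF W12_L2[OF f] W12_L2[OF g]] by (auto simp: W12_space_def)
  next
    fix c and f :: "'a => 'b" assume f: "f \<in> W12_space S"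
    have "\<exists>k\<in>L2_space S. has_weak_deriv S e (c *\<^sub>R f) k" if e: "e \<in> Basis" for e
      using has_weak_deriv_scaleR[OF W12_weak_deriv(1)[OF f e], of c]
        L.H_mem(4)[OF W12_weak_deriv(2)[OF f e], of c] unfolding scaleR_fun_def by blast
    then show "c *\<^sub>R f \<in> W12_space S" using L.H_mem(4)[OF W12_L2[OF f]] by (auto simp: W12_space_def)
  qed
qed

definition w12 :: "('a => 'b::euclidean_space) => ('a => 'b) => real" where
  "w12 f g = L2_pair S f g + (\<Sum>e\<in>Basis. L2_pair S (weak_deriv S e f) (weak_deriv S e g))"

lemma weak_deriv_pair_add:
  assumes "f \<in> W12_space S" "g \<in> W12_space S" "k \<in> L2_space S" "e \<in> Basis"
  shows "L2_pair S (weak_deriv S e (f + g)) k = L2_pair S (weak_deriv S e f) k + L2_pair S (weak_deriv S e g) k"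
proof -
  interpret L: semi_inner "L2_space S :: ('a => 'b) set" "L2_pair S" by (rule semi_inner_L2)
  have fg: "f + g \<in> W12_space S" using assms W12_subspace subspace_add by blast
  have "L2_pair S (weak_deriv S e (f + g)) k = L2_pair S (weak_deriv S e f + weak_deriv S e g) k"
    by (rule L2_pair_cong_AE[OF weak_deriv_add_AE]) (use assms fg W12_weak_deriv in auto)
  then show ?thesis using assms by (simp add: L.add_left W12_weak_deriv)
qed

lemma weak_deriv_pair_scaleR:
  assumes "f \<in> W12_space S" "k \<in> L2_space S" "e \<in> Basis"
  shows "L2_pair S (weak_deriv S e (c *\<^sub>R f)) k = c * L2_pair S (weak_deriv S e f) k"
proof -
  interpret L: semi_inner "L2_space S :: ('a => 'b) set" "L2_pair S" by (rule semi_inner_L2)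
  have fg: "c *\<^sub>R f \<in> W12_space S" using assms W12_subspace subspace_scale by blast
  have "L2_pair S (weak_deriv S e (c *\<^sub>R f)) k = L2_pair S (c *\<^sub>R weak_deriv S e f) k"
    by (rule L2_pair_cong_AE[OF weak_deriv_scaleR_AE]) (use assms fg W12_weak_deriv in auto)
  then show ?thesis using assms by (simp add: L.scaleR_left W12_weak_deriv)
qed

lemma semi_inner_w12: "semi_inner (W12_space S :: ('a => 'b::euclidean_space) set) w12"
proof -
  interpret L: semi_inner "L2_space S :: ('a => 'b) set" "L2_pair S" by (rule semi_inner_L2)
  show ?thesis
  proof
    fix f g k :: "'a => 'b" assume "f \<in> W12_space S" "g \<in> W12_space S" "k \<in> W12_space S"
    then show "w12 (f + g) k = w12 f k + w12 g k"
      by (simp add: w12_def L.add_left W12_L2 weak_deriv_pair_add W12_weak_deriv sum.distrib)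
  next
    fix c and f k :: "'a => 'b" assume "f \<in> W12_space S" "k \<in> W12_space S"
    then show "w12 (c *\<^sub>R f) k = c * w12 f k"
      by (simp add: w12_def L.scaleR_left W12_L2 weak_deriv_pair_scaleR W12_weak_deriv sum_distrib_left algebra_simps)
  next
    fix f :: "'a => 'b" assume "f \<in> W12_space S"
    then show "0 \<le> w12 f f" unfolding w12_def
      by (intro add_nonneg_nonneg sum_nonneg L.nonneg W12_L2 W12_weak_deriv)
  next
    fix f g :: "'a => 'b" assume "f \<in> W12_space S" "g \<in> W12_space S"
    then show "w12 f g = w12 g f" unfolding w12_def
      by (intro arg_cong2[where f = "(+)"] sum.cong L.sym W12_L2 W12_weak_deriv) auto
  qed (rule W12_subspace)
qed

lemma W12_norm_square:
  fixes f :: "'a => 'b::euclidean_space"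
  shows "(W12_norm S f)^2 = (L2_norm S f)^2 + (\<Sum>e\<in>Basis. (L2_norm S (weak_deriv S e f))^2)"
  unfolding W12_norm_def by (rule real_sqrt_pow2) (intro add_nonneg_nonneg sum_nonneg zero_le_power2)

lemma hnorm_w12: "semi_inner.hnorm w12 = W12_norm S"
proof -
  interpret W: semi_inner "W12_space S :: ('a => 'b) set" w12 by (rule semi_inner_w12)
  have "(L2_norm S f)^2 = L2_pair S f f" for f :: "'a => 'b" by (simp add: L2_norm_square L2_pair_def power2_norm_eq_inner)
  then show ?thesis by (auto simp: W.hnorm_def W12_norm_def w12_def fun_eq_iff)
qed

lemma seminormed_W12: "seminormed (W12_space S :: ('a => 'b::euclidean_space) set) (W12_norm S)"
  using semi_inner.seminormed_hnorm[OF semi_inner_w12] unfolding hnorm_w12 .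

lemma W12_norm_nonneg: "0 \<le> W12_norm S f"
  unfolding W12_norm_def by (intro real_sqrt_ge_zero add_nonneg_nonneg sum_nonneg zero_le_power2)

lemma L2_norm_nonneg: "0 \<le> L2_norm S f"
  unfolding L2_norm_def by simp

lemma L2_le_W12: "L2_norm S f \<le> W12_norm S f"
  by (rule power2_le_imp_le[OF _ W12_norm_nonneg]) (simp add: W12_norm_square sum_nonneg)

lemma weak_deriv_le_W12: "e \<in> Basis ==> L2_norm S (weak_deriv S e f) \<le> W12_norm S f"
  by (rule power2_le_imp_le[OF _ W12_norm_nonneg])
    (simp add: W12_norm_square, intro add_increasing member_le_sum, auto)

lemma weak_deriv_diff_norm:
  assumes "f \<in> W12_space S" "g \<in> W12_space S" "e \<in> Basis"
  shows "L2_norm S (weak_deriv S e f - weak_deriv S e g) = L2_norm S (weak_deriv S e (f - g))"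
proof -
  interpret L: semi_inner "L2_space S :: ('a => 'b) set" "L2_pair S" by (rule semi_inner_L2)
  have fg: "f - g \<in> W12_space S" using assms W12_subspace subspace_diff by blast
  have ae: "AE x in lebesgue_on S. weak_deriv S e (f - g) x = (weak_deriv S e f - weak_deriv S e g) x"
    using weak_deriv_add_AE[OF fg assms(2,3)] by eventually_elim simp
  have "L2_pair S (weak_deriv S e (f - g)) (weak_deriv S e (f - g)) =
      L2_pair S (weak_deriv S e f - weak_deriv S e g) (weak_deriv S e f - weak_deriv S e g)"
    by (rule L2_pair_cong_AE[OF ae ae]) (use fg assms W12_weak_deriv in auto)
  then show ?thesis by (simp add: L2_norm_eq)
qed

text \<open>The functions and all their first derivatives have limits in L2, and closedness of the
  weak derivative identifies the limits of the derivatives.\<close>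

theorem W12_complete: "semi_complete (W12_space S :: ('a => 'b::euclidean_space) set) (W12_norm S)"
  unfolding semi_complete_def
proof (intro allI impI, elim conjE)
  interpret W: seminormed "W12_space S :: ('a => 'b) set" "W12_norm S" by (rule seminormed_W12)
  interpret L: seminormed "L2_space S :: ('a => 'b) set" "L2_norm S" by (rule seminormed_L2)
  fix f :: "nat => 'a => 'b" assume "\<forall>n. f n \<in> W12_space S" and C: "\<forall>e>0. \<exists>K. \<forall>m\<ge>K. \<forall>n\<ge>K. W12_norm S (f m - f n) < e"
  then have f: "f n \<in> W12_space S" for n by blast
  have C1: "\<exists>K. \<forall>m\<ge>K. \<forall>n\<ge>K. L2_norm S (f m - f n) < \<epsilon>" if "\<epsilon> > 0" for \<epsilon>
    using C that order_le_less_trans[OF L2_le_W12] by meson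
  have C2: "\<exists>K. \<forall>m\<ge>K. \<forall>n\<ge>K. L2_norm S (weak_deriv S e (f m) - weak_deriv S e (f n)) < \<epsilon>" if "\<epsilon> > 0" "e \<in> Basis" for \<epsilon> e
    unfolding weak_deriv_diff_norm[OF f f that(2)] using C that order_le_less_trans[OF weak_deriv_le_W12[OF that(2)]] by meson
  obtain f' where f': "f' \<in> L2_space S" "(\<lambda>n. L2_norm S (f' - f n)) \<longlonglongrightarrow> 0"
    using L2_space_complete[OF W12_L2[OF f] C1] by blast
  have "\<exists>g. g \<in> L2_space S \<and> (\<lambda>n. L2_norm S (g - weak_deriv S e (f n))) \<longlonglongrightarrow> 0" if e: "e \<in> Basis" for e
    using L2_space_complete[OF W12_weak_deriv(2)[OF f e] C2[OF _ e]] by blast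
  then obtain g where g: "\<And>e. e \<in> Basis ==> g e \<in> L2_space S" "\<And>e. e \<in> Basis ==> (\<lambda>n. L2_norm S (g e - weak_deriv S e (f n))) \<longlonglongrightarrow> 0"
    by metis
  have wd: "has_weak_deriv S e f' (g e)" if e: "e \<in> Basis" for e
    by (rule has_weak_deriv_limit[OF W12_weak_deriv(1)[OF f e] e W12_L2[OF f] W12_weak_deriv(2)[OF f e] f'(1) g(1)[OF e] f'(2) g(2)[OF e]])
  have fW: "f' \<in> W12_space S" using f' wd g by (auto simp: W12_space_def)
  have "(\<lambda>n. W12_norm S (f' - f n)) \<longlonglongrightarrow> sqrt (0^2 + (\<Sum>e\<in>(Basis::'a set). 0^2))"
    unfolding W12_norm_def
  proof (intro tendsto_intros f'(2))
    fix e :: 'a assume e: "e \<in> Basis"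
    have "L2_norm S (g e - weak_deriv S e (f n)) = L2_norm S (weak_deriv S e (f' - f n))" for n
    proof -
      have ae: "AE x in lebesgue_on S. (weak_deriv S e f' - weak_deriv S e (f n)) x = (g e - weak_deriv S e (f n)) x"
        using weak_deriv_AE_eq[OF wd[OF e]] by eventually_elim simp
      have "L2_pair S (weak_deriv S e f' - weak_deriv S e (f n)) (weak_deriv S e f' - weak_deriv S e (f n)) =
        L2_pair S (g e - weak_deriv S e (f n)) (g e - weak_deriv S e (f n))"
        by (rule L2_pair_cong_AE[OF ae ae])
            (use L.diff_mem[OF W12_weak_deriv(2)[OF fW e] W12_weak_deriv(2)[OF f e]] in \<open>auto simp: fun_diff_def\<close>)
      then show ?thesis using weak_deriv_diff_norm[OF fW f e] by (simp add: L2_norm_eq)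
    qed
    then show "(\<lambda>n. L2_norm S (weak_deriv S e (f' - f n))) \<longlonglongrightarrow> 0" using g(2)[OF e] by simp
  qed
  then show "\<exists>y\<in>W12_space S. (\<lambda>n. W12_norm S (y - f n)) \<longlonglongrightarrow> 0" using fW by auto
qed

end

section \<open>Calculus and integrals of test functions\<close>

lemma test_fun_Ck: "\<phi> \<in> test_fun S ==> Ck k \<phi>"
  by (simp add: test_fun_def)

lemma test_fun_I:
  assumes \<phi>: "\<phi> \<in> test_fun S" and C: "\<And>k. Ck k \<psi>" and z: "\<And>x. \<phi> x = 0 ==> \<psi> x = 0"
  shows "\<psi> \<in> test_fun S"
proof -
  have cl: "closure {x. \<psi> x \<noteq> 0} \<subseteq> closure {x. \<phi> x \<noteq> 0}" using z by (intro closure_mono) auto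
  moreover have "compact (closure {x. \<psi> x \<noteq> 0})"
    using \<phi> bounded_subset[OF compact_imp_bounded cl] by (simp add: compact_eq_bounded_closed test_fun_def)
  ultimately show ?thesis using \<phi> C by (auto simp: test_fun_def)
qed

lemma test_fun_linear:
  assumes \<phi>: "\<phi> \<in> test_fun S" and L: "bounded_linear L"
  shows "(\<lambda>x. L (\<phi> x)) \<in> test_fun S"
  by (rule test_fun_I[OF \<phi> Ck_bounded_linear[OF L test_fun_Ck[OF \<phi>]]])
    (simp add: linear_0 bounded_linear.linear[OF L])

lemma test_fun_mult:
  fixes \<psi> :: "'a::euclidean_space => real"
  assumes "\<psi> \<in> test_fun S" "\<And>k. Ck k f" shows "(\<lambda>x. \<psi> x *\<^sub>R f x) \<in> test_fun S"
  by (rule test_fun_I[OF assms(1) Ck_scaleR[OF test_fun_Ck[OF assms(1)] assms(2)]]) simp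

lemma test_fun_subspace: "subspace (test_fun S :: ('a::euclidean_space => 'b::real_normed_vector) set)"
proof (rule subspaceI)
  show "0 \<in> (test_fun S :: ('a => 'b) set)" by (simp add: test_fun_def Ck_const zero_fun_def)
next
  fix f g :: "'a => 'b" assume f: "f \<in> test_fun S" and g: "g \<in> test_fun S"
  have "closure {x. (f + g) x \<noteq> 0} \<subseteq> closure ({x. f x \<noteq> 0} \<union> {x. g x \<noteq> 0})" by (rule closure_mono) auto
  then have cl: "closure {x. (f + g) x \<noteq> 0} \<subseteq> closure {x. f x \<noteq> 0} \<union> closure {x. g x \<noteq> 0}" by simp
  have "bounded (closure {x. f x \<noteq> 0} \<union> closure {x. g x \<noteq> 0})"
    using f g by (auto simp: test_fun_def compact_imp_bounded)
  from bounded_subset[OF this cl] have "compact (closure {x. (f + g) x \<noteq> 0})" by (simp add: compact_eq_bounded_closed)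
  moreover have "closure {x. (f + g) x \<noteq> 0} \<subseteq> S" using cl f g by (auto simp: test_fun_def)
  moreover have "Ck k (f + g)" for k unfolding plus_fun_def by (intro Ck_add test_fun_Ck[OF f] test_fun_Ck[OF g])
  ultimately show "f + g \<in> test_fun S" by (simp add: test_fun_def)
next
  fix c and f :: "'a => 'b" assume "f \<in> test_fun S"
  then show "c *\<^sub>R f \<in> test_fun S"
    unfolding scaleR_fun_def by (rule test_fun_linear[OF _ bounded_linear_scaleR_right])
qed

lemma test_fun_has_derivative:
  assumes "\<phi> \<in> test_fun S" shows "(\<phi> has_derivative (\<lambda>e. dir_deriv e \<phi> x)) (at x)"
  using test_fun_Ck[OF assms, of "Suc 0"] by (rule Ck_Suc_has_derivative)

lemma test_fun_support:
  fixes \<phi> :: "'a::euclidean_space => 'b::real_normed_vector"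
  assumes "\<phi> \<in> test_fun S"
  obtains R where "R > 0" "\<And>x. norm x > R ==> \<phi> x = 0"
proof -
  have "bounded (closure {x. \<phi> x \<noteq> 0})" using assms by (auto simp: test_fun_def compact_imp_bounded)
  then obtain R where R: "R > 0" "\<forall>x\<in>closure {x. \<phi> x \<noteq> 0}. norm x \<le> R" unfolding bounded_pos by blast
  have "\<phi> x = 0" if "norm x > R" for x
    using R(2) that closure_subset[of "{x. \<phi> x \<noteq> 0}"] by (auto simp: not_less[symmetric])
  with R(1) show ?thesis by (rule that)
qed

lemma borel_bounded_support_integrable:
  fixes f :: "'a::euclidean_space => 'b::euclidean_space"
  assumes "f \<in> borel_measurable borel" "\<And>x. norm (f x) \<le> B" "\<And>x. norm x > R ==> f x = 0"
  shows "integrable lborel f"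
proof (rule Bochner_Integration.integrable_bound)
  have "emeasure lborel (cball 0 R :: 'a set) < \<infinity>" by (rule emeasure_bounded_finite) simp
  then show "integrable lborel (\<lambda>x::'a. B * indicator (cball 0 R) x :: real)"
    by (intro integrable_mult_right integrable_real_indicator) auto
  have "norm (f x) \<le> B * indicator (cball 0 R) x" for x using assms(2,3)[of x] by (cases "norm x \<le> R") auto
  then show "AE x in lborel. norm (f x) \<le> norm (B * indicator (cball 0 R) x :: real)"
    by (intro AE_I2) (auto intro: order_trans[OF _ abs_ge_self])
qed (use assms in simp)

lemma test_fun_integrable:
  fixes \<phi> :: "'a::euclidean_space => 'b::euclidean_space"
  assumes "\<phi> \<in> test_fun S" shows "integrable lborel \<phi>"
proof -
  obtain B where "\<And>x. norm (\<phi> x) \<le> B" using test_fun_bounded[OF assms] by blast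
  moreover obtain R where "\<And>x. norm x > R ==> \<phi> x = 0" using test_fun_support[OF assms] by blast
  ultimately show ?thesis using test_fun_borel[OF assms] by (intro borel_bounded_support_integrable)
qed

lemma integral_lebesgue_on_lborel:
  fixes f :: "'a::euclidean_space => 'b::euclidean_space"
  assumes S: "S \<in> sets lebesgue" and f: "f \<in> borel_measurable borel" and z: "\<And>x. x \<notin> S ==> f x = 0"
  shows "integral\<^sup>L (lebesgue_on S) f = integral\<^sup>L lborel f"
    and "integrable (lebesgue_on S) f \<longleftrightarrow> integrable lborel f"
proof -
  have eq: "indicator S x *\<^sub>R f x = indicator UNIV x *\<^sub>R f x" for x using z[of x] by (auto simp: indicator_def)
  show "integral\<^sup>L (lebesgue_on S) f = integral\<^sup>L lborel f"
    using lebesgue_on_indicator_cong(2)[OF S _ eq] f by (simp add: lebesgue_on_UNIV_eq integral_completion)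
  show "integrable (lebesgue_on S) f \<longleftrightarrow> integrable lborel f"
    using lebesgue_on_indicator_cong(1)[OF S _ eq] f by (simp add: lebesgue_on_UNIV_eq integrable_completion)
qed

lemma test_fun_line:
  fixes F :: "'a::euclidean_space => 'b::real_normed_vector"
  assumes F: "F \<in> test_fun S"
  shows "((\<lambda>t. F (x + t *\<^sub>R e)) has_vector_derivative dir_deriv e F (x + t *\<^sub>R e)) (at t within A)"
proof -
  have D: "(F has_derivative (\<lambda>d. dir_deriv d F (x + t *\<^sub>R e))) (at (x + t *\<^sub>R e))" by (rule test_fun_has_derivative[OF F])
  interpret linear "\<lambda>d. dir_deriv d F (x + t *\<^sub>R e)" using D has_derivative_linear by blast
  have "((\<lambda>t. F (x + t *\<^sub>R e)) has_derivative (\<lambda>s. dir_deriv (s *\<^sub>R e) F (x + t *\<^sub>R e))) (at t within A)"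
    by (rule has_derivative_compose[of "\<lambda>t. x + t *\<^sub>R e" "\<lambda>s. s *\<^sub>R e"]) (auto intro!: derivative_eq_intros D)
  then show ?thesis by (simp add: has_vector_derivative_def scale)
qed

lemma test_fun_lipschitz:
  fixes F :: "'a::euclidean_space => 'b::euclidean_space"
  assumes F: "F \<in> test_fun S" and C: "\<And>x. norm (dir_deriv e F x) \<le> C"
  shows "norm (F (x + h *\<^sub>R e) - F x) \<le> C * \<bar>h\<bar>"
proof -
  have "norm (F (x + h *\<^sub>R e) - F (x + 0 *\<^sub>R e)) \<le> C * norm (h - 0)"
  proof (rule differentiable_bound[OF convex_UNIV test_fun_line[OF F, unfolded has_vector_derivative_def]])
    fix t show "onorm (\<lambda>s. s *\<^sub>R dir_deriv e F (x + t *\<^sub>R e)) \<le> C"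
      using mult_left_mono[OF C[of "x + t *\<^sub>R e"] abs_ge_zero] order_trans[OF norm_ge_zero C[of x]]
      by (intro onorm_bound) (auto simp: mult.commute)
  qed auto
  then show ?thesis by simp
qed

text \<open>Difference quotients have integral 0 because Lebesgue measure is translation invariant;
  dominated convergence transfers this to the derivative.\<close>

lemma test_fun_integral_dir_deriv:
  fixes F :: "'a::euclidean_space => 'b::euclidean_space"
  assumes F: "F \<in> test_fun S" and e: "e \<in> Basis"
  shows "(LINT x|lborel. dir_deriv e F x) = 0"
proof -
  define h where "h n = 1 / real (Suc n)" for n
  have h: "h n > 0" "h n \<le> 1" for n by (auto simp: h_def)
  define D where "D n x = (1 / h n) *\<^sub>R (F (x + h n *\<^sub>R e) - F x)" for n x
  obtain C where C: "C \<ge> 0" "\<And>x. norm (dir_deriv e F x) \<le> C" using test_fun_bounded[OF test_fun_dir_deriv[OF F e]] by blast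
  obtain R where R: "R > 0" "\<And>x. norm x > R ==> F x = 0" using test_fun_support[OF F] by blast
  have [measurable]: "F \<in> borel_measurable borel" by (rule test_fun_borel[OF F])
  have Fi: "integrable lborel F" by (rule test_fun_integrable[OF F])
  have shift: "(LINT x|lborel. F (x + c)) = (LINT x|lborel. F x)" "integrable lborel (\<lambda>x. F (x + c))" for c
  proof -
    have "(LINT x|distr lborel borel ((+) c). F x) = (LINT x|lborel. F (c + x))" by (rule integral_distr) auto
    then show "(LINT x|lborel. F (x + c)) = (LINT x|lborel. F x)" by (simp add: lborel_distr_plus add.commute)
    have "integrable (distr lborel borel ((+) c)) F \<longleftrightarrow> integrable lborel (\<lambda>x. F (c + x))" by (rule integrable_distr_eq) auto
    then show "integrable lborel (\<lambda>x. F (x + c))" using Fi by (simp add: lborel_distr_plus add.commute)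
  qed
  have "(\<lambda>n. LINT x|lborel. D n x) \<longlonglongrightarrow> (LINT x|lborel. dir_deriv e F x)"
  proof (rule integral_dominated_convergence)
    show "dir_deriv e F \<in> borel_measurable lborel" using test_fun_borel[OF test_fun_dir_deriv[OF F e]] by simp
    show "D n \<in> borel_measurable lborel" for n unfolding D_def[abs_def] by measurable
    \<comment> \<open>The step lengths are at most 1, so all difference quotients vanish outside the
      ball of radius \<open>R + 1\<close>; inside, the bound \<open>C\<close> on the derivative
      dominates them.\<close>
    have "emeasure lborel (cball 0 (R + 1) :: 'a set) < \<infinity>" by (rule emeasure_bounded_finite) simp
    then show "integrable lborel (\<lambda>x::'a. C * indicator (cball 0 (R + 1)) x :: real)"
      by (intro integrable_mult_right integrable_real_indicator) auto
    show "AE x in lborel. (\<lambda>n. D n x) \<longlonglongrightarrow> dir_deriv e F x"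
    proof (rule AE_I2)
      fix x
      have "((\<lambda>t. F (x + t *\<^sub>R e)) has_vector_derivative dir_deriv e F x) (at 0)"
        using test_fun_line[OF F, where t = 0 and A = UNIV] by simp
      then have "((\<lambda>t. norm (F (x + t *\<^sub>R e) - F x - t *\<^sub>R dir_deriv e F x) / norm t) \<longlongrightarrow> 0) (at 0)"
        by (simp add: has_vector_derivative_def has_derivative_at)
      then have "((\<lambda>t. norm ((F (x + t *\<^sub>R e) - F x) /\<^sub>R t - dir_deriv e F x)) \<longlongrightarrow> 0) (at 0)"
      proof (rule Lim_transform_eventually)
        have "norm (u - t *\<^sub>R d) / norm t = norm (u /\<^sub>R t - d)" if "t \<noteq> 0" for t and u d :: 'b
        proof -
          have "u /\<^sub>R t - d = (u - t *\<^sub>R d) /\<^sub>R t" using that by (simp add: scaleR_diff_right)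
          then show ?thesis by (simp add: divide_inverse mult.commute)
        qed
        then show "\<forall>\<^sub>F t in at 0. norm (F (x + t *\<^sub>R e) - F x - t *\<^sub>R dir_deriv e F x) / norm t =
            norm ((F (x + t *\<^sub>R e) - F x) /\<^sub>R t - dir_deriv e F x)"
          by (auto simp: eventually_at_filter)
      qed
      then have "((\<lambda>t. (F (x + t *\<^sub>R e) - F x) /\<^sub>R t) \<longlongrightarrow> dir_deriv e F x) (at 0)"
        by (simp add: Lim_null[of _ "dir_deriv e F x"] tendsto_norm_zero_iff)
      moreover have "filterlim h (at 0) sequentially"
        unfolding filterlim_at using h LIMSEQ_inverse_real_of_nat by (auto simp: h_def[abs_def] inverse_eq_divide)
      ultimately have "(\<lambda>n. (F (x + h n *\<^sub>R e) - F x) /\<^sub>R h n) \<longlonglongrightarrow> dir_deriv e F x" by (rule filterlim_compose)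
      then show "(\<lambda>n. D n x) \<longlonglongrightarrow> dir_deriv e F x" by (simp add: D_def inverse_eq_divide)
    qed
    show "AE x in lborel. norm (D n x) \<le> C * indicator (cball 0 (R + 1)) x" for n
    proof (rule AE_I2)
      fix x :: 'a
      show "norm (D n x) \<le> C * indicator (cball 0 (R + 1)) x"
      proof (cases "norm x \<le> R + 1")
        case True
        then show ?thesis using test_fun_lipschitz[OF F C(2), of x "h n"] h[of n] by (simp add: D_def divide_le_eq flip: scaleR_diff_right)
      next
        case False
        have "norm x \<le> norm (x + h n *\<^sub>R e) + norm (h n *\<^sub>R e)" by (metis add_diff_cancel_right' norm_triangle_ineq4)
        moreover have "norm (h n *\<^sub>R e) \<le> 1" using h[of n] e by simp
        ultimately have "norm (x + h n *\<^sub>R e) > R" "norm x > R" using False by linarith+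
        then have "D n x = 0" using R(2) by (simp add: D_def)
        then show ?thesis using False by simp
      qed
    qed
  qed
  moreover have "(LINT x|lborel. D n x) = 0" for n
    using shift Fi by (simp add: D_def)
  ultimately show ?thesis by (simp add: LIMSEQ_const_iff)
qed

lemma dir_deriv_scaleR:
  fixes \<psi> :: "'a::euclidean_space => real"
  assumes "\<psi> \<in> test_fun S" "\<phi> \<in> test_fun S'"
  shows "dir_deriv e (\<lambda>x. \<psi> x *\<^sub>R \<phi> x) x = \<psi> x *\<^sub>R dir_deriv e \<phi> x + dir_deriv e \<psi> x *\<^sub>R \<phi> x"
  by (rule dir_deriv_unique) (intro has_derivative_scaleR test_fun_has_derivative[OF assms(1)] test_fun_has_derivative[OF assms(2)])

lemma dir_deriv_linear:
  assumes "\<phi> \<in> test_fun S" "bounded_linear L"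
  shows "dir_deriv e (\<lambda>x. L (\<phi> x)) x = L (dir_deriv e \<phi> x)"
  by (rule dir_deriv_unique[OF bounded_linear.has_derivative[OF assms(2) test_fun_has_derivative[OF assms(1)]]])

lemma dir_deriv_norm_square:
  fixes \<phi> :: "'a::euclidean_space => 'b::euclidean_space"
  assumes \<phi>: "\<phi> \<in> test_fun S"
  shows "(\<lambda>x. \<phi> x \<bullet> \<phi> x) \<in> test_fun S"
    and "dir_deriv e (\<lambda>x. \<phi> x \<bullet> \<phi> x) x = 2 * (dir_deriv e \<phi> x \<bullet> \<phi> x)"
proof -
  have c: "(\<lambda>x. \<phi> x \<bullet> b) \<in> test_fun S" for b by (rule test_fun_linear[OF \<phi> bounded_linear_inner_left])
  have p: "(\<lambda>x. (\<phi> x \<bullet> b) *\<^sub>R (\<phi> x \<bullet> b)) \<in> test_fun S" for b by (intro test_fun_mult c test_fun_Ck[OF c])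
  have "(\<Sum>b\<in>Basis. (\<lambda>x. (\<phi> x \<bullet> b) *\<^sub>R (\<phi> x \<bullet> b))) \<in> test_fun S" by (rule subspace_sum[OF test_fun_subspace p])
  moreover have "(\<Sum>b\<in>Basis. (\<lambda>x. (\<phi> x \<bullet> b) *\<^sub>R (\<phi> x \<bullet> b))) = (\<lambda>x. \<phi> x \<bullet> \<phi> x)"
  proof
    fix x show "(\<Sum>b\<in>Basis. (\<lambda>x. (\<phi> x \<bullet> b) *\<^sub>R (\<phi> x \<bullet> b))) x = \<phi> x \<bullet> \<phi> x"
      using euclidean_inner[of "\<phi> x" "\<phi> x"] by (simp only: sum_fun_apply real_scaleR_def)
  qed
  ultimately show "(\<lambda>x. \<phi> x \<bullet> \<phi> x) \<in> test_fun S" by simp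
  show "dir_deriv e (\<lambda>x. \<phi> x \<bullet> \<phi> x) x = 2 * (dir_deriv e \<phi> x \<bullet> \<phi> x)"
    by (rule trans[OF dir_deriv_unique[OF has_derivative_inner[OF test_fun_has_derivative[OF \<phi>] test_fun_has_derivative[OF \<phi>]]]])
      (simp add: inner_commute)
qed

context bounded_open begin

lemma test_fun_L2:
  fixes \<phi> :: "'a => 'b::euclidean_space"
  assumes \<phi>: "\<phi> \<in> test_fun S" shows "\<phi> \<in> L2_space S"
proof -
  obtain B where "\<And>x. norm (\<phi> x) \<le> B" using test_fun_bounded[OF \<phi>] by blast
  then have B: "(norm (\<phi> x))^2 \<le> B^2" for x by (intro power_mono) auto
  show ?thesis
    by (rule L2_bound[OF borel_lebesgue_on[OF test_fun_borel[OF \<phi>]], of "\<lambda>_. B^2"]) (rule integrable_const AE_I2[OF B])+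
qed

text \<open>The product rule, integrated: the derivative of the product of two test functions has
  integral 0.\<close>

lemma test_weak_deriv:
  fixes \<phi> :: "'a => 'b::euclidean_space"
  assumes \<phi>: "\<phi> \<in> test_fun S" and e: "e \<in> Basis"
  shows "has_weak_deriv S e \<phi> (dir_deriv e \<phi>)"
  unfolding has_weak_deriv_def
proof (intro conjI ballI L2_loc_integrable test_fun_L2 test_fun_dir_deriv[OF \<phi> e] \<phi>)
  fix \<psi> :: "'a => real" assume \<psi>: "\<psi> \<in> test_fun S"
  note t1 = test_fun_mult[OF test_fun_dir_deriv[OF \<psi> e] test_fun_Ck[OF \<phi>]]
  note t2 = test_fun_mult[OF \<psi> test_fun_Ck[OF test_fun_dir_deriv[OF \<phi> e]]]
  have "0 = (LINT x|lborel. dir_deriv e (\<lambda>x. \<psi> x *\<^sub>R \<phi> x) x)"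
    by (rule test_fun_integral_dir_deriv[OF test_fun_mult[OF \<psi> test_fun_Ck[OF \<phi>]] e, symmetric])
  also have "\<dots> = (LINT x|lborel. \<psi> x *\<^sub>R dir_deriv e \<phi> x + dir_deriv e \<psi> x *\<^sub>R \<phi> x)"
    unfolding dir_deriv_scaleR[OF \<psi> \<phi>] ..
  also have "\<dots> = (LINT x|lborel. \<psi> x *\<^sub>R dir_deriv e \<phi> x) + (LINT x|lborel. dir_deriv e \<psi> x *\<^sub>R \<phi> x)"
    by (intro Bochner_Integration.integral_add test_fun_integrable[OF t1] test_fun_integrable[OF t2])
  finally have "(LINT x|lborel. dir_deriv e \<psi> x *\<^sub>R \<phi> x) = - (LINT x|lborel. \<psi> x *\<^sub>R dir_deriv e \<phi> x)"
    by (simp add: add_eq_0_iff)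
  then show "(LINT x|lebesgue_on S. dir_deriv e \<psi> x *\<^sub>R \<phi> x) = - (LINT x|lebesgue_on S. \<psi> x *\<^sub>R dir_deriv e \<phi> x)"
    using integral_lebesgue_on_lborel(1)[OF S_sets test_fun_borel[OF t1] test_fun_zero[OF t1]]
      integral_lebesgue_on_lborel(1)[OF S_sets test_fun_borel[OF t2] test_fun_zero[OF t2]] by simp
qed

lemma test_fun_W12: "\<phi> \<in> test_fun S ==> \<phi> \<in> W12_space S"
  unfolding W12_space_def using test_weak_deriv test_fun_L2 test_fun_dir_deriv by blast

lemma test_weak_deriv_AE: "\<phi> \<in> test_fun S ==> e \<in> Basis ==> AE x in lebesgue_on S. weak_deriv S e \<phi> x = dir_deriv e \<phi> x"
  by (rule weak_deriv_AE_eq[OF test_weak_deriv])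

end

section \<open>Ladyzhenskaya and Poincare inequalities in the plane\<close>

lemma Basis_real2: "(Basis :: (real^2) set) = {e1, e2}" "e1 \<noteq> e2"
  by (auto simp: Basis_vec_def UNIV_2 axis_eq_axis)

text \<open>Both measures agree on boxes. The representation opens the way to iterated integrals
  along the two axes, on which the planar inequalities rest.\<close>

lemma lborel_real2: "(lborel :: (real^2) measure) = distr lborel borel (\<lambda>(x, y). x *\<^sub>R e1 + y *\<^sub>R e2)"
proof (rule lborel_eqI)
  fix l u :: "real^2" assume *: "\<And>b. b \<in> Basis ==> l \<bullet> b \<le> u \<bullet> b"
  have le: "l$1 \<le> u$1" "l$2 \<le> u$2" using *[of e1] *[of e2] by (simp_all add: Basis_real2 inner_axis)
  have m: "(\<lambda>(x, y). x *\<^sub>R e1 + y *\<^sub>R e2) \<in> lborel \<rightarrow>\<^sub>M (borel :: (real^2) measure)"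
    by (auto simp: case_prod_beta' intro!: borel_measurable_continuous_onI continuous_intros)
  have "(\<lambda>(x, y). x *\<^sub>R e1 + y *\<^sub>R e2) -` box l u = {l$1<..<u$1} \<times> {l$2<..<u$2}"
    by (auto simp: mem_box_cart forall_2 axis_def)
  then have "emeasure (distr lborel borel (\<lambda>(x, y). x *\<^sub>R e1 + y *\<^sub>R e2)) (box l u) =
      emeasure (lborel \<Otimes>\<^sub>M lborel) ({l$1<..<u$1} \<times> {l$2<..<u$2})"
    using m by (simp add: emeasure_distr lborel_prod)
  also have "\<dots> = ennreal (u$1 - l$1) * ennreal (u$2 - l$2)"
    using le by (subst lborel.emeasure_pair_measure_Times) auto
  also have "\<dots> = ennreal (\<Prod>b\<in>Basis. (u - l) \<bullet> b)"
    using le Basis_real2(2) by (simp add: Basis_real2(1) inner_axis ennreal_mult)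
  finally show "emeasure (distr lborel borel (\<lambda>(x, y). x *\<^sub>R e1 + y *\<^sub>R e2)) (box l u) = ennreal (\<Prod>b\<in>Basis. (u - l) \<bullet> b)" .
qed simp

lemma nn_integral_real2:
  assumes f: "f \<in> borel_measurable (borel :: (real^2) measure)"
  shows "(\<integral>\<^sup>+z. f z \<partial>lborel) = (\<integral>\<^sup>+x. \<integral>\<^sup>+y. f (x *\<^sub>R e1 + y *\<^sub>R e2) \<partial>lborel \<partial>lborel)"
    and "(\<integral>\<^sup>+z. f z \<partial>lborel) = (\<integral>\<^sup>+y. \<integral>\<^sup>+x. f (x *\<^sub>R e1 + y *\<^sub>R e2) \<partial>lborel \<partial>lborel)"
    and "(\<lambda>(x, y). f (x *\<^sub>R e1 + y *\<^sub>R e2)) \<in> borel_measurable (lborel \<Otimes>\<^sub>M lborel)"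
proof -
  have m: "(\<lambda>(x, y). x *\<^sub>R e1 + y *\<^sub>R e2) \<in> lborel \<rightarrow>\<^sub>M (borel :: (real^2) measure)"
    by (auto simp: case_prod_beta' intro!: borel_measurable_continuous_onI continuous_intros)
  from measurable_compose[OF m f]
  show m2: "(\<lambda>(x, y). f (x *\<^sub>R e1 + y *\<^sub>R e2)) \<in> borel_measurable (lborel \<Otimes>\<^sub>M lborel)"
    by (simp add: lborel_prod case_prod_beta')
  have "(\<integral>\<^sup>+z. f z \<partial>lborel) = (\<integral>\<^sup>+z. f (case z of (x, y) => x *\<^sub>R e1 + y *\<^sub>R e2) \<partial>lborel)"
    by (subst lborel_real2, rule nn_integral_distr[OF m]) (simp add: f)
  then have eq: "(\<integral>\<^sup>+z. f z \<partial>lborel) = (\<integral>\<^sup>+z. (case z of (x, y) => f (x *\<^sub>R e1 + y *\<^sub>R e2)) \<partial>(lborel \<Otimes>\<^sub>M lborel))"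
    by (simp add: lborel_prod case_prod_beta')
  show "(\<integral>\<^sup>+z. f z \<partial>lborel) = (\<integral>\<^sup>+x. \<integral>\<^sup>+y. f (x *\<^sub>R e1 + y *\<^sub>R e2) \<partial>lborel \<partial>lborel)"
    unfolding eq by (subst lborel.nn_integral_fst[OF m2, symmetric]) simp
  show "(\<integral>\<^sup>+z. f z \<partial>lborel) = (\<integral>\<^sup>+y. \<integral>\<^sup>+x. f (x *\<^sub>R e1 + y *\<^sub>R e2) \<partial>lborel \<partial>lborel)"
    unfolding eq by (subst lborel_pair.nn_integral_snd[OF m2, symmetric]) simp
qed

text \<open>The fundamental theorem of calculus for the squared norm, started at a point left of the
  support. The factor 2 is that of the derivative of a square, and the bound does not depend on
  \<open>t\<close>.\<close>

lemma norm_square_le_line_integral: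
  fixes U :: "real => 'b::real_inner"
  assumes U: "\<And>t. (U has_vector_derivative U' t) (at t)" and U': "continuous_on UNIV U'" and z: "\<And>t. t < - R ==> U t = 0"
  shows "ennreal ((norm (U t))^2) \<le> 2 * (\<integral>\<^sup>+s. ennreal (norm (U s) * norm (U' s)) \<partial>lborel)"
proof -
  define a where "a = min t (- R) - 1"
  have a: "a \<le> t" "U a = 0" using z by (auto simp: a_def)
  have Uc: "continuous_on A U" for A
    using U by (auto intro!: continuous_at_imp_continuous_on has_vector_derivative_continuous)
  have c: "continuous_on {a..t} (\<lambda>s. 2 * (norm (U s) * norm (U' s)))"
    by (intro continuous_intros Uc continuous_on_subset[OF U']) auto
  have "((\<lambda>s. U s \<bullet> U s) has_vector_derivative 2 * (U s \<bullet> U' s)) (at s within {a..t})" for s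
    using has_derivative_inner[OF U[unfolded has_vector_derivative_def, of s] U[unfolded has_vector_derivative_def, of s]]
    unfolding has_vector_derivative_def
    by (rule has_derivative_at_withinI[OF has_derivative_eq_rhs]) (auto simp: inner_commute fun_eq_iff)
  then have "((\<lambda>s. 2 * (U s \<bullet> U' s)) has_integral (U t \<bullet> U t - U a \<bullet> U a)) {a..t}"
    using a(1) by (intro fundamental_theorem_of_calculus) auto
  then have "U t \<bullet> U t - U a \<bullet> U a \<le> integral {a..t} (\<lambda>s. 2 * (norm (U s) * norm (U' s)))"
    by (rule has_integral_le[OF _ integrable_integral[OF integrable_continuous_interval[OF c]]]) (simp add: norm_cauchy_schwarz)
  then have "ennreal ((norm (U t))^2) \<le> ennreal (integral {a..t} (\<lambda>s. 2 * (norm (U s) * norm (U' s))))"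
    using a(2) by (intro ennreal_leI) (simp add: power2_norm_eq_inner)
  also have "\<dots> = (\<integral>\<^sup>+s. ennreal (indicator {a..t} s * (2 * (norm (U s) * norm (U' s)))) \<partial>lborel)"
    by (rule nn_integral_has_integral_lebesgue[OF _ integrable_integral[OF integrable_continuous_interval[OF c]], symmetric]) simp
  also have "\<dots> \<le> (\<integral>\<^sup>+s. 2 * ennreal (norm (U s) * norm (U' s)) \<partial>lborel)"
    by (intro nn_integral_mono) (auto simp: indicator_def ennreal_mult)
  also have "\<dots> = 2 * (\<integral>\<^sup>+s. ennreal (norm (U s) * norm (U' s)) \<partial>lborel)"
    by (intro nn_integral_cmult measurable_compose[OF _ measurable_ennreal])
      (auto intro!: borel_measurable_continuous_onI continuous_intros Uc U')
  finally show ?thesis .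
qed

lemma test_fun_le_line_integral:
  fixes \<phi> :: "real^2 => 'b::euclidean_space"
  assumes \<phi>: "\<phi> \<in> test_fun S" and e: "e \<in> Basis" and o: "norm e = 1" "z \<bullet> e = 0"
  shows "ennreal ((norm (\<phi> (z + t *\<^sub>R e)))^2)
    \<le> 2 * (\<integral>\<^sup>+s. ennreal (norm (\<phi> (z + s *\<^sub>R e)) * norm (dir_deriv e \<phi> (z + s *\<^sub>R e))) \<partial>lborel)"
proof -
  obtain R where R: "R > 0" "\<And>x. norm x > R ==> \<phi> x = 0" using test_fun_support[OF \<phi>] by blast
  show ?thesis
  proof (rule norm_square_le_line_integral[where R = R])
    show "((\<lambda>t. \<phi> (z + t *\<^sub>R e)) has_vector_derivative dir_deriv e \<phi> (z + t *\<^sub>R e)) (at t)" for t by (rule test_fun_line[OF \<phi>])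
    show "continuous_on UNIV (\<lambda>t. dir_deriv e \<phi> (z + t *\<^sub>R e))"
      by (rule continuous_on_compose2[OF test_fun_continuous[OF test_fun_dir_deriv[OF \<phi> e]]]) (auto intro!: continuous_intros)
    fix t assume t: "t < - R"
    have "\<bar>(z + t *\<^sub>R e) \<bullet> e\<bar> = \<bar>t\<bar>" using o by (simp add: inner_add_left dot_square_norm)
    then have "\<bar>t\<bar> \<le> norm (z + t *\<^sub>R e)" using Cauchy_Schwarz_ineq2[of "z + t *\<^sub>R e" e] o by simp
    then show "\<phi> (z + t *\<^sub>R e) = 0" using t R by simp
  qed
qed

text \<open>The squared norm is bounded along horizontal lines by \<open>2 * A y\<close>, a function
  of \<open>y\<close> alone, and along vertical lines by \<open>2 * C x\<close>, a function of
  \<open>x\<close> alone. The integral of the product of the two bounds is the product of their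
  integrals, which is the heart of Ladyzhenskaya's inequality. Integrating the first bound alone
  over a strip of width \<open>2 * \<rho>\<close> leads to Poincare's inequality.\<close>

lemma test_fun_plane:
  fixes \<phi> :: "real^2 => 'b::euclidean_space"
  assumes \<phi>: "\<phi> \<in> test_fun S"
  shows "(\<integral>\<^sup>+z. ennreal ((norm (\<phi> z))^4) \<partial>lborel) \<le> 4 * (\<integral>\<^sup>+z. ennreal (norm (\<phi> z) * norm (dir_deriv e1 \<phi> z)) \<partial>lborel)
      * (\<integral>\<^sup>+z. ennreal (norm (\<phi> z) * norm (dir_deriv e2 \<phi> z)) \<partial>lborel)"
    and "\<rho> \<ge> 0 ==> (\<And>z. z \<in> S ==> \<bar>z$1\<bar> \<le> \<rho>) ==> (\<integral>\<^sup>+z. ennreal ((norm (\<phi> z))^2) \<partial>lborel)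
      \<le> ennreal (4 * \<rho>) * (\<integral>\<^sup>+z. ennreal (norm (\<phi> z) * norm (dir_deriv e1 \<phi> z)) \<partial>lborel)"
proof -
  define P where "P z = ennreal (norm (\<phi> z) * norm (dir_deriv e1 \<phi> z))" for z
  define Q where "Q z = ennreal (norm (\<phi> z) * norm (dir_deriv e2 \<phi> z))" for z
  have B: "e1 \<in> Basis" "e2 \<in> Basis" by (auto simp: Basis_real2)
  have m: "\<phi> \<in> borel_measurable borel" "dir_deriv e1 \<phi> \<in> borel_measurable borel" "dir_deriv e2 \<phi> \<in> borel_measurable borel"
    by (rule test_fun_borel[OF \<phi>] test_fun_borel[OF test_fun_dir_deriv[OF \<phi> B(1)]] test_fun_borel[OF test_fun_dir_deriv[OF \<phi> B(2)]])+
  have P: "P \<in> borel_measurable borel" and Q: "Q \<in> borel_measurable borel"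
    unfolding P_def[abs_def] Q_def[abs_def] using m by measurable
  define A where "A y = (\<integral>\<^sup>+s. P (s *\<^sub>R e1 + y *\<^sub>R e2) \<partial>lborel)" for y
  define C where "C x = (\<integral>\<^sup>+s. Q (x *\<^sub>R e1 + s *\<^sub>R e2) \<partial>lborel)" for x
  have C: "C \<in> borel_measurable lborel" unfolding C_def[abs_def]
    using lborel.borel_measurable_nn_integral[OF nn_integral_real2(3)[OF Q]] by simp
  have A: "A \<in> borel_measurable lborel" unfolding A_def[abs_def]
    using lborel.borel_measurable_nn_integral[OF measurable_pair_swap[OF nn_integral_real2(3)[OF P]]] by (simp add: case_prod_beta')
  have leA: "ennreal ((norm (\<phi> (x *\<^sub>R e1 + y *\<^sub>R e2)))^2) \<le> 2 * A y" for x y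
    using test_fun_le_line_integral[OF \<phi> B(1), of "y *\<^sub>R e2" x] by (simp add: A_def P_def inner_axis_axis add.commute)
  have leC: "ennreal ((norm (\<phi> (x *\<^sub>R e1 + y *\<^sub>R e2)))^2) \<le> 2 * C x" for x y
    using test_fun_le_line_integral[OF \<phi> B(2), of "x *\<^sub>R e1" y] by (simp add: C_def Q_def inner_axis_axis)
  have "(\<integral>\<^sup>+z. ennreal ((norm (\<phi> z))^4) \<partial>lborel) = (\<integral>\<^sup>+x. \<integral>\<^sup>+y. ennreal ((norm (\<phi> (x *\<^sub>R e1 + y *\<^sub>R e2)))^4) \<partial>lborel \<partial>lborel)"
    by (rule nn_integral_real2) (use m in measurable)
  also have "\<dots> \<le> (\<integral>\<^sup>+x. \<integral>\<^sup>+y. (2 * C x) * (2 * A y) \<partial>lborel \<partial>lborel)"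
  proof (intro nn_integral_mono)
    fix x y :: real
    have "ennreal ((norm (\<phi> (x *\<^sub>R e1 + y *\<^sub>R e2)))^4) = ennreal ((norm (\<phi> (x *\<^sub>R e1 + y *\<^sub>R e2)))^2) * ennreal ((norm (\<phi> (x *\<^sub>R e1 + y *\<^sub>R e2)))^2)"
      by (simp flip: ennreal_mult power_add)
    then show "ennreal ((norm (\<phi> (x *\<^sub>R e1 + y *\<^sub>R e2)))^4) \<le> (2 * C x) * (2 * A y)"
      using mult_mono[OF leC[of x y] leA[of x y]] by simp
  qed
  also have "\<dots> = (\<integral>\<^sup>+x. (2 * C x) * (2 * (\<integral>\<^sup>+y. A y \<partial>lborel)) \<partial>lborel)"
    using A by (simp add: nn_integral_cmult)
  also have "\<dots> = 4 * (\<integral>\<^sup>+y. A y \<partial>lborel) * (\<integral>\<^sup>+x. C x \<partial>lborel)"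
    using C by (simp add: nn_integral_multc nn_integral_cmult mult_ac)
  finally show "(\<integral>\<^sup>+z. ennreal ((norm (\<phi> z))^4) \<partial>lborel) \<le> 4 * (\<integral>\<^sup>+z. ennreal (norm (\<phi> z) * norm (dir_deriv e1 \<phi> z)) \<partial>lborel)
      * (\<integral>\<^sup>+z. ennreal (norm (\<phi> z) * norm (dir_deriv e2 \<phi> z)) \<partial>lborel)"
    using nn_integral_real2(1)[OF Q] nn_integral_real2(2)[OF P] unfolding A_def C_def P_def Q_def by simp
  assume \<rho>: "\<rho> \<ge> 0" "\<And>z. z \<in> S ==> \<bar>z$1\<bar> \<le> \<rho>"
  have "(\<integral>\<^sup>+z. ennreal ((norm (\<phi> z))^2) \<partial>lborel) = (\<integral>\<^sup>+y. \<integral>\<^sup>+x. ennreal ((norm (\<phi> (x *\<^sub>R e1 + y *\<^sub>R e2)))^2) \<partial>lborel \<partial>lborel)"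
    by (rule nn_integral_real2) (use m in measurable)
  also have "\<dots> \<le> (\<integral>\<^sup>+y. \<integral>\<^sup>+x. 2 * A y * indicator {-\<rho>..\<rho>} x \<partial>lborel \<partial>lborel)"
  proof (intro nn_integral_mono)
    fix x y :: real
    show "ennreal ((norm (\<phi> (x *\<^sub>R e1 + y *\<^sub>R e2)))^2) \<le> 2 * A y * indicator {-\<rho>..\<rho>} x"
    proof (cases "\<bar>x\<bar> \<le> \<rho>")
      case True
      then have "x \<in> {-\<rho>..\<rho>}" by auto
      then show ?thesis using leA[of x y] by simp
    next
      case False
      then have "x *\<^sub>R e1 + y *\<^sub>R e2 \<notin> S" using \<rho>(2)[of "x *\<^sub>R e1 + y *\<^sub>R e2"] by (auto simp: axis_def)
      then show ?thesis using test_fun_zero[OF \<phi>] by simp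
    qed
  qed
  also have "\<dots> = (\<integral>\<^sup>+y. 2 * A y * ennreal (2 * \<rho>) \<partial>lborel)"
    using \<rho>(1) by (simp add: nn_integral_cmult_indicator)
  also have "\<dots> = 2 * (\<integral>\<^sup>+y. A y \<partial>lborel) * ennreal (2 * \<rho>)"
    using A by (simp add: nn_integral_multc nn_integral_cmult)
  also have "\<dots> = ennreal (4 * \<rho>) * (\<integral>\<^sup>+y. A y \<partial>lborel)"
    using \<rho>(1) ennreal_mult[of 2 "2 * \<rho>"] by (simp add: mult_ac)
  finally show "(\<integral>\<^sup>+z. ennreal ((norm (\<phi> z))^2) \<partial>lborel)
      \<le> ennreal (4 * \<rho>) * (\<integral>\<^sup>+z. ennreal (norm (\<phi> z) * norm (dir_deriv e1 \<phi> z)) \<partial>lborel)"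
    using nn_integral_real2(2)[OF P] unfolding A_def P_def by simp
qed

lemma nn_integral_lebesgue_on_lborel:
  assumes S: "S \<in> sets lebesgue" and z: "\<And>x. x \<notin> S ==> f x = 0"
  shows "(\<integral>\<^sup>+x. f x \<partial>lebesgue_on S) = (\<integral>\<^sup>+x. f x \<partial>lborel)"
proof -
  have "f x * indicator S x = f x" for x using z[of x] by (auto simp: indicator_def)
  then show ?thesis using S by (simp add: nn_integral_restrict_space nn_integral_completion)
qed

locale plane_open = bounded_open S for S :: "(real^2) set"
begin

lemma test_pair_le:
  fixes \<phi> :: "real^2 => 'b::euclidean_space"
  assumes \<phi>: "\<phi> \<in> test_fun S" and e: "e \<in> Basis"
  shows "(\<integral>\<^sup>+z. ennreal (norm (\<phi> z) * norm (dir_deriv e \<phi> z)) \<partial>lborel) \<le> ennreal (L2_norm S \<phi> * L2_norm S (dir_deriv e \<phi>))"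
proof -
  note L = L2_norm_Cauchy_Schwarz[OF test_fun_L2[OF \<phi>] test_fun_L2[OF test_fun_dir_deriv[OF \<phi> e]]]
  have "(\<integral>\<^sup>+z. ennreal (norm (\<phi> z) * norm (dir_deriv e \<phi> z)) \<partial>lborel) = (\<integral>\<^sup>+z. ennreal (norm (\<phi> z) * norm (dir_deriv e \<phi> z)) \<partial>lebesgue_on S)"
    by (rule nn_integral_lebesgue_on_lborel[symmetric]) (simp_all add: test_fun_zero[OF \<phi>])
  also have "\<dots> = ennreal (LINT z|lebesgue_on S. norm (\<phi> z) * norm (dir_deriv e \<phi> z))"
    by (rule nn_integral_eq_integral[OF L(1)]) simp
  also have "\<dots> \<le> ennreal (L2_norm S \<phi> * L2_norm S (dir_deriv e \<phi>))" by (intro ennreal_leI L(2))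
  finally show ?thesis .
qed

lemma Ladyzhenskaya_test:
  fixes \<phi> :: "real^2 => 'b::euclidean_space"
  assumes \<phi>: "\<phi> \<in> test_fun S"
  shows "(\<integral>\<^sup>+z. ennreal ((norm (\<phi> z))^4) \<partial>lebesgue_on S)
    \<le> ennreal (4 * (L2_norm S \<phi>)^2 * L2_norm S (dir_deriv e1 \<phi>) * L2_norm S (dir_deriv e2 \<phi>))"
proof -
  have B: "e1 \<in> Basis" "e2 \<in> Basis" by (auto simp: Basis_real2)
  have "(\<integral>\<^sup>+z. ennreal ((norm (\<phi> z))^4) \<partial>lebesgue_on S) = (\<integral>\<^sup>+z. ennreal ((norm (\<phi> z))^4) \<partial>lborel)"
    by (rule nn_integral_lebesgue_on_lborel) (simp_all add: test_fun_zero[OF \<phi>])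
  also have "\<dots> \<le> 4 * (\<integral>\<^sup>+z. ennreal (norm (\<phi> z) * norm (dir_deriv e1 \<phi> z)) \<partial>lborel)
      * (\<integral>\<^sup>+z. ennreal (norm (\<phi> z) * norm (dir_deriv e2 \<phi> z)) \<partial>lborel)"
    by (rule test_fun_plane(1)[OF \<phi>])
  also have "\<dots> \<le> 4 * ennreal (L2_norm S \<phi> * L2_norm S (dir_deriv e1 \<phi>)) * ennreal (L2_norm S \<phi> * L2_norm S (dir_deriv e2 \<phi>))"
    by (intro mult_mono order_refl test_pair_le \<phi> B) auto
  also have "\<dots> = ennreal (4 * (L2_norm S \<phi>)^2 * L2_norm S (dir_deriv e1 \<phi>) * L2_norm S (dir_deriv e2 \<phi>))"
    using ennreal_mult[of 4 "L2_norm S \<phi> * L2_norm S (dir_deriv e1 \<phi>)"]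
      ennreal_mult[of "4 * (L2_norm S \<phi> * L2_norm S (dir_deriv e1 \<phi>))" "L2_norm S \<phi> * L2_norm S (dir_deriv e2 \<phi>)"]
    by (simp add: L2_norm_nonneg power2_eq_square mult_ac)
  finally show ?thesis .
qed

text \<open>By the Cauchy-Schwarz inequality the strip estimate bounds the squared norm by the norm
  times that of the derivative; one factor cancels. The constant \<open>4 * \<rho>\<close> is twice
  the width of the strip.\<close>

lemma Poincare_test:
  fixes \<phi> :: "real^2 => 'b::euclidean_space"
  assumes \<phi>: "\<phi> \<in> test_fun S" and \<rho>: "\<rho> \<ge> 0" "\<And>z. z \<in> S ==> \<bar>z$1\<bar> \<le> \<rho>"
  shows "L2_norm S \<phi> \<le> 4 * \<rho> * L2_norm S (dir_deriv e1 \<phi>)"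
proof -
  have B: "e1 \<in> Basis" by (auto simp: Basis_real2)
  have "ennreal ((L2_norm S \<phi>)^2) = (\<integral>\<^sup>+z. ennreal ((norm (\<phi> z))^2) \<partial>lebesgue_on S)"
    unfolding L2_norm_square by (rule nn_integral_eq_integral[OF L2_integrable[OF test_fun_L2[OF \<phi>]], symmetric]) simp
  also have "\<dots> = (\<integral>\<^sup>+z. ennreal ((norm (\<phi> z))^2) \<partial>lborel)"
    by (rule nn_integral_lebesgue_on_lborel) (simp_all add: test_fun_zero[OF \<phi>])
  also have "\<dots> \<le> ennreal (4 * \<rho>) * (\<integral>\<^sup>+z. ennreal (norm (\<phi> z) * norm (dir_deriv e1 \<phi> z)) \<partial>lborel)"
    by (rule test_fun_plane(2)[OF \<phi> \<rho>])
  also have "\<dots> \<le> ennreal (4 * \<rho>) * ennreal (L2_norm S \<phi> * L2_norm S (dir_deriv e1 \<phi>))"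
    by (intro mult_left_mono test_pair_le \<phi> B) auto
  also have "\<dots> = ennreal (4 * \<rho> * (L2_norm S \<phi> * L2_norm S (dir_deriv e1 \<phi>)))"
    using \<rho> by (simp add: ennreal_mult L2_norm_nonneg)
  finally have "(L2_norm S \<phi>)^2 \<le> 4 * \<rho> * (L2_norm S \<phi> * L2_norm S (dir_deriv e1 \<phi>))"
    using \<rho> by (subst (asm) ennreal_le_iff) (auto intro!: mult_nonneg_nonneg L2_norm_nonneg)
  then have "L2_norm S \<phi> * L2_norm S \<phi> \<le> L2_norm S \<phi> * (4 * \<rho> * L2_norm S (dir_deriv e1 \<phi>))"
    by (simp add: power2_eq_square mult_ac)
  then show ?thesis
    using \<rho> L2_norm_nonneg[of \<phi>] L2_norm_nonneg[of "dir_deriv e1 \<phi>"] by (cases "L2_norm S \<phi> = 0") auto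
qed

end

section \<open>Extension of the inequalities to the closure of the test functions\<close>

context plane_open begin

lemma e_Basis: "e1 \<in> Basis" "e2 \<in> Basis" by (auto simp: Basis_real2)

lemma test_weak_deriv_norm:
  fixes \<phi> :: "real^2 => 'b::euclidean_space"
  assumes "\<phi> \<in> test_fun S" "e \<in> Basis"
  shows "L2_norm S (weak_deriv S e \<phi>) = L2_norm S (dir_deriv e \<phi>)"
  unfolding L2_norm_eq using test_weak_deriv_AE[OF assms] W12_weak_deriv(2)[OF test_fun_W12 assms(2)] assms(1)
  by (auto intro!: arg_cong[where f = sqrt] L2_pair_cong_AE)

lemma W12_0_approx:
  fixes u :: "real^2 => 'b::euclidean_space"
  assumes u: "u \<in> W12_0 S"
  obtains \<phi> where "\<And>n. \<phi> n \<in> test_fun S" "(\<lambda>n. W12_norm S (u - \<phi> n)) \<longlonglongrightarrow> 0"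
proof -
  interpret W: seminormed "W12_space S :: (real^2 => 'b) set" "W12_norm S" by (rule seminormed_W12)
  show ?thesis by (rule W.norm_closure_E[OF u[unfolded W12_0_def]]) (auto intro: test_fun_W12 that)
qed

lemma W12_0_W12: "u \<in> W12_0 S ==> u \<in> W12_space S"
  by (simp add: W12_0_def norm_closure_def)

lemma W12_limits:
  fixes u :: "real^2 => 'b::euclidean_space"
  assumes u: "u \<in> W12_space S" and \<phi>: "\<And>n. \<phi> n \<in> W12_space S" and lim: "(\<lambda>n. W12_norm S (u - \<phi> n)) \<longlonglongrightarrow> 0"
  shows "(\<lambda>n. W12_norm S (\<phi> n)) \<longlonglongrightarrow> W12_norm S u" "(\<lambda>n. L2_norm S (u - \<phi> n)) \<longlonglongrightarrow> 0" "(\<lambda>n. L2_norm S (\<phi> n)) \<longlonglongrightarrow> L2_norm S u"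
    "\<And>e. e \<in> Basis ==> (\<lambda>n. L2_norm S (weak_deriv S e (\<phi> n))) \<longlonglongrightarrow> L2_norm S (weak_deriv S e u)"
proof -
  interpret W: seminormed "W12_space S :: (real^2 => 'b) set" "W12_norm S" by (rule seminormed_W12)
  interpret L: seminormed "L2_space S :: (real^2 => 'b) set" "L2_norm S" by (rule seminormed_L2)
  show "(\<lambda>n. W12_norm S (\<phi> n)) \<longlonglongrightarrow> W12_norm S u" by (rule W.N_tendsto[OF \<phi> u lim])
  show l: "(\<lambda>n. L2_norm S (u - \<phi> n)) \<longlonglongrightarrow> 0"
    by (rule tendsto_sandwich[OF _ _ tendsto_const lim]) (auto intro!: always_eventually L2_le_W12 L2_norm_nonneg)
  show "(\<lambda>n. L2_norm S (\<phi> n)) \<longlonglongrightarrow> L2_norm S u" by (rule L.N_tendsto[OF W12_L2[OF \<phi>] W12_L2[OF u] l])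
  fix e :: "real^2" assume e: "e \<in> Basis"
  have "(\<lambda>n. L2_norm S (weak_deriv S e u - weak_deriv S e (\<phi> n))) \<longlonglongrightarrow> 0"
    unfolding weak_deriv_diff_norm[OF u \<phi> e]
    by (rule tendsto_sandwich[OF _ _ tendsto_const lim]) (auto intro!: always_eventually weak_deriv_le_W12 L2_norm_nonneg e)
  then show "(\<lambda>n. L2_norm S (weak_deriv S e (\<phi> n))) \<longlonglongrightarrow> L2_norm S (weak_deriv S e u)"
    by (rule L.N_tendsto[OF W12_weak_deriv(2)[OF \<phi> e] W12_weak_deriv(2)[OF u e]])
qed

lemma Poincare:
  fixes u :: "real^2 => 'b::euclidean_space"
  assumes u: "u \<in> W12_0 S" and \<rho>: "\<rho> \<ge> 0" "\<And>z. z \<in> S ==> \<bar>z$1\<bar> \<le> \<rho>"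
  shows "L2_norm S u \<le> 4 * \<rho> * L2_norm S (weak_deriv S e1 u)"
proof -
  obtain \<phi> where \<phi>: "\<And>n. \<phi> n \<in> test_fun S" "(\<lambda>n. W12_norm S (u - \<phi> n)) \<longlonglongrightarrow> 0" using W12_0_approx[OF u] by blast
  note l = W12_limits[OF W12_0_W12[OF u] test_fun_W12[OF \<phi>(1)] \<phi>(2)]
  show ?thesis
  proof (rule LIMSEQ_le[OF l(3) tendsto_mult[OF tendsto_const l(4)[OF e_Basis(1)]]])
    show "\<exists>N. \<forall>n\<ge>N. L2_norm S (\<phi> n) \<le> 4 * \<rho> * L2_norm S (weak_deriv S e1 (\<phi> n))"
      using Poincare_test[OF \<phi>(1) \<rho>] test_weak_deriv_norm[OF \<phi>(1) e_Basis(1)] by simp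
  qed
qed

text \<open>Stated for the integral with values in the extended half-line, because integrability of
  the fourth power is not known in advance. A subsequence of the approximating test functions
  converges almost everywhere, and Fatou's lemma passes to the limit.\<close>

lemma Ladyzhenskaya_nn:
  fixes u :: "real^2 => 'b::euclidean_space"
  assumes u: "u \<in> W12_0 S"
  shows "(\<integral>\<^sup>+z. ennreal ((norm (u z))^4) \<partial>lebesgue_on S) \<le> ennreal (4 * (L2_norm S u)^2 * (W12_norm S u)^2)"
proof -
  obtain \<phi> where \<phi>: "\<And>n. \<phi> n \<in> test_fun S" "(\<lambda>n. W12_norm S (u - \<phi> n)) \<longlonglongrightarrow> 0" using W12_0_approx[OF u] by blast
  note l = W12_limits[OF W12_0_W12[OF u] test_fun_W12[OF \<phi>(1)] \<phi>(2)]
  interpret L: seminormed "L2_space S :: (real^2 => 'b) set" "L2_norm S" by (rule seminormed_L2)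
  have uL: "u \<in> L2_space S" by (rule W12_L2[OF W12_0_W12[OF u]])
  have "(\<lambda>n. (L2_norm S (u - \<phi> n))^2) \<longlonglongrightarrow> 0^2" by (intro tendsto_power l(2))
  then have "(\<lambda>n. LINT x|lebesgue_on S. norm ((norm ((u - \<phi> n) x))^2)) \<longlonglongrightarrow> 0"
    by (simp add: L2_norm_square)
  moreover have "integrable (lebesgue_on S) (\<lambda>x. (norm ((u - \<phi> n) x))^2)" for n
    by (rule L2_integrable[OF L.diff_mem[OF uL test_fun_L2[OF \<phi>(1)]]])
  ultimately obtain r :: "nat => nat" where r: "strict_mono r" "AE x in lebesgue_on S. (\<lambda>n. (norm ((u - \<phi> (r n)) x))^2) \<longlonglongrightarrow> 0"
    using tendsto_L1_AE_subseq[of "lebesgue_on S" "\<lambda>n x. (norm ((u - \<phi> n) x))^2"] by blast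
  have "AE x in lebesgue_on S. ennreal ((norm (u x))^4) = liminf (\<lambda>n. ennreal ((norm (\<phi> (r n) x))^4))"
    using r(2)
  proof eventually_elim
    case (elim x)
    then have "(\<lambda>n. sqrt ((norm (u x - \<phi> (r n) x))^2)) \<longlonglongrightarrow> sqrt 0" by (intro tendsto_real_sqrt) simp
    then have "(\<lambda>n. u x - \<phi> (r n) x) \<longlonglongrightarrow> 0" by (simp add: tendsto_norm_zero_iff)
    then have "(\<lambda>n. u x - (u x - \<phi> (r n) x)) \<longlonglongrightarrow> u x - 0" by (intro tendsto_intros)
    then have "(\<lambda>n. \<phi> (r n) x) \<longlonglongrightarrow> u x" by simp
    then have "(\<lambda>n. ennreal ((norm (\<phi> (r n) x))^4)) \<longlonglongrightarrow> ennreal ((norm (u x))^4)" by (intro tendsto_intros tendsto_ennrealI)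
    then show ?case by (intro lim_imp_Liminf[symmetric]) auto
  qed
  then have "(\<integral>\<^sup>+z. ennreal ((norm (u z))^4) \<partial>lebesgue_on S) = (\<integral>\<^sup>+z. liminf (\<lambda>n. ennreal ((norm (\<phi> (r n) z))^4)) \<partial>lebesgue_on S)"
    by (rule nn_integral_cong_AE)
  also have "\<dots> \<le> liminf (\<lambda>n. \<integral>\<^sup>+z. ennreal ((norm (\<phi> (r n) z))^4) \<partial>lebesgue_on S)"
  proof (rule nn_integral_liminf)
    show "(\<lambda>z. ennreal ((norm (\<phi> (r n) z))^4)) \<in> borel_measurable (lebesgue_on S)" for n
      using borel_lebesgue_on[OF test_fun_borel[OF \<phi>(1)[of "r n"]]] by measurable
  qed
  also have "\<dots> \<le> liminf (\<lambda>n. ennreal (4 * (L2_norm S (\<phi> (r n)))^2 * (W12_norm S (\<phi> (r n)))^2))"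
  proof (intro Liminf_mono always_eventually allI)
    fix n
    have le: "L2_norm S (dir_deriv e (\<phi> (r n))) \<le> W12_norm S (\<phi> (r n))" if "e \<in> Basis" for e
      using weak_deriv_le_W12[OF that, of "\<phi> (r n)"] test_weak_deriv_norm[OF \<phi>(1) that] by simp
    have "(\<integral>\<^sup>+z. ennreal ((norm (\<phi> (r n) z))^4) \<partial>lebesgue_on S) \<le>
      ennreal (4 * (L2_norm S (\<phi> (r n)))^2 * L2_norm S (dir_deriv e1 (\<phi> (r n))) * L2_norm S (dir_deriv e2 (\<phi> (r n))))"
      by (rule Ladyzhenskaya_test[OF \<phi>(1)])
    also have "\<dots> \<le> ennreal (4 * (L2_norm S (\<phi> (r n)))^2 * W12_norm S (\<phi> (r n)) * W12_norm S (\<phi> (r n)))"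
      by (intro ennreal_leI mult_mono le e_Basis mult_nonneg_nonneg L2_norm_nonneg W12_norm_nonneg) auto
    finally show "(\<integral>\<^sup>+z. ennreal ((norm (\<phi> (r n) z))^4) \<partial>lebesgue_on S) \<le> ennreal (4 * (L2_norm S (\<phi> (r n)))^2 * (W12_norm S (\<phi> (r n)))^2)"
      by (simp add: power2_eq_square mult_ac)
  qed
  also have "\<dots> = ennreal (4 * (L2_norm S u)^2 * (W12_norm S u)^2)"
    using LIMSEQ_subseq_LIMSEQ[OF l(1) r(1)] LIMSEQ_subseq_LIMSEQ[OF l(3) r(1)]
    by (intro lim_imp_Liminf tendsto_ennrealI tendsto_intros) (auto simp: o_def)
  finally show ?thesis .
qed

lemma norm_square_L2:
  fixes u :: "real^2 => 'b::euclidean_space"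
  assumes u: "u \<in> W12_0 S"
  shows "(\<lambda>x. (norm (u x))^2) \<in> L2_space S" "L2_norm S (\<lambda>x. (norm (u x))^2) \<le> 2 * L2_norm S u * W12_norm S u"
proof -
  have m: "u \<in> borel_measurable (lebesgue_on S)" by (rule L2_measurable[OF W12_L2[OF W12_0_W12[OF u]]])
  then have m2: "(\<lambda>x. (norm (u x))^2) \<in> borel_measurable (lebesgue_on S)" "(\<lambda>x. (norm (u x))^4) \<in> borel_measurable (lebesgue_on S)" by measurable
  have i: "integrable (lebesgue_on S) (\<lambda>x. (norm (u x))^4)"
  proof (rule integrableI_bounded[OF m2(2)])
    show "(\<integral>\<^sup>+ x. ennreal (norm ((norm (u x))^4)) \<partial>lebesgue_on S) < \<infinity>"
      using order_le_less_trans[OF Ladyzhenskaya_nn[OF u] ennreal_less_top] by simp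
  qed
  have eq: "(norm ((norm (u x))^2))^2 = (norm (u x))^4" for x by (simp flip: power_mult)
  show "(\<lambda>x. (norm (u x))^2) \<in> L2_space S" using i m2(1) by (simp add: L2_space_def eq)
  have "ennreal (LINT x|lebesgue_on S. (norm (u x))^4) = (\<integral>\<^sup>+z. ennreal ((norm (u z))^4) \<partial>lebesgue_on S)"
    by (rule nn_integral_eq_integral[OF i, symmetric]) simp
  also note Ladyzhenskaya_nn[OF u]
  finally have "(LINT x|lebesgue_on S. (norm (u x))^4) \<le> (2 * L2_norm S u * W12_norm S u)^2"
    by (simp add: power_mult_distrib)
  then show "L2_norm S (\<lambda>x. (norm (u x))^2) \<le> 2 * L2_norm S u * W12_norm S u"
    unfolding L2_norm_def[of S "\<lambda>x. (norm (u x))^2"] eq by (intro real_le_lsqrt) (auto simp: L2_norm_nonneg W12_norm_nonneg)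
qed

text \<open>The Cauchy-Schwarz inequality for the squares of the norms, each in L2 by
  Ladyzhenskaya's inequality. The factor 2 is the square root of the constant 4 there.\<close>

lemma norm_product_L2:
  fixes u :: "real^2 => 'b::euclidean_space" and w :: "real^2 => 'c::euclidean_space"
  assumes u: "u \<in> W12_0 S" and w: "w \<in> W12_0 S"
  shows "(\<lambda>x. norm (u x) * norm (w x)) \<in> L2_space S"
    "L2_norm S (\<lambda>x. norm (u x) * norm (w x)) \<le> 2 * sqrt (L2_norm S u * W12_norm S u) * sqrt (L2_norm S w * W12_norm S w)"
proof -
  have m: "u \<in> borel_measurable (lebesgue_on S)" "w \<in> borel_measurable (lebesgue_on S)"
    by (rule L2_measurable[OF W12_L2[OF W12_0_W12[OF u]]] L2_measurable[OF W12_L2[OF W12_0_W12[OF w]]])+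
  have m2: "(\<lambda>x. norm (u x) * norm (w x)) \<in> borel_measurable (lebesgue_on S)" using m by measurable
  note cs = L2_norm_Cauchy_Schwarz[OF norm_square_L2(1)[OF u] norm_square_L2(1)[OF w]]
  have eq: "(norm (norm (u x) * norm (w x)))^2 = norm ((norm (u x))^2) * norm ((norm (w x))^2)" for x by (simp add: power_mult_distrib)
  show "(\<lambda>x. norm (u x) * norm (w x)) \<in> L2_space S" using cs(1) m2 by (simp add: L2_space_def power_mult_distrib)
  have "(LINT x|lebesgue_on S. (norm (norm (u x) * norm (w x)))^2) \<le> L2_norm S (\<lambda>x. (norm (u x))^2) * L2_norm S (\<lambda>x. (norm (w x))^2)"
    unfolding eq by (rule cs(2))
  also have "\<dots> \<le> (2 * L2_norm S u * W12_norm S u) * (2 * L2_norm S w * W12_norm S w)"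
    by (intro mult_mono norm_square_L2(2) u w) (auto simp: L2_norm_nonneg W12_norm_nonneg)
  also have "\<dots> = (2 * sqrt (L2_norm S u * W12_norm S u) * sqrt (L2_norm S w * W12_norm S w))^2"
    by (simp add: power_mult_distrib L2_norm_nonneg W12_norm_nonneg)
  finally show "L2_norm S (\<lambda>x. norm (u x) * norm (w x)) \<le> 2 * sqrt (L2_norm S u * W12_norm S u) * sqrt (L2_norm S w * W12_norm S w)"
    unfolding L2_norm_def[of S "\<lambda>x. norm (u x) * norm (w x)"] by (intro real_le_lsqrt) (auto simp: L2_norm_nonneg W12_norm_nonneg)
qed

end

section \<open>The forms on a plane section\<close>

locale plane_section = plane_open S for S :: "(real^2) set" +
  fixes a1 a2 :: real
begin

abbreviation "V \<equiv> V_space S a1 a2"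
abbreviation "H \<equiv> H_space S a1 a2"
abbreviation "D \<equiv> div_free_tests S a1 a2"
abbreviation "W \<equiv> W12_norm S :: field3 => real"

lemma D_test: "\<phi> \<in> D ==> \<phi> \<in> test_fun S"
  by (simp add: div_free_tests_def)

lemma D_subspace: "subspace D"
proof (rule subspaceI)
  have 0: "(0 :: field3) \<in> test_fun S" by (rule subspace_0[OF test_fun_subspace])
  have d: "dir_deriv e (0 :: field3) x = 0" for e x
    by (rule dir_deriv_unique[where f' = "\<lambda>_. 0"]) (simp add: zero_fun_def)
  show "0 \<in> D" using 0 by (simp add: div_free_tests_def d)
next
  fix f g assume f: "f \<in> D" and g: "g \<in> D"
  have d: "dir_deriv e (f + g) x = dir_deriv e f x + dir_deriv e g x" for e x
    using dir_deriv_unique[OF has_derivative_add[OF test_fun_has_derivative[OF D_test[OF f]] test_fun_has_derivative[OF D_test[OF g]]]]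
    by (simp add: plus_fun_def)
  have "dir_deriv e1 (f + g) x $ 1 + dir_deriv e2 (f + g) x $ 2
      - 1/2 * (inverse a1 * dir_deriv e1 (f + g) x $ 3 + inverse a2 * dir_deriv e2 (f + g) x $ 3) = 0" if x: "x \<in> S" for x
  proof -
    have "dir_deriv e1 f x $ 1 + dir_deriv e2 f x $ 2 - 1/2 * (inverse a1 * dir_deriv e1 f x $ 3 + inverse a2 * dir_deriv e2 f x $ 3) +
      (dir_deriv e1 g x $ 1 + dir_deriv e2 g x $ 2 - 1/2 * (inverse a1 * dir_deriv e1 g x $ 3 + inverse a2 * dir_deriv e2 g x $ 3)) = 0 + 0"
      by (rule arg_cong2[where f = "(+)"]) (use f g x in \<open>auto simp: div_free_tests_def\<close>)
    then show ?thesis by (simp add: d algebra_simps)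
  qed
  then show "f + g \<in> D" using subspace_add[OF test_fun_subspace D_test[OF f] D_test[OF g]]
    by (simp add: div_free_tests_def)
next
  fix c f assume f: "f \<in> D"
  have d: "dir_deriv e (c *\<^sub>R f) x = c *\<^sub>R dir_deriv e f x" for e x
    using dir_deriv_linear[OF D_test[OF f] bounded_linear_scaleR_right] by (simp add: scaleR_fun_def)
  have "c * (dir_deriv e1 f x $ 1 + dir_deriv e2 f x $ 2 - 1/2 * (inverse a1 * dir_deriv e1 f x $ 3 + inverse a2 * dir_deriv e2 f x $ 3)) = 0"
    if "x \<in> S" for x using f that by (simp add: div_free_tests_def)
  then show "c *\<^sub>R f \<in> D" using subspace_scale[OF test_fun_subspace D_test[OF f]]
    by (simp add: div_free_tests_def d algebra_simps)
qed

lemma V_W12_0: "v \<in> V ==> v \<in> W12_0 S"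
  and D_W12_0: "D \<subseteq> W12_0 S"
proof -
  show "v \<in> V ==> v \<in> W12_0 S" by (simp add: V_space_def norm_closure_def)
  interpret W: seminormed "W12_space S :: field3 set" W by (rule seminormed_W12)
  have "test_fun S \<subseteq> (W12_0 S :: field3 set)" unfolding W12_0_def by (rule W.subset_norm_closure) (auto intro: test_fun_W12)
  then show "D \<subseteq> W12_0 S" using D_test by blast
qed

lemma V_W12: "v \<in> V ==> v \<in> W12_space S"
  by (rule W12_0_W12[OF V_W12_0])

lemma V_weak_deriv: "v \<in> V ==> weak_deriv S e1 v \<in> L2_space S" "v \<in> V ==> weak_deriv S e2 v \<in> L2_space S"
  using W12_weak_deriv(2)[OF V_W12 e_Basis(1)] W12_weak_deriv(2)[OF V_W12 e_Basis(2)] by blast+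

lemma seminormed_W12_0: "seminormed (W12_0 S :: field3 set) W"
  and W12_0_complete: "semi_complete (W12_0 S :: field3 set) W"
proof -
  interpret W: seminormed "W12_space S :: field3 set" W by (rule seminormed_W12)
  have sub: "test_fun S \<subseteq> (W12_space S :: field3 set)" by (auto intro: test_fun_W12)
  show "seminormed (W12_0 S :: field3 set) W"
    unfolding W12_0_def by (rule W.norm_closure_seminormed[OF test_fun_subspace sub])
  show "semi_complete (W12_0 S :: field3 set) W"
    unfolding W12_0_def by (rule W.norm_closure_complete[OF sub W12_complete])
qed

lemma seminormed_V: "seminormed V W"
  and V_complete: "semi_complete V W"
  and D_V: "D \<subseteq> V"
proof -
  interpret W0: seminormed "W12_0 S :: field3 set" W by (rule seminormed_W12_0)
  show "seminormed V W" unfolding V_space_def by (rule W0.norm_closure_seminormed[OF D_subspace D_W12_0])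
  show "semi_complete V W" unfolding V_space_def by (rule W0.norm_closure_complete[OF D_W12_0 W12_0_complete])
  show "D \<subseteq> V" unfolding V_space_def by (rule W0.subset_norm_closure[OF D_W12_0])
qed

sublocale V: seminormed V W by (rule seminormed_V)

sublocale L: semi_inner "L2_space S :: field3 set" "L2_pair S" by (rule semi_inner_L2)

lemma V_approx:
  assumes "v \<in> V"
  obtains \<phi> where "\<And>n. \<phi> n \<in> D" "(\<lambda>n. W (v - \<phi> n)) \<longlonglongrightarrow> 0"
proof -
  interpret W0: seminormed "W12_0 S :: field3 set" W by (rule seminormed_W12_0)
  show ?thesis by (rule W0.norm_closure_E[OF assms[unfolded V_space_def] D_W12_0]) (rule that)
qed

lemma semi_inner_H: "semi_inner H (L2_pair S)"
proof -
  interpret N: seminormed "L2_space S :: field3 set" "L2_norm S" by (rule seminormed_L2)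
  have sub: "x \<in> L2_space S" if "x \<in> H" for x using that by (simp add: H_space_def norm_closure_def)
  have "subspace H" unfolding H_space_def
    by (rule N.norm_closure_subspace[OF D_subspace]) (auto intro: test_fun_L2 D_test)
  then show ?thesis
    by unfold_locales (auto intro: L.sym L.add_left L.scaleR_left L.nonneg sub)
qed

lemma V_sub_H: "V \<subseteq> H"
proof
  fix v assume v: "v \<in> V"
  obtain \<phi> where \<phi>: "\<And>n. \<phi> n \<in> D" "(\<lambda>n. W (v - \<phi> n)) \<longlonglongrightarrow> 0" using V_approx[OF v] by blast
  have "\<exists>y\<in>D. L2_norm S (v - y) < \<epsilon>" if e: "\<epsilon> > 0" for \<epsilon>
  proof -
    obtain n where "W (v - \<phi> n) < \<epsilon>" using order_tendstoD(2)[OF \<phi>(2) e] eventually_happens'[OF sequentially_bot] by blast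
    then show ?thesis using \<phi>(1) order_le_less_trans[OF L2_le_W12] by blast
  qed
  then show "v \<in> H" using W12_L2[OF V_W12[OF v]] by (auto simp: H_space_def norm_closure_def)
qed

lemma V_L2: "v \<in> V ==> v \<in> L2_space S" by (rule W12_L2[OF V_W12])

text \<open>One constant that dominates all coefficients stemming from the slopes of the
  plane.\<close>

definition K :: real where "K = 1 + \<bar>inverse a1\<bar> + \<bar>inverse a2\<bar>"

text \<open>Regroups convection as transport by a field with two components. The condition in
  \<open>div_free_tests\<close> says precisely that this plane field has divergence 0.\<close>

lemma B1_split: "B1_op S a1 a2 u v x \<bullet> w =
    (u x $ 1 - 1/2 * inverse a1 * u x $ 3) * (weak_deriv S e1 v x \<bullet> w)
  + (u x $ 2 - 1/2 * inverse a2 * u x $ 3) * (weak_deriv S e2 v x \<bullet> w)"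
  by (simp add: B1_op_def inner_simps algebra_simps)

lemma coefficient_le: "\<bar>(z::real^3) $ i - 1/2 * c * z $ j\<bar> \<le> (1 + \<bar>c\<bar>) * norm z"
proof -
  have "\<bar>z $ i - 1/2 * c * z $ j\<bar> \<le> \<bar>z $ i\<bar> + \<bar>c\<bar> * \<bar>z $ j\<bar>"
  proof -
    have "0 \<le> \<bar>c\<bar> * \<bar>z $ j\<bar>" by simp
    moreover have "\<bar>1/2 * c * z $ j\<bar> = 1/2 * (\<bar>c\<bar> * \<bar>z $ j\<bar>)" by (simp add: abs_mult)
    ultimately show ?thesis using abs_triangle_ineq4[of "z $ i" "1/2 * c * z $ j"] by linarith
  qed
  also have "\<dots> \<le> norm z + \<bar>c\<bar> * norm z" by (intro add_mono mult_left_mono component_le_norm_cart) auto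
  finally show ?thesis by (simp add: algebra_simps)
qed

lemma B1_le: "\<bar>B1_op S a1 a2 u v x \<bullet> w\<bar> \<le> K * (norm (u x) * norm w * norm (weak_deriv S e1 v x) + norm (u x) * norm w * norm (weak_deriv S e2 v x))"
proof -
  have t: "\<bar>(u x $ i - 1/2 * c * u x $ 3) * (d \<bullet> w)\<bar> \<le> K * (norm (u x) * norm w * norm d)" if "1 + \<bar>c\<bar> \<le> K" for i c and d :: "real^3"
  proof -
    have "\<bar>u x $ i - 1/2 * c * u x $ 3\<bar> * \<bar>d \<bullet> w\<bar> \<le> ((1 + \<bar>c\<bar>) * norm (u x)) * (norm d * norm w)"
      by (intro mult_mono coefficient_le Cauchy_Schwarz_ineq2) auto
    also have "\<dots> = (1 + \<bar>c\<bar>) * (norm (u x) * norm w * norm d)" by simp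
    also have "\<dots> \<le> K * (norm (u x) * norm w * norm d)" using that by (intro mult_right_mono) auto
    finally show ?thesis by (simp add: abs_mult)
  qed
  have "\<bar>B1_op S a1 a2 u v x \<bullet> w\<bar> \<le> K * (norm (u x) * norm w * norm (weak_deriv S e1 v x)) + K * (norm (u x) * norm w * norm (weak_deriv S e2 v x))"
    unfolding B1_split by (rule order_trans[OF abs_triangle_ineq add_mono]) (rule t, simp add: K_def)+
  then show ?thesis by (simp add: algebra_simps)
qed

text \<open>The product of the norms of \<open>u\<close> and \<open>w\<close> is in L2 by
  \<open>norm_product_L2\<close> and is paired with each of the two derivatives of \<open>v\<close>.
  The factor 4 consists of the 2 from that lemma and the number of derivatives.\<close>

lemma B1_bound:
  assumes u: "u \<in> V" and v: "v \<in> V" and w: "w \<in> V"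
  shows "integrable (lebesgue_on S) (\<lambda>x. B1_op S a1 a2 u v x \<bullet> w x)"
    and "\<bar>L2_pair S (B1_op S a1 a2 u v) w\<bar> \<le> 4 * K * sqrt (L2_norm S u * W u) * W v * sqrt (L2_norm S w * W w)"
proof -
  define p where "p x = norm (u x) * norm (w x)" for x
  note p = norm_product_L2[OF V_W12_0[OF u] V_W12_0[OF w], folded p_def]
  note c1 = L2_norm_Cauchy_Schwarz[OF p(1) V_weak_deriv(1)[OF v]] and c2 = L2_norm_Cauchy_Schwarz[OF p(1) V_weak_deriv(2)[OF v]]
  have np: "norm (p x) = norm (u x) * norm (w x)" for x by (simp add: p_def)
  have i: "integrable (lebesgue_on S) (\<lambda>x. K * (norm (p x) * norm (weak_deriv S e1 v x) + norm (p x) * norm (weak_deriv S e2 v x)))"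
    by (intro integrable_mult_right Bochner_Integration.integrable_add c1(1) c2(1))
  have m: "u \<in> borel_measurable (lebesgue_on S)" "w \<in> borel_measurable (lebesgue_on S)" "weak_deriv S e1 v \<in> borel_measurable (lebesgue_on S)"
    "weak_deriv S e2 v \<in> borel_measurable (lebesgue_on S)"
    by (rule L2_measurable[OF V_L2[OF u]] L2_measurable[OF V_L2[OF w]] L2_measurable[OF V_weak_deriv(1)[OF v]] L2_measurable[OF V_weak_deriv(2)[OF v]])+
  have le: "\<bar>B1_op S a1 a2 u v x \<bullet> w x\<bar> \<le> K * (norm (p x) * norm (weak_deriv S e1 v x) + norm (p x) * norm (weak_deriv S e2 v x))" for x
    using B1_le[of u v x "w x"] by (simp only: np)
  show I: "integrable (lebesgue_on S) (\<lambda>x. B1_op S a1 a2 u v x \<bullet> w x)"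
  proof (rule Bochner_Integration.integrable_bound[OF i])
    have "(\<lambda>x. u x $ k) = (\<lambda>x. u x \<bullet> axis k 1)" for k by (simp add: inner_axis)
    then have "(\<lambda>x. u x $ k) \<in> borel_measurable (lebesgue_on S)" for k using m by simp
    then show "(\<lambda>x. B1_op S a1 a2 u v x \<bullet> w x) \<in> borel_measurable (lebesgue_on S)"
      unfolding B1_split using m by measurable
    show "AE x in lebesgue_on S. norm (B1_op S a1 a2 u v x \<bullet> w x)
        \<le> norm (K * (norm (p x) * norm (weak_deriv S e1 v x) + norm (p x) * norm (weak_deriv S e2 v x)))"
      using order_trans[OF le abs_ge_self] by (intro AE_I2) (simp only: real_norm_def)
  qed
  have K: "K \<ge> 0" by (simp add: K_def)
  have nn: "0 \<le> 2 * sqrt (L2_norm S u * W u) * sqrt (L2_norm S w * W w)" by (simp add: L2_norm_nonneg W12_norm_nonneg)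
  have "\<bar>L2_pair S (B1_op S a1 a2 u v) w\<bar> \<le> (LINT x|lebesgue_on S. \<bar>B1_op S a1 a2 u v x \<bullet> w x\<bar>)"
    unfolding L2_pair_def by (rule integral_abs_bound)
  also have "\<dots> \<le> (LINT x|lebesgue_on S. K * (norm (p x) * norm (weak_deriv S e1 v x) + norm (p x) * norm (weak_deriv S e2 v x)))"
    by (rule integral_mono[OF integrable_abs[OF I] i le])
  also have "\<dots> = K * ((LINT x|lebesgue_on S. norm (p x) * norm (weak_deriv S e1 v x)) + (LINT x|lebesgue_on S. norm (p x) * norm (weak_deriv S e2 v x)))"
    using c1(1) c2(1) by simp
  also have "\<dots> \<le> K * (L2_norm S p * W v + L2_norm S p * W v)"
    using K by (intro mult_left_mono add_mono order_trans[OF c1(2)] order_trans[OF c2(2)] weak_deriv_le_W12 e_Basis L2_norm_nonneg) auto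
  also have "\<dots> = (2 * K * W v) * L2_norm S p" by simp
  also have "\<dots> \<le> (2 * K * W v) * (2 * sqrt (L2_norm S u * W u) * sqrt (L2_norm S w * W w))"
    using K p(2) by (intro mult_left_mono) (auto simp: W12_norm_nonneg)
  finally show "\<bar>L2_pair S (B1_op S a1 a2 u v) w\<bar> \<le> 4 * K * sqrt (L2_norm S u * W u) * W v * sqrt (L2_norm S w * W w)"
    by (simp add: mult_ac)
qed

definition b_form :: "field3 => field3 => field3 => real" where
  "b_form u v w = L2_pair S (B1_op S a1 a2 u v) w"

lemma b_form_add1: "u \<in> V ==> u' \<in> V ==> v \<in> V ==> w \<in> V ==> b_form (u + u') v w = b_form u v w + b_form u' v w"
  and b_form_scaleR1: "u \<in> V ==> v \<in> V ==> w \<in> V ==> b_form (c *\<^sub>R u) v w = c * b_form u v w"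
  and b_form_add3: "u \<in> V ==> v \<in> V ==> w \<in> V ==> w' \<in> V ==> b_form u v (w + w') = b_form u v w + b_form u v w'"
  and b_form_scaleR3: "u \<in> V ==> v \<in> V ==> w \<in> V ==> b_form u v (c *\<^sub>R w) = c * b_form u v w"
proof -
  have 1: "B1_op S a1 a2 (u + u') v x \<bullet> z = B1_op S a1 a2 u v x \<bullet> z + B1_op S a1 a2 u' v x \<bullet> z"
    "B1_op S a1 a2 (c *\<^sub>R u) v x \<bullet> z = c * (B1_op S a1 a2 u v x \<bullet> z)" for u u' x z
    unfolding B1_split by (simp_all add: algebra_simps)
  show "u \<in> V ==> u' \<in> V ==> v \<in> V ==> w \<in> V ==> b_form (u + u') v w = b_form u v w + b_form u' v w"
    "u \<in> V ==> v \<in> V ==> w \<in> V ==> b_form (c *\<^sub>R u) v w = c * b_form u v w"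
    "u \<in> V ==> v \<in> V ==> w \<in> V ==> w' \<in> V ==> b_form u v (w + w') = b_form u v w + b_form u v w'"
    "u \<in> V ==> v \<in> V ==> w \<in> V ==> b_form u v (c *\<^sub>R w) = c * b_form u v w"
    unfolding b_form_def L2_pair_def by (simp_all add: 1 B1_bound(1) inner_add_right)
qed

lemma b_form_add2:
  assumes u: "u \<in> V" and v: "v \<in> V" "v' \<in> V" and w: "w \<in> V"
  shows "b_form u (v + v') w = b_form u v w + b_form u v' w"
proof -
  have vv: "v + v' \<in> V" by (intro V.add_mem v)
  have "b_form u (v + v') w = (LINT x|lebesgue_on S. B1_op S a1 a2 u v x \<bullet> w x + B1_op S a1 a2 u v' x \<bullet> w x)"
    unfolding b_form_def L2_pair_def
  proof (rule integral_cong_AE)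
    show "AE x in lebesgue_on S. B1_op S a1 a2 u (v + v') x \<bullet> w x = B1_op S a1 a2 u v x \<bullet> w x + B1_op S a1 a2 u v' x \<bullet> w x"
      using weak_deriv_add_AE[OF V_W12[OF v(1)] V_W12[OF v(2)] e_Basis(1)] weak_deriv_add_AE[OF V_W12[OF v(1)] V_W12[OF v(2)] e_Basis(2)]
      by eventually_elim (simp add: B1_split inner_add_left distrib_left)
  qed (use B1_bound(1)[OF u vv w] B1_bound(1)[OF u v(1) w] B1_bound(1)[OF u v(2) w] in auto)
  then show ?thesis using B1_bound(1)[OF u v(1) w] B1_bound(1)[OF u v(2) w] by (simp add: b_form_def L2_pair_def)
qed

lemma b_form_scaleR2:
  assumes u: "u \<in> V" and v: "v \<in> V" and w: "w \<in> V"
  shows "b_form u (c *\<^sub>R v) w = c * b_form u v w"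
proof -
  have vv: "c *\<^sub>R v \<in> V" by (intro V.scaleR_mem v)
  have "b_form u (c *\<^sub>R v) w = (LINT x|lebesgue_on S. c * (B1_op S a1 a2 u v x \<bullet> w x))"
    unfolding b_form_def L2_pair_def
  proof (rule integral_cong_AE)
    show "AE x in lebesgue_on S. B1_op S a1 a2 u (c *\<^sub>R v) x \<bullet> w x = c * (B1_op S a1 a2 u v x \<bullet> w x)"
      using weak_deriv_scaleR_AE[OF V_W12[OF v] e_Basis(1), of c] weak_deriv_scaleR_AE[OF V_W12[OF v] e_Basis(2), of c]
      by eventually_elim (simp add: B1_split algebra_simps)
  qed (use B1_bound(1)[OF u vv w] B1_bound(1)[OF u v w] in auto)
  then show ?thesis by (simp add: b_form_def L2_pair_def)
qed

lemma b_form_bound: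
  assumes "u \<in> V" "v \<in> V" "w \<in> V"
  shows "\<bar>b_form u v w\<bar> \<le> 4 * K * W u * W v * W w"
proof -
  have i: "sqrt (L2_norm S f * W f) \<le> W f" for f
  proof -
    have "sqrt (L2_norm S f * W f) \<le> sqrt (W f * W f)" by (intro real_sqrt_le_mono mult_right_mono L2_le_W12 W12_norm_nonneg)
    then show ?thesis by (simp add: W12_norm_nonneg)
  qed
  have "\<bar>b_form u v w\<bar> \<le> 4 * K * sqrt (L2_norm S u * W u) * W v * sqrt (L2_norm S w * W w)"
    unfolding b_form_def by (rule B1_bound(2)[OF assms])
  also have "\<dots> \<le> 4 * K * W u * W v * W w"
    by (intro mult_mono i mult_nonneg_nonneg order_refl) (auto simp: K_def W12_norm_nonneg L2_norm_nonneg)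
  finally show ?thesis .
qed

text \<open>With the transporting field \<open>c\<close> of divergence 0,
  \<open>2 * (c . grad \<psi>) . \<psi>\<close> is the divergence of \<open>c\<close> times the
  squared norm of \<open>\<psi>\<close>. That field has test functions as components, so its
  divergence has integral 0.\<close>

lemma b_form_alt_test:
  assumes \<phi>: "\<phi> \<in> D" and \<psi>: "\<psi> \<in> D"
  shows "b_form \<phi> \<psi> \<psi> = 0"
proof -
  note \<phi>t = D_test[OF \<phi>] and \<psi>t = D_test[OF \<psi>]
  have vV: "\<phi> \<in> V" "\<psi> \<in> V" using \<phi> \<psi> D_V by auto
  define c1 c2 q where "c1 x = \<phi> x $ 1 - 1/2 * inverse a1 * \<phi> x $ 3" and "c2 x = \<phi> x $ 2 - 1/2 * inverse a2 * \<phi> x $ 3"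
    and "q x = \<psi> x \<bullet> \<psi> x" for x
  have L: "bounded_linear (\<lambda>z::real^3. z $ i - 1/2 * c * z $ 3)" for i c
    by (intro bounded_linear_sub bounded_linear_vec_nth bounded_linear_compose[OF bounded_linear_mult_right bounded_linear_vec_nth])
  have c: "c1 \<in> test_fun S" "c2 \<in> test_fun S" unfolding c1_def[abs_def] c2_def[abs_def] by (rule test_fun_linear[OF \<phi>t L])+
  have q: "q \<in> test_fun S" "dir_deriv e q x = 2 * (dir_deriv e \<psi> x \<bullet> \<psi> x)" for e x
    unfolding q_def[abs_def] by (rule dir_deriv_norm_square[OF \<psi>t])+
  have p: "(\<lambda>x. c1 x *\<^sub>R q x) \<in> test_fun S" "(\<lambda>x. c2 x *\<^sub>R q x) \<in> test_fun S" by (intro test_fun_mult c test_fun_Ck[OF q(1)])+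
  note dp = test_fun_dir_deriv[OF p(1) e_Basis(1)] test_fun_dir_deriv[OF p(2) e_Basis(2)]
  have div: "dir_deriv e1 (\<lambda>x. c1 x *\<^sub>R q x) x + dir_deriv e2 (\<lambda>x. c2 x *\<^sub>R q x) x =
      2 * (c1 x * (dir_deriv e1 \<psi> x \<bullet> \<psi> x) + c2 x * (dir_deriv e2 \<psi> x \<bullet> \<psi> x))" if x: "x \<in> S" for x
  proof -
    have "dir_deriv e1 c1 x + dir_deriv e2 c2 x = 0"
      unfolding c1_def[abs_def] c2_def[abs_def] dir_deriv_linear[OF \<phi>t L] using \<phi> x by (simp add: div_free_tests_def algebra_simps)
    then have "(dir_deriv e1 c1 x + dir_deriv e2 c2 x) * q x = 0" by simp
    then show ?thesis
      using dir_deriv_scaleR[OF c(1) q(1), of e1 x] dir_deriv_scaleR[OF c(2) q(1), of e2 x] q(2) by (simp add: algebra_simps)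
  qed
  have B1: "B1_op S a1 a2 \<phi> \<psi> x \<bullet> \<psi> x = c1 x * (weak_deriv S e1 \<psi> x \<bullet> \<psi> x) + c2 x * (weak_deriv S e2 \<psi> x \<bullet> \<psi> x)" for x
    by (simp only: B1_split c1_def c2_def)
  have "2 * b_form \<phi> \<psi> \<psi> = (LINT x|lebesgue_on S. 2 * (B1_op S a1 a2 \<phi> \<psi> x \<bullet> \<psi> x))"
    by (simp add: b_form_def L2_pair_def)
  also have "\<dots> = (LINT x|lebesgue_on S. dir_deriv e1 (\<lambda>x. c1 x *\<^sub>R q x) x + dir_deriv e2 (\<lambda>x. c2 x *\<^sub>R q x) x)"
  proof (rule integral_cong_AE)
    show "AE x in lebesgue_on S. 2 * (B1_op S a1 a2 \<phi> \<psi> x \<bullet> \<psi> x) = dir_deriv e1 (\<lambda>x. c1 x *\<^sub>R q x) x + dir_deriv e2 (\<lambda>x. c2 x *\<^sub>R q x) x"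
      using test_weak_deriv_AE[OF \<psi>t e_Basis(1)] test_weak_deriv_AE[OF \<psi>t e_Basis(2)] AE_space
    proof eventually_elim
      case (elim x)
      then have x: "x \<in> S" by simp
      show ?case unfolding div[OF x] B1 elim(1,2) ..
    qed
  qed (use B1_bound(1)[OF vV vV(2)] borel_lebesgue_on[OF test_fun_borel[OF dp(1)]] borel_lebesgue_on[OF test_fun_borel[OF dp(2)]]
      in \<open>auto intro!: borel_measurable_add borel_measurable_times\<close>)
  also have "\<dots> = (LINT x|lborel. dir_deriv e1 (\<lambda>x. c1 x *\<^sub>R q x) x + dir_deriv e2 (\<lambda>x. c2 x *\<^sub>R q x) x)"
    by (rule integral_lebesgue_on_lborel(1)[OF S_sets])
      (use test_fun_borel[OF dp(1)] test_fun_borel[OF dp(2)] test_fun_zero[OF dp(1)] test_fun_zero[OF dp(2)] in auto)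
  also have "\<dots> = 0"
    using test_fun_integrable[OF dp(1)] test_fun_integrable[OF dp(2)] test_fun_integral_dir_deriv[OF p(1) e_Basis(1)] test_fun_integral_dir_deriv[OF p(2) e_Basis(2)]
    by simp
  finally show ?thesis by simp
qed

text \<open>Density in two stages: the repeated argument is approximated first, with a fixed test
  field in front, then the transporting argument. Continuity is supplied by
  \<open>b_form_bound\<close>.\<close>

lemma b_form_alt:
  assumes u: "u \<in> V" and v: "v \<in> V" shows "b_form u v v = 0"
proof -
  have D': "\<And>\<phi>. \<phi> \<in> D ==> \<phi> \<in> V" using D_V by auto
  have test: "b_form \<phi> v v = 0" if \<phi>: "\<phi> \<in> D" for \<phi>
  proof -
    obtain \<psi> where \<psi>: "\<And>n. \<psi> n \<in> D" "(\<lambda>n. W (v - \<psi> n)) \<longlonglongrightarrow> 0" using V_approx[OF v] by blast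
    have bd: "\<bar>b_form \<phi> v v\<bar> \<le> 4 * K * W \<phi> * W (v - \<psi> n) * W v + 4 * K * W \<phi> * W (\<psi> n) * W (v - \<psi> n)" for n
    proof -
      have m: "\<phi> \<in> V" "\<psi> n \<in> V" "v - \<psi> n \<in> V" using D'[OF \<phi>] D'[OF \<psi>(1)] v by auto
      have "b_form \<phi> v v = b_form \<phi> (v - \<psi> n + \<psi> n) v" by simp
      also have "\<dots> = b_form \<phi> (v - \<psi> n) v + b_form \<phi> (\<psi> n) v" by (rule b_form_add2[OF m(1,3,2) v])
      also have "b_form \<phi> (\<psi> n) v = b_form \<phi> (\<psi> n) (v - \<psi> n + \<psi> n)" by simp
      also have "b_form \<phi> (\<psi> n) (v - \<psi> n + \<psi> n) = b_form \<phi> (\<psi> n) (v - \<psi> n) + b_form \<phi> (\<psi> n) (\<psi> n)" by (rule b_form_add3[OF m(1,2,3,2)])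
      also have "b_form \<phi> (\<psi> n) (\<psi> n) = 0" by (rule b_form_alt_test[OF \<phi> \<psi>(1)])
      finally show ?thesis using b_form_bound[OF m(1,3) v] b_form_bound[OF m(1,2,3)] by linarith
    qed
    have "(\<lambda>n. 4 * K * W \<phi> * W (v - \<psi> n) * W v + 4 * K * W \<phi> * W (\<psi> n) * W (v - \<psi> n)) \<longlonglongrightarrow> 4 * K * W \<phi> * 0 * W v + 4 * K * W \<phi> * W v * 0"
      by (intro tendsto_intros \<psi>(2) V.N_tendsto[OF D'[OF \<psi>(1)] v \<psi>(2)])
    then have "\<bar>b_form \<phi> v v\<bar> \<le> 0" using bd by (intro LIMSEQ_le_const) auto
    then show ?thesis by simp
  qed
  obtain \<phi> where \<phi>: "\<And>n. \<phi> n \<in> D" "(\<lambda>n. W (u - \<phi> n)) \<longlonglongrightarrow> 0" using V_approx[OF u] by blast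
  have bd: "\<bar>b_form u v v\<bar> \<le> 4 * K * W (u - \<phi> n) * W v * W v" for n
  proof -
    have m: "\<phi> n \<in> V" "u - \<phi> n \<in> V" using D'[OF \<phi>(1)] u by auto
    have "b_form u v v = b_form (u - \<phi> n + \<phi> n) v v" by simp
    also have "\<dots> = b_form (u - \<phi> n) v v + b_form (\<phi> n) v v" by (rule b_form_add1[OF m(2,1) v v])
    finally show ?thesis using b_form_bound[OF m(2) v v] test[OF \<phi>(1)] by simp
  qed
  have "(\<lambda>n. 4 * K * W (u - \<phi> n) * W v * W v) \<longlonglongrightarrow> 4 * K * 0 * W v * W v" by (intro tendsto_intros \<phi>(2))
  then have "\<bar>b_form u v v\<bar> \<le> 0" using bd by (intro LIMSEQ_le_const) auto
  then show ?thesis by simp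
qed

text \<open>Not the full gradient, but the derivative in the one direction
  \<open>(1/a1, 1/a2)\<close> whose second power occurs in the operator \<open>A1\<close>.\<close>

definition grad :: "field3 => field3" where
  "grad u = inverse a1 *\<^sub>R weak_deriv S e1 u + inverse a2 *\<^sub>R weak_deriv S e2 u"

definition a_form :: "field3 => field3 => real" where
  "a_form u v = L2_pair S (weak_deriv S e1 u) (weak_deriv S e1 v) + L2_pair S (weak_deriv S e2 u) (weak_deriv S e2 v)
     + 1/4 * L2_pair S (grad u) (grad v)"

lemma grad_L2: "v \<in> V ==> grad v \<in> L2_space S"
proof -
  assume v: "v \<in> V"
  show ?thesis unfolding grad_def by (intro L.H_mem V_weak_deriv v)
qed

lemma grad_pair:
  assumes v: "v \<in> V" and k: "k \<in> L2_space S"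
  shows "L2_pair S (grad v) k = inverse a1 * L2_pair S (weak_deriv S e1 v) k + inverse a2 * L2_pair S (weak_deriv S e2 v) k"
proof -
  show ?thesis using V_weak_deriv[OF v] k by (simp add: grad_def L.add_left L.scaleR_left L.H_mem)
qed

text \<open>Each outer derivative moves to the test field with the sign that
  \<open>dual_deriv\<close> carries; the two outer derivatives of the mixed term recombine to
  \<open>grad v\<close>.\<close>

lemma A1_op_eq:
  assumes u: "u \<in> V" and v: "v \<in> V" shows "A1_op S a1 a2 u v = - a_form u v"
proof -
  have g: "(\<lambda>x. inverse a1 *\<^sub>R weak_deriv S e1 u x + inverse a2 *\<^sub>R weak_deriv S e2 u x) = grad u"
    by (simp add: grad_def fun_eq_iff)
  have "L2_pair S (grad u) (grad v) = inverse a1 * L2_pair S (grad u) (weak_deriv S e1 v) + inverse a2 * L2_pair S (grad u) (weak_deriv S e2 v)"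
    using grad_pair[OF v grad_L2[OF u]] V_weak_deriv[OF v] grad_L2[OF u] grad_L2[OF v] by (simp add: L.sym)
  then show ?thesis by (simp add: A1_op_def dual_deriv_def a_form_def g Let_def algebra_simps)
qed

lemma semi_inner_a: "semi_inner V a_form"
proof -
  show ?thesis
  proof
    fix f g k assume f: "f \<in> V" and g: "g \<in> V" and k: "k \<in> V"
    have fg: "f + g \<in> V" using f g by auto
    show "a_form (f + g) k = a_form f k + a_form g k"
      using f g k fg by (simp add: a_form_def grad_pair grad_L2 weak_deriv_pair_add V_W12 V_weak_deriv e_Basis algebra_simps)
  next
    fix c f k assume f: "f \<in> V" and k: "k \<in> V"
    have cf: "c *\<^sub>R f \<in> V" using f by auto
    show "a_form (c *\<^sub>R f) k = c * a_form f k"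
      using f k cf by (simp add: a_form_def grad_pair grad_L2 weak_deriv_pair_scaleR V_W12 V_weak_deriv e_Basis algebra_simps)
  next
    fix f assume f: "f \<in> V"
    then show "0 \<le> a_form f f" using L.nonneg[OF grad_L2[OF f]] L.nonneg[OF V_weak_deriv(1)[OF f]] L.nonneg[OF V_weak_deriv(2)[OF f]]
      by (simp add: a_form_def)
  next
    fix f g assume "f \<in> V" "g \<in> V"
    then show "a_form f g = a_form g f" by (simp add: a_form_def L.sym grad_L2 V_weak_deriv)
  qed (rule V.subspace)
qed

lemma a_form_bound:
  assumes u: "u \<in> V" and v: "v \<in> V" shows "\<bar>a_form u v\<bar> \<le> (2 + K^2) * W u * W v"
proof -
  interpret N: seminormed "L2_space S :: field3 set" "L2_norm S" by (rule seminormed_L2)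
  have g: "L2_norm S (grad f) \<le> K * W f" if f: "f \<in> V" for f
  proof -
    have "L2_norm S (grad f) \<le> L2_norm S (inverse a1 *\<^sub>R weak_deriv S e1 f) + L2_norm S (inverse a2 *\<^sub>R weak_deriv S e2 f)"
      unfolding grad_def using V_weak_deriv[OF f] by (intro N.triangle) auto
    also have "\<dots> = \<bar>inverse a1\<bar> * L2_norm S (weak_deriv S e1 f) + \<bar>inverse a2\<bar> * L2_norm S (weak_deriv S e2 f)"
      using V_weak_deriv[OF f] by (simp only: N.homogeneous)
    also have "\<dots> \<le> \<bar>inverse a1\<bar> * W f + \<bar>inverse a2\<bar> * W f"
      by (intro add_mono mult_left_mono weak_deriv_le_W12 e_Basis) auto
    also have "\<dots> \<le> K * W f" using W12_norm_nonneg[of f] by (simp add: K_def algebra_simps)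
    finally show ?thesis .
  qed
  have wd: "\<bar>L2_pair S (weak_deriv S e u) (weak_deriv S e v)\<bar> \<le> W u * W v" if e: "e \<in> Basis" for e
    by (rule order_trans[OF L2_Cauchy_Schwarz[OF W12_weak_deriv(2)[OF V_W12[OF u] e] W12_weak_deriv(2)[OF V_W12[OF v] e]]])
      (intro mult_mono weak_deriv_le_W12 e W12_norm_nonneg L2_norm_nonneg)
  have "\<bar>L2_pair S (grad u) (grad v)\<bar> \<le> (K * W u) * (K * W v)"
    by (rule order_trans[OF L2_Cauchy_Schwarz[OF grad_L2[OF u] grad_L2[OF v]]])
      (intro mult_mono g u v L2_norm_nonneg mult_nonneg_nonneg W12_norm_nonneg, simp add: K_def)
  then have "\<bar>L2_pair S (grad u) (grad v)\<bar> \<le> K^2 * W u * W v" by (simp add: power2_eq_square mult_ac)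
  then have "\<bar>a_form u v\<bar> \<le> W u * W v + W u * W v + K^2 * W u * W v"
    unfolding a_form_def using wd[OF e_Basis(1)] wd[OF e_Basis(2)] by (simp add: abs_le_iff)
  then show ?thesis by (simp add: algebra_simps)
qed

text \<open>The first partial derivative controls the L2 part of the norm by Poincare's inequality
  on a ball of radius \<open>\<rho>\<close> containing \<open>S\<close>; the mixed term is
  nonnegative and is dropped.\<close>

lemma a_form_coercive:
  obtains \<alpha> where "\<alpha> > 0" "\<And>v. v \<in> V ==> \<alpha> * (W v)^2 \<le> a_form v v"
proof -
  obtain \<rho> where \<rho>: "\<rho> > 0" "\<And>z. z \<in> S ==> norm z \<le> \<rho>" using S_bounded unfolding bounded_pos by blast
  have \<rho>': "\<bar>z$1\<bar> \<le> \<rho>" if "z \<in> S" for z using \<rho>(2)[OF that] component_le_norm_cart[of z 1] by simp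
  define C where "C = 1 + (4 * \<rho>)^2"
  have C: "C \<ge> 1" by (simp add: C_def)
  have "(1 / C) * (W v)^2 \<le> a_form v v" if v: "v \<in> V" for v
  proof -
    have "(L2_norm S v)^2 \<le> (4 * \<rho> * L2_norm S (weak_deriv S e1 v))^2"
      by (intro power_mono Poincare[OF V_W12_0[OF v]] L2_norm_nonneg \<rho>') (use \<rho> in auto)
    then have "(W v)^2 \<le> C * (L2_norm S (weak_deriv S e1 v))^2 + (L2_norm S (weak_deriv S e2 v))^2"
      unfolding W12_norm_square by (simp add: Basis_real2 axis_eq_axis C_def algebra_simps)
    also have "\<dots> \<le> C * ((L2_norm S (weak_deriv S e1 v))^2 + (L2_norm S (weak_deriv S e2 v))^2)"
      using C mult_right_mono[OF C, of "(L2_norm S (weak_deriv S e2 v))^2"] by (simp add: algebra_simps)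
    also have "\<dots> \<le> C * a_form v v"
      using C L.nonneg[OF grad_L2[OF v]] by (intro mult_left_mono) (auto simp: a_form_def L2_norm_eq L.nonneg[OF V_weak_deriv(1)[OF v]] L.nonneg[OF V_weak_deriv(2)[OF v]])
    finally show ?thesis using C by (simp add: field_simps)
  qed
  then show ?thesis using that[of "1 / C"] C by auto
qed

lemma navier_stokes:
  assumes T: "T > 0" and \<nu>: "\<nu> > 0"
  obtains \<alpha> where "navier_stokes V W T H (L2_pair S) (\<lambda>u v. \<nu> * a_form u v) b_form \<alpha> (\<nu> * (2 + K^2)) (4 * K)"
proof -
  interpret H: semi_inner H "L2_pair S" by (rule semi_inner_H)
  interpret A: semi_inner V a_form by (rule semi_inner_a)
  interpret E: evolution V W T H "L2_pair S"
    by unfold_locales (use T V_sub_H L2_le_W12 in \<open>auto simp: hnorm_L2\<close>)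
  obtain \<alpha> where \<alpha>: "\<alpha> > 0" "\<And>v. v \<in> V ==> \<alpha> * (W v)^2 \<le> a_form v v" using a_form_coercive by blast
  have a: "semi_inner V (\<lambda>u v. \<nu> * a_form u v)"
    by unfold_locales (use \<nu> V.subspace A.sym A.add_left A.scaleR_left A.nonneg in \<open>auto simp: algebra_simps\<close>)
  have b: "\<bar>b_form u v w\<bar> \<le> 4 * K * sqrt (H.hnorm u * W u) * W v * sqrt (H.hnorm w * W w)"
    if "u \<in> V" "v \<in> V" "w \<in> V" for u v w
    using B1_bound(2)[OF that] by (simp only: b_form_def hnorm_L2)
  have "navier_stokes V W T H (L2_pair S) (\<lambda>u v. \<nu> * a_form u v) b_form (\<nu> * \<alpha>) (\<nu> * (2 + K^2)) (4 * K)"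
  proof (intro navier_stokes.intro[OF E.evolution_axioms] navier_stokes_axioms.intro V_complete a b_form_add1 b_form_add2 b_form_add3
      b_form_scaleR1 b_form_scaleR2 b_form_scaleR3 b_form_alt b, goal_cases)
    case (1 x e)
    then show ?case using D_V unfolding H_space_def norm_closure_def hnorm_L2 by blast
  next
    case (3 v) then show ?case using mult_left_mono[OF \<alpha>(2), of v \<nu>] \<nu> by (simp add: mult_ac)
  next
    case (4 u v) then show ?case using mult_left_mono[OF a_form_bound, of u v \<nu>] \<nu> by (simp add: abs_mult mult_ac)
  qed (use \<nu> \<alpha> in \<open>auto simp: K_def\<close>)
  then show ?thesis by (rule that)
qed

end

section \<open>Weak derivatives on an interval\<close>

lemma bounded_open_Ioo: "bounded_open {a<..<b::real}"
  by unfold_locales auto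

lemma (in bounded_open) has_weak_deriv_cong_AE:
  fixes f f' :: "'a => 'b::euclidean_space"
  assumes wd: "has_weak_deriv S e f g" and ae: "AE x in lebesgue_on S. f x = f' x" and e: "e \<in> Basis"
  shows "has_weak_deriv S e f' g"
proof -
  note W = has_weak_derivD[OF wd]
  have f': "loc_integrable S f'"
    unfolding loc_integrable_def
  proof (intro allI impI)
    fix K assume K: "compact K \<and> K \<subseteq> S"
    then have KL: "K \<in> sets lebesgue" by (simp add: compact_imp_closed borel_closed)
    interpret K: complete_measure "lebesgue_on K" by (rule complete_measure_lebesgue_on[OF KL])
    have aeK: "AE x in lebesgue_on K. f x = f' x" by (rule AE_lebesgue_on_subset[OF ae]) (use K KL in auto)
    have fK: "integrable (lebesgue_on K) f" using W(1) K by (simp add: loc_integrable_def)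
    note m = K.borel_measurable_AE_eq[OF borel_measurable_integrable[OF fK] aeK]
    show "integrable (lebesgue_on K) f'"
      using fK by (subst (asm) integrable_cong_AE[OF borel_measurable_integrable[OF fK] m aeK])
  qed
  have "(LINT x|lebesgue_on S. dir_deriv e \<psi> x *\<^sub>R f' x) = (LINT x|lebesgue_on S. dir_deriv e \<psi> x *\<^sub>R f x)"
    if \<psi>: "\<psi> \<in> test_fun S" for \<psi> :: "'a => real"
  proof (rule integral_cong_AE)
    note i = test_fun_mult_integrable[OF test_fun_dir_deriv[OF \<psi> e] _ S_sets]
    show "(\<lambda>x. dir_deriv e \<psi> x *\<^sub>R f' x) \<in> borel_measurable (lebesgue_on S)" "(\<lambda>x. dir_deriv e \<psi> x *\<^sub>R f x) \<in> borel_measurable (lebesgue_on S)"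
      by (rule borel_measurable_integrable[OF i[OF f']] borel_measurable_integrable[OF i[OF W(1)]])+
  qed (use ae in \<open>auto elim: eventually_mono\<close>)
  then show ?thesis using W f' by (simp add: has_weak_deriv_def)
qed

lemma test_fun_has_real_derivative:
  fixes \<psi> :: "real => real"
  assumes "\<psi> \<in> test_fun S" shows "(\<psi> has_vector_derivative dir_deriv 1 \<psi> t) (at t within A)"
  using test_fun_line[OF assms, of 0 1 t A] by simp

lemma continuous_L2_Ioo:
  fixes f :: "real => real"
  assumes f: "continuous_on {0..T} f" shows "f \<in> L2_space {0<..<T}"
proof -
  interpret bounded_open "{0<..<T}" by (rule bounded_open_Ioo)
  have "bounded (f ` {0..T})" by (intro compact_imp_bounded compact_continuous_image f) simp
  then obtain B where "\<forall>x\<in>f ` {0..T}. norm x \<le> B" unfolding bounded_iff by blast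
  then have B: "\<bar>f t\<bar> \<le> B" if "t \<in> {0..T}" for t using that by auto
  show ?thesis
  proof (rule L2_bound)
    show "f \<in> borel_measurable (lebesgue_on {0<..<T})"
      by (rule continuous_imp_measurable_on_sets_lebesgue[OF continuous_on_subset[OF f]]) auto
    show "AE t in lebesgue_on {0<..<T}. (norm (f t))^2 \<le> B^2"
      using B by (intro AE_I2 power_mono) auto
  qed simp
qed

lemma primitive_weak_deriv_continuous:
  fixes q :: "real => real"
  assumes T: "T > 0" and q: "continuous_on {0..T} q"
  shows "has_weak_deriv {0<..<T} 1 (\<lambda>t. c + integral {0..t} q) q"
proof -
  interpret bounded_open "{0<..<T}" by (rule bounded_open_Ioo)
  define P where "P t = c + integral {0..t} q" for t
  have P: "(P has_vector_derivative q t) (at t within {0..T})" if "t \<in> {0..T}" for t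
    unfolding P_def[abs_def] using has_vector_derivative_add[OF has_vector_derivative_const integral_has_vector_derivative[OF q that]] by simp
  then have Pc: "continuous_on {0..T} P" using has_vector_derivative_continuous continuous_on_eq_continuous_within by blast
  note L = L2_loc_integrable[OF continuous_L2_Ioo[OF Pc]] L2_loc_integrable[OF continuous_L2_Ioo[OF q]]
  show ?thesis
    unfolding has_weak_deriv_def P_def[symmetric, abs_def]
  proof (intro conjI ballI L)
    fix \<psi> :: "real => real" assume \<psi>: "\<psi> \<in> test_fun {0<..<T}"
    have d\<psi>: "dir_deriv 1 \<psi> \<in> test_fun {0<..<T}" by (rule test_fun_dir_deriv[OF \<psi>]) simp
    note i = test_fun_mult_integrable[OF d\<psi> L(1) S_sets] test_fun_mult_integrable[OF \<psi> L(2) S_sets]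
    have "((\<lambda>t. \<psi> t * q t + dir_deriv 1 \<psi> t * P t) has_integral \<psi> T * P T - \<psi> 0 * P 0) {0..T}"
      using has_vector_derivative_mult[OF test_fun_has_real_derivative[OF \<psi>] P] T
      by (intro fundamental_theorem_of_calculus) auto
    then have "integral {0..T} (\<lambda>t. \<psi> t * q t + dir_deriv 1 \<psi> t * P t) = 0"
      using test_fun_zero[OF \<psi>] by (simp add: integral_unique)
    then have "integral {0..T} (\<lambda>t. \<psi> t * q t) + integral {0..T} (\<lambda>t. dir_deriv 1 \<psi> t * P t) = 0"
      using i by (subst (asm) integral_add) (auto intro: integrable_Ioo_HK)
    then show "(LINT t|lebesgue_on {0<..<T}. dir_deriv 1 \<psi> t *\<^sub>R P t) = - (LINT t|lebesgue_on {0<..<T}. \<psi> t *\<^sub>R q t)"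
      using i by (simp add: integral_lebesgue_on_Ioo)
  qed
qed

text \<open>For continuous integrands this is integration by parts. Lipschitz functions are dense in
  L2, which is the case of real values in \<open>approx_L2\<close>, and closedness of the weak
  derivative covers the general integrand.\<close>

lemma primitive_weak_deriv:
  fixes q :: "real => real"
  assumes T: "T > 0" and q: "q \<in> L2_space {0<..<T}"
  shows "has_weak_deriv {0<..<T} 1 (\<lambda>t. c + integral {0..t} q) q"
    and "integrable (lebesgue_on {0<..<T}) q"
proof -
  interpret bounded_open "{0<..<T}" by (rule bounded_open_Ioo)
  interpret L: seminormed "L2_space {0<..<T} :: (real => real) set" "L2_norm {0<..<T}" by (rule seminormed_L2)
  interpret X: bochner_time "UNIV :: real set" norm T using T by unfold_locales (auto simp: norm_triangle_ineq abs_mult)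
  let ?S = "{0<..<T}" and ?M = "lebesgue_on {0<..<T}"
  have int: "integrable ?M f" if "f \<in> L2_space ?S" for f :: "real => real"
    using square_integrable_imp_integrable[OF L2_measurable[OF that]] L2_integrable[OF that] by simp
  then show "integrable ?M q" using q .
  have "\<exists>z. continuous_on {0..T} z \<and> L2_norm ?S (q - z) < inverse (real (Suc n))" for n
  proof -
    have "X.approx q 0" using q by (intro X.approx_L2) (auto simp: L2_space_eq)
    then obtain L z where z: "X.lip_curve L z" "(LINT t|?M. (norm (q t - z t))^2) < (inverse (real (Suc n)))^2"
      by (rule X.approx_E[where e = "(inverse (real (Suc n)))^2"]) auto
    have "L-lipschitz_on {0..T} z" using z(1) by (auto simp: X.lip_curve_def lipschitz_on_def dist_real_def)
    then have "continuous_on {0..T} z" by (rule lipschitz_on_continuous_on)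
    moreover have "L2_norm ?S (q - z) < inverse (real (Suc n))"
      using real_sqrt_less_mono[OF z(2)] by (simp add: L2_norm_def real_sqrt_inverse)
    ultimately show ?thesis by blast
  qed
  then obtain z where z: "\<And>n. continuous_on {0..T} (z n)" "\<And>n. L2_norm ?S (q - z n) < inverse (real (Suc n))" by metis
  have zL: "z n \<in> L2_space ?S" for n by (rule continuous_L2_Ioo[OF z(1)])
  have lim: "(\<lambda>n. L2_norm ?S (q - z n)) \<longlonglongrightarrow> 0" by (rule tendsto_zero_inverse[OF L2_norm_nonneg z(2)])
  define P where "P f t = c + integral {0..t} f" for f and t :: real
  have PL: "P f \<in> L2_space ?S" if "f \<in> L2_space ?S" for f
    unfolding P_def[abs_def] by (intro continuous_L2_Ioo continuous_intros HK_primitive_continuous int that)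
  \<comment> \<open>\<open>m\<close> enters twice: from the Cauchy-Schwarz inequality for the
    primitive at a fixed time, and from taking the L2 norm of the resulting uniform bound.\<close>
  define m where "m = L2_norm ?S (\<lambda>_. 1 :: real)"
  have one: "(\<lambda>_. 1 :: real) \<in> L2_space ?S" by (rule continuous_L2_Ioo) simp
  have le: "L2_norm ?S (P q - P (z n)) \<le> (L2_norm ?S (q - z n) * m) * m" for n
  proof -
    have d: "q - z n \<in> L2_space ?S" by (rule L.diff_mem[OF q zL])
    have pt: "\<bar>P q t - P (z n) t\<bar> \<le> L2_norm ?S (q - z n) * m" if t: "t \<in> ?S" for t
    proof -
      have "P q t - P (z n) t = integral {0..t} (q - z n)"
        using integrable_Ioo_HK[OF int[OF q], of 0 t] integrable_Ioo_HK[OF int[OF zL], of 0 t] t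
        by (simp add: P_def fun_diff_def integral_diff)
      also have "\<bar>\<dots>\<bar> \<le> integral {0..t} (\<lambda>t. \<bar>(q - z n) t\<bar>)"
        by (rule HK_abs_le[OF int[OF d] integrable_abs[OF int[OF d]]]) (use t in auto)
      also have "\<dots> \<le> integral {0..T} (\<lambda>t. \<bar>(q - z n) t\<bar>)"
        by (rule HK_primitive_mono[OF integrable_abs[OF int[OF d]]]) (use t in auto)
      also have "\<dots> = (LINT t|?M. norm ((q - z n) t) * norm (1::real))"
        using integral_lebesgue_on_Ioo[OF integrable_abs[OF int[OF d]]] by simp
      also have "\<dots> \<le> L2_norm ?S (q - z n) * m" unfolding m_def by (rule L2_norm_Cauchy_Schwarz(2)[OF d one])
      finally show ?thesis .
    qed
    have "L2_norm ?S (P q - P (z n)) \<le> L2_norm ?S ((L2_norm ?S (q - z n) * m) *\<^sub>R (\<lambda>_. 1 :: real))"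
      unfolding L2_norm_def[of ?S "P q - P (z n)"] L2_norm_def[of ?S "_ *\<^sub>R _"]
    proof (intro real_sqrt_le_mono integral_mono L2_integrable L.diff_mem L.scaleR_mem PL q zL one)
      fix t assume "t \<in> space ?M"
      then have "norm ((P q - P (z n)) t) \<le> norm (((L2_norm ?S (q - z n) * m) *\<^sub>R (\<lambda>_. 1 :: real)) t)"
        using order_trans[OF pt abs_ge_self] by simp
      then show "(norm ((P q - P (z n)) t))^2 \<le> (norm (((L2_norm ?S (q - z n) * m) *\<^sub>R (\<lambda>_. 1 :: real)) t))^2"
        by (rule power_mono) simp
    qed
    then show ?thesis using L.homogeneous[OF one] L2_norm_nonneg[of "q - z n"] L2_norm_nonneg[of "\<lambda>_. 1 :: real"] by (simp add: m_def abs_mult)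
  qed
  have limP: "(\<lambda>n. L2_norm ?S (P q - P (z n))) \<longlonglongrightarrow> 0"
  proof (rule tendsto_sandwich[OF _ _ tendsto_const])
    show "(\<lambda>n. (L2_norm ?S (q - z n) * m) * m) \<longlonglongrightarrow> 0" using tendsto_mult_left_zero[OF tendsto_mult_left_zero[OF lim]] .
  qed (auto simp: le L2_norm_nonneg)
  have "has_weak_deriv ?S 1 (P (z n)) (z n)" for n
    using primitive_weak_deriv_continuous[OF T z(1)] by (simp add: P_def[abs_def])
  then have "has_weak_deriv ?S 1 (P q) q"
    by (rule has_weak_deriv_limit[OF _ _ PL[OF zL] zL PL[OF q] q limP lim]) simp
  then show "has_weak_deriv ?S 1 (\<lambda>t. c + integral {0..t} q) q" by (simp add: P_def[abs_def])
qed

text \<open>A test function of mean 0 is the derivative of a test function: its primitive vanishes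
  to the left of the support, and to the right of it because the total integral is 0.\<close>

lemma test_fun_primitive:
  fixes \<eta> :: "real => real"
  assumes \<eta>: "\<eta> \<in> test_fun {0<..<T}" and z: "integral {0..T} \<eta> = 0"
  shows "(\<lambda>t. integral {0..t} \<eta>) \<in> test_fun {0<..<T}" "dir_deriv 1 (\<lambda>t. integral {0..t} \<eta>) = \<eta>"
proof -
  define E where "E t = integral {0..t} \<eta>" for t
  have c: "continuous_on A \<eta>" for A using test_fun_continuous[OF \<eta>] continuous_on_subset by blast
  have i: "\<eta> integrable_on {a..b}" for a b by (rule integrable_continuous_interval[OF c])
  have z0: "\<eta> t = 0" if "t \<le> 0 \<or> t \<ge> T" for t using test_fun_zero[OF \<eta>, of t] that by auto
  have E: "E t = integral {a..t} \<eta>" if "a \<le> 0" "a \<le> t" for a t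
  proof (cases "t \<le> 0")
    case True
    have "integral {a..t} \<eta> = integral {a..t} (\<lambda>_. 0)" "integral {0..t} \<eta> = integral {0..t} (\<lambda>_. 0)"
      by (rule integral_cong; use z0 True in auto)+
    then show ?thesis by (simp add: E_def)
  next
    case False
    have "integral {a..0} \<eta> = integral {a..0} (\<lambda>_. 0)" by (rule integral_cong) (use z0 in auto)
    then show ?thesis using Henstock_Kurzweil_Integration.integral_combine[of a 0 t \<eta>] that False i by (simp add: E_def)
  qed
  have D: "(E has_vector_derivative \<eta> t) (at t)" for t
  proof -
    define a where "a = min 0 t - 1"
    have "((\<lambda>s. integral {a..s} \<eta>) has_vector_derivative \<eta> t) (at t within {a..t+1})"
      by (rule integral_has_vector_derivative[OF c]) (auto simp: a_def)
    moreover have "t \<in> interior {a..t+1}" by (auto simp: a_def)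
    ultimately have "((\<lambda>s. integral {a..s} \<eta>) has_vector_derivative \<eta> t) (at t)" by (simp only: at_within_interior)
    then show ?thesis
    proof (rule has_vector_derivative_transform_within_open[of _ _ _ "{a<..}"])
      fix s assume "s \<in> {a<..}"
      then show "integral {a..s} \<eta> = E s" by (intro E[symmetric]) (auto simp: a_def)
    qed (auto simp: a_def)
  qed
  then have D': "(E has_derivative (\<lambda>e. e * \<eta> t)) (at t)" for t by (simp add: has_vector_derivative_def)
  show "dir_deriv 1 (\<lambda>t. integral {0..t} \<eta>) = \<eta>"
    using dir_deriv_unique[OF D', of 1] by (simp add: E_def[abs_def] fun_eq_iff)
  have "Ck k E" for k
  proof (rule Ck_mono, rule Ck_Suc_I[OF D'])
    fix e :: real show "Ck k (\<lambda>x. e * \<eta> x)" by (rule Ck_bounded_linear[OF bounded_linear_mult_right test_fun_Ck[OF \<eta>]])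
  qed
  moreover
  \<comment> \<open>Compact support in the open interval leaves room at both ends. For
    \<open>\<eta> = 0\<close> the last condition is vacuous, and any \<open>p > 0\<close> and
    \<open>r < T\<close> will do.\<close>
  obtain p r where pr: "0 < p" "r < T" "\<And>t. \<eta> t \<noteq> 0 ==> p \<le> t \<and> t \<le> r"
  proof (cases "{x. \<eta> x \<noteq> 0} = {}")
    case True
    then show ?thesis using that[of 1 "T - 1"] by auto
  next
    case False
    let ?K = "closure {x. \<eta> x \<noteq> 0}"
    have K: "compact ?K" "?K \<noteq> {}" "?K \<subseteq> {0<..<T}" using \<eta> False by (auto simp: test_fun_def)
    obtain p where p: "p \<in> ?K" "\<And>t. t \<in> ?K ==> p \<le> t" using compact_attains_inf[OF K(1,2)] by blast
    obtain r where r: "r \<in> ?K" "\<And>t. t \<in> ?K ==> t \<le> r" using compact_attains_sup[OF K(1,2)] by blast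
    show ?thesis
      by (rule that[of p r]) (use K(3) p r closure_subset[of "{x. \<eta> x \<noteq> 0}"] in auto)
  qed
  have supp: "p \<le> t \<and> t \<le> r" if "E t \<noteq> 0" for t
  proof (rule ccontr)
    assume "\<not> (p \<le> t \<and> t \<le> r)"
    then consider "t < p" | "r < t" by linarith
    then have "E t = 0"
    proof cases
      case 1
      have "integral {0..t} \<eta> = integral {0..t} (\<lambda>_. 0)" by (rule integral_cong) (use pr(3) 1 in force)
      then show ?thesis by (simp add: E_def)
    next
      case 2
      show ?thesis
      proof (cases "0 \<le> t")
        case True
        have "(\<eta> has_integral 0) {0..T}" using i[of 0 T] z by (simp add: has_integral_iff)
        then have "(\<eta> has_integral 0) {0..max t T}" by (rule has_integral_on_superset) (use z0 in auto)
        moreover have "integral {t..max t T} \<eta> = integral {t..max t T} (\<lambda>_. 0)" by (rule integral_cong) (use pr(3) 2 in force)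
        ultimately show ?thesis
          using Henstock_Kurzweil_Integration.integral_combine[of 0 t "max t T" \<eta>] True i by (simp add: E_def has_integral_iff)
      qed (simp add: E_def)
    qed
    then show False using that by simp
  qed
  have "closure {t. E t \<noteq> 0} \<subseteq> {p..r}" using supp by (intro closure_minimal) auto
  moreover from this have "compact (closure {t. E t \<noteq> 0})"
    using bounded_subset[of "{p..r}"] by (simp add: compact_eq_bounded_closed)
  ultimately show "(\<lambda>t. integral {0..t} \<eta>) \<in> test_fun {0<..<T}"
    using pr(1,2) unfolding test_fun_def E_def[abs_def] by force
qed

text \<open>Lemma of du Bois-Reymond: every test function is a multiple of a fixed
  \<open>\<theta>\<close> with nonzero integral plus one of mean 0, and the latter is a derivative,
  against which \<open>f\<close> integrates to 0. The constant \<open>k\<close> is the mean of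
  \<open>f\<close> with weight \<open>\<theta>\<close>.\<close>

lemma weak_deriv_zero_constant:
  fixes f g :: "real => real"
  assumes T: "T > 0" and wd: "has_weak_deriv {0<..<T} 1 f g" and g: "AE t in lebesgue_on {0<..<T}. g t = 0"
  obtains k where "AE t in lebesgue_on {0<..<T}. f t = k"
proof -
  interpret bounded_open "{0<..<T}" by (rule bounded_open_Ioo)
  let ?S = "{0<..<T}" and ?M = "lebesgue_on {0<..<T}"
  have f: "loc_integrable ?S f" using has_weak_derivD[OF wd] by blast
  have one: "loc_integrable ?S (\<lambda>_. 1 :: real)" by (rule L2_loc_integrable[OF continuous_L2_Ioo]) simp
  have ti: "integrable ?M \<psi>" if "\<psi> \<in> test_fun ?S" for \<psi> :: "real => real"
    using test_fun_mult_integrable[OF that one S_sets] by simp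
  have null: "(LINT t|?M. \<eta> t * f t) = 0" if \<eta>: "\<eta> \<in> test_fun ?S" and z: "(LINT t|?M. \<eta> t) = 0" for \<eta> :: "real => real"
  proof -
    have "integral {0..T} \<eta> = 0" using z integral_lebesgue_on_Ioo[OF ti[OF \<eta>]] by simp
    note E = test_fun_primitive[OF \<eta> this]
    have "(LINT t|?M. integral {0..t} \<eta> *\<^sub>R g t) = 0"
      by (rule integral_eq_zero_AE) (use g in \<open>auto elim: eventually_mono\<close>)
    then show ?thesis using has_weak_derivD(3)[OF wd E(1)] E(2) by simp
  qed
  \<comment> \<open>If all test functions had integral 0, the fundamental lemma would make the
    constant 1 vanish almost everywhere on the interval.\<close>
  have "\<exists>\<theta>\<in>test_fun ?S. (LINT t|?M. \<theta> t) \<noteq> (0::real)"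
  proof (rule ccontr)
    assume "\<not> ?thesis"
    then have "(LINT t|?M. \<theta> t *\<^sub>R (1::real)) = 0" if "\<theta> \<in> test_fun ?S" for \<theta> :: "real => real" using that by simp
    from fundamental_lemma[OF S_open one this] have "AE t in lebesgue. t \<notin> ?S" by (simp add: AE_restrict_space_iff)
    then have "emeasure lebesgue {t \<in> space lebesgue. \<not> t \<notin> ?S} = 0" by (subst (asm) AE_iff_measurable[OF _ refl]) auto
    then show False using T by (simp flip: greaterThanLessThan_iff del: greaterThanLessThan_iff)
  qed
  then obtain \<theta> where \<theta>: "\<theta> \<in> test_fun ?S" "(LINT t|?M. \<theta> t) \<noteq> (0::real)" by blast
  define I where "I = (LINT t|?M. \<theta> t)"
  define k where "k = (LINT t|?M. \<theta> t * f t) / I"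
  have fk: "loc_integrable ?S (\<lambda>t. f t - k)" using loc_integrable_add[OF f loc_integrable_scaleR[OF one, of "- k"]] by simp
  have "AE t in ?M. f t - k = 0"
  proof (rule fundamental_lemma[OF S_open fk])
    fix \<psi> :: "real => real" assume \<psi>: "\<psi> \<in> test_fun ?S"
    define c where "c = (LINT t|?M. \<psi> t) / I"
    define \<eta> where "\<eta> = \<psi> - c *\<^sub>R \<theta>"
    have \<eta>: "\<eta> \<in> test_fun ?S" unfolding \<eta>_def by (intro subspace_diff[OF test_fun_subspace] subspace_scale[OF test_fun_subspace] \<psi> \<theta>(1))
    have "(LINT t|?M. \<eta> t) = (LINT t|?M. \<psi> t) - c * I" using ti[OF \<psi>] ti[OF \<theta>(1)] by (simp add: \<eta>_def I_def)
    also have "\<dots> = 0" using \<theta>(2) by (simp add: c_def I_def)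
    finally have "(LINT t|?M. \<eta> t * f t) = 0" by (rule null[OF \<eta>])
    then have "(LINT t|?M. \<psi> t * f t) = c * (LINT t|?M. \<theta> t * f t)"
      using test_fun_mult_integrable[OF \<psi> f S_sets] test_fun_mult_integrable[OF \<theta>(1) f S_sets]
      by (simp add: \<eta>_def left_diff_distrib mult.assoc)
    then show "(LINT t|?M. \<psi> t *\<^sub>R (f t - k)) = 0"
      using test_fun_mult_integrable[OF \<psi> f S_sets] ti[OF \<psi>] by (simp add: right_diff_distrib c_def k_def)
  qed
  then show ?thesis by (intro that[of k]) (auto elim: eventually_mono)
qed

text \<open>Recovers the integrated equation from the distributional one. The free constant is found
  by comparing the continuous representative \<open>c\<close> with the continuous primitive at time
  0.\<close>

lemma weak_deriv_primitive:
  fixes p q g c :: "real => real"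
  assumes T: "T > 0" and q: "q \<in> L2_space {0<..<T}" and wd: "has_weak_deriv {0<..<T} 1 p g"
    and g: "AE t in lebesgue_on {0<..<T}. g t = q t"
    and c: "continuous_on {0..T} c" "AE t in lebesgue_on {0<..<T}. c t = p t"
  shows "AE t in lebesgue_on {0<..<T}. p t = c 0 + integral {0..t} q"
proof -
  interpret bounded_open "{0<..<T}" by (rule bounded_open_Ioo)
  note Q = primitive_weak_deriv(1)[OF T q, of 0] and i = primitive_weak_deriv(2)[OF T q]
  have "has_weak_deriv {0<..<T} 1 (\<lambda>t. p t + (-1) *\<^sub>R (0 + integral {0..t} q)) (\<lambda>t. g t + (-1) *\<^sub>R q t)"
    by (rule has_weak_deriv_add[OF wd has_weak_deriv_scaleR[OF Q]]) simp
  then obtain k where k: "AE t in lebesgue_on {0<..<T}. p t + (-1) *\<^sub>R (0 + integral {0..t} q) = k"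
    by (rule weak_deriv_zero_constant[OF T]) (use g in \<open>auto elim: eventually_mono\<close>)
  have P: "continuous_on {0..T} (\<lambda>t. k + integral {0..t} q)" by (intro continuous_intros HK_primitive_continuous i)
  have eq: "AE t in lebesgue_on {0<..<T}. c t = k + integral {0..t} q" using k c(2) by eventually_elim simp
  have "c 0 = k + integral {0..0} q"
  proof (rule antisym)
    show "c 0 \<le> k + integral {0..0} q" by (rule AE_le_continuous[OF _ c(1) P T]) (use eq T in \<open>auto elim: eventually_mono\<close>)
    show "k + integral {0..0} q \<le> c 0" by (rule AE_le_continuous[OF _ P c(1) T]) (use eq T in \<open>auto elim: eventually_mono\<close>)
  qed
  then have "c 0 = k" by simp
  show ?thesis unfolding \<open>c 0 = k\<close> using k by eventually_elim simp
qed

section \<open>Weak solutions\<close>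

context plane_section begin

text \<open>Translation in both directions: an abstract solution satisfies the distributional
  equation and has continuous pairings, and conversely every weak solution satisfies the abstract
  integrated equation, so that abstract uniqueness applies to it.\<close>

lemma weak_solutions:
  fixes f :: "real => field3 => real" and u0 :: field3
  assumes T: "T > 0" and \<nu>: "\<nu> > 0" and f: "f \<in> Bochner_L2 T (V_dual S a1 a2) (V_dual_norm S a1 a2)" and u0: "u0 \<in> H"
  shows "\<exists>u. weak_solution T S a1 a2 \<nu> f u0 u \<and> (\<forall>w. weak_solution T S a1 a2 \<nu> f u0 w \<longrightarrow>
    (AE t in lebesgue_on {0<..<T}. AE x in lebesgue_on S. w t x = u t x))"
proof -
  obtain \<alpha> where "navier_stokes V W T H (L2_pair S) (\<lambda>u v. \<nu> * a_form u v) b_form \<alpha> (\<nu> * (2 + K^2)) (4 * K)"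
    by (rule navier_stokes[OF T \<nu>])
  then interpret NS: navier_stokes V W T H "L2_pair S" "\<lambda>u v. \<nu> * a_form u v" b_form \<alpha> "\<nu> * (2 + K^2)" "4 * K" .
  let ?M = "lebesgue_on {0<..<T}"
  have dual: "V_dual S a1 a2 = V.dual" "V_dual_norm S a1 a2 = V.dnorm"
    unfolding V_dual_def V.dual_def plus_fun_def scaleR_fun_def by (auto simp: V_dual_norm_def V.dnorm_def fun_eq_iff)
  have L2: "Bochner_L2 T X N = L2b ?M X N" for X :: "'x::minus set" and N by (simp add: Bochner_L2_def L2b_def)
  have fL: "f \<in> NS.D.L2" using f by (simp add: L2 dual)
  have H_L2: "x \<in> L2_space S" if "x \<in> H" for x using that by (simp add: H_space_def norm_closure_def)
  \<comment> \<open>\<open>NS.force\<close> is the time derivative that the equation prescribes, and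
    by this identity it is also the only possible value of the function \<open>g\<close> in
    \<open>weak_solution\<close>.\<close>
  have eqn: "NS.force w f t v - \<nu> * A1_op S a1 a2 (w t) v + L2_pair S (B1_op S a1 a2 (w t) (w t)) v = f t v" if "w t \<in> V" "v \<in> V" for w t v
    using A1_op_eq[OF that] by (simp add: NS.force_def NS.A_op_def NS.B_op_def b_form_def)
  have force_real: "(\<lambda>t. F t v) \<in> L2_space {0<..<T}" if F: "F \<in> NS.D.L2" and v: "v \<in> V" for F v
  proof -
    interpret I: bounded_open "{0<..<T}" by (rule bounded_open_Ioo)
    show ?thesis
    proof (rule I.L2_bound)
      show "(\<lambda>t. F t v) \<in> borel_measurable ?M"
        using NS.pairing_integrable[OF F NS.const_L2[OF v]] by (rule borel_measurable_integrable)
      show "integrable ?M (\<lambda>t. (W v)^2 * (V.dnorm (F t))^2)" using NS.D.L2_D(2)[OF F] by simp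
      show "AE t in ?M. (norm (F t v))^2 \<le> (W v)^2 * (V.dnorm (F t))^2"
        using NS.D.L2_D(3)[OF F]
      proof eventually_elim
        case (elim t)
        from power_mono[OF V.dual_bound[OF this v] abs_ge_zero, of 2] show ?case by (simp add: power_mult_distrib mult.commute)
      qed
    qed
  qed
  obtain u where u: "NS.solves u u0 f" using NS.existence[OF fL u0] by blast
  then obtain C where uL: "u \<in> NS.L2" and C: "AE t in ?M. NS.hnorm (u t) \<le> C" and uw: "NS.weakly u u0 (NS.force u f)"
    by (auto simp: NS.solves_def)
  note Fo = NS.force_L2[OF uL C fL]
  have wd: "has_weak_deriv {0<..<T} 1 (\<lambda>t. L2_pair S (u t) v) (\<lambda>t. NS.force u f t v)" if v: "v \<in> V" for v
  proof -
    interpret I: bounded_open "{0<..<T}" by (rule bounded_open_Ioo)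
    have P: "has_weak_deriv {0<..<T} 1 (\<lambda>t. L2_pair S u0 v + integral {0..t} (\<lambda>r. NS.force u f r v)) (\<lambda>t. NS.force u f t v)"
      by (rule primitive_weak_deriv(1)[OF T force_real[OF Fo v]])
    have ae: "AE t in ?M. L2_pair S (u t) v = L2_pair S u0 v + integral {0..t} (\<lambda>r. NS.force u f r v)" using uw v by (simp add: NS.weakly_def)
    show ?thesis by (rule I.has_weak_deriv_cong_AE[OF P]) (use ae in \<open>auto elim: eventually_mono\<close>)
  qed
  \<comment> \<open>For test vectors in \<open>V\<close> the integrated equation itself provides the
    continuous representative. A test vector in \<open>H\<close> is approximated from
    \<open>V\<close>; the bound of \<open>u\<close> in \<open>H\<close> makes the representatives
    uniformly Cauchy, and their uniform limit keeps the value at time 0.\<close>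
  have init: "\<exists>c. continuous_on {0..T} c \<and> (AE t in ?M. c t = L2_pair S (u t) v) \<and> c 0 = L2_pair S u0 v" if v: "v \<in> H" for v
  proof -
    have "\<exists>v'. v' \<in> V \<and> NS.hnorm (v - v') < inverse (real (Suc n))" for n using NS.dense[OF v, of "inverse (real (Suc n))"] by auto
    then obtain v' where v': "\<And>n. v' n \<in> V" "\<And>n. NS.hnorm (v - v' n) < inverse (real (Suc n))" by metis
    have lim: "(\<lambda>n. NS.hnorm (v - v' n)) \<longlonglongrightarrow> 0" by (rule tendsto_zero_inverse) (use v v' in \<open>auto simp: NS.H_mem\<close>)
    define c where "c n t = L2_pair S u0 (v' n) + integral {0..t} (\<lambda>r. NS.force u f r (v' n))" for n t
    have cc: "continuous_on {0..T} (c n)" for n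
      unfolding c_def[abs_def] by (intro continuous_intros HK_primitive_continuous NS.pairing_integrable[OF Fo NS.const_L2[OF v'(1)]])
    have ca: "AE t in ?M. c n t = L2_pair S (u t) (v' n)" for n
      using uw v'(1)[of n] unfolding NS.weakly_def c_def by (auto elim: eventually_mono)
    have le: "\<bar>c m t - c n t\<bar> \<le> C * NS.hnorm (v' m - v' n)" if t: "t \<in> {0..T}" for m n t
    proof (rule AE_le_continuous[OF _ _ _ T t])
      show "AE t in ?M. \<bar>c m t - c n t\<bar> \<le> C * NS.hnorm (v' m - v' n)"
        using ca[of m] ca[of n] C NS.L2_D(3)[OF uL]
      proof eventually_elim
        case (elim t)
        have "c m t - c n t = L2_pair S (u t) (v' m - v' n)" using elim v' by (simp add: NS.diff_right)
        moreover have "\<bar>L2_pair S (u t) (v' m - v' n)\<bar> \<le> NS.hnorm (u t) * NS.hnorm (v' m - v' n)"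
          using elim v' by (intro NS.Cauchy_Schwarz NS.H_mem NS.in_H)
        moreover have "\<dots> \<le> C * NS.hnorm (v' m - v' n)" using elim v' by (intro mult_right_mono NS.hnorm_nonneg NS.H_mem NS.in_H)
        ultimately show ?case by linarith
      qed
    qed (intro continuous_intros cc)+
    interpret HN: seminormed H NS.hnorm by (rule NS.seminormed_hnorm)
    have "uniformly_Cauchy_on {0..T} c"
    proof (rule uniformly_Cauchy_onI)
      fix e :: real assume e: "e > 0"
      define \<delta> where "\<delta> = e / (2 * (\<bar>C\<bar> + 1))"
      have \<delta>: "\<delta> > 0" using e by (simp add: \<delta>_def)
      obtain k where k: "\<And>n. n \<ge> k ==> NS.hnorm (v - v' n) < \<delta>"
        using order_tendstoD(2)[OF lim \<delta>] unfolding eventually_sequentially by blast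
      have "dist (c m t) (c n t) < e" if "t \<in> {0..T}" "m \<ge> k" "n \<ge> k" for m n t
      proof -
        have "NS.hnorm (v' m - v' n) \<le> NS.hnorm (v' m - v) + NS.hnorm (v - v' n)" using v v' by (intro HN.triangle_3) auto
        also have "\<dots> \<le> 2 * \<delta>" using k[OF that(2)] k[OF that(3)] HN.N_commute[OF v NS.in_H[OF v'(1)[of m]]] by simp
        finally have *: "NS.hnorm (v' m - v' n) \<le> 2 * \<delta>" .
        have "\<bar>c m t - c n t\<bar> \<le> C * NS.hnorm (v' m - v' n)" by (rule le[OF that(1)])
        also have "\<dots> \<le> \<bar>C\<bar> * (2 * \<delta>)" using * v' by (intro mult_mono) (auto intro: HN.N_nonneg)
        also have "\<dots> < (\<bar>C\<bar> + 1) * (2 * \<delta>)" using \<delta> by (intro mult_strict_right_mono) auto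
        also have "\<dots> = e" by (simp add: \<delta>_def field_simps)
        finally show ?thesis by (simp add: dist_real_def)
      qed
      then show "\<exists>M. \<forall>x\<in>{0..T}. \<forall>m\<ge>M. \<forall>n\<ge>M. dist (c m x) (c n x) < e" by blast
    qed
    then obtain c' where c': "uniform_limit {0..T} c c' sequentially"
      using Cauchy_uniformly_convergent uniformly_convergent_on_def by blast
    have pair: "(\<lambda>n. L2_pair S x (v' n)) \<longlonglongrightarrow> L2_pair S x v" if x: "x \<in> H" for x
      by (rule HN.tendsto_functional[OF _ _ v NS.in_H[OF v'(1)] lim, where C = "NS.hnorm x"])
        (use NS.Cauchy_Schwarz[OF x] NS.diff_right[OF _ _ x] in blast)+
    have "continuous_on {0..T} c'" by (rule uniform_limit_theorem[OF _ c']) (auto simp: cc)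
    moreover have "AE t in ?M. c' t = L2_pair S (u t) v"
    proof -
      have "AE t in ?M. \<forall>n. c n t = L2_pair S (u t) (v' n)" using ca by (simp add: AE_all_countable)
      then show ?thesis using NS.L2_D(3)[OF uL] AE_space
      proof eventually_elim
        case (elim t)
        then have "t \<in> {0..T}" by simp
        have "(\<lambda>n. c n t) \<longlonglongrightarrow> L2_pair S (u t) v" using pair[OF NS.in_H[OF elim(2)]] elim(1) by simp
        then show ?case using tendsto_uniform_limitI[OF c' \<open>t \<in> {0..T}\<close>] by (rule LIMSEQ_unique[rotated])
      qed
    qed
    moreover have "c' 0 = L2_pair S u0 v"
      using tendsto_uniform_limitI[OF c', of 0] pair[OF u0] T by (simp add: c_def LIMSEQ_unique)
    ultimately show ?thesis by blast
  qed
  have uV: "u \<in> VQ_space T S a1 a2"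
    unfolding VQ_space_def L2
  proof (intro CollectI conjI IntI bexI[of _ "NS.force u f"] ballI wd uL)
    show "NS.force u f \<in> L2b ?M (V_dual S a1 a2) (V_dual_norm S a1 a2)" using Fo by (simp add: dual)
    \<comment> \<open>The simple functions that approximate \<open>u\<close> in the norm of
      \<open>V\<close> also do so in the weaker norm of \<open>H\<close>.\<close>
    obtain s where s: "\<And>n. simple_function ?M (s n)" "\<And>n t. t \<in> space ?M ==> s n t \<in> V"
      "AE t in ?M. u t \<in> V" "AE t in ?M. (\<lambda>n. W (u t - s n t)) \<longlonglongrightarrow> 0"
      using NS.L2_D(1)[OF uL] by (rule NS.SM_E) blast
    have "AE t in ?M. (\<lambda>n. L2_norm S (u t - s n t)) \<longlonglongrightarrow> 0"
      using s(4) by eventually_elim (rule tendsto_sandwich[OF _ _ tendsto_const], auto intro!: always_eventually L2_le_W12 L2_norm_nonneg)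
    moreover have "AE t in ?M. u t \<in> H" using s(3) by eventually_elim (rule NS.in_H)
    ultimately have "strongly_measurable ?M H (L2_norm S) u"
      unfolding strongly_measurable_def using s(1,2) NS.in_H by (intro conjI exI[of _ s]) auto
    then show "u \<in> Bochner_Linf T H (L2_norm S)" using C unfolding Bochner_Linf_def hnorm_L2 by blast
  qed
  have "weak_solution T S a1 a2 \<nu> f u0 u"
    unfolding weak_solution_def
  proof (intro conjI ballI uV init)
    fix v assume v: "v \<in> V"
    have "AE t in ?M. NS.force u f t v - \<nu> * A1_op S a1 a2 (u t) v + L2_pair S (B1_op S a1 a2 (u t) (u t)) v = f t v"
      using NS.L2_D(3)[OF uL] by eventually_elim (rule eqn[OF _ v])
    then show "\<exists>g. has_weak_deriv {0<..<T} 1 (\<lambda>t. L2_pair S (u t) v) g \<and>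
        (AE t in ?M. g t - \<nu> * A1_op S a1 a2 (u t) v + L2_pair S (B1_op S a1 a2 (u t) (u t)) v = f t v)"
      using wd[OF v] by blast
  qed
  \<comment> \<open>The value at time 0 demanded for test vectors in \<open>H\<close> is applied to
    those in \<open>V\<close>. Uniqueness yields seminorm 0 of the difference, which for functions
    on \<open>S\<close> is equality almost everywhere.\<close>
  moreover have "AE t in ?M. AE x in lebesgue_on S. w t x = u t x" if w: "weak_solution T S a1 a2 \<nu> f u0 w" for w
  proof -
    have wL: "w \<in> NS.L2" and "\<exists>C. AE t in ?M. L2_norm S (w t) \<le> C"
      using w by (auto simp: weak_solution_def VQ_space_def L2 Bochner_Linf_def)
    then obtain C' where C': "AE t in ?M. NS.hnorm (w t) \<le> C'" by (auto simp: hnorm_L2)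
    have "NS.weakly w u0 (NS.force w f)"
      unfolding NS.weakly_def
    proof
      fix v assume v: "v \<in> V"
      obtain g where g: "has_weak_deriv {0<..<T} 1 (\<lambda>t. L2_pair S (w t) v) g"
          "AE t in ?M. g t - \<nu> * A1_op S a1 a2 (w t) v + L2_pair S (B1_op S a1 a2 (w t) (w t)) v = f t v"
        using w v unfolding weak_solution_def by blast
      have gF: "AE t in ?M. g t = NS.force w f t v"
        using g(2) NS.L2_D(3)[OF wL]
      proof eventually_elim
        case (elim t)
        then show ?case using eqn[of w t v] v by linarith
      qed
      obtain c where c: "continuous_on {0..T} c" "AE t in ?M. c t = L2_pair S (w t) v" "c 0 = L2_pair S u0 v"
        using w NS.in_H[OF v] unfolding weak_solution_def by blast
      show "AE t in ?M. L2_pair S (w t) v = L2_pair S u0 v + integral {0..t} (\<lambda>r. NS.force w f r v)"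
        using weak_deriv_primitive[OF T force_real[OF NS.force_L2[OF wL C' fL] v] g(1) gF c(1,2)] c(3) by simp
    qed
    then have "NS.solves w u0 f" using wL C' by (auto simp: NS.solves_def)
    from NS.uniqueness[OF this u fL u0] show ?thesis
      using NS.L2_D(3)[OF wL] NS.L2_D(3)[OF uL]
    proof eventually_elim
      case (elim t)
      then have "w t - u t \<in> L2_space S" by (intro H_L2 NS.H_mem NS.in_H)
      from L2_norm_zero_AE[OF this] elim(1) show ?case by (simp add: hnorm_L2)
    qed
  qed
  ultimately show ?thesis by blast
qed

end

text \<open>The affine map \<open>?q\<close> parametrizes the plane by the first two coordinates and
  inverts the projection there. The projected section is thus the preimage of an open set under a
  continuous map, and the image of a bounded set under a linear one.\<close>

lemma section_open_bounded:
  fixes \<Omega> :: "(real^3) set"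
  assumes "open \<Omega>" "bounded \<Omega>"
  shows "bounded_open (proj12 ` (\<Omega> \<inter> {x. x$3 = b - a1 * x$1 - a2 * x$2}))"
proof
  let ?q = "\<lambda>z::real^2. z$1 *\<^sub>R axis 1 1 + z$2 *\<^sub>R axis 2 1 + (b - a1 * z$1 - a2 * z$2) *\<^sub>R axis 3 1 :: real^3"
  have "proj12 ` (\<Omega> \<inter> {x. x$3 = b - a1 * x$1 - a2 * x$2}) = ?q -` \<Omega>"
  proof (intro set_eqI iffI)
    fix z assume "z \<in> proj12 ` (\<Omega> \<inter> {x. x$3 = b - a1 * x$1 - a2 * x$2})"
    then obtain x where x: "x \<in> \<Omega>" "x$3 = b - a1 * x$1 - a2 * x$2" "z = proj12 x" by blast
    then have "?q z = x" by (simp add: proj12_def vec_eq_iff forall_3 axis_def)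
    then show "z \<in> ?q -` \<Omega>" using x by simp
  next
    fix z assume "z \<in> ?q -` \<Omega>"
    moreover have "z = proj12 (?q z)" by (simp add: proj12_def vec_eq_iff forall_2 axis_def)
    moreover have "(?q z)$3 = b - a1 * (?q z)$1 - a2 * (?q z)$2" by (simp add: axis_def)
    ultimately show "z \<in> proj12 ` (\<Omega> \<inter> {x. x$3 = b - a1 * x$1 - a2 * x$2})" by blast
  qed
  moreover have "open (?q -` \<Omega>)" by (intro open_vimage assms continuous_intros)
  ultimately show "open (proj12 ` (\<Omega> \<inter> {x. x$3 = b - a1 * x$1 - a2 * x$2}))" by simp
  have "linear proj12" by (rule linearI) (simp_all add: proj12_def vec_eq_iff forall_2)
  then show "bounded (proj12 ` (\<Omega> \<inter> {x. x$3 = b - a1 * x$1 - a2 * x$2}))"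
    by (intro bounded_linear_image bounded_Int disjI1 assms) (simp add: linear_conv_bounded_linear)
qed

theorem theorem4:
  fixes \<Omega> L :: "(real^3) set" and S :: "(real^2) set" and T \<nu> a1 a2 b :: real
    and f :: "real \<Rightarrow> field3 \<Rightarrow> real" and u0 :: field3
  assumes "lip_loc_domain \<Omega>" "bounded \<Omega>"
    and "T > 0" "\<nu> > 0" "a1 \<noteq> 0" "a2 \<noteq> 0"
    and "L = {x. x$3 = b - a1 * x$1 - a2 * x$2}"
    and "\<Omega> \<inter> L \<noteq> {}"
    and "S = proj12 ` (\<Omega> \<inter> L)"
    and "f \<in> Bochner_L2 T (V_dual S a1 a2) (V_dual_norm S a1 a2)"
    and "u0 \<in> H_space S a1 a2"
  shows "\<exists>u. weak_solution T S a1 a2 \<nu> f u0 u \<and> u \<in> VQ_space T S a1 a2 \<and>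
    (\<forall>w. weak_solution T S a1 a2 \<nu> f u0 w \<longrightarrow>
       (AE t in lebesgue_on {0<..<T}. AE x in lebesgue_on S. w t x = u t x))"
proof -
  have "bounded_open S" using assms section_open_bounded[of \<Omega>] by (simp add: lip_loc_domain_def)
  then interpret plane_section S a1 a2 by (simp add: plane_section_def plane_open_def)
  show ?thesis using weak_solutions[OF assms(3,4,10,11)] by (auto simp: weak_solution_def)
qed

end
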